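(* Let $N=\{1,\dots,n\}$ and let $u,z_1,\dots,z_n$ be variables. A correlator with two variables $u$ and $-u$ that add up to zero can be expressed in terms of the functions $Z_\ell$ and correlators not involving $u$ by the formula $$F(u,-u,\mathfrak Z_N)\;=\;\sum_{J\subseteq N}F(z_J,\mathfrak Z_{J^c})\,M(u,\mathfrak Z_J),$$ where the factor $F(z_J,\mathfrak Z_{J^c})$ for $J=\emptyset$ is understood as $F(\mathfrak Z_N)$, and where $M(u,\mathfrak Z_J)=Z_0'(u)$ if $J=\emptyset$ and $$M(u,\mathfrak Z_J)=\sum_{I\subseteq J}(-1)^{|J\smallsetminus I|}\bigl(Z_{|J|}(z_I+u)+Z_{|J|}(z_I-u)\bigr)\qquad\text{if }|J|\ge1.$$
   Context: For $J\subseteq N$ write $\mathfrak Z_J=(z_j)_{j\in J}$, $z_J=\sum_{j\in J}z_j$ (so $z_\emptyset=0$), $J^c=N\smallsetminus J$. Correlators: define $\beta_k$ by $\frac{z/2}{\sinh(z/2)}=\sum_{k\ge0}\beta_kz^k$ and, for a partition $\lambda$, $Q_0(\lambda)=1$, $Q_k(\lambda)=\frac{1}{(k-1)!}\sum_{i\ge1}\bigl[(\lambda_i-i+\tfrac12)^{k-1}-(-i+\tfrac12)^{k-1}\bigr]+\beta_k$ for $k\ge1$. For a function $f$ on partitions, $\langle f\rangle_q=\sum_\lambda f(\lambda)q^{|\lambda|}\big/\sum_\lambda q^{|\lambda|}$. The $m$-point Bloch-Okounkov correlator is $$F(x_1,\dots,x_m)=\sum_{k_1,\dots,k_m\ge0}\langle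 Q_{k_1}\cdots Q_{k_m}\rangle_q\,x_1^{k_1-1}\cdots x_m^{k_m-1}$$ (with $F(\,)=1$ for $m=0$), which is the Laurent expansion at the origin of a meromorphic function (for fixed $|q|<1$), denoted by the same letter; the claimed identity is an identity of meromorphic functions. Theta function: $\theta(z)=\sum_{\nu\in\mathbb Z+\frac12}(-1)^{\lfloor\nu\rfloor}e^{\nu z}q^{\nu^2/2}$, with $'$ denoting $d/dz$. The functions $Z_\ell(u)$, $\ell\ge0$, are defined by $$\frac{\theta(u+v)\,\theta'(0)}{\theta(u)\,\theta(v)}=\frac1v+\sum_{\ell=0}^\infty Z_\ell(u)\,\frac{v^\ell}{\ell!};$$ in particular $Z_0(u)=\theta'(u)/\theta(u)$ (denoted $\zeta(u)$ in the paper). *)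

theory Defs
  imports "HOL-Complex_Analysis.Complex_Analysis"
begin

section \<open>Partitions, the functions \<open>Q\<^sub>k\<close> and the \<open>q\<close>-bracket\<close>

definition partitions :: "nat list set" where
  "partitions = {\<mu>. sorted_wrt (\<ge>) \<mu> \<and> 0 \<notin> set \<mu>}"

text \<open>The coefficients of \<open>(z/2) / sinh (z/2)\<close>, with \<open>sinh (z/2) = (e\<^bsup>z/2\<^esup> - e\<^bsup>-z/2\<^esup>) / 2\<close>.\<close>

definition bo_beta :: "nat \<Rightarrow> complex" where
  "bo_beta k = fps_nth ((fps_const (1/2) * fps_X) /
                        (fps_const (1/2) * (fps_exp (1/2) - fps_exp (-1/2)))) k"

text \<open>The entry \<open>\<mu> ! i\<close> is the part \<open>\<mu>\<^sub>i\<^sub>+\<^sub>1\<close>, which explains the shift \<open>-i + 1/2\<close> to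
  \<open>-(i + 1) + 1/2\<close>. The summands beyond the length of the partition vanish.\<close>

definition bo_Q :: "nat \<Rightarrow> nat list \<Rightarrow> complex" where
  "bo_Q k \<mu> = (if k = 0 then 1 else
     1 / fact (k - 1) *
       (\<Sum>i<length \<mu>. (of_nat (\<mu> ! i) - of_nat (i + 1) + 1/2) ^ (k - 1)
                       - (- of_nat (i + 1) + 1/2) ^ (k - 1))
     + bo_beta k)"

definition q_bracket :: "complex \<Rightarrow> (nat list \<Rightarrow> complex) \<Rightarrow> complex" where
  "q_bracket q f = (\<Sum>\<^sub>\<infinity>\<mu>\<in>partitions. f \<mu> * q ^ sum_list \<mu>) / (\<Sum>\<^sub>\<infinity>\<mu>\<in>partitions. q ^ sum_list \<mu>)"


section \<open>Holomorphic and meromorphic functions of several variables\<close>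

text \<open>Since functions of different numbers of variables occur together, a point of \<open>\<complex>\<^sup>m\<close> is a
  list of length \<open>m\<close>, and one function on lists represents a function on each \<open>\<complex>\<^sup>m\<close>.\<close>

definition polydisc :: "complex list \<Rightarrow> real \<Rightarrow> complex list set" where
  "polydisc p r = {x. length x = length p \<and> (\<forall>i<length p. norm (x ! i - p ! i) < r)}"

text \<open>Near \<open>p\<close> the function is the sum of a convergent power series in \<open>length p\<close> variables.\<close>

definition holomorphic_at :: "(complex list \<Rightarrow> complex) \<Rightarrow> complex list \<Rightarrow> bool" where
  "holomorphic_at f p \<longleftrightarrow>
     (\<exists>r>0. \<exists>a :: nat list \<Rightarrow> complex. \<forall>x\<in>polydisc p r.
        ((\<lambda>ks. a ks * (\<Prod>i<length p. (x ! i - p ! i) ^ (ks ! i))) has_sum f x)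
          {ks. length ks = length p})"

text \<open>Near every point the function is a quotient of holomorphic functions whose denominator does
  not vanish identically. The values where the denominator vanishes are not restricted, so
  statements about such a function should be read off at the points where it is holomorphic.\<close>

definition meromorphic_on_Cn :: "nat \<Rightarrow> (complex list \<Rightarrow> complex) \<Rightarrow> bool" where
  "meromorphic_on_Cn m f \<longleftrightarrow>
     (\<forall>p. length p = m \<longrightarrow>
        (\<exists>g h. holomorphic_at g p \<and> holomorphic_at h p \<and>
           (\<forall>s>0. \<exists>x\<in>polydisc p s. h x \<noteq> 0) \<and>
           (\<exists>r>0. \<forall>x\<in>polydisc p r. h x \<noteq> 0 \<longrightarrow> f x = g x / h x)))"


section \<open>The Bloch--Okounkov correlators\<close>

text \<open>For every \<open>m\<close>, the restriction of \<open>F\<close> to \<open>\<complex>\<^sup>m\<close> is the meromorphic function whose Laurent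
  expansion at the origin is the generating series of the \<open>q\<close>-brackets of
  \<open>Q\<^bsub>k\<^sub>1\<^esub> \<cdots> Q\<^bsub>k\<^sub>m\<^esub>\<close>. For \<open>m = 0\<close> this amounts to \<open>F [] = 1\<close>. The poles
  close to the origin all lie on the coordinate hyperplanes.\<close>

definition is_bo_correlator :: "complex \<Rightarrow> (complex list \<Rightarrow> complex) \<Rightarrow> bool" where
  "is_bo_correlator q F \<longleftrightarrow>
     (\<forall>m. meromorphic_on_Cn m F \<and>
        (\<exists>\<epsilon>>0. \<forall>x. length x = m \<and> (\<forall>i<m. 0 < norm (x ! i) \<and> norm (x ! i) < \<epsilon>) \<longrightarrow>
           ((\<lambda>ks. q_bracket q (\<lambda>\<mu>. \<Prod>i<m. bo_Q (ks ! i) \<mu>) *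
                  (\<Prod>i<m. (x ! i) powi (int (ks ! i) - 1))) has_sum F x)
             {ks. length ks = m}))"


section \<open>The theta function and the functions \<open>Z\<^sub>l\<close>\<close>

text \<open>The sum over \<open>\<nu> = k + 1/2\<close>, for which \<open>k\<close> is the floor of \<open>\<nu>\<close>. The fractional power of \<open>q\<close>
  uses the principal logarithm and needs \<open>q \<noteq> 0\<close>; another branch multiplies the function by a
  constant, which cancels in \<open>bo_Z\<close>.\<close>

definition bo_theta :: "complex \<Rightarrow> complex \<Rightarrow> complex" where
  "bo_theta q z = (\<Sum>\<^sub>\<infinity>k::int. (-1) powi k * exp ((of_int k + 1/2) * z) *
                                  q powr ((of_int k + 1/2)\<^sup>2 / 2))"

definition bo_Z :: "complex \<Rightarrow> nat \<Rightarrow> complex \<Rightarrow> complex" where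
  "bo_Z q l u = fact l * fls_nth (laurent_expansion
     (\<lambda>v. bo_theta q (u + v) * deriv (bo_theta q) 0 / (bo_theta q u * bo_theta q v)) 0) (int l)"


section \<open>The factor \<open>M\<close>\<close>

text \<open>The list \<open>(z\<^sub>j)\<^bsub>j \<in> J\<^esub>\<close> in increasing order of \<open>j\<close>, for finite \<open>J\<close>.\<close>

definition vars :: "(nat \<Rightarrow> complex) \<Rightarrow> nat set \<Rightarrow> complex list" where
  "vars z J = map z (sorted_list_of_set J)"

definition bo_M :: "complex \<Rightarrow> complex \<Rightarrow> (nat \<Rightarrow> complex) \<Rightarrow> nat set \<Rightarrow> complex" where
  "bo_M q u z J =
     (if J = {} then deriv (bo_Z q 0) u
      else (\<Sum>I\<in>Pow J. (-1) ^ card (J - I) *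
              (bo_Z q (card J) (sum z I + u) + bo_Z q (card J) (sum z I - u))))"

text \<open>The arguments of the correlator in the summand of \<open>J\<close>: \<open>z\<^sub>J\<close> followed by the variables
  outside \<open>J\<close>, where \<open>z\<^sub>J\<close> is omitted if \<open>J\<close> is empty.\<close>

definition merged_vars :: "(nat \<Rightarrow> complex) \<Rightarrow> nat set \<Rightarrow> nat set \<Rightarrow> complex list" where
  "merged_vars z N J = (if J = {} then vars z N else sum z J # vars z (N - J))"

end

theory Submission
  imports Defs
begin

text \<open>
  A partition is a Maya diagram \<open>S\<close>, a set of integers that differs from the negative integers in
  finitely many elements, and near the origin the correlator is the average over \<open>S\<close>, weighted by
  \<open>q\<close> to the energy, of a product of the sums \<open>W(z) = \<Sum>k\<in>S. exp ((k + 1/2) z)\<close>.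
  The product \<open>W(u) W(v)\<close> differs from a multiple of \<open>W(u + v)\<close> by a sum over the hooks of
  \<open>S\<close>. Removing a hook of length \<open>m\<close> lowers the energy by \<open>m\<close>, which gives a linear recursion for
  the averages of the hook sums. Its solution expresses \<open>F(u, v, z)\<close> as a sum over \<open>J\<close> of
  \<open>F(u + v + z\<^sub>J, z\<^sub>J\<^sub>c)\<close> times alternating sums of Lambert series, and the Kronecker identity for
  the theta function recognises these as the functions \<open>Z\<^sub>l\<close>.
  The identity propagates to generic points by meromorphic continuation along lines through the origin.
  As \<open>v\<close> tends to \<open>-u\<close>, the term of \<open>J = {}\<close> is the product of \<open>F(w, z)\<close> with \<open>w = u + v\<close>, whose
  residue at \<open>w = 0\<close> is \<open>F(z)\<close>, and of \<open>Z\<^sub>0(u) + Z\<^sub>0(v) = Z\<^sub>0(u) - Z\<^sub>0(u - w)\<close>, and so it tends to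
  \<open>F(z) Z\<^sub>0'(u)\<close>.
\<close>

section \<open>Maya diagrams and their hooks\<close>

text \<open>The variable \<open>v\<close> cannot be \<open>-u\<close> from the start: the formula
  for \<open>W(u) W(v)\<close> contains \<open>W(u + v)\<close>, which has a pole at
  \<open>u + v = 0\<close>. With \<open>v\<close> free, the specialisation becomes a cancellation of
  this pole against the zero of \<open>Z_0(u) + Z_0(v)\<close>. The correlator is explicit only
  close to the origin; elsewhere it is a local quotient with unspecified values on the zero set of
  the denominator. Every line through the origin reaches the explicit region, but a given line may
  lie inside such a zero set. Hence lines are perturbed, and the nonvanishing conditions are
  collected as finitely many generic ones. The residue at \<open>w = 0\<close> is needed far from
  the origin, where no expansion is at hand, so it is extracted from the same two-point identity for
  the pair \<open>w, z_1\<close>. One point must therefore be generic for two identities at once,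
  which is why variables are encoded as sums of coordinates over disjoint blocks. The residue also
  requires theta to be nonzero at the sums of the \<open>z_j\<close>, a condition absent from the
  theorem; a second limit, over \<open>u\<close> and \<open>z\<close> with \<open>v = -u\<close>
  kept, removes it.\<close>

definition maya_bd :: "nat \<Rightarrow> int set \<Rightarrow> bool" where
  "maya_bd L S \<longleftrightarrow> {..<- int L} \<subseteq> S \<and> S \<subseteq> {..<int L}"

text \<open>The sum over \<open>S\<close>, regularised by subtracting the sum over the negative integers.\<close>

definition msum :: "int set \<Rightarrow> (int \<Rightarrow> 'a::comm_ring_1) \<Rightarrow> 'a" where
  "msum S f = sum f (S - {..<0}) - sum f ({..<0} - S)"

text \<open>Maya diagrams of total charge \<open>0\<close>. The element \<open>k\<close> stands for the half-integer \<open>k + 1/2\<close>;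
  the energy is the size of the corresponding partition because the charge vanishes.\<close>

definition maya :: "int set set" where
  "maya = {S. (\<exists>L. maya_bd L S) \<and> msum S (\<lambda>_. 1::int) = 0}"

definition energy :: "int set \<Rightarrow> nat" where
  "energy S = nat (msum S (\<lambda>k. k))"

text \<open>The closed form of the sum of \<open>exp ((k + 1/2) x)\<close> over \<open>k \<in> S\<close>, which converges for \<open>Re x > 0\<close>.\<close>

definition weight :: "int set \<Rightarrow> complex \<Rightarrow> complex" where
  "weight S x = exp (x / 2) * (1 / (exp x - 1) + msum S (\<lambda>k. exp (x * of_int k)))"

text \<open>A pair of \<open>k \<in> S\<close> and \<open>k - m \<notin> S\<close> is a hook of length \<open>m\<close> of the partition;
  exchanging the roles of \<open>k\<close> and \<open>k - m\<close> removes it.\<close>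

definition heads :: "int set \<Rightarrow> nat \<Rightarrow> int set" where
  "heads S m = {k \<in> S. k - int m \<notin> S}"

definition tails :: "int set \<Rightarrow> nat \<Rightarrow> int set" where
  "tails S m = {k. k \<notin> S \<and> k - int m \<in> S}"

lemma maya_bdD:
  assumes "maya_bd L S"
  shows "k < - int L \<Longrightarrow> k \<in> S" "k \<ge> int L \<Longrightarrow> k \<notin> S"
    "k \<in> S \<Longrightarrow> k < int L" "k \<notin> S \<Longrightarrow> - int L \<le> k"
  using assms by (auto simp: maya_bd_def not_less [symmetric])

lemma maya_bd_mono: "maya_bd L S \<Longrightarrow> L \<le> L' \<Longrightarrow> maya_bd L' S"
  by (auto simp: maya_bd_def)

lemma msum_eq:
  assumes "maya_bd L S"
  shows "msum S f = (\<Sum>k\<in>{-int L..<int L}. f k * (of_bool (k \<in> S) - of_bool (k < 0)))"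
proof -
  let ?K = "{-int L..<int L}"
  have "(\<Sum>k\<in>?K. f k * (of_bool (k \<in> S) - of_bool (k < 0)))
      = (\<Sum>k\<in>?K. (if k \<in> S - {..<0} then f k else 0)) - (\<Sum>k\<in>?K. (if k \<in> {..<0} - S then f k else 0))"
    by (subst sum_subtractf [symmetric]) (rule sum.cong, auto)
  also have "(\<Sum>k\<in>?K. (if k \<in> S - {..<0} then f k else 0)) = sum f (S - {..<0})"
    using assms by (subst sum.inter_restrict [symmetric]) (auto simp: maya_bd_def intro!: sum.cong)
  also have "(\<Sum>k\<in>?K. (if k \<in> {..<0} - S then f k else 0)) = sum f ({..<0} - S)"
    by (subst sum.inter_restrict [symmetric])
       (use assms in \<open>auto simp: maya_bd_def not_less [symmetric] intro!: sum.cong\<close>)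
  finally show ?thesis by (simp add: msum_def)
qed

lemma sum_extend_bd:
  fixes f :: "int \<Rightarrow> 'a::comm_ring_1"
  assumes "maya_bd L S" "{-int L..<int L} \<subseteq> K" "finite K"
  shows "(\<Sum>k\<in>K. f k * (of_bool (k \<in> S) - of_bool (k < 0))) = msum S f"
  unfolding msum_eq[OF assms(1)]
  using assms(2,3) maya_bdD(3,4)[OF assms(1)]
  by (intro sum.mono_neutral_right) (auto simp: not_le not_less dest: maya_bdD(3,4)[OF assms(1)])

lemma heads_tails_subset:
  assumes "maya_bd L S"
  shows "heads S m \<subseteq> {-int L..<int L + int m}" "tails S m \<subseteq> {-int L..<int L + int m}"
proof -
  show "heads S m \<subseteq> {-int L..<int L + int m}"
  proof
    fix k assume k: "k \<in> heads S m"
    then have "k \<in> S" "k - int m \<notin> S" by (auto simp: heads_def)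
    then have "k < int L" "- int L \<le> k - int m"
      by (auto dest: maya_bdD(3,4)[OF assms])
    then show "k \<in> {-int L..<int L + int m}" by auto
  qed
  show "tails S m \<subseteq> {-int L..<int L + int m}"
  proof
    fix k assume k: "k \<in> tails S m"
    then have "k \<notin> S" "k - int m \<in> S" by (auto simp: tails_def)
    then have "k - int m < int L" "- int L \<le> k"
      by (auto dest: maya_bdD(3,4)[OF assms])
    then show "k \<in> {-int L..<int L + int m}" by auto
  qed
qed

lemma finite_heads: "maya_bd L S \<Longrightarrow> finite (heads S m)"
  and finite_tails: "maya_bd L S \<Longrightarrow> finite (tails S m)"
  by (rule finite_subset[OF heads_tails_subset(1)] finite_subset[OF heads_tails_subset(2)], assumption, simp)+

text \<open>Pointwise, the indicator of heads minus that of tails is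
  \<open>[k in S] - [k - m in S]\<close>. Regularising the two sums separately subtracts
  \<open>[k < 0]\<close> and \<open>[k < m]\<close>, and the mismatch is the sum over
  \<open>0 <= k < m\<close>.\<close>

lemma heads_minus_tails:
  fixes f :: "int \<Rightarrow> 'a::comm_ring_1"
  assumes L: "maya_bd L S"
  shows "sum f (heads S m) - sum f (tails S m)
       = msum S f - msum S (\<lambda>k. f (k + int m)) - sum f {0..<int m}"
proof -
  define K where "K = {-int L - int m..<int L + int m}"
  have sub: "heads S m \<subseteq> K" "tails S m \<subseteq> K"
    using heads_tails_subset[OF L] unfolding K_def by force+
  have fin: "finite K" by (simp add: K_def)
  have "sum f (heads S m) = (\<Sum>k\<in>K. f k * of_bool (k \<in> heads S m))"
    using sub fin by (intro sum.mono_neutral_cong_left) auto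
  moreover have "sum f (tails S m) = (\<Sum>k\<in>K. f k * of_bool (k \<in> tails S m))"
    using sub fin by (intro sum.mono_neutral_cong_left) auto
  ultimately have "sum f (heads S m) - sum f (tails S m)
     = (\<Sum>k\<in>K. f k * of_bool (k \<in> heads S m) - f k * of_bool (k \<in> tails S m))"
    by (simp add: sum_subtractf)
  also have "\<dots> = (\<Sum>k\<in>K. f k * (of_bool (k \<in> S) - of_bool (k < 0))
        - f k * (of_bool (k - int m \<in> S) - of_bool (k - int m < 0))
        - f k * (of_bool (k - int m < 0) - of_bool (k < 0)))"
    by (intro sum.cong refl) (auto simp: heads_def tails_def)
  also have "\<dots> = (\<Sum>k\<in>K. f k * (of_bool (k \<in> S) - of_bool (k < 0)))
        - (\<Sum>k\<in>K. f k * (of_bool (k - int m \<in> S) - of_bool (k - int m < 0)))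
        - (\<Sum>k\<in>K. f k * (of_bool (k - int m < 0) - of_bool (k < 0)))"
    by (simp add: sum_subtractf)
  also have "(\<Sum>k\<in>K. f k * (of_bool (k \<in> S) - of_bool (k < 0))) = msum S f"
    by (rule sum_extend_bd[OF L]) (auto simp: K_def)
  also have "(\<Sum>k\<in>K. f k * (of_bool (k - int m \<in> S) - of_bool (k - int m < 0)))
     = (\<Sum>k\<in>(\<lambda>k. k - int m) ` K. f (k + int m) * (of_bool (k \<in> S) - of_bool (k < 0)))"
    by (subst sum.reindex) (auto simp: inj_on_def)
  also have "\<dots> = msum S (\<lambda>k. f (k + int m))"
    by (rule sum_extend_bd[OF L]) (auto simp: K_def image_iff intro!: bexI[of _ "x + int m" for x])
  also have "(\<Sum>k\<in>K. f k * (of_bool (k - int m < 0) - of_bool (k < 0))) = sum f {0..<int m}"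
    by (intro sum.mono_neutral_cong_right) (auto simp: K_def)
  finally show ?thesis .
qed

lemma msum_add: "msum S (\<lambda>k. f k + g k) = msum S f + msum S g"
  and msum_diff: "msum S (\<lambda>k. f k - g k) = msum S f - msum S g"
  and msum_cmult: "msum S (\<lambda>k. c * f k) = c * msum S f"
  by (simp_all add: msum_def sum.distrib sum_subtractf sum_distrib_left algebra_simps)

lemma msum_of_int: "msum S (\<lambda>k. of_int (f k)) = of_int (msum S f)"
  by (simp add: msum_def)

section \<open>Removing and adding hooks\<close>

lemma maya_bd_move:
  assumes "maya_bd L S" "k \<in> S" "k - int m \<notin> S"
  shows "maya_bd (L + m) (insert (k - int m) (S - {k}))"
proof -
  have "k < int L" "- int L \<le> k - int m"
    using maya_bdD(3)[OF assms(1) assms(2)] maya_bdD(4)[OF assms(1) assms(3)] .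
  then show ?thesis using assms(1) by (auto simp: maya_bd_def)
qed

lemma msum_move:
  fixes f :: "int \<Rightarrow> 'a::comm_ring_1"
  assumes L: "maya_bd L S" and k: "k \<in> S" "k - int m \<notin> S" and "m > 0"
  shows "msum (insert (k - int m) (S - {k})) f = msum S f - f k + f (k - int m)"
proof -
  let ?S = "insert (k - int m) (S - {k})" and ?K = "{-int (L+m)..<int (L+m)}"
  have *: "k < int L" "- int L \<le> k - int m"
    using maya_bdD(3)[OF L k(1)] maya_bdD(4)[OF L k(2)] .
  have "msum ?S f - msum S f = (\<Sum>j\<in>?K. f j * (of_bool (j \<in> ?S) - of_bool (j < 0)))
      - (\<Sum>j\<in>?K. f j * (of_bool (j \<in> S) - of_bool (j < 0)))"
    by (subst msum_eq[OF maya_bd_move[OF L k]], subst msum_eq[OF maya_bd_mono[OF L, of "L+m"]]) auto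
  also have "\<dots> = (\<Sum>j\<in>?K. f j * (of_bool (j \<in> ?S) - of_bool (j \<in> S)))"
    by (subst sum_subtractf [symmetric]) (rule sum.cong, auto simp: algebra_simps)
  also have "\<dots> = (\<Sum>j\<in>{k, k - int m}. f j * (of_bool (j \<in> ?S) - of_bool (j \<in> S)))"
    using * by (intro sum.mono_neutral_right) auto
  also have "\<dots> = f (k - int m) - f k"
    using k \<open>m > 0\<close> by simp
  finally show ?thesis by (simp add: algebra_simps)
qed

lemma maya_move:
  assumes "S \<in> maya" "k \<in> heads S m" "m > 0"
  shows "insert (k - int m) (S - {k}) \<in> maya"
    and "k \<in> tails (insert (k - int m) (S - {k})) m"
proof -
  obtain L where L: "maya_bd L S" using assms by (auto simp: maya_def)
  have k: "k \<in> S" "k - int m \<notin> S" using assms by (auto simp: heads_def)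
  show "insert (k - int m) (S - {k}) \<in> maya"
    using maya_bd_move[OF L k] msum_move[OF L k assms(3), of "\<lambda>_. 1::int"] assms(1)
    by (auto simp: maya_def)
  show "k \<in> tails (insert (k - int m) (S - {k})) m"
    using k assms(3) by (auto simp: tails_def)
qed

lemma maya_move_back:
  assumes "S \<in> maya" "k \<in> tails S m" "m > 0"
  shows "insert k (S - {k - int m}) \<in> maya"
    and "k \<in> heads (insert k (S - {k - int m})) m"
proof -
  let ?S = "insert k (S - {k - int m})"
  obtain L where L: "maya_bd L S" "msum S (\<lambda>_. 1::int) = 0" using assms by (auto simp: maya_def)
  have k: "k \<notin> S" "k - int m \<in> S" using assms by (auto simp: tails_def)
  then have "k \<ge> - int L" "k - int m < int L"
    using maya_bdD(4)[OF L(1) k(1)] maya_bdD(3)[OF L(1) k(2)] by auto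
  then have bd: "maya_bd (L+m) ?S" using L(1) by (auto simp: maya_bd_def)
  show h: "k \<in> heads ?S m" using k \<open>m > 0\<close> by (auto simp: heads_def)
  have "insert (k - int m) (?S - {k}) = S" using k by auto
  then have "msum S (\<lambda>_. 1::int) = msum ?S (\<lambda>_. 1)"
    using msum_move[OF bd, of k m "\<lambda>_. 1::int"] h \<open>m > 0\<close> by (auto simp: heads_def)
  then show "?S \<in> maya" using bd L by (auto simp: maya_def)
qed

text \<open>The position \<open>k\<close> is carried along unchanged, because it is both the head
  that disappears and the tail that appears. Factors that depend on the hook through
  \<open>k\<close> only are not altered by this reindexing.\<close>

lemma bij_betw_hook_move:
  assumes "m > 0"
  shows "bij_betw (\<lambda>(S,k). (insert (k - int m) (S - {k}), k))
     (Sigma maya (\<lambda>S. heads S m)) (Sigma maya (\<lambda>S. tails S m))"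
proof (rule bij_betwI[where g = "\<lambda>(S,k). (insert k (S - {k - int m}), k)"])
  show "(\<lambda>(S,k). (insert (k - int m) (S - {k}), k))
      \<in> Sigma maya (\<lambda>S. heads S m) \<rightarrow> Sigma maya (\<lambda>S. tails S m)"
    using maya_move[OF _ _ assms] by (auto simp: Pi_def)
  show "(\<lambda>(S,k). (insert k (S - {k - int m}), k))
      \<in> Sigma maya (\<lambda>S. tails S m) \<rightarrow> Sigma maya (\<lambda>S. heads S m)"
    using maya_move_back[OF _ _ assms] by (auto simp: Pi_def)
qed (auto simp: heads_def tails_def)

lemma maya_bdE:
  assumes "S \<in> maya" obtains L where "maya_bd L S"
  using assms by (auto simp: maya_def)

lemma maya_finite:
  assumes "S \<in> maya" shows "finite (S - {..<0})" "finite ({..<0} - S)"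
proof -
  obtain L where L: "maya_bd L S" using assms by (rule maya_bdE)
  have "S - {..<0} \<subseteq> {0..<int L}" "{..<0} - S \<subseteq> {-int L..<0}"
    by (auto dest: maya_bdD(3,4)[OF L])
  then show "finite (S - {..<0})" "finite ({..<0} - S)" by (blast intro: finite_subset)+
qed

text \<open>Charge \<open>0\<close> makes it free to add \<open>1/2\<close> to every element. After
  this shift each bead at a nonnegative position and each gap at a negative one contributes a
  positive amount, so the \<open>nat\<close> in \<open>energy\<close> truncates nothing.\<close>

lemma energy_eq:
  assumes "S \<in> maya"
  shows "real (energy S) = (\<Sum>k\<in>S - {..<0}. of_int k + 1/2) + (\<Sum>k\<in>{..<0} - S. - of_int k - 1/2)"
    and "int (energy S) = msum S (\<lambda>k. k)"
proof -
  have 1: "msum S (\<lambda>_. 1::int) = 0" using assms by (auto simp: maya_def)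
  have "msum S (\<lambda>k. of_int k + 1/2 :: real) = of_int (msum S (\<lambda>k. k)) + (1/2) * of_int (msum S (\<lambda>_. 1::int))"
    unfolding msum_of_int[symmetric] msum_cmult[symmetric] by (subst msum_add[symmetric]) simp
  then have 2: "msum S (\<lambda>k. of_int k + 1/2 :: real) = of_int (msum S (\<lambda>k. k))" using 1 by simp
  have 3: "msum S (\<lambda>k. of_int k + 1/2 :: real)
     = (\<Sum>k\<in>S - {..<0}. of_int k + 1/2) + (\<Sum>k\<in>{..<0} - S. - of_int k - 1/2)"
    by (simp add: msum_def sum_subtractf sum.distrib sum_negf algebra_simps)
  have "0 \<le> (\<Sum>k\<in>S - {..<0}. of_int k + 1/2::real)" 
    by (rule sum_nonneg) auto
  moreover have "0 \<le> (\<Sum>k\<in>{..<0} - S. - of_int k - 1/2::real)"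
  proof (rule sum_nonneg)
    fix k :: int assume "k \<in> {..<0} - S"
    then have "k \<le> -1" by auto
    then have "real_of_int k \<le> -1" by linarith
    then show "0 \<le> - real_of_int k - 1/2" by simp
  qed
  ultimately have "0 \<le> real_of_int (msum S (\<lambda>k. k))" using 2 3 by linarith
  then have nn: "0 \<le> msum S (\<lambda>k. k)" by linarith
  show i: "int (energy S) = msum S (\<lambda>k. k)" using nn by (simp add: energy_def)
  show "real (energy S) = (\<Sum>k\<in>S - {..<0}. of_int k + 1/2) + (\<Sum>k\<in>{..<0} - S. - of_int k - 1/2)"
    using 2 3 i by (metis of_int_of_nat_eq)
qed

lemma energy_move:
  assumes "S \<in> maya" "k \<in> heads S m" "m > 0"
  shows "energy S = energy (insert (k - int m) (S - {k})) + m"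
proof -
  obtain L where L: "maya_bd L S" using assms by (auto simp: maya_def)
  have "int (energy (insert (k - int m) (S - {k}))) = int (energy S) - k + (k - int m)"
    using msum_move[OF L, of k m "\<lambda>k. k"] assms energy_eq(2)[OF assms(1)] energy_eq(2)[OF maya_move(1)[OF assms]]
    by (auto simp: heads_def)
  then show ?thesis by simp
qed

lemma weight_move:
  assumes "S \<in> maya" "k \<in> heads S m" "m > 0"
  shows "weight S z = weight (insert (k - int m) (S - {k})) z
     + exp (z * (of_int k + 1/2)) * (1 - exp (- of_nat m * z))"
proof -
  obtain L where L: "maya_bd L S" using assms by (auto simp: maya_def)
  let ?T = "insert (k - int m) (S - {k})"
  have "msum ?T (\<lambda>k. exp (z * of_int k)) 
     = msum S (\<lambda>k. exp (z * of_int k)) - exp (z * of_int k) + exp (z * of_int (k - int m))"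
    using msum_move[OF L, of k m "\<lambda>k. exp (z * of_int k)"] assms by (simp add: heads_def)
  moreover have "exp (z * (of_int k + 1/2)) = exp (z / 2) * exp (z * of_int k)"
    by (simp add: exp_add [symmetric] algebra_simps)
  moreover have "exp (z * of_int (k - int m)) = exp (z * of_int k) * exp (- of_nat m * z)"
    by (simp add: exp_add [symmetric] algebra_simps)
  ultimately show ?thesis
    unfolding weight_def by (simp only: ring_distribs) (simp add: algebra_simps)
qed

text \<open>Shifting by \<open>m\<close> multiplies the regularised sum by \<open>exp (m w)\<close>.
  The window term of \<open>heads_minus_tails\<close> is a geometric sum, and it is exactly what the
  vacuum term in \<open>weight\<close> absorbs.\<close>

lemma weight_heads_tails:
  assumes "S \<in> maya" "exp w \<noteq> 1"
  shows "(\<Sum>k\<in>heads S m. exp (w * (of_int k + 1/2))) - (\<Sum>k\<in>tails S m. exp (w * (of_int k + 1/2)))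
       = (1 - exp (of_nat m * w)) * weight S w"
proof -
  obtain L where L: "maya_bd L S" using assms by (auto simp: maya_def)
  have "(\<Sum>k\<in>{0..<int m}. exp (w * of_int k)) = (\<Sum>k<m. exp w ^ k)"
    by (rule sum.reindex_bij_witness[of _ int nat]) (auto simp flip: exp_of_nat_mult simp: mult.commute)
  also have "\<dots> = (1 - exp w ^ m) / (1 - exp w)"
    using assms(2) by (simp add: sum_gp_strict)
  finally have geo: "(\<Sum>k\<in>{0..<int m}. exp (w * of_int k)) = (1 - exp w ^ m) / (1 - exp w)" .
  have "exp (w/2) * ((\<Sum>k\<in>heads S m. exp (w * of_int k)) - (\<Sum>k\<in>tails S m. exp (w * of_int k)))
     = exp (w/2) * (msum S (\<lambda>k. exp (w * of_int k)) - exp w ^ m * msum S (\<lambda>k. exp (w * of_int k))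
        - (1 - exp w ^ m) / (1 - exp w))"
    unfolding heads_minus_tails[OF L] geo msum_cmult[symmetric]
    by (simp add: algebra_simps exp_add exp_of_nat_mult[symmetric])
  also have "\<dots> = (1 - exp (of_nat m * w)) * weight S w"
    using assms(2) unfolding exp_of_nat_mult weight_def by (simp add: divide_simps) (simp add: algebra_simps)
  finally show ?thesis
    by (simp add: ring_distribs sum_distrib_left exp_add mult.commute)
qed

section \<open>The product of two weights as a sum over hooks\<close>

lemma sum_pairs_split:
  fixes X Y :: "'a::comm_ring_1"
  assumes "finite B"
  shows "(\<Sum>b\<in>B. \<Sum>c\<in>{..<b::nat} \<inter> B. X^b * Y^c + Y^b * X^c)
       = (\<Sum>b\<in>B. X^b) * (\<Sum>b\<in>B. Y^b) - (\<Sum>b\<in>B. (X * Y)^b)"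
proof -
  have "(\<Sum>b\<in>B. \<Sum>c\<in>{..<b} \<inter> B. X^b * Y^c + Y^b * X^c)
     = (\<Sum>b\<in>B. \<Sum>c\<in>B. of_bool (c < b) * (X^b * Y^c)) + (\<Sum>b\<in>B. \<Sum>c\<in>B. of_bool (c < b) * (X^c * Y^b))"
    unfolding sum.distrib [symmetric]
    by (rule sum.cong[OF refl], rule sum.mono_neutral_cong_left) (use assms in \<open>auto simp: mult.commute\<close>)
  also have "(\<Sum>b\<in>B. \<Sum>c\<in>B. of_bool (c < b) * (X^c * Y^b)) = (\<Sum>b\<in>B. \<Sum>c\<in>B. of_bool (b < c) * (X^b * Y^c))"
    by (rule sum.swap)
  also have "(\<Sum>b\<in>B. \<Sum>c\<in>B. of_bool (c < b) * (X^b * Y^c)) + (\<Sum>b\<in>B. \<Sum>c\<in>B. of_bool (b < c) * (X^b * Y^c))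
     = (\<Sum>b\<in>B. \<Sum>c\<in>B. X^b * Y^c - (if c = b then (X * Y)^b else 0))"
    unfolding sum.distrib [symmetric] by (intro sum.cong refl) (auto simp: power_mult_distrib)
  also have "\<dots> = (\<Sum>b\<in>B. X^b) * (\<Sum>b\<in>B. Y^b) - (\<Sum>b\<in>B. (X * Y)^b)"
    using assms by (simp add: sum_subtractf sum_product)
  finally show ?thesis .
qed

text \<open>Pairs in \<open>B\<close> with \<open>c < b\<close> are all pairs with
  \<open>c < b\<close> minus those whose lower entry is a gap. The former are geometric sums that
  recombine with the terms \<open>1 / (X - 1)\<close> and \<open>1 / (Y - 1)\<close>; the latter
  remain as the defect.\<close>

lemma geometric_product:
  fixes X Y :: complex
  assumes "finite B" "X \<noteq> 1" "Y \<noteq> 1" "X * Y \<noteq> 1"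
  shows "((\<Sum>b\<in>B. X^b) + 1 / (X - 1)) * ((\<Sum>b\<in>B. Y^b) + 1 / (Y - 1))
     = ((\<Sum>b\<in>B. (X*Y)^b) + 1 / (X*Y - 1)) * ((X*Y - 1) / ((X - 1) * (Y - 1)))
       - (\<Sum>b\<in>B. \<Sum>c\<in>{..<b} - B. X^b * Y^c + Y^b * X^c)"
proof -
  define sX sY sXY where "sX = (\<Sum>b\<in>B. X^b)" and "sY = (\<Sum>b\<in>B. Y^b)" and "sXY = (\<Sum>b\<in>B. (X*Y)^b)"
  have geo: "(\<Sum>c<b. Z^c) = (Z^b - 1) / (Z - 1)" if "Z \<noteq> 1" for Z :: complex and b
    using that by (simp add: sum_gp_strict divide_simps) (simp add: algebra_simps)
  have "(\<Sum>b\<in>B. \<Sum>c\<in>{..<b} - B. X^b * Y^c + Y^b * X^c)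
     = (\<Sum>b\<in>B. (\<Sum>c<b. X^b * Y^c + Y^b * X^c) - (\<Sum>c\<in>{..<b} \<inter> B. X^b * Y^c + Y^b * X^c))"
  proof (rule sum.cong [OF refl])
    fix b assume "b \<in> B"
    show "(\<Sum>c\<in>{..<b} - B. X^b * Y^c + Y^b * X^c)
      = (\<Sum>c<b. X^b * Y^c + Y^b * X^c) - (\<Sum>c\<in>{..<b} \<inter> B. X^b * Y^c + Y^b * X^c)"
      using sum.Int_Diff [of "{..<b}" "\<lambda>c. X^b * Y^c + Y^b * X^c" B] by simp
  qed
  also have "\<dots> = (\<Sum>b\<in>B. X^b * ((Y^b - 1) / (Y - 1)) + Y^b * ((X^b - 1) / (X - 1))) - (sX * sY - sXY)"
    unfolding sum_subtractf sum_pairs_split[OF assms(1)]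
    by (simp add: sX_def sY_def sXY_def sum.distrib sum_distrib_left [symmetric] geo[OF assms(2)] geo[OF assms(3)])
  also have "(\<Sum>b\<in>B. X^b * ((Y^b - 1) / (Y - 1)) + Y^b * ((X^b - 1) / (X - 1)))
     = (\<Sum>b\<in>B. (X*Y)^b * (1 / (Y - 1) + 1 / (X - 1)) - X^b * (1/(Y - 1)) - Y^b * (1/(X - 1)))"
    using assms by (intro sum.cong refl) (simp add: divide_simps power_mult_distrib, simp add: algebra_simps)
  also have "\<dots> = sXY * (1 / (Y - 1) + 1 / (X - 1)) - sX * (1 / (Y - 1)) - sY * (1 / (X - 1))"
    by (simp only: sum_subtractf sum_distrib_right [symmetric] sX_def sY_def sXY_def)
  finally have *: "(\<Sum>b\<in>B. \<Sum>c\<in>{..<b} - B. X^b * Y^c + Y^b * X^c)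
    = sXY * (1 / (Y - 1) + 1 / (X - 1)) - sX * (1 / (Y - 1)) - sY * (1 / (X - 1)) - (sX * sY - sXY)" .
  have c: "(X*Y - 1) / ((X - 1) * (Y - 1)) = 1 / (Y - 1) + 1 / (X - 1) + 1"
    using assms by (simp add: divide_simps) (simp add: algebra_simps)
  have d: "1 / (X*Y - 1) * ((X*Y - 1) / ((X - 1) * (Y - 1))) = 1 / (X - 1) * (1 / (Y - 1))"
    using assms by simp
  show ?thesis
    unfolding * sX_def[symmetric] sY_def[symmetric] sXY_def[symmetric] distrib_right d unfolding c
    by (simp add: ring_distribs)
qed

text \<open>This is \<open>coth (u / 2) / 2\<close>, an odd function with a simple pole of residue 1
  at 0. For \<open>X = exp u\<close> and \<open>Y = exp v\<close> the sum
  \<open>hcoth u + hcoth v\<close> is the factor \<open>(X Y - 1) / ((X - 1) (Y - 1))\<close> of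
  \<open>geometric_product\<close>.\<close>

definition hcoth :: "complex \<Rightarrow> complex" where
  "hcoth u = (exp u + 1) / (2 * (exp u - 1))"

text \<open>Translation by \<open>L\<close> turns the beads from \<open>- L\<close> upwards into a
  finite set of natural numbers; the filled positions below contribute the vacuum term
  \<open>1 / (exp x - 1)\<close> times the same translation factor.\<close>

lemma weight_conv_geometric:
  assumes L: "maya_bd L S" and "exp x \<noteq> 1"
  shows "weight S x = exp (x / 2) * exp (- of_nat L * x) *
     ((\<Sum>b | int b - int L \<in> S. exp x ^ b) + 1 / (exp x - 1))"
proof -
  define B where "B = {b. int b - int L \<in> S}"
  have B: "B \<subseteq> {..<2*L}" by (auto simp: B_def dest: maya_bdD(3)[OF L])
  have pw: "exp (x * of_int (int b - int L)) = exp (- of_nat L * x) * exp x ^ b" for b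
    by (simp add: exp_of_nat_mult [symmetric] exp_add [symmetric] algebra_simps)
  have "msum S (\<lambda>k. exp (x * of_int k))
     = (\<Sum>b<2*L. exp (x * of_int (int b - int L)) * (of_bool (b \<in> B) - of_bool (b < L)))"
    unfolding msum_eq[OF L] B_def
    by (rule sum.reindex_bij_witness[of _ "\<lambda>b. int b - int L" "\<lambda>k. nat (k + int L)"]) auto
  also have "\<dots> = exp (- of_nat L * x) * (\<Sum>b<2*L. exp x ^ b * of_bool (b \<in> B) - exp x ^ b * of_bool (b < L))"
    unfolding pw sum_distrib_left by (intro sum.cong refl) (simp add: algebra_simps)
  also have "(\<Sum>b<2*L. exp x ^ b * of_bool (b \<in> B) - exp x ^ b * of_bool (b < L))
      = (\<Sum>b\<in>B. exp x ^ b) - (\<Sum>b<L. exp x ^ b)"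
    unfolding sum_subtractf using B
    by (intro arg_cong2[where f = "(-)"] sum.mono_neutral_cong_right) auto
  also have "(\<Sum>b<L. exp x ^ b) = (exp x ^ L - 1) / (exp x - 1)"
    using assms(2) by (simp add: sum_gp_strict divide_simps) (simp add: algebra_simps)
  finally have "msum S (\<lambda>k. exp (x * of_int k)) + 1 / (exp x - 1)
    = exp (- of_nat L * x) * ((\<Sum>b\<in>B. exp x ^ b) - (exp x ^ L - 1) / (exp x - 1)) + 1 / (exp x - 1)" by simp
  also have "\<dots> = exp (- of_nat L * x) * ((\<Sum>b\<in>B. exp x ^ b) - (exp x ^ L - 1) / (exp x - 1) + exp x ^ L / (exp x - 1))"
    by (simp add: ring_distribs exp_of_nat_mult exp_minus)
  also have "(\<Sum>b\<in>B. exp x ^ b) - (exp x ^ L - 1) / (exp x - 1) + exp x ^ L / (exp x - 1)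
     = (\<Sum>b\<in>B. exp x ^ b) + 1 / (exp x - 1)"
    by (simp add: diff_divide_distrib)
  finally show ?thesis by (simp add: weight_def B_def add.commute mult.assoc)
qed

lemma heads_empty:
  assumes "S \<in> maya" "m > energy S" shows "heads S m = {}"
  using energy_move[OF assms(1)] assms(2) by fastforce

text \<open>The defect in \<open>geometric_product\<close> runs over pairs of a bead and a lower
  gap, that is, over hooks. There are no gaps below \<open>- L\<close>, so the translated finite set
  sees all of them.\<close>

lemma weight_product:
  assumes S: "S \<in> maya" and u: "exp u \<noteq> 1" "exp v \<noteq> 1" "exp (u + v) \<noteq> 1"
  shows "weight S u * weight S v = weight S (u + v) * (hcoth u + hcoth v)
     - (\<Sum>m\<in>{1..energy S}. (exp (- of_nat m * u) + exp (- of_nat m * v)) *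
          (\<Sum>k\<in>heads S m. exp ((u + v) * (of_int k + 1/2))))"
proof -
  obtain L where L: "maya_bd L S" using S by (rule maya_bdE)
  define B where "B = {b. int b - int L \<in> S}"
  define X where "X = exp u"
  define Y where "Y = exp v"
  have XY: "exp (u + v) = X * Y" by (simp add: X_def Y_def exp_add)
  have B: "B \<subseteq> {..<2*L}" by (auto simp: B_def dest: maya_bdD(3)[OF L])
  then have fB: "finite B" by (rule finite_subset) simp
  define h where "h = (\<Sum>b\<in>B. \<Sum>c\<in>{..<b} - B. X^b * Y^c + Y^b * X^c)"
  \<comment> \<open>The half-integer shift and the translation cost the same for the product of the
    two weights as for one weight at \<open>u + v\<close>, so \<open>e\<close> factors out of the
    whole identity.\<close>
  define e where "e = exp ((u + v) / 2) * exp (- of_nat L * (u + v))"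
  have e: "exp (u / 2) * exp (- of_nat L * u) * (exp (v / 2) * exp (- of_nat L * v)) = e"
    unfolding e_def by (simp add: exp_add [symmetric]) (simp add: algebra_simps add_divide_distrib)
  have hc: "hcoth u + hcoth v = (X * Y - 1) / ((X - 1) * (Y - 1))"
    using u unfolding hcoth_def X_def[symmetric] Y_def[symmetric]
    by (simp add: divide_simps) (simp add: algebra_simps)
  have "weight S u * weight S v = e * (((\<Sum>b\<in>B. X^b) + 1 / (X - 1)) * ((\<Sum>b\<in>B. Y^b) + 1 / (Y - 1)))"
    unfolding weight_conv_geometric[OF L u(1)] weight_conv_geometric[OF L u(2)] B_def[symmetric] X_def[symmetric] Y_def[symmetric]
      e [symmetric] by (simp only: mult_ac)
  also have "\<dots> = e * ((\<Sum>b\<in>B. (X*Y)^b) + 1 / (X*Y - 1)) * (hcoth u + hcoth v) - e * h"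
  proof -
    have "((\<Sum>b\<in>B. X^b) + 1 / (X - 1)) * ((\<Sum>b\<in>B. Y^b) + 1 / (Y - 1))
       = ((\<Sum>b\<in>B. (X*Y)^b) + 1 / (X*Y - 1)) * (hcoth u + hcoth v) - h"
      unfolding h_def hc by (rule geometric_product[OF fB]) (use u XY in \<open>simp_all add: X_def Y_def\<close>)
    then show ?thesis by (simp only: right_diff_distrib mult.assoc)
  qed
  also have "e * ((\<Sum>b\<in>B. (X*Y)^b) + 1 / (X*Y - 1)) = weight S (u + v)"
    unfolding weight_conv_geometric[OF L u(3)] e_def XY B_def ..
  also have "e * h = (\<Sum>m\<in>{1..energy S}. (exp (- of_nat m * u) + exp (- of_nat m * v)) *
          (\<Sum>k\<in>heads S m. exp ((u + v) * (of_int k + 1/2))))"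
  proof -
    have "e * h = (\<Sum>(b,c)\<in>Sigma B (\<lambda>b. {..<b} - B). e * (X^b * Y^c + Y^b * X^c))"
      unfolding h_def sum_distrib_left using fB by (subst sum.Sigma) auto
    also have "\<dots> = (\<Sum>(m,k)\<in>Sigma {1..energy S} (heads S). (exp (- of_nat m * u) + exp (- of_nat m * v)) *
        exp ((u + v) * (of_int k + 1/2)))"
    \<comment> \<open>A bead \<open>b\<close> with a gap \<open>c\<close> below it is the hook of
      length \<open>b - c\<close> with head \<open>b - L\<close>; by \<open>heads_empty\<close> the
      length is at most the energy.\<close>
    proof (rule sum.reindex_bij_witness[of _ "\<lambda>(m,k). (nat (k + int L), nat (k + int L - int m))"
             "\<lambda>(b,c). (b - c, int b - int L)"])
      fix p assume p: "p \<in> Sigma B (\<lambda>b. {..<b} - B)"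
      obtain b c where [simp]: "p = (b,c)" by force
      have bc: "b \<in> B" "c < b" "c \<notin> B" using p by auto
      show "(case case p of (b, c) \<Rightarrow> (b - c, int b - int L) of
          (m, k) \<Rightarrow> (nat (k + int L), nat (k + int L - int m))) = p"
        using bc by auto
      have hd: "int b - int L \<in> heads S (b - c)"
        using bc by (auto simp: heads_def B_def of_nat_diff)
      then have "b - c \<le> energy S"
        using heads_empty[OF S, of "b - c"] by force
      then show "(case p of (b, c) \<Rightarrow> (b - c, int b - int L)) \<in> Sigma {1..energy S} (heads S)"
        using bc hd by auto
      have "(exp (- of_nat (b - c) * u) + exp (- of_nat (b - c) * v)) * exp ((u + v) * (of_int (int b - int L) + 1/2))
         = e * (X^b * Y^c + Y^b * X^c)"
        unfolding e_def X_def Y_def using bc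
        by (simp add: ring_distribs exp_of_nat_mult [symmetric] exp_add [symmetric] of_nat_diff)
           (simp add: algebra_simps add_divide_distrib)
      then show "(case case p of (b, c) \<Rightarrow> (b - c, int b - int L) of
          (m, k) \<Rightarrow> (exp (- of_nat m * u) + exp (- of_nat m * v)) * exp ((u + v) * (of_int k + 1/2))) =
         (case p of (b, c) \<Rightarrow> e * (X^b * Y^c + Y^b * X^c))" by simp
    next
      fix p assume p: "p \<in> Sigma {1..energy S} (heads S)"
      obtain m k where [simp]: "p = (m,k)" by force
      have mk: "m \<ge> 1" "k \<in> S" "k - int m \<notin> S" using p by (auto simp: heads_def)
      then have "k - int m \<ge> - int L" using maya_bdD(4)[OF L] by auto
      then show "(case case p of (m, k) \<Rightarrow> (nat (k + int L), nat (k + int L - int m)) of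
          (b, c) \<Rightarrow> (b - c, int b - int L)) = p"
        "(case p of (m, k) \<Rightarrow> (nat (k + int L), nat (k + int L - int m))) \<in> Sigma B (\<lambda>b. {..<b} - B)"
        using mk by (auto simp: B_def nat_diff_distrib algebra_simps)
    qed
    also have "\<dots> = (\<Sum>m\<in>{1..energy S}. \<Sum>k\<in>heads S m. (exp (- of_nat m * u) + exp (- of_nat m * v)) *
        exp ((u + v) * (of_int k + 1/2)))"
      using finite_heads[OF L] by (subst sum.Sigma) auto
    finally show ?thesis by (simp only: sum_distrib_left)
  qed
  finally show ?thesis .
qed

section \<open>Partitions as Maya diagrams\<close>

text \<open>Raised by \<open>1/2\<close>, the element of index \<open>i\<close> is the number
  \<open>\<mu> ! i - (i + 1) + 1/2\<close> of \<open>bo_Q\<close>. Trailing zeros are permitted: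
  they occupy negative positions that are filled in any case.\<close>

definition maya_of :: "nat list \<Rightarrow> int set" where
  "maya_of \<mu> = (\<lambda>i. int (\<mu> ! i) - int i - 1) ` {..<length \<mu>} \<union> {..<- int (length \<mu>)}"

lemma maya_of_bd:
  assumes "length \<mu> \<le> L" "\<And>i. i < length \<mu> \<Longrightarrow> \<mu> ! i \<le> L"
  shows "maya_bd L (maya_of \<mu>)"
proof -
  have "k \<in> maya_of \<mu>" if "k < - int L" for k
    using that assms(1) by (auto simp: maya_of_def)
  moreover have "k < int L" if "k \<in> maya_of \<mu>" for k
    using that assms(2) by (fastforce simp: maya_of_def)
  ultimately show ?thesis by (auto simp: maya_bd_def)
qed

lemma sorted_nth_shift:
  assumes "sorted_wrt (\<ge>) \<mu>" "i < j" "j < length \<mu>"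
  shows "int (\<mu> ! j) - int j - 1 < int (\<mu> ! i) - int i - 1"
  using sorted_wrt_nth_less[OF assms(1,2,3)] assms(2) by simp

lemma inj_on_shift:
  assumes "sorted_wrt (\<ge>) \<mu>"
  shows "inj_on (\<lambda>i. int (\<mu> ! i) - int i - 1) {..<length \<mu>}"
proof (rule inj_onI)
  fix i j assume "i \<in> {..<length \<mu>}" "j \<in> {..<length \<mu>}" "int (\<mu> ! i) - int i - 1 = int (\<mu> ! j) - int j - 1"
  then show "i = j"
    using sorted_nth_shift[OF assms, of i j] sorted_nth_shift[OF assms, of j i] by (cases i j rule: linorder_cases) auto
qed

text \<open>The vacuum beads at \<open>-1, ..., -n\<close> are matched with the \<open>n\<close>
  shifted parts. A constant \<open>f\<close> then gives the charge, and the identity gives the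
  energy.\<close>

lemma msum_maya_of:
  assumes "sorted_wrt (\<ge>) \<mu>"
  shows "msum (maya_of \<mu>) f = (\<Sum>i<length \<mu>. f (int (\<mu> ! i) - int i - 1) - f (- int i - 1))"
proof -
  define n where "n = length \<mu>"
  define L where "L = length \<mu> + sum_list \<mu>"
  let ?K = "{-int L..<int L}"
  define I where "I = (\<lambda>i. int (\<mu> ! i) - int i - 1) ` {..<n}"
  have bd: "maya_bd L (maya_of \<mu>)"
    by (rule maya_of_bd) (auto simp: L_def intro!: elem_le_sum_list trans_le_add2)
  have IK: "I \<subseteq> {-int n..<int L}"
    using elem_le_sum_list[of _ \<mu>] by (force simp: I_def n_def L_def)
  have "msum (maya_of \<mu>) f = (\<Sum>k\<in>?K. f k * (of_bool (k \<in> I) - of_bool (k \<in> {-int n..<0})))"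
    unfolding msum_eq[OF bd] using IK
    by (intro sum.cong refl arg_cong2[where f = "(*)"]) (auto simp: maya_of_def I_def n_def)
  also have "\<dots> = (\<Sum>k\<in>?K. f k * of_bool (k \<in> I)) - (\<Sum>k\<in>?K. f k * of_bool (k \<in> {-int n..<0}))"
    by (simp add: sum_subtractf algebra_simps)
  also have "(\<Sum>k\<in>?K. f k * of_bool (k \<in> I)) = sum f I"
    using IK by (intro sum.mono_neutral_cong_right) (auto simp: L_def n_def)
  also have "\<dots> = (\<Sum>i<n. f (int (\<mu> ! i) - int i - 1))"
    unfolding I_def by (subst sum.reindex) (use inj_on_shift[OF assms] in \<open>auto simp: n_def\<close>)
  also have "(\<Sum>k\<in>?K. f k * of_bool (k \<in> {-int n..<0})) = sum f {-int n..<0}"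
    by (intro sum.mono_neutral_cong_right) (auto simp: L_def n_def)
  also have "\<dots> = (\<Sum>i<n. f (- int i - 1))"
    by (rule sum.reindex_bij_witness[of _ "\<lambda>i. - int i - 1" "\<lambda>k. nat (- k - 1)"]) auto
  finally show ?thesis by (simp add: sum_subtractf n_def)
qed

lemma maya_of_in_maya:
  assumes "sorted_wrt (\<ge>) \<mu>"
  shows "maya_of \<mu> \<in> maya" "energy (maya_of \<mu>) = sum_list \<mu>"
proof -
  have "maya_bd (length \<mu> + sum_list \<mu>) (maya_of \<mu>)"
    by (rule maya_of_bd) (auto intro!: elem_le_sum_list trans_le_add2)
  then show "maya_of \<mu> \<in> maya" by (auto simp: maya_def msum_maya_of[OF assms])
  have "msum (maya_of \<mu>) (\<lambda>k. k) = int (sum_list \<mu>)"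
    unfolding msum_maya_of[OF assms] by (simp add: sum_list_sum_nth atLeast0LessThan)
  then show "energy (maya_of \<mu>) = sum_list \<mu>" by (simp add: energy_def)
qed

lemma maya_of_pad: "maya_of (\<mu> @ replicate r 0) = maya_of \<mu>"
proof (induction r)
  case (Suc r)
  have step: "maya_of (\<nu> @ [0]) = maya_of \<nu>" for \<nu>
  proof -
    have "(\<lambda>i. int ((\<nu> @ [0]) ! i) - int i - 1) ` {..<length \<nu>} = (\<lambda>i. int (\<nu> ! i) - int i - 1) ` {..<length \<nu>}"
      by (intro image_cong refl) (simp add: nth_append)
    moreover have "{..<- int (length \<nu>)} = insert (- int (length \<nu>) - 1) {..<- 1 - int (length \<nu>)}"
      by auto
    ultimately show ?thesis by (simp add: maya_of_def lessThan_Suc)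
  qed
  show ?case using step[of "\<mu> @ replicate r 0"] Suc by (simp add: replicate_append_same)
qed simp

lemma sorted_pad:
  "sorted_wrt (\<ge>) (\<mu> @ replicate r (0::nat)) \<longleftrightarrow> sorted_wrt (\<ge>) \<mu>"
proof -
  have "sorted_wrt (\<ge>) (replicate r (0::nat))" by (induction r) auto
  then show ?thesis by (auto simp: sorted_wrt_append)
qed

lemma sorted_eq_pad:
  "sorted_wrt (\<ge>) (\<mu> :: nat list) \<Longrightarrow> \<mu> = filter (\<lambda>x. x \<noteq> 0) \<mu> @ replicate (length \<mu> - length (filter (\<lambda>x. x \<noteq> 0) \<mu>)) 0"
proof (induction \<mu>)
  case (Cons a \<mu>)
  show ?case
  proof (cases "a = 0")
    case True
    then have z: "\<forall>x\<in>set \<mu>. x = 0" using Cons.prems by auto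
    then have "filter (\<lambda>x. x \<noteq> 0) \<mu> = []" by (auto simp: filter_empty_conv)
    moreover have "\<mu> = replicate (length \<mu>) 0" using z by (simp add: replicate_eqI)
    ultimately show ?thesis using True by simp
  qed (use Cons in auto)
qed simp

text \<open>The shifted parts, read backwards, enumerate the beads from \<open>- n\<close> upwards
  in increasing order, and a finite set has only one such enumeration. Equal lengths matter, because
  trailing zeros leave no trace in the set.\<close>

lemma maya_of_inj_same_length:
  assumes "sorted_wrt (\<ge>) \<mu>" "sorted_wrt (\<ge>) \<nu>" "length \<mu> = length \<nu>" "maya_of \<mu> = maya_of \<nu>"
  shows "\<mu> = \<nu>"
proof -
  define n where "n = length \<mu>"
  let ?g = "\<lambda>\<mu> i. int (\<mu> ! i) - int i - 1"
  let ?l = "\<lambda>\<mu>. map (?g \<mu>) (rev [0..<n])"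
  have S: "sorted (?l \<mu>) \<and> distinct (?l \<mu>) \<and> set (?l \<mu>) = maya_of \<mu> - {..<- int n}" 
    if "sorted_wrt (\<ge>) \<mu>" "length \<mu> = n" for \<mu>
  proof -
    have "sorted_wrt (\<lambda>i j. ?g \<mu> j \<le> ?g \<mu> i) [0..<n]"
      using that(2) less_imp_le[OF sorted_nth_shift[OF that(1)]] unfolding sorted_wrt_iff_nth_less by simp
    then have "sorted (?l \<mu>)" by (simp add: sorted_wrt_rev sorted_wrt_map)
    moreover have "distinct (?l \<mu>)"
      using inj_on_shift[OF that(1)] that(2) by (simp add: distinct_map atLeast0LessThan)
    moreover have "set (?l \<mu>) = maya_of \<mu> - {..<- int n}"
      using that(2) by (auto simp: maya_of_def)
    ultimately show ?thesis by blast
  qed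
  have "?l \<mu> = ?l \<nu>"
    using S[of \<mu>] S[of \<nu>] assms by (intro sorted_distinct_set_unique) (auto simp: n_def)
  then have "?g \<mu> i = ?g \<nu> i" if "i < n" for i
    using that by (auto simp: map_eq_conv)
  then show ?thesis using assms(3) by (intro nth_equalityI) (auto simp: n_def)
qed

lemma maya_of_surj:
  assumes "S \<in> maya"
  obtains \<mu> where "sorted_wrt (\<ge>) \<mu>" "maya_of \<mu> = S"
proof -
  obtain L where L: "maya_bd L S" and c0: "msum S (\<lambda>_. 1::int) = 0" using assms by (auto simp: maya_def)
  define B where "B = S \<inter> {-int L..<int L}"
  have fB: "finite B" by (simp add: B_def)
  have "msum S (\<lambda>_. 1::int) = (\<Sum>k\<in>{-int L..<int L}. of_bool (k \<in> B) - of_bool (k < 0))"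
    unfolding msum_eq[OF L] by (intro sum.cong refl) (auto simp: B_def)
  also have "\<dots> = (\<Sum>k\<in>{-int L..<int L}. of_bool (k \<in> B)) - (\<Sum>k\<in>{-int L..<int L}. of_bool (k < 0))"
    by (rule sum_subtractf)
  also have "(\<Sum>k\<in>{-int L..<int L}. of_bool (k \<in> B) :: int) = (\<Sum>k\<in>B. 1)"
    by (intro sum.mono_neutral_cong_right) (auto simp: B_def)
  also have "(\<Sum>k\<in>{-int L..<int L}. of_bool (k < 0) :: int) = (\<Sum>k\<in>{-int L..<0}. 1)"
    by (intro sum.mono_neutral_cong_right) auto
  \<comment> \<open>Charge \<open>0\<close> says that the window holds as many beads as it has
    negative positions.\<close>
  finally have cB: "card B = L" using c0 by simp
  define l where "l = rev (sorted_list_of_set B)"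
  have len: "length l = L" by (simp add: l_def cB)
  have sl: "set l = B" using fB by (simp add: l_def)
  have "sorted_wrt (<) (sorted_list_of_set B)" by (rule strict_sorted_list_of_set)
  then have desc: "sorted_wrt (>) l" by (simp add: l_def sorted_wrt_rev)
  \<comment> \<open>Strictly decreasing integers drop by at least one per step, so
    \<open>l ! i + i\<close> decreases weakly and the parts come out sorted.\<close>
  have gap: "l ! i + int i \<ge> l ! j + int j" if "i \<le> j" "j < L" for i j
    using that
  proof (induction j rule: dec_induct)
    case (step j)
    have "l ! j > l ! Suc j" using desc step by (auto simp: sorted_wrt_iff_nth_less len)
    then show ?case using step by auto
  qed simp
  define \<mu> where "\<mu> = map (\<lambda>i. nat (l ! i + int i + 1)) [0..<L]"
  \<comment> \<open>The lowest bead has index \<open>L - 1\<close> and lies at or above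
    \<open>- L\<close>, so no part is negative and the \<open>nat\<close> in \<open>\<mu>\<close> is
    harmless.\<close>
  have nn: "l ! i + int i + 1 \<ge> 0" if "i < L" for i
  proof -
    have "l ! (L - 1) \<in> set l" using that len by (intro nth_mem) simp
    then have "l ! (L - 1) \<in> B" by (simp add: sl)
    then have "l ! (L - 1) \<ge> - int L" by (auto simp: B_def)
    moreover have "l ! (L - 1) + int (L - 1) \<le> l ! i + int i" by (rule gap) (use that in auto)
    ultimately show ?thesis using that by (simp add: of_nat_diff)
  qed
  have "sorted_wrt (\<ge>) \<mu>"
    unfolding \<mu>_def sorted_wrt_map sorted_wrt_iff_nth_less using gap
    by (auto intro!: nat_mono)
  moreover have "maya_of \<mu> = S"
  proof -
    have "(\<lambda>i. int (\<mu> ! i) - int i - 1) ` {..<length \<mu>} = (\<lambda>i. l ! i) ` {..<L}"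
      using nn by (intro image_cong) (auto simp: \<mu>_def)
    also have "\<dots> = B" unfolding sl[symmetric] len[symmetric] by (auto simp: in_set_conv_nth)
    finally show ?thesis using L by (auto simp: maya_of_def \<mu>_def B_def maya_bd_def not_less [symmetric])
  qed
  ultimately show ?thesis by (rule that)
qed

lemma bij_betw_maya_of: "bij_betw maya_of partitions maya"
proof (rule bij_betwI')
  fix \<mu> \<nu> assume mn: "\<mu> \<in> partitions" "\<nu> \<in> partitions"
  show "maya_of \<mu> = maya_of \<nu> \<longleftrightarrow> \<mu> = \<nu>"
  proof
    assume eq: "maya_of \<mu> = maya_of \<nu>"
    \<comment> \<open>Padding each list by the length of the other one reduces to lists of equal
      length; deleting the zeros afterwards recovers the partitions.\<close>
    define \<mu>' where "\<mu>' = \<mu> @ replicate (length \<nu>) 0"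
    define \<nu>' where "\<nu>' = \<nu> @ replicate (length \<mu>) 0"
    have "\<mu>' = \<nu>'"
      using mn eq by (intro maya_of_inj_same_length)
        (simp_all add: \<mu>'_def \<nu>'_def sorted_pad maya_of_pad partitions_def)
    then have "filter (\<lambda>x. x \<noteq> 0) \<mu>' = filter (\<lambda>x. x \<noteq> 0) \<nu>'" by simp
    moreover have "filter (\<lambda>x. x \<noteq> 0) \<mu> = \<mu>" "filter (\<lambda>x. x \<noteq> 0) \<nu> = \<nu>"
      using mn by (auto simp: partitions_def filter_id_conv intro: ccontr)
    ultimately show "\<mu> = \<nu>" by (simp add: \<mu>'_def \<nu>'_def)
  qed simp
next
  fix \<mu> assume "\<mu> \<in> partitions"
  then show "maya_of \<mu> \<in> maya" by (simp add: partitions_def maya_of_in_maya)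
next
  fix S assume "S \<in> maya"
  then obtain \<mu> where m: "sorted_wrt (\<ge>) \<mu>" "maya_of \<mu> = S" by (rule maya_of_surj)
  let ?f = "filter (\<lambda>x. x \<noteq> 0) \<mu>"
  have "maya_of ?f = S" using m sorted_eq_pad[OF m(1)] maya_of_pad by metis
  moreover have "?f \<in> partitions" using m by (auto simp: partitions_def sorted_wrt_filter)
  ultimately show "\<exists>\<mu>\<in>partitions. S = maya_of \<mu>" by blast
qed

section \<open>Convergence of the partition function\<close>

lemma summable_finite_subsets:
  fixes r :: real
  assumes "0 \<le> r" "r < 1"
  shows "(\<lambda>P. r ^ \<Sum>P) summable_on {P::nat set. finite P}"
proof (rule nonneg_bdd_above_summable_on)
  show "bdd_above (sum (\<lambda>P. r ^ \<Sum>P) ` {F. F \<subseteq> {P. finite P} \<and> finite F})"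
  proof (rule bdd_aboveI2)
    fix F :: "nat set set" assume F: "F \<in> {F. F \<subseteq> {P. finite P} \<and> finite F}"
    then have "finite (\<Union>F)" by auto
    then obtain n where n: "\<Union>F \<subseteq> {..<n}" using finite_nat_iff_bounded by blast
    have "(\<Sum>P\<in>F. r ^ \<Sum>P) \<le> (\<Sum>P\<in>Pow {..<n}. r ^ \<Sum>P)"
      using n assms by (intro sum_mono2) auto
    \<comment> \<open>Subsets are the terms of the expanded product, and
      \<open>1 + x <= exp x\<close> then bounds it independently of \<open>n\<close>.\<close>
    also have "\<dots> = (\<Prod>k<n. r ^ k + 1)"
      by (subst prod_add) (auto simp: power_sum intro!: sum.cong)
    also have "\<dots> \<le> (\<Prod>k<n. exp (r ^ k))"
      using assms by (intro prod_mono) (auto simp: add.commute exp_ge_add_one_self)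
    also have "\<dots> = exp (\<Sum>k<n. r ^ k)" by (simp add: exp_sum)
    also have "\<dots> \<le> exp (1 / (1 - r))"
      using assms by (simp add: sum_gp_strict divide_right_mono)
    finally show "(\<Sum>P\<in>F. r ^ \<Sum>P) \<le> exp (1 / (1 - r))" .
  qed
qed (use assms in auto)

text \<open>A diagram is determined by its beads at nonnegative positions and its gaps at negative
  ones, two finite sets of naturals after reflecting the gaps. Forgetting that the two have equal
  size only enlarges the sum, and the energy dominates both subset sums together, since a gap counts
  \<open>- k\<close> rather than \<open>- k - 1\<close>.\<close>

lemma maya_summable:
  fixes r :: real
  assumes "0 \<le> r" "r < 1"
  shows "(\<lambda>S. r ^ energy S) summable_on maya"
proof -
  let ?Fin = "{P::nat set. finite P}"
  define \<phi> where "\<phi> = (\<lambda>S::int set. (nat ` (S - {..<0}), (\<lambda>k. nat (-k-1)) ` ({..<0} - S)))"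
  have s: "(\<lambda>P. r ^ \<Sum>P) summable_on ?Fin" by (rule summable_finite_subsets[OF assms])
  have "(\<lambda>x. norm (case x of (P,Q) \<Rightarrow> r ^ \<Sum>P * r ^ \<Sum>Q)) summable_on (?Fin \<times> ?Fin)"
  proof (subst Infinite_Sum.abs_summable_on_Sigma_iff, intro conjI ballI)
    fix P :: "nat set"
    show "(\<lambda>Q. norm (case (P, Q) of (P,Q) \<Rightarrow> r ^ \<Sum>P * r ^ \<Sum>Q)) summable_on ?Fin"
      using s assms by (simp add: norm_mult norm_power summable_on_cmult_right)
    have "(\<lambda>P. norm (r ^ \<Sum>P * (\<Sum>\<^sub>\<infinity>Q\<in>?Fin. r ^ \<Sum>Q))) summable_on ?Fin"
      using s by (intro summable_on_iff_abs_summable_on_real[THEN iffD1] summable_on_cmult_left)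
    then show "(\<lambda>P. norm (\<Sum>\<^sub>\<infinity>Q\<in>?Fin. norm (case (P, Q) of (P,Q) \<Rightarrow> r ^ \<Sum>P * r ^ \<Sum>Q))) summable_on ?Fin"
      using assms by (simp add: norm_mult norm_power infsum_cmult_right')
  qed
  then have "(\<lambda>(P,Q). r ^ \<Sum>P * r ^ \<Sum>Q) summable_on (?Fin \<times> ?Fin)"
    by (rule abs_summable_summable)
  moreover have sub: "\<phi> ` maya \<subseteq> ?Fin \<times> ?Fin"
    using maya_finite by (auto simp: \<phi>_def)
  ultimately have "(\<lambda>(P,Q). r ^ \<Sum>P * r ^ \<Sum>Q) summable_on \<phi> ` maya"
    by (rule summable_on_subset_banach)
  moreover have "inj_on \<phi> maya"
  proof (rule inj_onI)
    fix S T assume "\<phi> S = \<phi> T"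
    then have *: "nat ` (S - {..<0}) = nat ` (T - {..<0})"
       "(\<lambda>k. nat (-k-1)) ` ({..<0} - S) = (\<lambda>k. nat (-k-1)) ` ({..<0} - T)" by (auto simp: \<phi>_def)
    have "S - {..<0} = T - {..<0}"
      by (rule inj_on_image_eq_iff[THEN iffD1, OF _ _ _ *(1), of "{0..}"]) (auto simp: inj_on_def)
    moreover have "{..<0} - S = {..<0} - T"
      by (rule inj_on_image_eq_iff[THEN iffD1, OF _ _ _ *(2), of "{..<0}"]) (auto simp: inj_on_def)
    ultimately show "S = T" by blast
  qed
  ultimately have 1: "(\<lambda>S. case \<phi> S of (P,Q) \<Rightarrow> r ^ \<Sum>P * r ^ \<Sum>Q) summable_on maya"
    by (subst (asm) summable_on_reindex) (auto simp: o_def)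
  show ?thesis
  proof (rule summable_on_comparison_test[OF 1])
    fix S assume S: "S \<in> maya"
    have fin: "finite (S - {..<0})" "finite ({..<0} - S)" using maya_finite[OF S] by auto
    have "int (\<Sum>(nat ` (S - {..<0})) + \<Sum>((\<lambda>k. nat (-k-1)) ` ({..<0} - S)))
       = (\<Sum>k\<in>S - {..<0}. k) + (\<Sum>k\<in>{..<0} - S. - k - 1)"
      by (subst (1 2) sum.reindex) (auto simp: inj_on_def o_def intro!: sum.cong)
    also have "\<dots> \<le> (\<Sum>k\<in>S - {..<0}. k) + (\<Sum>k\<in>{..<0} - S. - k)"
      by (intro add_mono sum_mono) auto
    also have "\<dots> = int (energy S)"
      using energy_eq(2)[OF S] by (simp add: msum_def sum_negf)
    finally have "\<Sum>(nat ` (S - {..<0})) + \<Sum>((\<lambda>k. nat (-k-1)) ` ({..<0} - S)) \<le> energy S"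
      by (simp only: of_nat_le_iff)
    then show "r ^ energy S \<le> (case \<phi> S of (P,Q) \<Rightarrow> r ^ \<Sum>P * r ^ \<Sum>Q)"
      unfolding \<phi>_def using assms by (simp add: power_add [symmetric] power_decreasing)
  qed (use assms in auto)
qed

section \<open>Sums over Maya diagrams and the two-point reduction\<close>

text \<open>The rate \<open>r\<close> competes with the decay of \<open>q ^ energy\<close>: averages
  converge once \<open>exp r * norm q < 1\<close>. Rates add under products, so all smallness
  requirements on arguments become linear inequalities.\<close>

definition growth :: "real \<Rightarrow> (int set \<Rightarrow> complex) \<Rightarrow> bool" where
  "growth r g \<longleftrightarrow> (\<exists>K. \<forall>S\<in>maya. norm (g S) \<le> K * exp (r * real (energy S)))"

lemma growthD:
  assumes "growth r g"
  shows "\<exists>K\<ge>0. \<forall>S\<in>maya. norm (g S) \<le> K * exp (r * real (energy S))"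
proof -
  obtain K where K: "\<And>S. S \<in> maya \<Longrightarrow> norm (g S) \<le> K * exp (r * real (energy S))"
    using assms by (auto simp: growth_def)
  have "norm (g S) \<le> max K 0 * exp (r * real (energy S))" if "S \<in> maya" for S
  proof -
    have "norm (g S) \<le> K * exp (r * real (energy S))" by (rule K[OF that])
    also have "\<dots> \<le> max K 0 * exp (r * real (energy S))" by (intro mult_right_mono) auto
    finally show ?thesis .
  qed
  then show ?thesis by (intro exI[of _ "max K 0"]) auto
qed

lemma growth_mono: "growth r g \<Longrightarrow> r \<le> r' \<Longrightarrow> growth r' g"
proof -
  assume g: "growth r g" and r: "r \<le> r'"
  obtain K where K: "K \<ge> 0" "\<And>S. S \<in> maya \<Longrightarrow> norm (g S) \<le> K * exp (r * real (energy S))"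
    using growthD[OF g] by blast
  have "K * exp (r * real (energy S)) \<le> K * exp (r' * real (energy S))" for S
    using K(1) r by (intro mult_left_mono) (auto intro: mult_right_mono)
  then show "growth r' g" using K(2) unfolding growth_def by (meson order_trans)
qed

lemma growth_mult:
  assumes "growth a f" "growth b g" shows "growth (a + b) (\<lambda>S. f S * g S)"
proof -
  obtain K where K: "K \<ge> 0" "\<And>S. S \<in> maya \<Longrightarrow> norm (f S) \<le> K * exp (a * real (energy S))"
    using growthD[OF assms(1)] by blast
  obtain K' where K': "K' \<ge> 0" "\<And>S. S \<in> maya \<Longrightarrow> norm (g S) \<le> K' * exp (b * real (energy S))"
    using growthD[OF assms(2)] by blast
  have "norm (f S * g S) \<le> (K * K') * exp ((a + b) * real (energy S))" if "S \<in> maya" for S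
  proof -
    have "norm (f S * g S) \<le> (K * exp (a * real (energy S))) * (K' * exp (b * real (energy S)))"
      unfolding norm_mult using K K' that by (intro mult_mono) auto
    then show ?thesis by (simp add: algebra_simps exp_add)
  qed
  then show ?thesis by (auto simp: growth_def)
qed

lemma growth_const: "growth 0 (\<lambda>_. c)"
  by (auto simp: growth_def intro!: exI[of _ "norm c"])

lemma growth_prod:
  assumes "finite J" "\<And>j. j \<in> J \<Longrightarrow> growth (r j) (g j)"
  shows "growth (\<Sum>j\<in>J. r j) (\<lambda>S. \<Prod>j\<in>J. g j S)"
  using assms by (induction J rule: finite_induct) (auto intro: growth_const growth_mult)

lemma growth_abs_summable:
  assumes "growth r g" "exp r * norm q < 1"
  shows "(\<lambda>S. norm (g S * q ^ energy S)) summable_on maya"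
proof -
  obtain K where K: "K \<ge> 0" "\<And>S. S \<in> maya \<Longrightarrow> norm (g S) \<le> K * exp (r * real (energy S))"
    using growthD[OF assms(1)] by blast
  have "(\<lambda>S. K * (exp r * norm q) ^ energy S) summable_on maya"
    using assms(2) by (intro summable_on_cmult_right maya_summable) auto
  then show ?thesis
  proof (rule summable_on_comparison_test)
    fix S assume S: "S \<in> maya"
    have "norm (g S * q ^ energy S) \<le> K * exp (r * real (energy S)) * norm q ^ energy S"
      unfolding norm_mult norm_power using K S by (intro mult_right_mono) auto
    then show "norm (g S * q ^ energy S) \<le> K * (exp r * norm q) ^ energy S"
      by (simp add: power_mult_distrib exp_of_nat_mult [symmetric] mult_ac)
  qed simp
qed

lemma card_symdiff_le:
  assumes "S \<in> maya"
  shows "real (card (S - {..<0}) + card ({..<0} - S)) \<le> 2 * real (energy S)"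
proof -
  have "(1/2) * real (card (S - {..<0})) \<le> (\<Sum>k\<in>S - {..<0}. real_of_int k + 1/2)"
    using sum_mono[of "S - {..<0}" "\<lambda>_. 1/2" "\<lambda>k. real_of_int k + 1/2"] by simp
  moreover have "(1/2) * real (card ({..<0} - S)) \<le> (\<Sum>k\<in>{..<0} - S. - real_of_int k - 1/2)"
  proof -
    have "1/2 \<le> - real_of_int k - 1/2" if "k < 0" for k
    proof -
      have "k \<le> -1" using that by simp
      then have "real_of_int k \<le> -1" by linarith
      then show ?thesis by simp
    qed
    then show ?thesis using sum_mono[of "{..<0} - S" "\<lambda>_. 1/2" "\<lambda>k. - real_of_int k - 1/2"] by simp
  qed
  ultimately show ?thesis unfolding energy_eq(1)[OF assms] by simp
qed

lemma abs_le_energy: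
  assumes "S \<in> maya" "k \<in> (S - {..<0}) \<union> ({..<0} - S)"
  shows "\<bar>real_of_int k + 1/2\<bar> \<le> real (energy S)"
proof -
  have nonneg: "0 \<le> real_of_int k + 1/2" if "k \<in> S - {..<0}" for k using that by auto
  have neg: "0 \<le> - real_of_int k - 1/2" if "k \<in> {..<0} - S" for k
  proof -
    have "k \<le> -1" using that by simp
    then have "real_of_int k \<le> -1" by linarith
    then show ?thesis by simp
  qed
  have s: "0 \<le> (\<Sum>k\<in>S - {..<0}. real_of_int k + 1/2)" "0 \<le> (\<Sum>k\<in>{..<0} - S. - real_of_int k - 1/2)"
    using nonneg neg by (auto intro!: sum_nonneg)
  show ?thesis using assms(2)
  proof
    assume k: "k \<in> S - {..<0}"
    have "real_of_int k + 1/2 \<le> (\<Sum>k\<in>S - {..<0}. real_of_int k + 1/2)"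
      using member_le_sum[OF k, of "\<lambda>k. real_of_int k + 1/2"] nonneg maya_finite[OF assms(1)] by auto
    then show ?thesis using nonneg[OF k] s unfolding energy_eq(1)[OF assms(1)] by simp
  next
    assume k: "k \<in> {..<0} - S"
    have "- real_of_int k - 1/2 \<le> (\<Sum>k\<in>{..<0} - S. - real_of_int k - 1/2)"
      using member_le_sum[OF k, of "\<lambda>k. - real_of_int k - 1/2"] neg maya_finite[OF assms(1)] by auto
    then show ?thesis using neg[OF k] s unfolding energy_eq(1)[OF assms(1)] by simp
  qed
qed

lemma norm_exp_half_le:
  fixes w :: complex
  shows "\<bar>real_of_int k + 1/2\<bar> \<le> b \<Longrightarrow> norm (exp (w * (of_int k + 1/2))) \<le> exp (norm w * b)"
proof -
  assume b: "\<bar>real_of_int k + 1/2\<bar> \<le> b"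
  have "norm (exp (w * (of_int k + 1/2))) \<le> exp (norm (w * (of_int k + 1/2)))"
    by (rule norm_exp)
  also have "norm (w * (of_int k + 1/2)) = norm w * \<bar>real_of_int k + 1/2\<bar>"
  proof -
    have "(of_int k + 1/2 :: complex) = of_real (real_of_int k + 1/2)" by simp
    then show ?thesis by (simp only: norm_mult norm_of_real)
  qed
  also have "exp (norm w * \<bar>real_of_int k + 1/2\<bar>) \<le> exp (norm w * b)"
    using b by (simp add: mult_left_mono)
  finally show ?thesis .
qed

text \<open>A factor that is linear in the energy is traded for an arbitrarily small increase
  \<open>d\<close> of the exponential rate. This is why growth is always claimed for rates strictly
  above the norms of the arguments.\<close>

lemma linear_le_exp:
  fixes c d e :: real
  assumes "d > 0" "c \<ge> 0" "e \<ge> 0"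
  shows "c + e \<le> (c + 1 / d) * exp (d * e)"
proof -
  have "c + e \<le> (c + 1 / d) * (1 + d * e)" using assms by (simp add: field_simps)
  also have "\<dots> \<le> (c + 1 / d) * exp (d * e)" using assms by (intro mult_left_mono) auto
  finally show ?thesis .
qed

lemma weight_eq:
  "weight S x = exp (x / 2) / (exp x - 1) + (\<Sum>k\<in>S - {..<0}. exp (x * (of_int k + 1/2)))
     - (\<Sum>k\<in>{..<0} - S. exp (x * (of_int k + 1/2)))"
  by (simp add: weight_def msum_def ring_distribs exp_add sum_distrib_left mult.commute)

lemma norm_weight_le:
  assumes "S \<in> maya"
  shows "norm (weight S x) \<le> norm (exp (x / 2) / (exp x - 1)) + 2 * real (energy S) * exp (norm x * real (energy S))"
proof -
  have b: "norm (\<Sum>k\<in>A. exp (x * (of_int k + 1/2))) \<le> real (card A) * exp (norm x * real (energy S))"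
    if "A \<subseteq> (S - {..<0}) \<union> ({..<0} - S)" for A
    using that abs_le_energy[OF assms] by (intro sum_norm_bound norm_exp_half_le) blast
  have "norm (weight S x) \<le> norm (exp (x / 2) / (exp x - 1)) + norm (\<Sum>k\<in>S - {..<0}. exp (x * (of_int k + 1/2)))
     + norm (\<Sum>k\<in>{..<0} - S. exp (x * (of_int k + 1/2)))"
    unfolding weight_eq by norm
  also have "\<dots> \<le> norm (exp (x / 2) / (exp x - 1)) + real (card (S - {..<0})) * exp (norm x * real (energy S))
     + real (card ({..<0} - S)) * exp (norm x * real (energy S))"
    by (intro add_mono b) auto
  also have "\<dots> = norm (exp (x / 2) / (exp x - 1)) 
     + real (card (S - {..<0}) + card ({..<0} - S)) * exp (norm x * real (energy S))"
    by (simp add: algebra_simps)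
  also have "\<dots> \<le> norm (exp (x / 2) / (exp x - 1)) + 2 * real (energy S) * exp (norm x * real (energy S))"
    using card_symdiff_le[OF assms] by (intro add_mono mult_right_mono) auto
  finally show ?thesis .
qed

lemma growth_weight:
  assumes "norm x < r" shows "growth r (\<lambda>S. weight S x)"
proof -
  define c where "c = norm (exp (x / 2) / (exp x - 1))"
  define d where "d = r - norm x"
  have d: "d > 0" using assms by (simp add: d_def)
  have "norm (weight S x) \<le> (2 * (c + 1 / d)) * exp (r * real (energy S))" if "S \<in> maya" for S
  proof -
    have "norm (weight S x) \<le> c + 2 * real (energy S) * exp (norm x * real (energy S))"
      unfolding c_def by (rule norm_weight_le[OF that])
    also have "c \<le> 2 * c * exp (norm x * real (energy S))"
      using mult_mono[of c "2 * c" 1 "exp (norm x * real (energy S))"] by (auto simp: c_def)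
    also have "2 * c * exp (norm x * real (energy S)) + 2 * real (energy S) * exp (norm x * real (energy S))
       = 2 * (c + real (energy S)) * exp (norm x * real (energy S))" by (simp add: algebra_simps)
    also have "\<dots> \<le> 2 * ((c + 1 / d) * exp (d * real (energy S))) * exp (norm x * real (energy S))"
      using d by (intro mult_right_mono mult_left_mono linear_le_exp) (auto simp: c_def)
    also have "\<dots> = (2 * (c + 1 / d)) * exp (r * real (energy S))"
    proof -
      have "exp (d * real (energy S)) * exp (norm x * real (energy S)) = exp (r * real (energy S))"
        by (simp add: d_def exp_add [symmetric] algebra_simps)
      then show ?thesis by (simp only: mult.assoc)
    qed
    finally show ?thesis by simp
  qed
  then show ?thesis by (auto simp: growth_def)
qed

text \<open>One of \<open>k\<close> and \<open>k - m\<close> is displaced relative to the negative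
  integers, hence bounded by the energy, except possibly for tails in the window
  \<open>0 <= k < m\<close>.\<close>

lemma heads_tails_bounds:
  assumes "S \<in> maya" "k \<in> heads S m \<or> k \<in> tails S m"
  shows "\<bar>real_of_int k + 1/2\<bar> \<le> real (energy S) + real m"
proof -
  have e: "\<bar>real_of_int j + 1/2\<bar> \<le> real (energy S)" if "j \<in> S - {..<0} \<or> j \<in> {..<0} - S" for j
    using abs_le_energy[OF assms(1)] that by blast
  show ?thesis
  proof (cases "k \<in> (S - {..<0}) \<union> ({..<0} - S)")
    case True
    then show ?thesis using abs_le_energy[OF assms(1)] by force
  next
    case False
    have "\<bar>real_of_int (k - int m) + 1/2\<bar> \<le> real (energy S) \<or> (0 \<le> k \<and> k < int m)"
      using assms(2) False e[of "k - int m"] by (auto simp: heads_def tails_def)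
    then show ?thesis
    proof
      assume k: "0 \<le> k \<and> k < int m"
      then have "0 \<le> k" "k + 1 \<le> int m" by auto
      then have "0 \<le> real_of_int k" "real_of_int k + 1 \<le> real m" by linarith+
      then show ?thesis by simp
    qed simp
  qed
qed

lemma card_heads_tails:
  assumes "S \<in> maya"
  shows "real (card (heads S m)) \<le> 2 * real (energy S)" "real (card (tails S m)) \<le> 2 * real (energy S) + real m"
proof -
  have f: "finite (S - {..<0})" "finite ({..<0} - S)" using maya_finite[OF assms] by auto
  have "heads S m \<subseteq> (S - {..<0}) \<union> (\<lambda>k. k + int m) ` ({..<0} - S)"
  proof
    fix k assume "k \<in> heads S m"
    then show "k \<in> (S - {..<0}) \<union> (\<lambda>k. k + int m) ` ({..<0} - S)"
      by (cases "k \<ge> 0") (auto simp: heads_def image_iff intro!: bexI[of _ "k - int m"])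
  qed
  then have "card (heads S m) \<le> card ((S - {..<0}) \<union> (\<lambda>k. k + int m) ` ({..<0} - S))"
    using f by (intro card_mono) auto
  also have "\<dots> \<le> card (S - {..<0}) + card ({..<0} - S)"
    using card_Un_le card_image_le[OF f(2)] by (meson add_left_mono order_trans)
  finally show "real (card (heads S m)) \<le> 2 * real (energy S)"
    using card_symdiff_le[OF assms] by linarith
  have "tails S m \<subseteq> ((\<lambda>k. k + int m) ` (S - {..<0}) \<union> ({..<0} - S)) \<union> {0..<int m}"
  proof
    fix k assume "k \<in> tails S m"
    then show "k \<in> ((\<lambda>k. k + int m) ` (S - {..<0}) \<union> ({..<0} - S)) \<union> {0..<int m}"
      by (cases "k \<ge> int m") (auto simp: tails_def image_iff intro!: bexI[of _ "k - int m"])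
  qed
  then have "card (tails S m) \<le> card (((\<lambda>k. k + int m) ` (S - {..<0}) \<union> ({..<0} - S)) \<union> {0..<int m})"
    using f by (intro card_mono) auto
  also have "\<dots> \<le> card ((\<lambda>k. k + int m) ` (S - {..<0})) + card ({..<0} - S) + card {0..<int m}"
    by (meson card_Un_le add_right_mono order_trans)
  also have "\<dots> \<le> card (S - {..<0}) + card ({..<0} - S) + m"
    using card_image_le[OF f(1)] by simp
  finally show "real (card (tails S m)) \<le> 2 * real (energy S) + real m"
    using card_symdiff_le[OF assms] by linarith
qed

lemma has_sum_sum:
  fixes f :: "'i \<Rightarrow> 'a \<Rightarrow> 'b::topological_comm_monoid_add"
  assumes "finite I" "\<And>i. i \<in> I \<Longrightarrow> (f i has_sum s i) A"
  shows "((\<lambda>x. \<Sum>i\<in>I. f i x) has_sum (\<Sum>i\<in>I. s i)) A"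
  using assms by (induction I rule: finite_induct) (auto intro: has_sum_add)

section \<open>Averages of weights and of hook sums\<close>

definition maya_sum :: "complex \<Rightarrow> (int set \<Rightarrow> complex) \<Rightarrow> complex" where
  "maya_sum q g = (\<Sum>\<^sub>\<infinity>S\<in>maya. g S * q ^ energy S)"

lemma growth_dominated:
  assumes "growth r g" "\<And>S. S \<in> maya \<Longrightarrow> norm (f S) \<le> norm (g S)"
  shows "growth r f"
proof -
  obtain K where "\<And>S. S \<in> maya \<Longrightarrow> norm (g S) \<le> K * exp (r * real (energy S))"
    using assms(1) by (auto simp: growth_def)
  then show ?thesis unfolding growth_def using assms(2) by (intro exI[of _ K]) (auto intro: order_trans)
qed

lemma maya_sum_has_sum:
  assumes "growth r g" "exp r * norm q < 1"
  shows "((\<lambda>S. g S * q ^ energy S) has_sum maya_sum q g) maya"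
  unfolding maya_sum_def using abs_summable_summable[OF growth_abs_summable[OF assms]] by simp

lemma maya_sum_diff:
  assumes "growth r f" "growth r g" "exp r * norm q < 1"
  shows "maya_sum q (\<lambda>S. f S - g S) = maya_sum q f - maya_sum q g"
proof -
  have "((\<lambda>S. f S * q ^ energy S + - (g S * q ^ energy S)) has_sum (maya_sum q f + - maya_sum q g)) maya"
    by (intro has_sum_add has_sum_uminusI maya_sum_has_sum[OF assms(1,3)] maya_sum_has_sum[OF assms(2,3)])
  then show ?thesis unfolding maya_sum_def[of q "\<lambda>S. f S - g S"]
    by (intro infsumI) (simp add: algebra_simps)
qed

lemma maya_sum_cmult: "maya_sum q (\<lambda>S. c * f S) = c * maya_sum q f"
  unfolding maya_sum_def by (simp add: mult.assoc infsum_cmult_right')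

lemma maya_sum_has_sum_Sigma:
  fixes f :: "int set \<Rightarrow> 'b \<Rightarrow> complex"
  assumes "growth r (\<lambda>S. of_real (\<Sum>k\<in>X S. norm (f S k)))" "exp r * norm q < 1"
    and fin: "\<And>S. S \<in> maya \<Longrightarrow> finite (X S)"
  shows "((\<lambda>(S,k). f S k * q ^ energy S) has_sum maya_sum q (\<lambda>S. \<Sum>k\<in>X S. f S k)) (Sigma maya X)"
proof -
  have "(\<lambda>x. norm (case x of (S,k) \<Rightarrow> f S k * q ^ energy S)) summable_on (Sigma maya X)"
  proof (subst Infinite_Sum.abs_summable_on_Sigma_iff, intro conjI ballI)
    fix S assume "S \<in> maya"
    then show "(\<lambda>k. norm (case (S,k) of (S,k) \<Rightarrow> f S k * q ^ energy S)) summable_on (X S)"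
      using fin by simp
  next
    have "(\<lambda>S. norm (of_real (\<Sum>k\<in>X S. norm (f S k)) * q ^ energy S)) summable_on maya"
      by (rule growth_abs_summable[OF assms(1,2)])
    then show "(\<lambda>S. norm (\<Sum>\<^sub>\<infinity>k\<in>X S. norm (case (S,k) of (S,k) \<Rightarrow> f S k * q ^ energy S))) summable_on maya"
      by (rule summable_on_cong[THEN iffD1, rotated])
         (simp add: fin norm_mult norm_power sum_distrib_right [symmetric] abs_mult del: of_real_sum)
  qed
  then have s: "(\<lambda>(S,k). f S k * q ^ energy S) summable_on (Sigma maya X)"
    by (rule abs_summable_summable)
  have "infsum (\<lambda>(S,k). f S k * q ^ energy S) (Sigma maya X)
      = (\<Sum>\<^sub>\<infinity>S\<in>maya. \<Sum>\<^sub>\<infinity>k\<in>X S. f S k * q ^ energy S)"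
    using infsum_Sigma'_banach[OF s] by simp
  also have "\<dots> = maya_sum q (\<lambda>S. \<Sum>k\<in>X S. f S k)"
    unfolding maya_sum_def by (intro infsum_cong) (simp add: fin sum_distrib_right)
  finally show ?thesis using has_sum_infsum[OF s] by simp
qed

lemma growth_hook_norms:
  fixes w :: complex
  assumes "norm w < r"
  shows "growth r (\<lambda>S. of_real (\<Sum>k\<in>heads S m. norm (exp (w * (of_int k + 1/2)))))"
    and "growth r (\<lambda>S. of_real (\<Sum>k\<in>tails S m. norm (exp (w * (of_int k + 1/2)))))"
proof -
  define d where "d = r - norm w"
  have d: "d > 0" using assms by (simp add: d_def)
  define K where "K = (real m + 1/d) * 2 * exp (norm w * real m)"
  have *: "norm (of_real (\<Sum>k\<in>X. norm (exp (w * (of_int k + 1/2)))) :: complex) \<le> K * exp (r * real (energy S))"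
    if S: "S \<in> maya" and X: "X \<subseteq> heads S m \<union> tails S m" "real (card X) \<le> 2 * real (energy S) + real m" for S X
  proof -
    have "norm (of_real (\<Sum>k\<in>X. norm (exp (w * (of_int k + 1/2)))) :: complex)
        = (\<Sum>k\<in>X. norm (exp (w * (of_int k + 1/2))))"
      by (subst norm_of_real, rule abs_of_nonneg) (simp add: sum_nonneg)
    also have "\<dots> \<le> real (card X) * exp (norm w * (real (energy S) + real m))"
    proof (rule sum_bounded_above)
      fix k assume "k \<in> X"
      then have "k \<in> heads S m \<or> k \<in> tails S m" using X(1) by blast
      then show "norm (exp (w * (of_int k + 1/2))) \<le> exp (norm w * (real (energy S) + real m))"
        by (rule norm_exp_half_le[OF heads_tails_bounds[OF S]])
    qed
    also have "\<dots> \<le> (2 * (real m + real (energy S))) * exp (norm w * (real (energy S) + real m))"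
      using X(2) by (intro mult_right_mono) auto
    also have "\<dots> \<le> (2 * ((real m + 1/d) * exp (d * real (energy S)))) * exp (norm w * (real (energy S) + real m))"
      using d by (intro mult_right_mono mult_left_mono linear_le_exp) auto
    also have "\<dots> = K * (exp (d * real (energy S)) * exp (norm w * real (energy S)))"
      by (simp add: K_def exp_add algebra_simps)
    also have "exp (d * real (energy S)) * exp (norm w * real (energy S)) = exp (r * real (energy S))"
      by (simp add: d_def exp_add [symmetric] algebra_simps)
    finally show ?thesis .
  qed
  show "growth r (\<lambda>S. of_real (\<Sum>k\<in>heads S m. norm (exp (w * (of_int k + 1/2)))))"
    unfolding growth_def by (intro exI[of _ K] ballI *) (auto intro: order_trans[OF card_heads_tails(1)])
  show "growth r (\<lambda>S. of_real (\<Sum>k\<in>tails S m. norm (exp (w * (of_int k + 1/2)))))"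
    unfolding growth_def by (intro exI[of _ K] ballI *) (use card_heads_tails(2) in \<open>auto intro: order_trans\<close>)
qed

lemma growth_mult_weight_prod:
  assumes "finite J" "norm w + (\<Sum>j\<in>J. norm (z j)) < r" "\<And>s. norm w < s \<Longrightarrow> growth s g"
  shows "growth r (\<lambda>S. g S * (\<Prod>j\<in>J. weight S (z j)))"
proof -
  \<comment> \<open>The slack is shared evenly by the \<open>card J + 1\<close> factors, each of
    which needs a rate slightly above its norm.\<close>
  define d where "d = (r - (norm w + (\<Sum>j\<in>J. norm (z j)))) / (real (card J) + 1)"
  have d: "d > 0" using assms by (simp add: d_def)
  have dd: "(real (card J) + 1) * d = r - (norm w + (\<Sum>j\<in>J. norm (z j)))"
    by (simp add: d_def)
  have "growth ((norm w + d) + (\<Sum>j\<in>J. norm (z j) + d)) (\<lambda>S. g S * (\<Prod>j\<in>J. weight S (z j)))"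
    using d by (intro growth_mult growth_prod assms growth_weight) auto
  also have "(norm w + d) + (\<Sum>j\<in>J. norm (z j) + d) = r"
    using dd by (simp add: sum.distrib algebra_simps)
  finally show ?thesis .
qed

definition maya_sum_weight :: "complex \<Rightarrow> (nat \<Rightarrow> complex) \<Rightarrow> complex \<Rightarrow> nat set \<Rightarrow> complex" where
  "maya_sum_weight q z w J = maya_sum q (\<lambda>S. weight S w * (\<Prod>j\<in>J. weight S (z j)))"

definition maya_sum_heads :: "complex \<Rightarrow> (nat \<Rightarrow> complex) \<Rightarrow> nat \<Rightarrow> complex \<Rightarrow> nat set \<Rightarrow> complex" where
  "maya_sum_heads q z m w J = maya_sum q (\<lambda>S. (\<Sum>k\<in>heads S m. exp (w * (of_int k + 1/2))) * (\<Prod>j\<in>J. weight S (z j)))"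

definition maya_sum_tails :: "complex \<Rightarrow> (nat \<Rightarrow> complex) \<Rightarrow> nat \<Rightarrow> complex \<Rightarrow> nat set \<Rightarrow> complex" where
  "maya_sum_tails q z m w J = maya_sum q (\<lambda>S. (\<Sum>k\<in>tails S m. exp (w * (of_int k + 1/2))) * (\<Prod>j\<in>J. weight S (z j)))"

lemma growth_hook_sums:
  assumes "norm w < r"
  shows "growth r (\<lambda>S. \<Sum>k\<in>heads S m. exp (w * (of_int k + 1/2)))"
    and "growth r (\<lambda>S. \<Sum>k\<in>tails S m. exp (w * (of_int k + 1/2)))"
  by (rule growth_dominated[OF growth_hook_norms(1)[OF assms]] growth_dominated[OF growth_hook_norms(2)[OF assms]],
      subst norm_of_real, rule order_trans[OF norm_sum abs_ge_self])+

lemma maya_sum_heads_minus_tails: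
  assumes "finite J" "norm w + (\<Sum>j\<in>J. norm (z j)) < r" "exp r * norm q < 1" "exp w \<noteq> 1"
  shows "maya_sum_heads q z m w J - maya_sum_tails q z m w J = (1 - exp (of_nat m * w)) * maya_sum_weight q z w J"
proof -
  have "maya_sum_heads q z m w J - maya_sum_tails q z m w J = maya_sum q (\<lambda>S.
     (\<Sum>k\<in>heads S m. exp (w * (of_int k + 1/2))) * (\<Prod>j\<in>J. weight S (z j)) -
     (\<Sum>k\<in>tails S m. exp (w * (of_int k + 1/2))) * (\<Prod>j\<in>J. weight S (z j)))"
    unfolding maya_sum_heads_def maya_sum_tails_def
    by (rule maya_sum_diff[symmetric, OF growth_mult_weight_prod[OF assms(1,2)] growth_mult_weight_prod[OF assms(1,2)] assms(3)])
       (rule growth_hook_sums; assumption)+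
  also have "\<dots> = maya_sum q (\<lambda>S. (1 - exp (of_nat m * w)) * (weight S w * (\<Prod>j\<in>J. weight S (z j))))"
    unfolding maya_sum_def
    by (intro infsum_cong) (simp only: left_diff_distrib [symmetric] weight_heads_tails[OF _ assms(4)] mult.assoc [symmetric])
  finally show ?thesis by (simp add: maya_sum_cmult maya_sum_weight_def)
qed

text \<open>Unfolding to a sum over pairs of a diagram and a position is what allows reindexing by
  \<open>bij_betw_hook_move\<close>, which does not act on diagrams alone.\<close>

lemma maya_sum_hook_has_sum:
  assumes "finite J" "norm w + (\<Sum>j\<in>J. norm (z j)) < r" "exp r * norm q < 1"
  shows "((\<lambda>(S,k). exp (w * (of_int k + 1/2)) * (\<Prod>j\<in>J. weight S (z j)) * q ^ energy S) has_sum maya_sum_heads q z m w J)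
           (Sigma maya (\<lambda>S. heads S m))" (is ?h)
    and "((\<lambda>(S,k). exp (w * (of_int k + 1/2)) * (\<Prod>j\<in>J. weight S (z j)) * q ^ energy S) has_sum maya_sum_tails q z m w J)
           (Sigma maya (\<lambda>S. tails S m))" (is ?t)
proof -
  have *: "growth r (\<lambda>S. of_real (\<Sum>k\<in>X S. norm (exp (w * (of_int k + 1/2)) * (\<Prod>j\<in>J. weight S (z j)))))"
    if "\<And>s. norm w < s \<Longrightarrow> growth s (\<lambda>S. of_real (\<Sum>k\<in>X S. norm (exp (w * (of_int k + 1/2)))))" for X :: "int set \<Rightarrow> int set"
    by (rule growth_dominated[OF growth_mult_weight_prod[OF assms(1,2) that]])
       (assumption, simp add: norm_mult sum_distrib_right abs_mult sum_nonneg prod_nonneg del: of_real_sum)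
  show ?h unfolding maya_sum_heads_def sum_distrib_right
    by (rule maya_sum_has_sum_Sigma[OF *[OF growth_hook_norms(1)] assms(3)]) (auto intro: finite_heads elim: maya_bdE)
  show ?t unfolding maya_sum_tails_def sum_distrib_right
    by (rule maya_sum_has_sum_Sigma[OF *[OF growth_hook_norms(2)] assms(3)]) (auto intro: finite_tails elim: maya_bdE)
qed

text \<open>Moving the bead \<open>k\<close> to \<open>k - m\<close> lowers the energy by \<open>m\<close> and changes every weight by a multiple of
  \<open>exp (z (k + 1/2))\<close>; expanding the product of the weights gives the sum over \<open>I\<close>.\<close>

lemma maya_sum_heads_conv_tails:
  assumes J: "finite J" "norm w + (\<Sum>j\<in>J. norm (z j)) < r" "exp r * norm q < 1" and m: "m > 0"
  shows "maya_sum_heads q z m w J = q ^ m *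
     (\<Sum>I\<in>Pow J. (\<Prod>i\<in>I. 1 - exp (- of_nat m * z i)) * maya_sum_tails q z m (w + sum z I) (J - I))"
proof -
  let ?g = "\<lambda>I. \<Prod>i\<in>I. 1 - exp (- of_nat m * z i)"
  let ?f = "\<lambda>w J (S,k). exp (w * (of_int k + 1/2)) * (\<Prod>j\<in>J. weight S (z j)) * q ^ energy S"
  let ?T = "Sigma maya (\<lambda>S. tails S m)" and ?H = "Sigma maya (\<lambda>S. heads S m)"
  have t: "(?f (w + sum z I) (J - I) has_sum maya_sum_tails q z m (w + sum z I) (J - I)) ?T" if I: "I \<in> Pow J" for I
  proof (rule maya_sum_hook_has_sum(2)[OF _ _ J(3)])
    have "norm (w + sum z I) + (\<Sum>j\<in>J - I. norm (z j)) \<le> norm w + (\<Sum>i\<in>I. norm (z i)) + (\<Sum>j\<in>J - I. norm (z j))"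
      using norm_triangle_ineq[of w "sum z I"] norm_sum[of z I] by simp
    also have "\<dots> = norm w + (\<Sum>j\<in>J. norm (z j))"
      using sum.subset_diff[of I J "\<lambda>j. norm (z j)"] I J(1) by simp
    finally show "norm (w + sum z I) + (\<Sum>j\<in>J - I. norm (z j)) < r" using J(2) by simp
  qed (use J in auto)
  have "((\<lambda>p. q ^ m * (\<Sum>I\<in>Pow J. ?g I * ?f (w + sum z I) (J - I) p)) has_sum
      (q ^ m * (\<Sum>I\<in>Pow J. ?g I * maya_sum_tails q z m (w + sum z I) (J - I)))) ?T"
    using J(1) t by (intro has_sum_cmult_right has_sum_sum) auto
  then have "((\<lambda>p. q ^ m * (\<Sum>I\<in>Pow J. ?g I * ?f (w + sum z I) (J - I)
        ((\<lambda>(S,k). (insert (k - int m) (S - {k}), k)) p))) has_sum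
      (q ^ m * (\<Sum>I\<in>Pow J. ?g I * maya_sum_tails q z m (w + sum z I) (J - I)))) ?H"
    by (subst has_sum_reindex_bij_betw[OF bij_betw_hook_move[OF m]])
  moreover have "q ^ m * (\<Sum>I\<in>Pow J. ?g I * ?f (w + sum z I) (J - I)
        ((\<lambda>(S,k). (insert (k - int m) (S - {k}), k)) p)) = ?f w J p" if p: "p \<in> ?H" for p
  proof -
    obtain S k where [simp]: "p = (S,k)" and S: "S \<in> maya" and k: "k \<in> heads S m" using p by auto
    let ?S = "insert (k - int m) (S - {k})"
    have prod_exp: "(\<Prod>i\<in>I. exp (z i * (of_int k + 1/2))) = exp (sum z I * (of_int k + 1/2))" if "finite I" for I
      using that by (simp add: exp_sum sum_distrib_right)
    have "(\<Prod>j\<in>J. weight S (z j)) = (\<Prod>j\<in>J. exp (z j * (of_int k + 1/2)) * (1 - exp (- of_nat m * z j)) + weight ?S (z j))"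
      by (intro prod.cong refl) (subst weight_move[OF S k m], simp only: add.commute)
    also have "\<dots> = (\<Sum>I\<in>Pow J. (\<Prod>i\<in>I. exp (z i * (of_int k + 1/2)) * (1 - exp (- of_nat m * z i))) * (\<Prod>j\<in>J - I. weight ?S (z j)))"
      by (rule prod_add[OF J(1)])
    also have "\<dots> = (\<Sum>I\<in>Pow J. ?g I * exp (sum z I * (of_int k + 1/2)) * (\<Prod>j\<in>J - I. weight ?S (z j)))"
      using finite_subset[OF _ J(1)] by (intro sum.cong refl) (simp add: prod.distrib prod_exp)
    finally have e: "(\<Prod>j\<in>J. weight S (z j)) = \<dots>" .
    have "?f w J p = q ^ m * (exp (w * (of_int k + 1/2)) * (\<Prod>j\<in>J. weight S (z j)) * q ^ energy ?S)"
      using energy_move[OF S k m] by (simp add: power_add mult_ac)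
    also have "exp (w * (of_int k + 1/2)) * (\<Prod>j\<in>J. weight S (z j)) * q ^ energy ?S
       = (\<Sum>I\<in>Pow J. ?g I * ?f (w + sum z I) (J - I) (?S, k))"
    proof -
      have "exp (w * (of_int k + 1/2)) * (?g I * exp (sum z I * (of_int k + 1/2)) * (\<Prod>j\<in>J - I. weight ?S (z j))) * q ^ energy ?S
        = ?g I * ?f (w + sum z I) (J - I) (?S, k)" for I
        by (simp add: distrib_right exp_add)
      then show ?thesis
        unfolding e sum_distrib_left[of "exp (w * (of_int k + 1/2))"] sum_distrib_right[of _ _ "q ^ energy ?S"]
        by (intro sum.cong refl)
    qed
    finally show ?thesis by simp
  qed
  ultimately have "(?f w J has_sum (q ^ m * (\<Sum>I\<in>Pow J. ?g I * maya_sum_tails q z m (w + sum z I) (J - I)))) ?H"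
    by (rule has_sum_cong[THEN iffD1, rotated])
  from has_sum_unique[OF maya_sum_hook_has_sum(1)[OF J, of m] this] show ?thesis .
qed

text \<open>The polylogarithm \<open>Li\<^sub>-\<^sub>k\<close>. Its values solve the linear recursion for the sums over hook heads.\<close>

definition polylog :: "nat \<Rightarrow> complex \<Rightarrow> complex" where
  "polylog k Q = (\<Sum>n. of_nat (Suc n) ^ k * Q ^ Suc n)"

lemma polylog_summable:
  fixes Q :: "'a::{real_normed_field,banach}"
  assumes "norm Q < 1"
  shows "summable (\<lambda>n. of_nat (Suc n) ^ k * Q ^ Suc n)"
proof -
  have "summable (\<lambda>n. of_nat n ^ k * Q ^ n)"
    using assms
  proof (induction k arbitrary: Q)
    case (Suc k)
    have "summable (\<lambda>n. diffs (\<lambda>n. of_nat n ^ k) n * Q ^ n)"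
      by (rule termdiff_converges[OF Suc.prems Suc.IH])
    then have "summable (\<lambda>n. Q * (diffs (\<lambda>n. of_nat n ^ k) n * Q ^ n))" by (rule summable_mult)
    then show ?case by (subst summable_Suc_iff [symmetric]) (simp add: diffs_def mult_ac)
  qed (simp add: summable_geometric)
  then show ?thesis by (subst summable_Suc_iff)
qed

lemma sum_Pow_power_card:
  fixes x :: "'a::comm_semiring_1"
  assumes "finite K" shows "(\<Sum>I\<in>Pow K. x ^ card I) = (x + 1) ^ card K"
  using prod_add[OF assms, of "\<lambda>_. x" "\<lambda>_. 1"] by simp

text \<open>Expanding the power \<open>(n + 1) ^ card K\<close> over subsets of \<open>K\<close>
  shifts the summation index by one; the summand \<open>1\<close> restores the lowest term.\<close>

lemma polylog_rec:
  assumes "norm Q < 1" "finite K"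
  shows "polylog (card K) Q = Q * ((\<Sum>I\<in>Pow K. polylog (card I) Q) + 1)"
proof -
  have s: "summable (\<lambda>n. of_nat (Suc n) ^ card K * Q ^ Suc n)" by (rule polylog_summable[OF assms(1)])
  have "(\<Sum>I\<in>Pow K. polylog (card I) Q) = (\<Sum>n. \<Sum>I\<in>Pow K. of_nat (Suc n) ^ card I * Q ^ Suc n)"
    unfolding polylog_def by (rule suminf_sum[symmetric]) (rule polylog_summable[OF assms(1)])
  also have "\<dots> = (\<Sum>n. of_nat (Suc (Suc n)) ^ card K * Q ^ Suc n)"
    unfolding sum_distrib_right [symmetric] sum_Pow_power_card[OF assms(2)] by (simp add: add.commute)
  finally have 1: "Q * (\<Sum>I\<in>Pow K. polylog (card I) Q) = Q * (\<Sum>n. of_nat (Suc (Suc n)) ^ card K * Q ^ Suc n)" by simp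
  have "polylog (card K) Q = Q + (\<Sum>n. of_nat (Suc (Suc n)) ^ card K * Q ^ Suc (Suc n))"
    unfolding polylog_def using suminf_split_head[OF s] by (simp add: algebra_simps)
  also have "(\<Sum>n. of_nat (Suc (Suc n)) ^ card K * Q ^ Suc (Suc n)) = Q * (\<Sum>n. of_nat (Suc (Suc n)) ^ card K * Q ^ Suc n)"
  proof (cases "Q = 0")
    case False
    have "summable (\<lambda>n. Q * (of_nat (Suc (Suc n)) ^ card K * Q ^ Suc n))"
      using s by (subst (asm) summable_Suc_iff [symmetric]) (simp add: mult_ac)
    then have "summable (\<lambda>n. of_nat (Suc (Suc n)) ^ card K * Q ^ Suc n)"
      using False by (subst (asm) summable_cmult_iff) auto
    from suminf_mult[OF this, of Q, symmetric] show ?thesis by (simp add: mult_ac)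
  qed simp
  finally show ?thesis unfolding distrib_left 1 by simp
qed

text \<open>Ordered pairs of disjoint subsets are classified by their union \<open>K\<close> and the
  second member.\<close>

lemma sum_Pow_Pow_Diff:
  assumes "finite J"
  shows "(\<Sum>I\<in>Pow J. \<Sum>I'\<in>Pow (J - I). f I I') = (\<Sum>K\<in>Pow J. \<Sum>I'\<in>Pow K. f (K - I') I')"
proof -
  have "(\<Sum>I\<in>Pow J. \<Sum>I'\<in>Pow (J - I). f I I') = (\<Sum>(I,I')\<in>Sigma (Pow J) (\<lambda>I. Pow (J - I)). f I I')"
    using assms by (subst sum.Sigma) auto
  also have "\<dots> = (\<Sum>(K,I')\<in>Sigma (Pow J) Pow. f (K - I') I')"
    by (rule sum.reindex_bij_witness[of _ "\<lambda>(K,I'). (K - I', I')" "\<lambda>(I,I'). (I \<union> I', I')"])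
       (auto simp: Un_Diff Diff_triv disjoint_iff intro!: arg_cong2[where f = f])
  also have "\<dots> = (\<Sum>K\<in>Pow J. \<Sum>I'\<in>Pow K. f (K - I') I')"
    using assms finite_subset by (subst sum.Sigma) auto
  finally show ?thesis .
qed

text \<open>Substituting the candidate on the right produces pairs of disjoint sets. Once they are
  grouped by union, the products of \<open>g\<close> and the values of \<open>V\<close> depend on
  the union only, and \<open>polylog_rec\<close> remains.\<close>

lemma polylog_transform_rec:
  fixes g z :: "nat \<Rightarrow> complex" and V :: "complex \<Rightarrow> nat set \<Rightarrow> complex"
  assumes "finite J" "norm Q < 1"
  defines "A' \<equiv> (\<lambda>w J. \<Sum>I\<in>Pow J. polylog (card I) Q * (prod g I) * V (w + sum z I) (J - I))"
  shows "A' w J = Q * (\<Sum>I\<in>Pow J. (prod g I) * (A' (w + sum z I) (J - I) + V (w + sum z I) (J - I)))"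
proof -
  have "(\<Sum>I\<in>Pow J. (prod g I) * A' (w + sum z I) (J - I))
     = (\<Sum>I\<in>Pow J. \<Sum>I'\<in>Pow (J - I). (prod g I) * (polylog (card I') Q * (prod g I') * V (w + sum z I + sum z I') (J - I - I')))"
    unfolding A'_def sum_distrib_left ..
  also have "\<dots> = (\<Sum>K\<in>Pow J. \<Sum>I'\<in>Pow K. (prod g (K - I')) *
     (polylog (card I') Q * (prod g I') * V (w + sum z (K - I') + sum z I') (J - (K - I') - I')))"
    by (rule sum_Pow_Pow_Diff[OF assms(1)])
  also have "\<dots> = (\<Sum>K\<in>Pow J. \<Sum>I'\<in>Pow K. polylog (card I') Q * (prod g K * V (w + sum z K) (J - K)))"
  proof (intro sum.cong refl)
    fix K I' assume K: "K \<in> Pow J" "I' \<in> Pow K"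
    then have fK: "finite K" using assms(1) finite_subset by auto
    have "prod g K = prod g (K - I') * prod g I'" using K fK by (intro prod.subset_diff) auto
    moreover have "sum z K = sum z (K - I') + sum z I'" using K fK by (intro sum.subset_diff) auto
    moreover have "J - (K - I') - I' = J - K" using K by auto
    ultimately show "prod g (K - I') * (polylog (card I') Q * prod g I' * V (w + sum z (K - I') + sum z I') (J - (K - I') - I'))
      = polylog (card I') Q * (prod g K * V (w + sum z K) (J - K))" by (simp add: mult_ac add.assoc)
  qed
  finally have "Q * (\<Sum>I\<in>Pow J. (prod g I) * (A' (w + sum z I) (J - I) + V (w + sum z I) (J - I)))
     = (\<Sum>K\<in>Pow J. Q * ((\<Sum>I'\<in>Pow K. polylog (card I') Q) + 1) * (prod g K * V (w + sum z K) (J - K)))"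
    by (simp add: distrib_left distrib_right sum.distrib sum_distrib_left sum_distrib_right mult_ac)
  also have "\<dots> = A' w J"
    unfolding A'_def using assms finite_subset[OF _ assms(1)]
    by (intro sum.cong refl) (simp add: polylog_rec mult.assoc)
  finally show ?thesis by simp
qed

text \<open>In the recursion the unknown itself reappears for \<open>I = {}\<close> with coefficient
  \<open>q ^ m\<close>, which is not 1, and otherwise only with the smaller sets
  \<open>J - I\<close>. Induction on the size of \<open>J\<close> thus gives uniqueness, and
  \<open>polylog_transform_rec\<close> supplies a solution.\<close>

lemma maya_sum_heads_eq:
  assumes "finite J" "norm w + (\<Sum>j\<in>J. norm (z j)) < r" "exp r * norm q < 1" "m > 0" "norm q < 1"
    and "\<And>I. I \<subseteq> J \<Longrightarrow> exp (w + sum z I) \<noteq> 1"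
  shows "maya_sum_heads q z m w J = (\<Sum>I\<in>Pow J. polylog (card I) (q ^ m) * (\<Prod>i\<in>I. 1 - exp (- of_nat m * z i)) *
      ((exp (of_nat m * (w + sum z I)) - 1) * maya_sum_weight q z (w + sum z I) (J - I)))"
  using assms(1,2,6)
proof (induction "card J" arbitrary: J w rule: less_induct)
  case less
  define Q where "Q = q ^ m"
  have Q: "norm Q < 1" using assms by (simp add: Q_def norm_power power_less_one_iff)
  then have Q1: "1 - Q \<noteq> 0" by auto
  define g where "g = (\<lambda>i. 1 - exp (- of_nat m * z i))"
  define V where "V = (\<lambda>w J. (exp (of_nat m * w) - 1) * maya_sum_weight q z w J)"
  define A' where "A' = (\<lambda>w J. \<Sum>I\<in>Pow J. polylog (card I) Q * (prod g I) * V (w + sum z I) (J - I))"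
  define A where "A = (\<lambda>w J. maya_sum_heads q z m w J)"
  define P where "P = Pow J - {{}}"
  have P: "Pow J = insert {} P" "finite P" "{} \<notin> P" using less.prems(1) by (auto simp: P_def)
  have bound: "norm (w + sum z I) + (\<Sum>j\<in>J - I. norm (z j)) < r" if "I \<subseteq> J" for I
  proof -
    have "norm (w + sum z I) + (\<Sum>j\<in>J - I. norm (z j)) \<le> norm w + (\<Sum>i\<in>I. norm (z i)) + (\<Sum>j\<in>J - I. norm (z j))"
      using norm_triangle_ineq[of w "sum z I"] norm_sum[of z I] by simp
    also have "\<dots> = norm w + (\<Sum>j\<in>J. norm (z j))"
      using sum.subset_diff[of I J "\<lambda>j. norm (z j)"] that less.prems(1) by simp
    finally show ?thesis using less.prems(2) by simp
  qed
  have A1: "A w J = Q * (\<Sum>I\<in>Pow J. prod g I * (A (w + sum z I) (J - I) + V (w + sum z I) (J - I)))"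
  proof -
    have "maya_sum_tails q z m (w + sum z I) (J - I) = A (w + sum z I) (J - I) + V (w + sum z I) (J - I)" if "I \<in> Pow J" for I
      using maya_sum_heads_minus_tails[of "J - I" "w + sum z I" z r q m] bound[of I] that less.prems assms(3)
      by (simp add: A_def V_def algebra_simps)
    then show ?thesis
      unfolding A_def Q_def g_def by (subst maya_sum_heads_conv_tails[OF less.prems(1,2) assms(3,4)]) simp
  qed
  have A2: "A' w J = Q * (\<Sum>I\<in>Pow J. prod g I * (A' (w + sum z I) (J - I) + V (w + sum z I) (J - I)))"
    unfolding A'_def by (rule polylog_transform_rec[OF less.prems(1) Q])
  have IH: "A (w + sum z I) (J - I) = A' (w + sum z I) (J - I)" if "I \<in> P" for I
  proof -
    have I: "I \<subseteq> J" "I \<noteq> {}" using that by (auto simp: P_def)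
    then have "card (J - I) < card J"
      using less.prems(1) by (metis Diff_subset Diff_eq_empty_iff Int_absorb1 card_Diff_subset_Int double_diff psubsetI psubset_card_mono subset_refl Diff_empty)
    moreover have "exp (w + sum z I + sum z I') \<noteq> 1" if "I' \<subseteq> J - I" for I'
    proof -
      have "sum z (I \<union> I') = sum z I + sum z I'"
        using I that less.prems(1) by (intro sum.union_disjoint) (auto intro: finite_subset)
      then show ?thesis using less.prems(3)[of "I \<union> I'"] I that by (auto simp: add.assoc)
    qed
    ultimately show ?thesis
      unfolding A_def A'_def V_def g_def Q_def using less.hyps[of "J - I" "w + sum z I"] bound[OF I(1)] less.prems(1)
      by simp
  qed
  have split: "(\<Sum>I\<in>Pow J. prod g I * (B (w + sum z I) (J - I) + V (w + sum z I) (J - I)))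
     = B w J + (V w J + (\<Sum>I\<in>P. prod g I * (B (w + sum z I) (J - I) + V (w + sum z I) (J - I))))" for B
    unfolding P(1) using P(2,3) by simp
  have "(1 - Q) * A w J = Q * (V w J + (\<Sum>I\<in>P. prod g I * (A (w + sum z I) (J - I) + V (w + sum z I) (J - I))))"
    using A1 unfolding split by (simp add: algebra_simps)
  also have "\<dots> = Q * (V w J + (\<Sum>I\<in>P. prod g I * (A' (w + sum z I) (J - I) + V (w + sum z I) (J - I))))"
    using IH by simp
  also have "\<dots> = (1 - Q) * A' w J"
    using A2 unfolding split by (simp add: algebra_simps)
  finally have "A w J = A' w J" using Q1 by simp
  then show ?case by (simp add: A_def A'_def V_def g_def Q_def)
qed

text \<open>Up to sign, the part of \<open>Z_l\<close> that remains once its constant and its pole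
  at the origin are split off, see \<open>bo_Z_small\<close>. Under \<open>a\<close> to
  \<open>- a\<close> it changes by \<open>(-1) ^ (l + 1)\<close>.\<close>

definition Z_series :: "complex \<Rightarrow> nat \<Rightarrow> complex \<Rightarrow> complex" where
  "Z_series q l a = (\<Sum>\<^sub>\<infinity>m\<in>{1..}. polylog l (q ^ m) * (exp (of_nat m * a) - (-1) ^ l * exp (- of_nat m * a)))"

lemma norm_polylog_le:
  assumes "norm q < 1" "m \<ge> 1"
  shows "norm (polylog l (q ^ m)) \<le> (\<Sum>n. real (Suc n) ^ l * norm q ^ n) * norm q ^ m"
proof -
  have s: "summable (\<lambda>n. real (Suc n) ^ l * norm q ^ n)"
  proof (cases "q = 0")
    case True
    show ?thesis by (rule summable_finite[of "{0}"]) (auto simp: True)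
  next
    case False
    have "summable (\<lambda>n. inverse (norm q) * (real (Suc n) ^ l * norm q ^ Suc n))"
      using polylog_summable[of "norm q" l] assms by (intro summable_mult) simp
    then show ?thesis using False by (simp add: field_simps)
  qed
  have sQ: "summable (\<lambda>n. norm (of_nat (Suc n) ^ l * (q ^ m) ^ Suc n))"
    using polylog_summable[of "norm q ^ m" l] assms
    by (simp add: norm_mult norm_power power_less_one_iff del: of_nat_Suc power_Suc)
  have "norm (polylog l (q ^ m)) \<le> (\<Sum>n. norm (of_nat (Suc n) ^ l * (q ^ m) ^ Suc n))"
    unfolding polylog_def by (rule summable_norm[OF sQ])
  also have "\<dots> \<le> (\<Sum>n. (real (Suc n) ^ l * norm q ^ n) * norm q ^ m)"
  proof (rule suminf_le[OF _ sQ summable_mult2[OF s]])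
    fix n
    have "(norm q ^ m) ^ n \<le> norm q ^ n"
      using assms unfolding power_mult [symmetric] by (intro power_decreasing) auto
    then show "norm (of_nat (Suc n) ^ l * (q ^ m) ^ Suc n) \<le> (real (Suc n) ^ l * norm q ^ n) * norm q ^ m"
      by (simp add: norm_mult norm_power mult_left_mono mult_right_mono mult.assoc mult.commute[of _ "norm q ^ m"] del: of_nat_Suc)
  qed
  also have "\<dots> = (\<Sum>n. real (Suc n) ^ l * norm q ^ n) * norm q ^ m"
    by (rule suminf_mult2[OF s, symmetric])
  finally show ?thesis .
qed

lemma polylog_exp_abs_summable:
  assumes "norm q < 1" "exp (norm a) * norm q < 1"
  shows "(\<lambda>m. norm (polylog l (q ^ m) * exp (of_nat m * a))) summable_on {1..}"
proof -
  define C where "C = (\<Sum>n. real (Suc n) ^ l * norm q ^ n)"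
  have "(\<lambda>m. C * (exp (norm a) * norm q) ^ m) summable_on UNIV"
    using assms(2) by (intro summable_on_cmult_right norm_summable_imp_summable_on) (simp add: norm_mult norm_power summable_geometric)
  then have "(\<lambda>m. C * (exp (norm a) * norm q) ^ m) summable_on {1..}"
    by (rule summable_on_subset_banach) simp
  then show ?thesis
  proof (rule summable_on_comparison_test)
    fix m :: nat assume m: "m \<in> {1..}"
    have "norm (exp (of_nat m * a)) \<le> exp (norm (of_nat m * a))" by (rule norm_exp)
    also have "\<dots> = exp (norm a) ^ m" by (simp add: norm_mult exp_of_nat_mult)
    finally have "norm (polylog l (q ^ m) * exp (of_nat m * a)) \<le> (C * norm q ^ m) * exp (norm a) ^ m"
      unfolding norm_mult using norm_polylog_le[OF assms(1), of m l] m by (intro mult_mono) (auto simp: C_def intro: order_trans[OF norm_ge_zero])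
    then show "norm (polylog l (q ^ m) * exp (of_nat m * a)) \<le> C * (exp (norm a) * norm q) ^ m"
      by (simp add: power_mult_distrib mult_ac)
  qed simp
qed

lemma Z_series_has_sum:
  assumes "norm q < 1" "exp (norm a) * norm q < 1"
  shows "((\<lambda>m. polylog l (q ^ m) * (exp (of_nat m * a) - (-1) ^ l * exp (- of_nat m * a))) has_sum Z_series q l a) {1..}"
proof -
  have "(\<lambda>m. polylog l (q ^ m) * exp (of_nat m * a)) summable_on {1..}"
    using polylog_exp_abs_summable[OF assms] by (rule abs_summable_summable)
  moreover have "(\<lambda>m. polylog l (q ^ m) * exp (of_nat m * (- a))) summable_on {1..}"
    by (rule abs_summable_summable, rule polylog_exp_abs_summable) (use assms in auto)
  ultimately have "(\<lambda>m. polylog l (q ^ m) * exp (of_nat m * a) + (- ((-1) ^ l)) * (polylog l (q ^ m) * exp (of_nat m * (- a)))) summable_on {1..}"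
    by (intro summable_on_add summable_on_cmult_right)
  then show ?thesis
    unfolding Z_series_def by (intro has_sum_infsum) (simp add: algebra_simps)
qed

text \<open>Split the last factor. Multiplication by \<open>exp (m (u + v + z_J))\<close> exchanges
  \<open>exp (- m u) + exp (- m v)\<close> for \<open>exp (m u) + exp (m v)\<close>, and each
  \<open>1 - exp (- m z_j)\<close> for \<open>exp (m z_j) - 1\<close>. Expanding both products over
  subsets gives the two halves of \<open>Z_series\<close>, with the relative sign
  \<open>(-1) ^ card J\<close>.\<close>

lemma Z_series_has_sum_combination:
  assumes "norm q < 1" "finite J" "exp (norm u + norm v + (\<Sum>j\<in>J. norm (z j))) * norm q < 1"
  shows "((\<lambda>m. (exp (- of_nat m * u) + exp (- of_nat m * v)) *
        (polylog (card J) (q ^ m) * (\<Prod>j\<in>J. 1 - exp (- of_nat m * z j)) * (exp (of_nat m * (u + v + sum z J)) - 1)))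
      has_sum (\<Sum>I\<in>Pow J. (-1) ^ card (J - I) * (Z_series q (card J) (sum z I + u) + Z_series q (card J) (sum z I + v)))) {1..}"
proof -
  let ?l = "card J"
  have small_arg: "exp (norm (sum z I + x)) * norm q < 1" if "I \<subseteq> J" "x \<in> {u,v}" for I x
  proof -
    have "norm (sum z I) \<le> (\<Sum>j\<in>I. norm (z j))" by (rule norm_sum)
    also have "\<dots> \<le> (\<Sum>j\<in>J. norm (z j))" using that assms(2) by (intro sum_mono2) auto
    finally have "norm (sum z I + x) \<le> (\<Sum>j\<in>J. norm (z j)) + norm x"
      by (intro order_trans[OF norm_triangle_ineq] add_mono) auto
    also have "\<dots> \<le> norm u + norm v + (\<Sum>j\<in>J. norm (z j))" using that by auto
    finally have "exp (norm (sum z I + x)) * norm q \<le> exp (norm u + norm v + (\<Sum>j\<in>J. norm (z j))) * norm q"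
      by (intro mult_right_mono) auto
    then show ?thesis using assms(3) by linarith
  qed
  have "((\<lambda>m. \<Sum>I\<in>Pow J. (-1) ^ card (J - I) *
        (polylog ?l (q ^ m) * (exp (of_nat m * (sum z I + u)) - (-1) ^ ?l * exp (- of_nat m * (sum z I + u))) +
         polylog ?l (q ^ m) * (exp (of_nat m * (sum z I + v)) - (-1) ^ ?l * exp (- of_nat m * (sum z I + v)))))
      has_sum (\<Sum>I\<in>Pow J. (-1) ^ card (J - I) * (Z_series q ?l (sum z I + u) + Z_series q ?l (sum z I + v)))) {1..}"
    using assms(1,2) small_arg
    by (intro has_sum_sum has_sum_cmult_right has_sum_add Z_series_has_sum) auto
  moreover have "(\<Sum>I\<in>Pow J. (-1) ^ card (J - I) *
        (polylog ?l (q ^ m) * (exp (of_nat m * (sum z I + u)) - (-1) ^ ?l * exp (- of_nat m * (sum z I + u))) +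
         polylog ?l (q ^ m) * (exp (of_nat m * (sum z I + v)) - (-1) ^ ?l * exp (- of_nat m * (sum z I + v)))))
     = (exp (- of_nat m * u) + exp (- of_nat m * v)) *
        (polylog ?l (q ^ m) * (\<Prod>j\<in>J. 1 - exp (- of_nat m * z j)) * (exp (of_nat m * (u + v + sum z J)) - 1))" for m
  proof -
    define M where "M = (of_nat m :: complex)"
    have card: "card (J - I) = ?l - card I" "card I \<le> ?l" if "I \<subseteq> J" for I
      using that assms(2) by (auto simp: card_Diff_subset finite_subset card_mono)
    have fin: "finite I" if "I \<in> Pow J" for I using that assms(2) finite_subset by auto
    have p1: "(\<Prod>j\<in>J. exp (M * z j) - 1) = (\<Sum>I\<in>Pow J. (-1) ^ card (J - I) * exp (M * sum z I))"
      using card fin by (subst prod_diff_conv_sum'[OF assms(2)]) (auto intro!: sum.cong simp: exp_sum sum_distrib_left)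
    have p2: "(\<Prod>j\<in>J. 1 - exp (- M * z j)) = (\<Sum>I\<in>Pow J. (-1) ^ card (J - I) * (-1) ^ ?l * exp (- M * sum z I))"
    proof (subst prod_diff_conv_sum[OF assms(2)], intro sum.cong refl)
      fix I assume I: "I \<in> Pow J"
      then have "(-1::complex) ^ card (J - I) * (-1) ^ ?l = (-1) ^ card I"
        using card[of I] by (simp add: power_add [symmetric] neg_one_power_add_eq_neg_one_power_diff minus_one_power_iff)
      then show "(-1) ^ card I * (\<Prod>j\<in>I. exp (- M * z j)) * (\<Prod>j\<in>J - I. 1)
        = (-1) ^ card (J - I) * (-1) ^ ?l * exp (- M * sum z I)"
        using fin[OF I] by (simp add: exp_sum sum_distrib_left sum_negf [symmetric])
    qed
    have p3: "(\<Prod>j\<in>J. 1 - exp (- M * z j)) * exp (M * sum z J) = (\<Prod>j\<in>J. exp (M * z j) - 1)"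
      using assms(2) by (simp add: sum_distrib_left exp_sum prod.distrib [symmetric] algebra_simps exp_add [symmetric])
    have e: "exp (M * (x + y)) = exp (M * x) * exp (M * y)" "exp (- M * (x + y)) = exp (- M * x) * exp (- M * y)" for x y
      by (simp_all add: distrib_left exp_add [symmetric])
    have e0: "exp (- M * x) * exp (M * x) = 1" for x by (simp add: exp_add [symmetric])
    have "(\<Sum>I\<in>Pow J. (-1) ^ card (J - I) *
        (polylog ?l (q ^ m) * (exp (M * (sum z I + u)) - (-1) ^ ?l * exp (- M * (sum z I + u))) +
         polylog ?l (q ^ m) * (exp (M * (sum z I + v)) - (-1) ^ ?l * exp (- M * (sum z I + v)))))
     = (\<Sum>I\<in>Pow J. polylog ?l (q ^ m) * ((exp (M * u) + exp (M * v)) * ((-1) ^ card (J - I) * exp (M * sum z I))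
          - (exp (- M * u) + exp (- M * v)) * ((-1) ^ card (J - I) * (-1) ^ ?l * exp (- M * sum z I))))"
      unfolding e by (intro sum.cong refl) (simp add: algebra_simps)
    also have "\<dots> = polylog ?l (q ^ m) * ((exp (M * u) + exp (M * v)) * (\<Prod>j\<in>J. exp (M * z j) - 1)
          - (exp (- M * u) + exp (- M * v)) * (\<Prod>j\<in>J. 1 - exp (- M * z j)))"
      unfolding p1 p2 by (simp only: sum_distrib_left sum_subtractf [symmetric])
    also have "(exp (M * u) + exp (M * v)) * (\<Prod>j\<in>J. exp (M * z j) - 1)
       = (exp (- M * u) + exp (- M * v)) * exp (M * (u + v)) * ((\<Prod>j\<in>J. 1 - exp (- M * z j)) * exp (M * sum z J))"
    proof -
      have "(exp (- M * u) + exp (- M * v)) * exp (M * (u + v)) = (exp (- M * u) * exp (M * u)) * exp (M * v) + (exp (- M * v) * exp (M * v)) * exp (M * u)"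
        unfolding e by (simp only: distrib_left distrib_right mult_ac)
      then show ?thesis unfolding p3 e0 by (simp add: add.commute)
    qed
    also have "polylog ?l (q ^ m) * (\<dots> - (exp (- M * u) + exp (- M * v)) * (\<Prod>j\<in>J. 1 - exp (- M * z j)))
      = (exp (- M * u) + exp (- M * v)) *
        (polylog ?l (q ^ m) * (\<Prod>j\<in>J. 1 - exp (- M * z j)) * (exp (M * (u + v + sum z J)) - 1))"
      unfolding e by (simp add: algebra_simps)
    finally show ?thesis by (simp only: M_def)
  qed
  ultimately show ?thesis by (simp only:)
qed

text \<open>In \<open>weight_product\<close> the range of hook lengths depends on the diagram,
  whereas \<open>maya_sum_heads_eq\<close> treats one length for all diagrams; the two orders of
  summation have to be exchanged.\<close>

lemma maya_sum_product_hooks_has_sum: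
  assumes "finite J" "norm q < 1" "exp (norm u + norm v + 2 * norm w + (\<Sum>j\<in>J. norm (z j)) + d) * norm q < 1" "d > 0"
  shows "((\<lambda>m. (exp (- of_nat m * u) + exp (- of_nat m * v)) * maya_sum_heads q z m w J) has_sum
     maya_sum q (\<lambda>S. (\<Sum>m\<in>{1..energy S}. (exp (- of_nat m * u) + exp (- of_nat m * v)) *
          (\<Sum>k\<in>heads S m. exp (w * (of_int k + 1/2)))) * (\<Prod>j\<in>J. weight S (z j)))) {1..}"
proof -
  let ?e = "\<lambda>m. exp (- of_nat m * u) + exp (- of_nat m * v)"
  let ?h = "\<lambda>S m. \<Sum>k\<in>heads S m. exp (w * (of_int k + 1/2))"
  let ?p = "\<lambda>S. \<Prod>j\<in>J. weight S (z j)"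
  define r where "r = norm u + norm v + 2 * norm w + (\<Sum>j\<in>J. norm (z j)) + d"
  \<comment> \<open>Head positions satisfy \<open>|k + 1/2| <= energy + m <= 2 * energy\<close>,
    whence \<open>2 * norm w\<close>. Half of \<open>d\<close> absorbs two factors of the energy,
    from the number of lengths and from the number of heads.\<close>
  define c where "c = norm u + norm v + 2 * norm w + d / 2"
  have gc: "growth c (\<lambda>S. of_real (\<Sum>m\<in>{1..energy S}. norm (?e m * ?h S m)))"
  proof -
    define d' where "d' = d / 4"
    have d': "d' > 0" using assms(4) by (simp add: d'_def)
    define K where "K = 4 * (1 / d') * (1 / d')"
    have "norm (of_real (\<Sum>m\<in>{1..energy S}. norm (?e m * ?h S m)) :: complex) \<le> K * exp (c * real (energy S))"
      if S: "S \<in> maya" for S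
    proof -
      define E where "E = real (energy S)"
      have "norm (?e m * ?h S m) \<le> (2 * exp ((norm u + norm v) * E)) * (2 * E * exp (norm w * (2 * E)))"
        if m: "m \<in> {1..energy S}" for m
      proof -
        have mE: "real m \<le> E" using m by (simp add: E_def)
        have b: "norm (exp (- of_nat m * x)) \<le> exp ((norm u + norm v) * E)" if "x \<in> {u,v}" for x :: complex
        proof -
          have "norm (exp (- of_nat m * x)) \<le> exp (norm (- of_nat m * x))" by (rule norm_exp)
          also have "norm (- of_nat m * x) = real m * norm x" by (simp add: norm_mult)
          also have "real m * norm x \<le> E * (norm u + norm v)"
            using mE that by (intro mult_mono) auto
          finally show ?thesis by (simp add: mult.commute)
        qed
        have "norm (?e m) \<le> 2 * exp ((norm u + norm v) * E)"
          using b[of u] b[of v] norm_triangle_ineq[of "exp (- of_nat m * u)" "exp (- of_nat m * v)"]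
          by (simp del: norm_exp_eq_Re)
        moreover have "norm (?h S m) \<le> 2 * E * exp (norm w * (2 * E))"
        proof -
          have "norm (?h S m) \<le> real (card (heads S m)) * exp (norm w * (2 * E))"
          proof (rule sum_norm_bound)
            fix k assume "k \<in> heads S m"
            then have "\<bar>real_of_int k + 1/2\<bar> \<le> 2 * E"
              using heads_tails_bounds[OF S, of k m] mE by (simp add: E_def)
            then show "norm (exp (w * (of_int k + 1/2))) \<le> exp (norm w * (2 * E))" by (rule norm_exp_half_le)
          qed
          also have "\<dots> \<le> 2 * E * exp (norm w * (2 * E))"
            using card_heads_tails(1)[OF S, of m] by (intro mult_right_mono) (auto simp: E_def)
          finally show ?thesis .
        qed
        ultimately show ?thesis unfolding norm_mult by (intro mult_mono) auto
      qed
      then have "(\<Sum>m\<in>{1..energy S}. norm (?e m * ?h S m)) \<le> E * ((2 * exp ((norm u + norm v) * E)) * (2 * E * exp (norm w * (2 * E))))"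
        using sum_bounded_above[of "{1..energy S}" "\<lambda>m. norm (?e m * ?h S m)"] by (simp add: E_def)
      also have "\<dots> = 4 * (E * E) * exp ((norm u + norm v + 2 * norm w) * E)"
        by (simp add: exp_add [symmetric] algebra_simps)
      also have "\<dots> \<le> 4 * (((1/d') * exp (d' * E)) * ((1/d') * exp (d' * E))) * exp ((norm u + norm v + 2 * norm w) * E)"
        using linear_le_exp[of d' 0 E] d' by (intro mult_right_mono mult_left_mono mult_mono) (auto simp: E_def)
      also have "\<dots> = K * (exp (d' * E) * exp (d' * E) * exp ((norm u + norm v + 2 * norm w) * E))"
        by (simp add: K_def)
      also have "exp (d' * E) * exp (d' * E) * exp ((norm u + norm v + 2 * norm w) * E) = exp (c * E)"
        unfolding exp_add [symmetric] c_def d'_def by (simp add: algebra_simps)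
      finally have "(\<Sum>m\<in>{1..energy S}. norm (?e m * ?h S m)) \<le> K * exp (c * E)" .
      then show ?thesis
        by (subst norm_of_real, subst abs_of_nonneg) (simp_all add: sum_nonneg E_def)
    qed
    then show ?thesis by (auto simp: growth_def)
  qed
  have g: "growth r (\<lambda>S. of_real (\<Sum>m\<in>{1..energy S}. norm (?e m * ?h S m * ?p S)))"
  proof -
    have "growth r (\<lambda>S. of_real (\<Sum>m\<in>{1..energy S}. norm (?e m * ?h S m)) * ?p S)"
    proof (rule growth_mult_weight_prod[OF assms(1)])
      have "norm (complex_of_real c) = c" using assms(4) by (simp add: c_def del: of_real_add)
      then show "norm (complex_of_real c) + (\<Sum>j\<in>J. norm (z j)) < r"
        "\<And>s. norm (complex_of_real c) < s \<Longrightarrow> growth s (\<lambda>S. of_real (\<Sum>m\<in>{1..energy S}. norm (?e m * ?h S m)))"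
        using assms(4) growth_mono[OF gc less_imp_le] by (simp_all add: r_def c_def)
    qed
    then show ?thesis
      by (rule growth_dominated)
         (simp add: norm_mult sum_distrib_right [symmetric] abs_mult sum_nonneg prod_nonneg del: of_real_sum)
  qed
  have q: "exp r * norm q < 1" using assms(3) by (simp add: r_def)
  have hs: "((\<lambda>(S,m). ?e m * ?h S m * ?p S * q ^ energy S) has_sum
     maya_sum q (\<lambda>S. \<Sum>m\<in>{1..energy S}. ?e m * ?h S m * ?p S)) (Sigma maya (\<lambda>S. {1..energy S}))"
    by (rule maya_sum_has_sum_Sigma[OF g q]) simp
  \<comment> \<open>Lengths beyond the energy admit no heads, so the range of \<open>m\<close> may
    be made independent of \<open>S\<close>.\<close>
  have "((\<lambda>(S,m). ?e m * ?h S m * ?p S * q ^ energy S) has_sum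
     maya_sum q (\<lambda>S. \<Sum>m\<in>{1..energy S}. ?e m * ?h S m * ?p S)) (maya \<times> {1..})"
  proof (rule has_sum_cong_neutral[THEN iffD1, OF _ _ _ hs])
    fix x assume "x \<in> maya \<times> {1..} - Sigma maya (\<lambda>S. {1..energy S})"
    then have "heads (fst x) (snd x) = {}" by (intro heads_empty) auto
    then show "(case x of (S,m) \<Rightarrow> ?e m * ?h S m * ?p S * q ^ energy S) = 0" by (simp add: case_prod_unfold)
  qed auto
  then have "((\<lambda>(m,S). ?e m * ?h S m * ?p S * q ^ energy S) has_sum
     maya_sum q (\<lambda>S. \<Sum>m\<in>{1..energy S}. ?e m * ?h S m * ?p S)) ({1..} \<times> maya)"
    by (subst has_sum_swap) (simp add: case_prod_unfold)
  moreover have "((\<lambda>S. ?e m * ?h S m * ?p S * q ^ energy S) has_sum (?e m * maya_sum_heads q z m w J)) maya" for m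
  proof -
    have "norm w + (\<Sum>j\<in>J. norm (z j)) < r"
      using assms(4) norm_ge_zero[of u] norm_ge_zero[of v] norm_ge_zero[of w] unfolding r_def by linarith
    then have "growth r (\<lambda>S. ?h S m * ?p S)"
      by (intro growth_mult_weight_prod assms growth_hook_sums)
    from has_sum_cmult_right[OF maya_sum_has_sum[OF this q], of "?e m"]
    show ?thesis by (simp add: maya_sum_heads_def mult.assoc)
  qed
  ultimately have "((\<lambda>m. ?e m * maya_sum_heads q z m w J) has_sum
     maya_sum q (\<lambda>S. \<Sum>m\<in>{1..energy S}. ?e m * ?h S m * ?p S)) {1..}"
    by (intro has_sum_SigmaD[of _ "{1..}" "\<lambda>_. maya"]) auto
  then show ?thesis by (simp only: sum_distrib_right)
qed

text \<open>Averaging \<open>weight_product\<close> leaves hook sums, which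
  \<open>maya_sum_heads_eq\<close> evaluates for each length and
  \<open>Z_series_has_sum_combination\<close> sums over the length. The coefficient \<open>3\<close>
  is \<open>1 + 2\<close>: the exchange of sums needs \<open>2 * norm (u + v)\<close> besides
  \<open>norm u + norm v\<close>.\<close>

theorem maya_sum_two_point_reduction:
  assumes J: "finite J" and q: "norm q < 1" and d: "d > 0"
    and small_arg: "exp (3 * norm u + 3 * norm v + (\<Sum>j\<in>J. norm (z j)) + d) * norm q < 1"
    and ne: "exp u \<noteq> 1" "exp v \<noteq> 1" "\<And>I. I \<subseteq> J \<Longrightarrow> exp (u + v + sum z I) \<noteq> 1"
  shows "maya_sum q (\<lambda>S. weight S u * weight S v * (\<Prod>j\<in>J. weight S (z j))) =
    (\<Sum>I\<in>Pow J. maya_sum_weight q z (u + v + sum z I) (J - I) *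
       ((if I = {} then hcoth u + hcoth v else 0) -
        (\<Sum>I'\<in>Pow I. (-1) ^ card (I - I') * (Z_series q (card I) (sum z I' + u) + Z_series q (card I) (sum z I' + v)))))"
proof -
  let ?e = "\<lambda>m. exp (- of_nat m * u) + exp (- of_nat m * v)"
  let ?g = "\<lambda>m I. \<Prod>i\<in>I. 1 - exp (- of_nat m * z i)"
  let ?p = "\<lambda>S. \<Prod>j\<in>J. weight S (z j)"
  let ?H = "\<lambda>S. \<Sum>m\<in>{1..energy S}. ?e m * (\<Sum>k\<in>heads S m. exp ((u + v) * (of_int k + 1/2)))"
  let ?M = "\<lambda>I. \<Sum>I'\<in>Pow I. (-1) ^ card (I - I') * (Z_series q (card I) (sum z I' + u) + Z_series q (card I) (sum z I' + v))"
  define s where "s = (\<Sum>j\<in>J. norm (z j))"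
  have snn: "s \<ge> 0" by (simp add: s_def sum_nonneg)
  define r where "r = 3 * norm u + 3 * norm v + s + d"
  have r: "exp r * norm q < 1" using small_arg by (simp add: r_def s_def)
  have le: "exp x * norm q < 1" if "x \<le> r" for x
    using that r by (smt (verit) exp_le_cancel_iff mult_right_mono norm_ge_zero)
  have w: "norm (u + v) \<le> norm u + norm v" by (rule norm_triangle_ineq)
  have pos: "norm u \<ge> 0" "norm v \<ge> 0" by auto
  have lr: "norm (u + v) + (\<Sum>j\<in>J. norm (z j)) < r" "norm u + norm v + (\<Sum>j\<in>J. norm (z j)) \<le> r"
    "norm u + norm v + 2 * norm (u + v) + (\<Sum>j\<in>J. norm (z j)) + d \<le> r"
    using w d pos snn unfolding r_def s_def [symmetric] by linarith+
  have hooks: "((\<lambda>m. ?e m * maya_sum_heads q z m (u + v) J) has_sum maya_sum q (\<lambda>S. ?H S * ?p S)) {1..}"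
    using lr(3) by (intro maya_sum_product_hooks_has_sum[OF J q _ d] le)
  moreover have "((\<lambda>m. ?e m * maya_sum_heads q z m (u + v) J) has_sum (\<Sum>I\<in>Pow J. ?M I * maya_sum_weight q z (u + v + sum z I) (J - I))) {1..}"
  proof -
    have "((\<lambda>m. (?e m * (polylog (card I) (q ^ m) * ?g m I * (exp (of_nat m * (u + v + sum z I)) - 1))) * maya_sum_weight q z (u + v + sum z I) (J - I))
      has_sum (?M I * maya_sum_weight q z (u + v + sum z I) (J - I))) {1..}" if "I \<in> Pow J" for I
    proof (intro has_sum_cmult_left Z_series_has_sum_combination q le)
      show "finite I" using that J finite_subset by auto
      have "(\<Sum>j\<in>I. norm (z j)) \<le> (\<Sum>j\<in>J. norm (z j))" using that J by (intro sum_mono2) auto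
      then show "norm u + norm v + (\<Sum>j\<in>I. norm (z j)) \<le> r" using lr(2) by linarith
    qed
    then have "((\<lambda>m. \<Sum>I\<in>Pow J. (?e m * (polylog (card I) (q ^ m) * ?g m I * (exp (of_nat m * (u + v + sum z I)) - 1))) * maya_sum_weight q z (u + v + sum z I) (J - I))
      has_sum (\<Sum>I\<in>Pow J. ?M I * maya_sum_weight q z (u + v + sum z I) (J - I))) {1..}"
      using J by (intro has_sum_sum) auto
    then show ?thesis
    proof (rule has_sum_cong[THEN iffD1, rotated])
      fix m :: nat assume "m \<in> {1..}"
      then have m: "m > 0" by simp
      show "(\<Sum>I\<in>Pow J. (?e m * (polylog (card I) (q ^ m) * ?g m I * (exp (of_nat m * (u + v + sum z I)) - 1))) * maya_sum_weight q z (u + v + sum z I) (J - I))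
         = ?e m * maya_sum_heads q z m (u + v) J"
        using maya_sum_heads_eq[OF J lr(1) r m q ne(3)] by (simp only: sum_distrib_left mult.assoc)
    qed
  qed
  ultimately have H: "maya_sum q (\<lambda>S. ?H S * ?p S) = (\<Sum>I\<in>Pow J. ?M I * maya_sum_weight q z (u + v + sum z I) (J - I))"
    by (rule has_sum_unique)
  define c where "c = hcoth u + hcoth v"
  have "((\<lambda>S. c * (weight S (u + v) * ?p S * q ^ energy S)) has_sum (c * maya_sum_weight q z (u + v) J)) maya"
    unfolding maya_sum_weight_def
    by (intro has_sum_cmult_right maya_sum_has_sum[OF _ r] growth_mult_weight_prod[OF J lr(1)] growth_weight)
  moreover have "((\<lambda>S. weight S u * (weight S v * ?p S) * q ^ energy S) has_sum maya_sum q (\<lambda>S. weight S u * (weight S v * ?p S))) maya"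
  proof (rule maya_sum_has_sum[OF _ r])
    have "growth (r - norm u - d/2) (\<lambda>S. weight S v * ?p S)"
    proof (rule growth_mult_weight_prod[OF J])
      show "norm v + (\<Sum>j\<in>J. norm (z j)) < r - norm u - d/2"
        using d pos unfolding r_def s_def by linarith
    qed (rule growth_weight)
    from growth_mult[OF growth_weight[of u "norm u + d/2"] this] d
    show "growth r (\<lambda>S. weight S u * (weight S v * ?p S))" by simp
  qed
  ultimately have "((\<lambda>S. c * (weight S (u + v) * ?p S * q ^ energy S) + - (weight S u * (weight S v * ?p S) * q ^ energy S)) has_sum
      (c * maya_sum_weight q z (u + v) J + - maya_sum q (\<lambda>S. weight S u * (weight S v * ?p S)))) maya"
    by (intro has_sum_add has_sum_uminusI)
  moreover have "c * (weight S (u + v) * ?p S * q ^ energy S) + - (weight S u * (weight S v * ?p S) * q ^ energy S) = ?H S * ?p S * q ^ energy S"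
    if S: "S \<in> maya" for S
  proof -
    have "?H S = c * weight S (u + v) - weight S u * weight S v"
      using weight_product[OF S ne(1,2)] ne(3)[of "{}"] by (simp add: c_def algebra_simps)
    then show ?thesis by (simp only: left_diff_distrib mult.assoc) simp
  qed
  ultimately have "((\<lambda>S. ?H S * ?p S * q ^ energy S) has_sum
      (c * maya_sum_weight q z (u + v) J + - maya_sum q (\<lambda>S. weight S u * (weight S v * ?p S)))) maya"
    by (subst has_sum_cong[symmetric]) auto
  then have "maya_sum q (\<lambda>S. ?H S * ?p S) = c * maya_sum_weight q z (u + v) J - maya_sum q (\<lambda>S. weight S u * (weight S v * ?p S))"
    unfolding maya_sum_def[of q "\<lambda>S. ?H S * ?p S"] by (simp add: infsumI)
  then have "maya_sum q (\<lambda>S. weight S u * weight S v * ?p S) = c * maya_sum_weight q z (u + v) J - (\<Sum>I\<in>Pow J. ?M I * maya_sum_weight q z (u + v + sum z I) (J - I))"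
    unfolding H by (simp add: mult.assoc)
  also have "c * maya_sum_weight q z (u + v) J = (\<Sum>I\<in>Pow J. maya_sum_weight q z (u + v + sum z I) (J - I) * (if I = {} then c else 0))"
    using J by (simp add: if_distrib[of "\<lambda>x. _ * x"] sum.delta cong: if_cong)
  finally show ?thesis
    unfolding c_def [symmetric] by (simp add: sum_subtractf right_diff_distrib mult.commute)
qed

section \<open>Correlators near the origin\<close>

lemma has_sum_product_abs:
  fixes f :: "'a \<Rightarrow> complex" and g :: "'b \<Rightarrow> complex"
  assumes "(\<lambda>x. norm (f x)) summable_on A" "(\<lambda>y. norm (g y)) summable_on B"
  shows "((\<lambda>(x,y). f x * g y) has_sum (infsum f A * infsum g B)) (A \<times> B)"
    and "(\<lambda>p. norm (f (fst p) * g (snd p))) summable_on (A \<times> B)"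
proof -
  have "(\<lambda>p. norm (case p of (x,y) \<Rightarrow> f x * g y)) summable_on (A \<times> B)"
  proof (subst Infinite_Sum.abs_summable_on_Sigma_iff, intro conjI ballI)
    fix x
    show "(\<lambda>y. norm (case (x, y) of (x,y) \<Rightarrow> f x * g y)) summable_on B"
      using assms by (simp add: norm_mult summable_on_cmult_right)
    have "(\<lambda>x. norm (norm (f x) * (\<Sum>\<^sub>\<infinity>y\<in>B. norm (g y)))) summable_on A"
      using assms(1) by (intro summable_on_iff_abs_summable_on_real[THEN iffD1] summable_on_cmult_left)
    then show "(\<lambda>x. norm (\<Sum>\<^sub>\<infinity>y\<in>B. norm (case (x, y) of (x,y) \<Rightarrow> f x * g y))) summable_on A"
      by (simp add: norm_mult infsum_cmult_right')
  qed
  then show n: "(\<lambda>p. norm (f (fst p) * g (snd p))) summable_on (A \<times> B)"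
    by (simp add: case_prod_unfold)
  then have s: "(\<lambda>(x,y). f x * g y) summable_on (A \<times> B)"
    by (intro abs_summable_summable[of "\<lambda>(x,y). f x * g y"]) (simp add: case_prod_unfold)
  have "infsum (\<lambda>(x,y). f x * g y) (A \<times> B) = infsum f A * infsum g B"
    using infsum_Sigma'_banach[OF s] by (simp add: infsum_cmult_right' infsum_cmult_left')
  then show "((\<lambda>(x,y). f x * g y) has_sum (infsum f A * infsum g B)) (A \<times> B)"
    using has_sum_infsum[OF s] by simp
qed

lemma bij_betw_Cons_lists: "bij_betw (\<lambda>(k,ks). k # ks) (UNIV \<times> {ks. length ks = m}) {ks. length ks = Suc m}"
  by (rule bij_betwI[where g = "\<lambda>ks. (hd ks, tl ks)"]) (auto simp: length_Suc_conv)

lemma has_sum_lists_prod: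
  fixes g :: "nat \<Rightarrow> nat \<Rightarrow> complex"
  assumes "\<And>i. i < m \<Longrightarrow> (\<lambda>k. norm (g i k)) summable_on UNIV"
  shows "((\<lambda>ks. \<Prod>i<m. g i (ks ! i)) has_sum (\<Prod>i<m. infsum (g i) UNIV)) {ks. length ks = m}"
    and "(\<lambda>ks. norm (\<Prod>i<m. g i (ks ! i))) summable_on {ks. length ks = m}"
proof -
  have "((\<lambda>ks. \<Prod>i<m. g i (ks ! i)) has_sum (\<Prod>i<m. infsum (g i) UNIV)) {ks. length ks = m} \<and>
     (\<lambda>ks. norm (\<Prod>i<m. g i (ks ! i))) summable_on {ks. length ks = m}"
    using assms
  proof (induction m arbitrary: g)
    case 0
    have "{ks::nat list. length ks = 0} = {[]}" by auto
    then show ?case by (simp add: has_sum_finite_iff)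
  next
    case (Suc m)
    let ?L = "{ks::nat list. length ks = m}"
    have IH: "((\<lambda>ks. \<Prod>i<m. g (Suc i) (ks ! i)) has_sum (\<Prod>i<m. infsum (g (Suc i)) UNIV)) ?L"
      "(\<lambda>ks. norm (\<Prod>i<m. g (Suc i) (ks ! i))) summable_on ?L"
      using Suc.IH[of "\<lambda>i. g (Suc i)"] Suc.prems by auto
    have i: "infsum (\<lambda>ks. \<Prod>i<m. g (Suc i) (ks ! i)) ?L = (\<Prod>i<m. infsum (g (Suc i)) UNIV)"
      using IH(1) by (rule infsumI)
    have g0: "(\<lambda>k. norm (g 0 k)) summable_on UNIV" using Suc.prems by auto
    note p = has_sum_product_abs[OF g0 IH(2)]
    have eq: "(\<Prod>i<Suc m. g i ((k # ks) ! i)) = g 0 k * (\<Prod>i<m. g (Suc i) (ks ! i))" for k ks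
      by (simp add: prod.lessThan_Suc_shift del: prod.lessThan_Suc)
    have "((\<lambda>p. \<Prod>i<Suc m. g i ((case p of (k,ks) \<Rightarrow> k # ks) ! i)) has_sum (\<Prod>i<Suc m. infsum (g i) UNIV)) (UNIV \<times> ?L)"
      using p(1) unfolding i
      by (simp add: prod.lessThan_Suc_shift case_prod_unfold del: prod.lessThan_Suc)
    moreover have "(\<lambda>p. norm (\<Prod>i<Suc m. g i ((case p of (k,ks) \<Rightarrow> k # ks) ! i))) summable_on (UNIV \<times> ?L)"
      using p(2) by (simp add: prod.lessThan_Suc_shift case_prod_unfold del: prod.lessThan_Suc)
    ultimately show ?case
      using has_sum_reindex_bij_betw[OF bij_betw_Cons_lists[of m], of "\<lambda>ks. \<Prod>i<Suc m. g i (ks ! i)"]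
        summable_on_reindex_bij_betw[OF bij_betw_Cons_lists[of m], of "\<lambda>ks. norm (\<Prod>i<Suc m. g i (ks ! i))"]
      by simp
  qed
  then show "((\<lambda>ks. \<Prod>i<m. g i (ks ! i)) has_sum (\<Prod>i<m. infsum (g i) UNIV)) {ks. length ks = m}"
    and "(\<lambda>ks. norm (\<Prod>i<m. g i (ks ! i))) summable_on {ks. length ks = m}" by auto
qed

text \<open>The function is \<open>x\<close> times the first term of \<open>weight_eq\<close>: the
  numbers \<open>bo_beta\<close> encode the weight of the empty partition.\<close>

lemma bo_beta_expansion:
  "(\<lambda>x. if x = 0 then 1 else x * (exp (x / 2) / (exp x - 1))) has_fps_expansion Abs_fps bo_beta"
proof -
  define F :: "complex fps" where "F = fps_const (1/2) * fps_X"
  define G :: "complex fps" where "G = fps_const (1/2) * (fps_exp (1/2) - fps_exp (-1/2))"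
  have G0: "fps_nth G 0 = 0" and G1: "fps_nth G 1 = 1/2" by (simp_all add: G_def)
  have Gn: "G \<noteq> 0" using G1 by (metis fps_zero_nth zero_neq_one divide_eq_0_iff zero_neq_numeral)
  have sub: "subdegree G = 1"
    by (rule subdegreeI) (use G0 G1 in auto)
  have "(\<lambda>x. 1/2 * x) has_fps_expansion F" unfolding F_def by (intro fps_expansion_intros)
  moreover have "(\<lambda>x. 1/2 * (exp (1/2 * x) - exp (-1/2 * x))) has_fps_expansion G"
    unfolding G_def by (intro fps_expansion_intros)
  ultimately have 1: "(\<lambda>x. if x = 0 then 1 else (1/2 * x) / (1/2 * (exp (1/2 * x) - exp (-1/2 * x)))) has_fps_expansion (F / G)"
    by (rule has_fps_expansion_divide) (use sub Gn G1 in \<open>auto simp: F_def mult.commute\<close>)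
  have 2: "F / G = Abs_fps bo_beta" by (rule fps_ext) (simp add: bo_beta_def F_def G_def)
  have 3: "(1/2 * x) / (1/2 * (exp (1/2 * x) - exp (-1/2 * x))) = x * (exp (x / 2) / (exp x - 1))" for x :: complex
  proof -
    have "exp x - 1 = exp (x/2) * (exp (x/2) - exp (-x/2))"
      by (simp add: right_diff_distrib exp_add [symmetric])
    then show ?thesis by simp
  qed
  show ?thesis using 1 unfolding 2 3 .
qed

lemma bo_beta_powser:
  "\<exists>\<rho>>0. \<forall>x. norm x < \<rho> \<longrightarrow> summable (\<lambda>k. norm (bo_beta k * x ^ k)) \<and>
    (x \<noteq> 0 \<longrightarrow> (\<lambda>k. bo_beta k * x ^ k) sums (x * (exp (x / 2) / (exp x - 1))))"
proof -
  let ?F = "Abs_fps bo_beta"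
  let ?f = "\<lambda>x::complex. if x = 0 then 1 else x * (exp (x / 2) / (exp x - 1))"
  have R: "fps_conv_radius ?F > 0" and ev: "eventually (\<lambda>z. eval_fps ?F z = ?f z) (nhds 0)"
    using bo_beta_expansion by (auto simp: has_fps_expansion_def)
  obtain e where e: "e > 0" "\<And>z. norm z < e \<Longrightarrow> eval_fps ?F z = ?f z"
    using ev by (auto simp: eventually_nhds_metric dist_norm)
  obtain r where r: "r > 0" "ereal r < fps_conv_radius ?F"
    using R by (metis ereal_dense2 ereal_less(2) zero_ereal_def)
  have s: "summable (\<lambda>k. norm (bo_beta k * x ^ k))" if "norm x < min e r" for x
  proof -
    have "ereal (norm x) < ereal r" using that by simp
    also note r(2)
    finally have "ereal (norm x) < fps_conv_radius ?F" .
    then show ?thesis using norm_summable_fps[of x ?F] by simp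
  qed
  have "(\<lambda>k. bo_beta k * x ^ k) sums (x * (exp (x / 2) / (exp x - 1)))" if x: "norm x < min e r" "x \<noteq> 0" for x
  proof -
    have "(\<lambda>k. bo_beta k * x ^ k) sums (\<Sum>k. bo_beta k * x ^ k)"
      by (rule summable_sums[OF summable_norm_cancel[OF s[OF x(1)]]])
    also have "(\<Sum>k. bo_beta k * x ^ k) = ?f x"
      using e(2)[of x] x(1) by (simp add: eval_fps_def)
    finally show ?thesis using x(2) by simp
  qed
  then show ?thesis using e(1) r(1) s by (intro exI[of _ "min e r"]) auto
qed

lemma bo_beta_0: "bo_beta 0 = 1"
  using has_fps_expansion_imp_0_eq_fps_nth_0[OF bo_beta_expansion] by simp

lemma weight_maya_of:
  assumes "sorted_wrt (\<ge>) \<mu>"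
  shows "weight (maya_of \<mu>) x = exp (x / 2) / (exp x - 1) +
    (\<Sum>i<length \<mu>. exp (x * (of_nat (\<mu> ! i) - of_nat (i + 1) + 1/2)) - exp (x * (- of_nat (i + 1) + 1/2)))"
proof -
  have e: "exp (x / 2) * exp (x * of_int k) = exp (x * (of_int k + 1/2))" for k
    by (simp add: exp_add [symmetric] algebra_simps)
  show ?thesis
    unfolding weight_def msum_maya_of[OF assms] distrib_left[of "exp (x / 2)"] sum_distrib_left
      right_diff_distrib[of "exp (x / 2)"] e by simp
qed

text \<open>The term of index 0 is set to 0 so that the exponential series starts at
  \<open>k = 1\<close>, in step with the powers \<open>k - 1\<close> in \<open>bo_Q\<close>.\<close>

lemma exp_powser_shift:
  fixes a x :: complex
  shows "(\<lambda>k. if k = 0 then 0 else (1 / fact (k - 1)) * a ^ (k - 1) * x powi (int k - 1)) sums exp (x * a)"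
    and "summable (\<lambda>k. norm (if k = 0 then 0 else (1 / fact (k - 1)) * a ^ (k - 1) * x powi (int k - 1)))"
    and "(\<Sum>k. norm (if k = 0 then 0 else (1 / fact (k - 1)) * a ^ (k - 1) * x powi (int k - 1))) = exp (norm x * norm a)"
proof -
  let ?f = "\<lambda>k. if k = 0 then 0 else (1 / fact (k - 1)) * a ^ (k - 1) * x powi (int k - 1)"
  have S: "?f (Suc k) = (x * a) ^ k /\<^sub>R fact k" for k
    by (simp add: power_mult_distrib scaleR_conv_of_real divide_simps)
  have N: "norm (?f (Suc k)) = (norm x * norm a) ^ k /\<^sub>R fact k" for k
    unfolding S by (simp add: norm_mult norm_power power_mult_distrib)
  show "?f sums exp (x * a)"
    by (subst sums_Suc_iff [where f = ?f and s = "exp (x * a)", simplified, symmetric])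
       (use exp_converges[of "x * a"] S in simp)
  have n: "(\<lambda>k. norm (?f k)) sums exp (norm x * norm a)"
    by (subst sums_Suc_iff [where f = "\<lambda>k. norm (?f k)" and s = "exp (norm x * norm a)", simplified, symmetric])
       (use exp_converges[of "norm x * norm a"] N in simp)
  then show "summable (\<lambda>k. norm (?f k))" "(\<Sum>k. norm (?f k)) = exp (norm x * norm a)"
    by (auto simp: sums_iff)
qed

text \<open>Because \<open>bo_beta 0 = 1\<close>, the special value \<open>bo_Q 0 = 1\<close> fits
  the general formula with no contribution from the parts.\<close>

lemma bo_Q_term:
  "bo_Q k \<mu> * x powi (int k - 1) = bo_beta k * x powi (int k - 1) +
    (\<Sum>i<length \<mu>. (if k = 0 then 0 else (1 / fact (k - 1)) * (of_nat (\<mu> ! i) - of_nat (i + 1) + 1/2) ^ (k - 1) * x powi (int k - 1))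
      - (if k = 0 then 0 else (1 / fact (k - 1)) * (- of_nat (i + 1) + 1/2) ^ (k - 1) * x powi (int k - 1)))"
  by (cases "k = 0") (simp_all add: bo_Q_def bo_beta_0 algebra_simps sum_distrib_left sum_distrib_right sum_subtractf)

lemma parts_le_sum_list:
  assumes "\<mu> \<in> partitions" "i < length \<mu>"
  shows "length \<mu> \<le> sum_list \<mu>" "norm (of_nat (\<mu> ! i) - of_nat (i + 1) + 1/2 :: complex) \<le> real (sum_list \<mu>)"
    "norm (- of_nat (i + 1) + 1/2 :: complex) \<le> real (sum_list \<mu>)"
proof -
  have "\<forall>x\<in>set \<mu>. 1 \<le> x" using assms(1) by (auto simp: partitions_def Suc_le_eq intro: gr0I)
  then show l: "length \<mu> \<le> sum_list \<mu>"
    using sum_list_mono[of \<mu> "\<lambda>_. 1" "\<lambda>x. x"] by (simp add: sum_list_triv)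
  have m: "\<mu> ! i \<le> sum_list \<mu>" by (rule elem_le_sum_list[OF assms(2)])
  have "(of_nat (\<mu> ! i) - of_nat (i + 1) + 1/2 :: complex) = of_real (real (\<mu> ! i) - real (i + 1) + 1/2)" by simp
  then show "norm (of_nat (\<mu> ! i) - of_nat (i + 1) + 1/2 :: complex) \<le> real (sum_list \<mu>)"
    using l m assms(2) by (simp only: norm_of_real; simp add: abs_le_iff)
  have "(- of_nat (i + 1) + 1/2 :: complex) = of_real (- real (i + 1) + 1/2)" by simp
  then show "norm (- of_nat (i + 1) + 1/2 :: complex) \<le> real (sum_list \<mu>)"
    using l assms(2) by (simp only: norm_of_real; simp add: abs_le_iff)
qed

text \<open>Summation over \<open>k\<close> turns powers of the shifted parts into exponentials,
  which together with the \<open>bo_beta\<close> part form the regularised sum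
  \<open>weight\<close>. The last bound, uniform in the partition up to energy factors, serves to
  exchange sums over \<open>k\<close> and over partitions.\<close>

lemma bo_Q_generating:
  assumes \<rho>: "\<And>x. norm x < \<rho> \<Longrightarrow> summable (\<lambda>k. norm (bo_beta k * x ^ k))"
    "\<And>x. norm x < \<rho> \<Longrightarrow> x \<noteq> 0 \<Longrightarrow> (\<lambda>k. bo_beta k * x ^ k) sums (x * (exp (x / 2) / (exp x - 1)))"
    and x: "norm x < \<rho>" "x \<noteq> 0" and \<mu>: "\<mu> \<in> partitions"
  shows "(\<lambda>k. norm (bo_Q k \<mu> * x powi (int k - 1))) summable_on UNIV"
    and "infsum (\<lambda>k. bo_Q k \<mu> * x powi (int k - 1)) UNIV = weight (maya_of \<mu>) x"
    and "infsum (\<lambda>k. norm (bo_Q k \<mu> * x powi (int k - 1))) UNIV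
       \<le> (\<Sum>k. norm (bo_beta k * x powi (int k - 1))) + 2 * real (sum_list \<mu>) * exp (norm x * real (sum_list \<mu>))"
proof -
  let ?e = "\<lambda>a k. if k = 0 then 0 else (1 / fact (k - 1)) * a ^ (k - 1) * x powi (int k - 1)"
  define a :: "nat \<Rightarrow> complex" where "a = (\<lambda>i. of_nat (\<mu> ! i) - of_nat (i + 1) + 1/2)"
  define b :: "nat \<Rightarrow> complex" where "b = (\<lambda>i. - of_nat (i + 1) + 1/2)"
  let ?T = "\<lambda>k. norm (bo_beta k * x powi (int k - 1)) + (\<Sum>i<length \<mu>. norm (?e (a i) k) + norm (?e (b i) k))"
  define E where "E = real (sum_list \<mu>)"
  have pw: "bo_beta k * x powi (int k - 1) = bo_beta k * x ^ k * (1 / x)" for k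
    using x(2) by (simp add: power_int_diff)
  have sb: "summable (\<lambda>k. norm (bo_beta k * x powi (int k - 1)))"
    unfolding pw norm_mult[of _ "1/x"] by (rule summable_mult2[OF \<rho>(1)[OF x(1)]])
  have bb: "(\<lambda>k. bo_beta k * x powi (int k - 1)) sums (exp (x / 2) / (exp x - 1))"
    unfolding pw using sums_mult2[OF \<rho>(2)[OF x], of "1/x"] x(2) by simp
  have tm: "bo_Q k \<mu> * x powi (int k - 1) = bo_beta k * x powi (int k - 1) + (\<Sum>i<length \<mu>. ?e (a i) k - ?e (b i) k)" for k
    unfolding a_def b_def by (rule bo_Q_term)
  have le: "norm (bo_Q k \<mu> * x powi (int k - 1)) \<le> ?T k" for k
    unfolding tm
    by (intro order_trans[OF norm_triangle_ineq] add_left_mono order_trans[OF norm_sum] sum_mono norm_triangle_ineq4)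
  have T: "?T sums ((\<Sum>k. norm (bo_beta k * x powi (int k - 1))) + (\<Sum>i<length \<mu>. exp (norm x * norm (a i)) + exp (norm x * norm (b i))))"
    using exp_powser_shift(2,3)[of _ x]
    by (intro sums_add sums_sum summable_sums sb) (auto simp: sums_iff)
  have sn: "summable (\<lambda>k. norm (bo_Q k \<mu> * x powi (int k - 1)))"
    by (rule summable_comparison_test'[OF sums_summable[OF T], of 0]) (use le in auto)
  show son: "(\<lambda>k. norm (bo_Q k \<mu> * x powi (int k - 1))) summable_on UNIV"
    using sn by (intro summable_nonneg_imp_summable_on) auto
  have "(\<lambda>k. bo_Q k \<mu> * x powi (int k - 1)) sums (exp (x / 2) / (exp x - 1) + (\<Sum>i<length \<mu>. exp (x * a i) - exp (x * b i)))"
    unfolding tm by (intro sums_add sums_sum sums_diff bb exp_powser_shift(1))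
  also have "exp (x / 2) / (exp x - 1) + (\<Sum>i<length \<mu>. exp (x * a i) - exp (x * b i)) = weight (maya_of \<mu>) x"
    using \<mu> by (simp add: weight_maya_of partitions_def a_def b_def)
  finally have "(\<lambda>k. bo_Q k \<mu> * x powi (int k - 1)) sums weight (maya_of \<mu>) x" .
  then show "infsum (\<lambda>k. bo_Q k \<mu> * x powi (int k - 1)) UNIV = weight (maya_of \<mu>) x"
    by (rule infsumI[OF norm_summable_imp_has_sum[OF sn]])
  have "infsum (\<lambda>k. norm (bo_Q k \<mu> * x powi (int k - 1))) UNIV = (\<Sum>k. norm (bo_Q k \<mu> * x powi (int k - 1)))"
    using sn by (intro infsumI norm_summable_imp_has_sum summable_sums) auto
  also have "\<dots> \<le> (\<Sum>k. norm (bo_beta k * x powi (int k - 1))) + (\<Sum>i<length \<mu>. exp (norm x * norm (a i)) + exp (norm x * norm (b i)))"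
    unfolding sums_unique[OF T] using le sn sums_summable[OF T] by (intro suminf_le) auto
  also have "(\<Sum>i<length \<mu>. exp (norm x * norm (a i)) + exp (norm x * norm (b i))) \<le> (\<Sum>i<length \<mu>. 2 * exp (norm x * E))"
  proof (rule sum_mono)
    fix i assume i: "i \<in> {..<length \<mu>}"
    have "exp (norm x * norm (a i)) \<le> exp (norm x * E)" "exp (norm x * norm (b i)) \<le> exp (norm x * E)"
      using parts_le_sum_list(2,3)[OF \<mu>, of i] i by (auto simp: a_def b_def E_def intro!: mult_left_mono)
    then show "exp (norm x * norm (a i)) + exp (norm x * norm (b i)) \<le> 2 * exp (norm x * E)"
      unfolding mult_2 by (rule add_mono)
  qed
  also have "(\<Sum>i<length \<mu>. 2 * exp (norm x * E)) \<le> 2 * E * exp (norm x * E)"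
  proof -
    have "real (length \<mu>) \<le> E" using parts_le_sum_list(1)[OF \<mu>, of 0] by (cases \<mu>) (auto simp: E_def)
    then have "real (length \<mu>) * (2 * exp (norm x * E)) \<le> E * (2 * exp (norm x * E))" by (intro mult_right_mono) auto
    then show ?thesis by simp
  qed
  finally show "infsum (\<lambda>k. norm (bo_Q k \<mu> * x powi (int k - 1))) UNIV
       \<le> (\<Sum>k. norm (bo_beta k * x powi (int k - 1))) + 2 * real (sum_list \<mu>) * exp (norm x * real (sum_list \<mu>))"
    by (simp add: E_def)
qed

definition bo_norm :: "complex \<Rightarrow> complex" where
  "bo_norm q = 1 / (\<Sum>\<^sub>\<infinity>\<mu>\<in>partitions. q ^ sum_list \<mu>)"

lemma exists_exp_small:
  assumes "norm (q::complex) < 1"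
  obtains r where "r > 0" "exp r * norm q < 1"
proof (cases "q = 0")
  case True
  then show ?thesis using that[of 1] by simp
next
  case False
  \<comment> \<open>With this choice \<open>exp r * norm q\<close> is the square root of
    \<open>norm q\<close>.\<close>
  have "exp (- ln (norm q) / 2) * norm q = exp (ln (norm q) / 2)"
    using False by (subst (2) exp_ln [symmetric]) (simp_all add: exp_add [symmetric] del: exp_ln)
  moreover have "ln (norm q) < 0" using assms False by simp
  ultimately show ?thesis using that[of "- ln (norm q) / 2"] by simp
qed

lemma summable_on_partitions:
  assumes "growth r g" "exp r * norm q < 1"
  shows "(\<lambda>\<mu>. norm (g (maya_of \<mu>) * q ^ sum_list \<mu>)) summable_on partitions"
proof -
  have "(\<lambda>\<mu>. norm (g (maya_of \<mu>) * q ^ energy (maya_of \<mu>))) summable_on partitions"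
    using growth_abs_summable[OF assms] by (subst summable_on_reindex_bij_betw[OF bij_betw_maya_of])
  then show ?thesis
    by (rule summable_on_cong[THEN iffD1, rotated]) (simp add: maya_of_in_maya partitions_def)
qed

lemma infsum_partitions_eq_maya_sum:
  "(\<Sum>\<^sub>\<infinity>\<mu>\<in>partitions. g (maya_of \<mu>) * q ^ sum_list \<mu>) = maya_sum q g"
proof -
  have "(\<Sum>\<^sub>\<infinity>\<mu>\<in>partitions. g (maya_of \<mu>) * q ^ sum_list \<mu>)
      = (\<Sum>\<^sub>\<infinity>\<mu>\<in>partitions. g (maya_of \<mu>) * q ^ energy (maya_of \<mu>))"
    by (rule infsum_cong) (simp add: maya_of_in_maya partitions_def)
  then show ?thesis unfolding maya_sum_def by (subst (asm) infsum_reindex_bij_betw[OF bij_betw_maya_of])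
qed

text \<open>The defining series is the expansion of the averaged product of weights, once the sum
  over exponent lists is exchanged with the sum over partitions. The exchange requires the absolute
  generating functions \<open>T\<close> to grow, jointly, more slowly than the powers of
  \<open>q\<close> decay.\<close>

lemma correlator_eq_maya_sum:
  assumes F: "is_bo_correlator q F" and q: "norm q < 1"
  shows "\<exists>\<epsilon>>0. \<forall>x. length x = m \<and> (\<forall>i<m. 0 < norm (x ! i) \<and> norm (x ! i) < \<epsilon>) \<longrightarrow>
     F x = maya_sum q (\<lambda>S. \<Prod>i<m. weight S (x ! i)) * bo_norm q"
proof -
  from conjunct2[OF spec[OF F[unfolded is_bo_correlator_def], of m]]
  obtain \<epsilon>F where \<epsilon>F': "\<epsilon>F > 0 \<and> (\<forall>x. length x = m \<and> (\<forall>i<m. 0 < norm (x ! i) \<and> norm (x ! i) < \<epsilon>F) \<longrightarrow>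
           ((\<lambda>ks. q_bracket q (\<lambda>\<mu>. \<Prod>i<m. bo_Q (ks ! i) \<mu>) *
                  (\<Prod>i<m. (x ! i) powi (int (ks ! i) - 1))) has_sum F x) {ks. length ks = m})"
    by (elim exE)
  have \<epsilon>F: "\<epsilon>F > 0" "\<And>x. length x = m \<Longrightarrow> (\<forall>i<m. 0 < norm (x ! i) \<and> norm (x ! i) < \<epsilon>F) \<Longrightarrow>
           ((\<lambda>ks. q_bracket q (\<lambda>\<mu>. \<Prod>i<m. bo_Q (ks ! i) \<mu>) *
                  (\<Prod>i<m. (x ! i) powi (int (ks ! i) - 1))) has_sum F x) {ks. length ks = m}"
    using \<epsilon>F' by simp_all
  obtain \<rho> where \<rho>': "\<rho> > 0 \<and> (\<forall>x. norm x < \<rho> \<longrightarrow> summable (\<lambda>k. norm (bo_beta k * x ^ k)) \<and>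
    (x \<noteq> 0 \<longrightarrow> (\<lambda>k. bo_beta k * x ^ k) sums (x * (exp (x / 2) / (exp x - 1)))))"
    using bo_beta_powser by (elim exE)
  have \<rho>: "\<rho> > 0" "\<And>x. norm x < \<rho> \<Longrightarrow> summable (\<lambda>k. norm (bo_beta k * x ^ k))"
    "\<And>x. norm x < \<rho> \<Longrightarrow> x \<noteq> 0 \<Longrightarrow> (\<lambda>k. bo_beta k * x ^ k) sums (x * (exp (x / 2) / (exp x - 1)))"
    using \<rho>' by simp_all
  obtain r where r: "r > 0" "exp r * norm q < 1" using exists_exp_small[OF q] .
  \<comment> \<open>Each of the \<open>m\<close> factors may use the rate \<open>r'\<close>, and
    together they stay within \<open>r\<close>.\<close>
  define r' where "r' = r / real (Suc m)"
  have r': "r' > 0" using r by (simp add: r'_def)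
  define \<epsilon> where "\<epsilon> = Min {\<epsilon>F, \<rho>, r'}"
  have "F x = maya_sum q (\<lambda>S. \<Prod>i<m. weight S (x ! i)) * bo_norm q"
    if len: "length x = m" and x: "\<forall>i<m. 0 < norm (x ! i) \<and> norm (x ! i) < \<epsilon>" for x
  proof -
    let ?L = "{ks :: nat list. length ks = m}"
    define a where "a = (\<lambda>i \<mu> k. bo_Q k \<mu> * (x ! i) powi (int k - 1))"
    define T where "T = (\<lambda>i \<mu>. infsum (\<lambda>k. norm (a i \<mu> k)) UNIV)"
    have xi: "norm (x ! i) < \<epsilon>F" "norm (x ! i) < \<rho>" "x ! i \<noteq> 0" "norm (x ! i) < r'" "0 < norm (x ! i)" if "i < m" for i
      using x that by (auto simp: \<epsilon>_def)
    have gen: "(\<lambda>k. norm (a i \<mu> k)) summable_on UNIV" "infsum (a i \<mu>) UNIV = weight (maya_of \<mu>) (x ! i)"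
      "T i \<mu> \<le> (\<Sum>k. norm (bo_beta k * (x ! i) powi (int k - 1))) + 2 * real (sum_list \<mu>) * exp (norm (x ! i) * real (sum_list \<mu>))"
      if "i < m" "\<mu> \<in> partitions" for i \<mu>
      unfolding a_def T_def
      by (rule bo_Q_generating[OF _ _ xi(2)[OF that(1)] xi(3)[OF that(1)] that(2)]; rule \<rho>; assumption)+
    note asum = gen(1) and aval = gen(2)
    have Tnn: "T i \<mu> \<ge> 0" for i \<mu> unfolding T_def by (rule infsum_nonneg) simp
    have lsum: "((\<lambda>ks. \<Prod>i<m. a i \<mu> (ks ! i)) has_sum (\<Prod>i<m. weight (maya_of \<mu>) (x ! i))) ?L"
      "(\<lambda>ks. norm (\<Prod>i<m. a i \<mu> (ks ! i))) summable_on ?L"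
      "infsum (\<lambda>ks. norm (\<Prod>i<m. a i \<mu> (ks ! i))) ?L = (\<Prod>i<m. T i \<mu>)" if \<mu>: "\<mu> \<in> partitions" for \<mu>
    proof -
      note h = has_sum_lists_prod[of m "\<lambda>i. a i \<mu>", OF asum[OF _ \<mu>]]
      show "((\<lambda>ks. \<Prod>i<m. a i \<mu> (ks ! i)) has_sum (\<Prod>i<m. weight (maya_of \<mu>) (x ! i))) ?L"
        using h(1) aval[OF _ \<mu>] by simp
      show "(\<lambda>ks. norm (\<Prod>i<m. a i \<mu> (ks ! i))) summable_on ?L" using h(2) .
      have "infsum (\<lambda>k. complex_of_real (norm (a i \<mu> k))) UNIV = of_real (T i \<mu>)" if "i < m" for i
        unfolding T_def by (intro infsumI has_sum_of_real has_sum_infsum asum that \<mu>)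
      then have "((\<lambda>ks. \<Prod>i<m. complex_of_real (norm (a i \<mu> (ks ! i)))) has_sum (\<Prod>i<m. of_real (T i \<mu>))) ?L"
        using has_sum_lists_prod(1)[of m "\<lambda>i k. complex_of_real (norm (a i \<mu> k))"] asum[OF _ \<mu>] by simp
      then have "((\<lambda>ks. complex_of_real (norm (\<Prod>i<m. a i \<mu> (ks ! i)))) has_sum of_real (\<Prod>i<m. T i \<mu>)) ?L"
        by (simp add: prod_norm [symmetric])
      then show "infsum (\<lambda>ks. norm (\<Prod>i<m. a i \<mu> (ks ! i))) ?L = (\<Prod>i<m. T i \<mu>)"
        by (intro infsumI) (simp only: has_sum_of_real_iff)
    qed
    \<comment> \<open>The bounds \<open>T\<close> are indexed by partitions, \<open>growth\<close>
      by Maya diagrams; \<open>inv\<close> transports them.\<close>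
    define inv where "inv = the_inv_into partitions maya_of"
    have inv: "inv S \<in> partitions" "maya_of (inv S) = S" if "S \<in> maya" for S
      using that bij_betw_maya_of unfolding inv_def
      by (auto simp: bij_betw_def the_inv_into_into f_the_inv_into_f)
    have inv': "inv (maya_of \<mu>) = \<mu>" if "\<mu> \<in> partitions" for \<mu>
      using that bij_betw_maya_of unfolding inv_def by (auto simp: bij_betw_def the_inv_into_f_f)
    have "growth r' (\<lambda>S. of_real (T i (inv S)))" if i: "i < m" for i
    proof -
      define c where "c = (\<Sum>k. norm (bo_beta k * (x ! i) powi (int k - 1)))"
      have c: "c \<ge> 0" unfolding c_def
        using gen(3)[OF i, of "[]"] Tnn[of i "[]"] by (simp add: partitions_def)
      define d where "d = r' - norm (x ! i)"
      have d: "d > 0" using xi(4)[OF i] by (simp add: d_def)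
      have "norm (of_real (T i (inv S)) :: complex) \<le> (2 * (c + 1 / d)) * exp (r' * real (energy S))" if S: "S \<in> maya" for S
      proof -
        have eE: "sum_list (inv S) = energy S"
          using maya_of_in_maya(2)[of "inv S"] inv[OF S] by (simp add: partitions_def)
        have "norm (of_real (T i (inv S)) :: complex) = T i (inv S)" using Tnn[of i "inv S"] by simp
        also have "\<dots> \<le> c + 2 * real (energy S) * exp (norm (x ! i) * real (energy S))"
          using gen(3)[OF i, of "inv S"] inv[OF S] unfolding c_def eE by simp
        also have "c \<le> 2 * c * exp (norm (x ! i) * real (energy S))"
          using mult_mono[of c "2 * c" 1 "exp (norm (x ! i) * real (energy S))"] c by auto
        also have "2 * c * exp (norm (x ! i) * real (energy S)) + 2 * real (energy S) * exp (norm (x ! i) * real (energy S))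
           = 2 * (c + real (energy S)) * exp (norm (x ! i) * real (energy S))" by (simp add: algebra_simps)
        also have "\<dots> \<le> 2 * ((c + 1 / d) * exp (d * real (energy S))) * exp (norm (x ! i) * real (energy S))"
          using d c by (intro mult_right_mono mult_left_mono linear_le_exp) auto
        also have "\<dots> = (2 * (c + 1 / d)) * exp (r' * real (energy S))"
        proof -
          have "exp (d * real (energy S)) * exp (norm (x ! i) * real (energy S)) = exp (r' * real (energy S))"
            by (simp add: d_def exp_add [symmetric] algebra_simps)
          then show ?thesis by (simp only: mult.assoc)
        qed
        finally show ?thesis by simp
      qed
      then show ?thesis by (auto simp: growth_def)
    qed
    then have "growth (\<Sum>i<m. r') (\<lambda>S. \<Prod>i<m. of_real (T i (inv S)))"
      by (intro growth_prod) auto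
    then have "growth r (\<lambda>S. \<Prod>i<m. of_real (T i (inv S)))"
      by (rule growth_mono) (use r in \<open>simp add: r'_def field_simps\<close>)
    from summable_on_partitions[OF this r(2)]
    have Tsum: "(\<lambda>\<mu>. norm (norm (q ^ sum_list \<mu>) * (\<Prod>i<m. T i \<mu>))) summable_on partitions"
      by (rule summable_on_cong[THEN iffD1, rotated])
         (simp add: inv' norm_mult norm_power prod_norm [symmetric] abs_mult abs_prod mult.commute)
    let ?f = "\<lambda>\<mu> ks. q ^ sum_list \<mu> * (\<Prod>i<m. a i \<mu> (ks ! i))"
    have "(\<lambda>p. norm (case p of (\<mu>,ks) \<Rightarrow> ?f \<mu> ks)) summable_on (partitions \<times> ?L)"
    proof (subst Infinite_Sum.abs_summable_on_Sigma_iff, intro conjI ballI)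
      fix \<mu> assume "\<mu> \<in> partitions"
      then show "(\<lambda>ks. norm (case (\<mu>, ks) of (\<mu>,ks) \<Rightarrow> ?f \<mu> ks)) summable_on ?L"
        unfolding prod.case norm_mult[of "q ^ _"] by (intro summable_on_cmult_right lsum(2))
    next
      show "(\<lambda>\<mu>. norm (\<Sum>\<^sub>\<infinity>ks\<in>?L. norm (case (\<mu>, ks) of (\<mu>,ks) \<Rightarrow> ?f \<mu> ks))) summable_on partitions"
        unfolding prod.case norm_mult[of "q ^ _"] infsum_cmult_right'
        by (rule summable_on_cong[THEN iffD2, OF _ Tsum]) (simp add: lsum(3))
    qed
    then have s: "(\<lambda>(\<mu>,ks). ?f \<mu> ks) summable_on (partitions \<times> ?L)" by (rule abs_summable_summable)
    have "F x = (\<Sum>\<^sub>\<infinity>ks\<in>?L. q_bracket q (\<lambda>\<mu>. \<Prod>i<m. bo_Q (ks ! i) \<mu>) * (\<Prod>i<m. (x ! i) powi (int (ks ! i) - 1)))"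
      using \<epsilon>F(2)[OF len] xi by (intro infsumI[symmetric]) auto
    also have "\<dots> = (\<Sum>\<^sub>\<infinity>ks\<in>?L. (\<Sum>\<^sub>\<infinity>\<mu>\<in>partitions. ?f \<mu> ks) * bo_norm q)"
    proof (rule infsum_cong)
      fix ks
      have "(\<Sum>\<^sub>\<infinity>\<mu>\<in>partitions. ?f \<mu> ks) = (\<Sum>\<^sub>\<infinity>\<mu>\<in>partitions. ((\<Prod>i<m. bo_Q (ks ! i) \<mu>) * q ^ sum_list \<mu>) * (\<Prod>i<m. (x ! i) powi (int (ks ! i) - 1)))"
        unfolding a_def prod.distrib by (simp only: mult_ac)
      also have "\<dots> = (\<Sum>\<^sub>\<infinity>\<mu>\<in>partitions. (\<Prod>i<m. bo_Q (ks ! i) \<mu>) * q ^ sum_list \<mu>) * (\<Prod>i<m. (x ! i) powi (int (ks ! i) - 1))"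
        by (rule infsum_cmult_left')
      finally show "q_bracket q (\<lambda>\<mu>. \<Prod>i<m. bo_Q (ks ! i) \<mu>) * (\<Prod>i<m. (x ! i) powi (int (ks ! i) - 1))
         = (\<Sum>\<^sub>\<infinity>\<mu>\<in>partitions. ?f \<mu> ks) * bo_norm q"
        by (simp add: q_bracket_def bo_norm_def)
    qed
    also have "\<dots> = (\<Sum>\<^sub>\<infinity>ks\<in>?L. \<Sum>\<^sub>\<infinity>\<mu>\<in>partitions. ?f \<mu> ks) * bo_norm q"
      by (rule infsum_cmult_left')
    also have "(\<Sum>\<^sub>\<infinity>ks\<in>?L. \<Sum>\<^sub>\<infinity>\<mu>\<in>partitions. ?f \<mu> ks) = (\<Sum>\<^sub>\<infinity>\<mu>\<in>partitions. \<Sum>\<^sub>\<infinity>ks\<in>?L. ?f \<mu> ks)"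
      by (rule infsum_swap_banach[OF s, symmetric])
    also have "\<dots> = (\<Sum>\<^sub>\<infinity>\<mu>\<in>partitions. (\<Prod>i<m. weight (maya_of \<mu>) (x ! i)) * q ^ sum_list \<mu>)"
    proof (rule infsum_cong)
      fix \<mu> assume "\<mu> \<in> partitions"
      then show "(\<Sum>\<^sub>\<infinity>ks\<in>?L. ?f \<mu> ks) = (\<Prod>i<m. weight (maya_of \<mu>) (x ! i)) * q ^ sum_list \<mu>"
        unfolding infsum_cmult_right' by (simp add: infsumI[OF lsum(1)])
    qed
    also have "\<dots> = maya_sum q (\<lambda>S. \<Prod>i<m. weight S (x ! i))" by (rule infsum_partitions_eq_maya_sum)
    finally show ?thesis .
  qed
  moreover have "\<epsilon> > 0" using \<epsilon>F(1) \<rho>(1) r' by (simp add: \<epsilon>_def)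
  ultimately show ?thesis by blast
qed

section \<open>The theta function and the Kronecker identity\<close>

definition triangular :: "nat \<Rightarrow> nat" where "triangular n = n * (n + 1) div 2"

lemma triangular_Suc: "triangular (Suc n) = triangular n + Suc n"
  unfolding triangular_def by simp

lemma summable_triangular:
  fixes q x :: "'a::{real_normed_field,banach}"
  assumes "norm q < 1"
  shows "summable (\<lambda>n. norm (q ^ triangular n * x ^ n))"
proof -
  have "(\<lambda>n. norm q ^ n * norm x) \<longlonglongrightarrow> 0 * norm x"
    by (intro tendsto_intros LIMSEQ_power_zero) (use assms in auto)
  then have "eventually (\<lambda>n. norm q ^ n * norm x < 1/2) sequentially"
    by (intro order_tendstoD(2)) auto
  then obtain N where N: "\<And>n. n \<ge> N \<Longrightarrow> norm q ^ n * norm x < 1/2"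
    by (auto simp: eventually_sequentially)
  show ?thesis
  proof (rule summable_ratio_test[of "1/2" N])
    fix n assume "n \<ge> N"
    then have le: "norm q ^ Suc n * norm x \<le> 1/2" using N[of "Suc n"] by simp
    have "norm (norm (q ^ triangular (Suc n) * x ^ Suc n)) = (norm q ^ Suc n * norm x) * norm (norm (q ^ triangular n * x ^ n))"
      by (simp add: triangular_Suc norm_mult norm_power power_add mult_ac)
    also have "\<dots> \<le> 1/2 * norm (norm (q ^ triangular n * x ^ n))" by (intro mult_right_mono le) auto
    finally show "norm (norm (q ^ triangular (Suc n) * x ^ Suc n)) \<le> 1/2 * norm (norm (q ^ triangular n * x ^ n))" .
  qed simp
qed

lemma has_sum_int_split:
  fixes f :: "int \<Rightarrow> 'a::{topological_comm_monoid_add,t2_space}"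
  assumes "((\<lambda>n. f (int n)) has_sum a) UNIV" "((\<lambda>n. f (- 1 - int n)) has_sum b) UNIV"
  shows "(f has_sum (a + b)) UNIV"
proof -
  have b: "bij_betw int UNIV {0..}" "bij_betw (\<lambda>n. - 1 - int n) UNIV {..<0}"
    by (rule bij_betwI[where g = nat], auto) (rule bij_betwI[where g = "\<lambda>k. nat (- 1 - k)"], auto)
  have "(f has_sum a) {0..}"
    using assms(1) has_sum_reindex_bij_betw[OF b(1), of f a] by simp
  moreover have "(f has_sum b) {..<0}"
    using assms(2) has_sum_reindex_bij_betw[OF b(2), of f b] by simp
  ultimately have "(f has_sum (a + b)) ({0..} \<union> {..<0})"
    by (intro has_sum_Un_disjoint) auto
  moreover have "{0..} \<union> {..<0} = (UNIV :: int set)" by auto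
  ultimately show ?thesis by simp
qed

lemma summable_on_int_split:
  fixes f :: "int \<Rightarrow> real"
  assumes "summable (\<lambda>n. f (int n))" "summable (\<lambda>n. f (- 1 - int n))" "\<And>k. f k \<ge> 0"
  shows "f summable_on UNIV"
proof -
  have "(\<lambda>n. f (int n)) summable_on UNIV" "(\<lambda>n. f (- 1 - int n)) summable_on UNIV"
    using assms by (auto intro: summable_nonneg_imp_summable_on)
  then show ?thesis
    unfolding summable_on_def[of f] by (intro exI) (rule has_sum_int_split; rule has_sum_infsum)
qed

text \<open>For \<open>\<nu> = k + 1/2\<close> one has
  \<open>\<nu>^2 / 2 = k (k + 1) / 2 + 1/8\<close>. Splitting off \<open>q powr (1/8)\<close> leaves
  integral powers of \<open>q\<close> and no choice of branch.\<close>

definition theta_coeff :: "complex \<Rightarrow> int \<Rightarrow> complex" where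
  "theta_coeff q k = (-1) powi k * q powi (k * (k + 1) div 2)"

lemma theta_coeff_int: "theta_coeff q (int n) = (-1) ^ n * q ^ triangular n"
proof -
  have "int n * (int n + 1) div 2 = int (triangular n)" by (simp add: triangular_def zdiv_int algebra_simps)
  then show ?thesis by (simp add: theta_coeff_def)
qed

text \<open>The reflection is \<open>\<nu>\<close> to \<open>- \<nu>\<close>, so the sign expresses
  that theta is odd.\<close>

lemma theta_coeff_reflect: "theta_coeff q (- 1 - k) = - theta_coeff q k"
proof -
  have "(- 1 - k) * (- 1 - k + 1) = k * (k + 1)" by (simp add: algebra_simps)
  moreover have "(-1 :: complex) powi (- 1 - k) = - ((-1) powi k)"
    using power_int_add[of "-1::complex" "-1" "- k"] by (simp add: power_int_minus_one_minus)
  ultimately show ?thesis unfolding theta_coeff_def by simp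
qed

lemma theta_coeff_pred:
  assumes "q \<noteq> 0" shows "q powi k * theta_coeff q (k - 1) = - theta_coeff q k"
proof -
  have "(k - 1) * (k - 1 + 1) div 2 = k * (k + 1) div 2 - k"
  proof -
    have "k * (k + 1) = (k - 1) * (k - 1 + 1) + 2 * k" by (simp add: algebra_simps)
    then show ?thesis by simp
  qed
  then show ?thesis using assms by (simp add: theta_coeff_def power_int_diff)
qed

lemma norm_theta_coeff_summable:
  assumes "norm q < 1" "x \<noteq> 0"
  shows "(\<lambda>k. norm (theta_coeff q k * x powi k)) summable_on UNIV"
proof (rule summable_on_int_split)
  show "summable (\<lambda>n. norm (theta_coeff q (int n) * x powi int n))"
    using summable_triangular[OF assms(1), of x] by (simp add: theta_coeff_int norm_mult norm_power)
  have "summable (\<lambda>n. norm (q ^ triangular n * (1/x) ^ n) * norm (1/x))"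
    by (intro summable_mult2 summable_triangular assms)
  moreover have "norm (q ^ triangular n * (1/x) ^ n) * norm (1/x) = norm (theta_coeff q (- 1 - int n) * x powi (- 1 - int n))" for n
    unfolding theta_coeff_reflect theta_coeff_int using assms(2)
    by (simp add: norm_mult norm_power power_int_diff norm_divide power_one_over divide_inverse norm_inverse power_inverse power_int_minus mult_ac)
  ultimately show "summable (\<lambda>n. norm (theta_coeff q (- 1 - int n) * x powi (- 1 - int n)))" by simp
qed simp

definition theta_series :: "complex \<Rightarrow> complex \<Rightarrow> complex" where
  "theta_series q x = (\<Sum>\<^sub>\<infinity>k. theta_coeff q k * x powi k)"

lemma theta_series_has_sum:
  assumes "norm q < 1" "x \<noteq> 0"
  shows "((\<lambda>k. theta_coeff q k * x powi k) has_sum theta_series q x) UNIV"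
  unfolding theta_series_def using abs_summable_summable[OF norm_theta_coeff_summable[OF assms]] by simp

lemma bo_theta_eq:
  assumes "q \<noteq> 0"
  shows "bo_theta q z = q powr (1/8) * exp (z / 2) * theta_series q (exp z)"
proof -
  have "(-1) powi k * exp ((of_int k + 1/2) * z) * q powr ((of_int k + 1/2)\<^sup>2 / 2)
     = q powr (1/8) * exp (z / 2) * (theta_coeff q k * exp z powi k)" for k :: int
  proof -
    define m where "m = k * (k + 1) div 2"
    have "even (k * (k + 1))" by simp
    then have "k * (k + 1) = 2 * m" by (simp add: m_def)
    then have "of_int (k * (k + 1)) = (2 * of_int m :: complex)" by simp
    then have "((of_int k + 1/2)\<^sup>2 / 2 :: complex) = of_int m + 1/8"
      by (simp add: power2_eq_square algebra_simps)
    then have 1: "q powr ((of_int k + 1/2)\<^sup>2 / 2) = q powi m * q powr (1/8)"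
      by (simp only: powr_add complex_powr_of_int[OF disjI1[OF assms]])
    have "exp z powi k = exp (of_int k * z)" by (simp add: exp_power_int)
    then have 2: "exp ((of_int k + 1/2) * z) = exp (z / 2) * exp z powi k"
      by (simp add: distrib_right exp_add)
    show ?thesis unfolding 1 2 by (simp add: theta_coeff_def m_def)
  qed
  then show ?thesis unfolding bo_theta_def theta_series_def by (simp add: infsum_cmult_right')
qed

text \<open>The terms with \<open>k >= 0\<close> form an entire function of \<open>x\<close>; by the
  reflection the other half is the same function at \<open>1 / x\<close>. Holomorphy of theta is
  then that of a power series.\<close>

definition theta_part :: "complex \<Rightarrow> complex \<Rightarrow> complex" where
  "theta_part q x = (\<Sum>n. (-1) ^ n * q ^ triangular n * x ^ n)"

lemma theta_part_sums:
  assumes "norm q < 1" shows "(\<lambda>n. (-1) ^ n * q ^ triangular n * x ^ n) sums theta_part q x"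
  unfolding theta_part_def
  by (rule summable_sums[OF summable_norm_cancel]) (use summable_triangular[OF assms, of x] in \<open>simp add: norm_mult norm_power\<close>)

lemma theta_part_holomorphic: "norm q < 1 \<Longrightarrow> theta_part q holomorphic_on A"
proof -
  assume q: "norm q < 1"
  have "theta_part q holomorphic_on ball 0 r" for r
    by (rule power_series_holomorphic) (use theta_part_sums[OF q] in simp)
  then have "theta_part q field_differentiable at z" for z
    using holomorphic_on_imp_differentiable_at[of "theta_part q" "ball 0 (norm z + 1)" z] by simp
  then show ?thesis
    by (meson field_differentiable_at_within holomorphic_on_def)
qed

lemma theta_series_conv_theta_part:
  assumes "norm q < 1" "x \<noteq> 0"
  shows "theta_series q x = theta_part q x - theta_part q (1 / x) / x"
proof -
  have 1: "((\<lambda>n. theta_coeff q (int n) * x powi int n) has_sum theta_part q x) UNIV"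
    by (rule norm_summable_imp_has_sum)
       (use summable_triangular[OF assms(1), of x] theta_part_sums[OF assms(1), of x] in \<open>simp_all add: theta_coeff_int norm_mult norm_power\<close>)
  have e: "theta_coeff q (- 1 - int n) * x powi (- 1 - int n) = - (1 / x) * (theta_coeff q (int n) * (1 / x) ^ n)" for n
    unfolding theta_coeff_reflect using assms(2)
    by (simp add: power_int_diff power_one_over divide_inverse power_inverse power_int_minus mult_ac)
  have "((\<lambda>n. theta_coeff q (int n) * (1 / x) ^ n) has_sum theta_part q (1 / x)) UNIV"
    by (rule norm_summable_imp_has_sum)
       (use summable_triangular[OF assms(1), of "1/x"] theta_part_sums[OF assms(1), of "1/x"] in \<open>simp_all add: theta_coeff_int norm_mult norm_power\<close>)
  then have 2: "((\<lambda>n. theta_coeff q (- 1 - int n) * x powi (- 1 - int n)) has_sum (- (1 / x) * theta_part q (1 / x))) UNIV"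
    unfolding e by (rule has_sum_cmult_right)
  show ?thesis
    using has_sum_unique[OF theta_series_has_sum[OF assms] has_sum_int_split[OF 1 2]] by simp
qed

lemma bo_theta_holomorphic:
  assumes "q \<noteq> 0" "norm q < 1"
  shows "bo_theta q holomorphic_on A"
proof -
  have eq: "bo_theta q = (\<lambda>z. q powr (1/8) * exp (z / 2) * (theta_part q (exp z) - theta_part q (exp (- z)) * exp (- z)))"
  proof (rule ext)
    fix z :: complex
    have "exp (- z) = 1 / exp z" by (simp add: exp_minus inverse_eq_divide)
    then show "bo_theta q z = q powr (1/8) * exp (z / 2) * (theta_part q (exp z) - theta_part q (exp (- z)) * exp (- z))"
      by (simp only: bo_theta_eq[OF assms(1)] theta_series_conv_theta_part[OF assms(2) exp_not_eq_zero] times_divide_eq_right mult_1_right)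
  qed
  show ?thesis unfolding eq
  proof -
    have c: "(\<lambda>z. theta_part q (f z)) holomorphic_on A" if "f holomorphic_on A" for f
      using holomorphic_on_compose_gen[OF that theta_part_holomorphic[OF assms(2), of UNIV]] by (simp add: o_def)
    have "(\<lambda>z. theta_part q (exp z)) holomorphic_on A" "(\<lambda>z. theta_part q (exp (- z))) holomorphic_on A"
      by (rule c, intro holomorphic_intros)+
    then show "(\<lambda>z. q powr (1/8) * exp (z / 2) * (theta_part q (exp z) - theta_part q (exp (- z)) * exp (- z))) holomorphic_on A"
      by (intro holomorphic_intros) auto
  qed
qed

lemma bo_theta_0:
  assumes "q \<noteq> 0" "norm q < 1"
  shows "bo_theta q 0 = 0"
  by (simp add: bo_theta_eq[OF assms(1)] theta_series_conv_theta_part[OF assms(2)])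

text \<open>\<open>kron_coeff\<close> is the solution of \<open>c\<^sub>j + q\<^sup>j c\<^sub>j\<^sub>+\<^sub>1 = 1\<close> for which \<open>c\<^sub>j y\<^sup>j\<close> is summable over all
  integers when \<open>|q| < |y| < 1\<close>.\<close>

definition kron_coeff_part :: "complex \<Rightarrow> nat \<Rightarrow> complex" where
  "kron_coeff_part q j = (\<Sum>a. (-1) ^ a * q ^ (a * (a - 1) div 2 + j * a))"

definition kron_coeff :: "complex \<Rightarrow> int \<Rightarrow> complex" where
  "kron_coeff q j = (if j \<ge> 0 then kron_coeff_part q (nat j) else 1 - kron_coeff_part q (nat (1 - j)))"

lemma kron_coeff_part_exponent: "Suc a * (Suc a - 1) div 2 = triangular a"
  by (simp add: triangular_def mult.commute)

lemma kron_coeff_part_summable: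
  fixes q :: complex
  assumes "norm q < 1"
  shows "summable (\<lambda>a. norm ((-1) ^ a * q ^ (a * (a - 1) div 2 + j * a)))"
proof -
  have "summable (\<lambda>a. norm ((-1) ^ Suc a * q ^ (Suc a * (Suc a - 1) div 2 + j * Suc a)))"
    unfolding kron_coeff_part_exponent
    using summable_mult[OF summable_triangular[OF assms, of "q ^ j"], of "norm (q ^ j)"]
    by (simp add: norm_mult norm_power power_add power_mult [symmetric] mult_ac)
  then show ?thesis by (subst (asm) summable_Suc_iff)
qed

lemma kron_coeff_part_rec:
  assumes "norm q < 1"
  shows "kron_coeff_part q j + q ^ j * kron_coeff_part q (Suc j) = 1"
proof -
  let ?f = "\<lambda>j a. (-1) ^ a * q ^ (a * (a - 1) div 2 + j * a)"
  have s: "summable (?f j)" for j by (rule summable_norm_cancel[OF kron_coeff_part_summable[OF assms]])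
  have e: "?f j (Suc a) = - (q ^ j * ?f (Suc j) a)" for a
  proof -
    have "Suc a * (Suc a - 1) div 2 = a * (a - 1) div 2 + a"
    proof (cases a)
      case (Suc b)
      show ?thesis unfolding Suc kron_coeff_part_exponent triangular_Suc by simp
    qed simp
    then show ?thesis by (simp add: power_add algebra_simps)
  qed
  have "kron_coeff_part q j = ?f j 0 + (\<Sum>a. ?f j (Suc a))"
    unfolding kron_coeff_part_def using suminf_split_head[OF s[of j]] by simp
  also have "(\<Sum>a. ?f j (Suc a)) = - (q ^ j * kron_coeff_part q (Suc j))"
    unfolding e kron_coeff_part_def by (simp only: suminf_minus[OF summable_mult[OF s]] suminf_mult[OF s])
  finally show ?thesis by simp
qed

text \<open>The two branches of \<open>kron_coeff\<close> satisfy the recursion separately. They fit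
  together at \<open>j = -1\<close> because the recursion for \<open>kron_coeff_part\<close> at 0
  gives \<open>kron_coeff_part q 0 = 1 - kron_coeff_part q 1\<close>.\<close>

lemma kron_coeff_rec:
  assumes "norm q < 1" "q \<noteq> 0"
  shows "kron_coeff q j + q powi j * kron_coeff q (j + 1) = 1"
proof (cases "j \<ge> 0")
  case True
  then have "nat (j + 1) = Suc (nat j)" by simp
  then show ?thesis using kron_coeff_part_rec[OF assms(1), of "nat j"] True
    by (simp add: kron_coeff_def power_int_def)
next
  case False
  define i where "i = nat (- j)"
  have j: "j = - int i" "i > 0" using False by (auto simp: i_def)
  have r: "q ^ i * kron_coeff_part q (Suc i) = 1 - kron_coeff_part q i" using kron_coeff_part_rec[OF assms(1), of i] by (simp add: algebra_simps)
  have c1: "kron_coeff q j = 1 - kron_coeff_part q (Suc i)" using j by (simp add: kron_coeff_def nat_add_distrib)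
  have c2: "kron_coeff q (j + 1) = 1 - kron_coeff_part q i"
  proof (cases "i = 1")
    case True
    then show ?thesis using kron_coeff_part_rec[OF assms(1), of 0] j by (simp add: kron_coeff_def algebra_simps)
  next
    case False
    then show ?thesis using j by (simp add: kron_coeff_def)
  qed
  have "q powi j * (1 - kron_coeff_part q i) = kron_coeff_part q (Suc i)"
    unfolding r[symmetric] using assms(2) j by (simp add: power_int_minus)
  then show ?thesis unfolding c1 c2 by simp
qed

lemma norm_kron_coeff_part_le:
  assumes "norm q < 1"
  shows "norm (kron_coeff_part q j) \<le> (\<Sum>a. norm ((-1) ^ a * q ^ (a * (a - 1) div 2 + 0 * a)))"
proof -
  have "norm (kron_coeff_part q j) \<le> (\<Sum>a. norm ((-1) ^ a * q ^ (a * (a - 1) div 2 + j * a)))"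
    unfolding kron_coeff_part_def by (rule summable_norm[OF kron_coeff_part_summable[OF assms]])
  also have "\<dots> \<le> (\<Sum>a. norm ((-1) ^ a * q ^ (a * (a - 1) div 2 + 0 * a)))"
    using assms by (intro suminf_le kron_coeff_part_summable) (auto simp: norm_mult norm_power intro!: power_decreasing)
  finally show ?thesis .
qed

text \<open>For negative \<open>j\<close> the recursion rewrites the value as
  \<open>q ^ (1 - j)\<close> times a bounded term. This decay permits \<open>norm y < 1\<close> down
  to \<open>norm y > norm q\<close>.\<close>

lemma norm_kron_coeff_le:
  assumes "norm q < 1" "q \<noteq> 0"
  shows "\<exists>C\<ge>0. \<forall>j. norm (kron_coeff q j) \<le> C \<and> (j < 0 \<longrightarrow> norm (kron_coeff q j) \<le> C * norm q ^ nat (- j))"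
proof -
  define C where "C = (\<Sum>a. norm ((-1) ^ a * q ^ (a * (a - 1) div 2 + 0 * a)))"
  have C: "norm (kron_coeff_part q j) \<le> C" for j unfolding C_def by (rule norm_kron_coeff_part_le[OF assms(1)])
  have C0: "C \<ge> 0" using C[of 0] norm_ge_zero order_trans by blast
  have neg: "norm (kron_coeff q j) \<le> C * norm q ^ nat (- j)" if "j < 0" for j
  proof -
    define i where "i = nat (- j)"
    have j: "j = - int i" "i > 0" using that by (auto simp: i_def)
    have "kron_coeff q j = 1 - kron_coeff_part q (Suc i)" using j by (simp add: kron_coeff_def nat_add_distrib)
    also have "\<dots> = q ^ Suc i * kron_coeff_part q (Suc (Suc i))" using kron_coeff_part_rec[OF assms(1), of "Suc i"] by (simp add: algebra_simps)
    finally have "norm (kron_coeff q j) = norm q ^ Suc i * norm (kron_coeff_part q (Suc (Suc i)))" by (simp add: norm_mult norm_power)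
    also have "\<dots> \<le> norm q ^ i * C"
      using assms by (intro mult_mono C power_decreasing) auto
    finally show ?thesis by (simp add: i_def mult.commute)
  qed
  have "norm (kron_coeff q j) \<le> C" for j
  proof (cases "j \<ge> 0")
    case False
    then have "norm (kron_coeff q j) \<le> C * norm q ^ nat (- j)" by (intro neg) auto
    also have "\<dots> \<le> C * 1" using assms C0 by (intro mult_left_mono power_le_one) auto
    finally show ?thesis by simp
  qed (use C in \<open>simp add: kron_coeff_def\<close>)
  then show ?thesis using C0 neg by blast
qed

definition kron_series :: "complex \<Rightarrow> complex \<Rightarrow> complex" where
  "kron_series q y = (\<Sum>\<^sub>\<infinity>j. kron_coeff q j * y powi j)"

lemma kron_series_abs_summable:
  assumes "norm q < 1" "q \<noteq> 0" "norm q < norm y" "norm y < 1"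
  shows "(\<lambda>j. norm (kron_coeff q j * y powi j)) summable_on UNIV"
proof -
  obtain C where C: "C \<ge> 0" "\<And>j. norm (kron_coeff q j) \<le> C" "\<And>j. j < 0 \<Longrightarrow> norm (kron_coeff q j) \<le> C * norm q ^ nat (- j)"
    using norm_kron_coeff_le[OF assms(1,2)] by blast
  have y: "y \<noteq> 0" using assms by auto
  show ?thesis
  proof (rule summable_on_int_split)
    show "summable (\<lambda>n. norm (kron_coeff q (int n) * y powi int n))"
    proof (rule summable_comparison_test'[of "\<lambda>n. C * norm y ^ n" 0])
      show "summable (\<lambda>n. C * norm y ^ n)" using assms by (intro summable_mult summable_geometric) auto
      show "norm (norm (kron_coeff q (int n) * y powi int n)) \<le> C * norm y ^ n" for n
        using C(2) by (simp add: norm_mult norm_power mult_right_mono)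
    qed
    show "summable (\<lambda>n. norm (kron_coeff q (- 1 - int n) * y powi (- 1 - int n)))"
    proof (rule summable_comparison_test'[of "\<lambda>n. C * (norm q / norm y) * (norm q / norm y) ^ n" 0])
      show "summable (\<lambda>n. C * (norm q / norm y) * (norm q / norm y) ^ n)"
        using assms y by (intro summable_mult summable_geometric) (simp add: field_simps)
      fix n
      have "norm (kron_coeff q (- 1 - int n)) \<le> C * norm q ^ Suc n"
        using C(3)[of "- 1 - int n"] by (simp add: nat_add_distrib)
      moreover have "norm (y powi (- 1 - int n)) = (1 / norm y) ^ Suc n"
        using y by (simp add: norm_power_int power_int_diff power_int_minus divide_inverse power_inverse norm_mult norm_inverse norm_power)
      ultimately have "norm (kron_coeff q (- 1 - int n) * y powi (- 1 - int n)) \<le> C * norm q ^ Suc n * (1 / norm y) ^ Suc n"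
        unfolding norm_mult by (simp only:) (intro mult_right_mono, auto)
      then show "norm (norm (kron_coeff q (- 1 - int n) * y powi (- 1 - int n))) \<le> C * (norm q / norm y) * (norm q / norm y) ^ n"
        by (simp add: power_divide field_simps)
    qed
  qed simp
qed

text \<open>The series is the Laurent expansion in \<open>x\<close> of
  \<open>theta_series q x / (1 - x q^n)\<close>. Multiplication by \<open>1 - x q^n\<close> pairs
  neighbouring terms; \<open>theta_coeff_pred\<close> aligns their theta coefficients and
  \<open>kron_coeff_rec\<close> collapses the pair to a single one.\<close>

lemma theta_series_div_expansion:
  assumes "norm q < 1" "q \<noteq> 0" "x \<noteq> 0"
  shows "((\<lambda>k. theta_coeff q k * kron_coeff q (n - k) * x powi k) has_sum s) UNIV \<Longrightarrow> (1 - x * q powi n) * s = theta_series q x"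
proof -
  assume s: "((\<lambda>k. theta_coeff q k * kron_coeff q (n - k) * x powi k) has_sum s) UNIV"
  let ?f = "\<lambda>k. theta_coeff q k * kron_coeff q (n - k) * x powi k"
  have "bij_betw (\<lambda>k::int. k - 1) UNIV UNIV" by (rule bij_betwI[where g = "\<lambda>k. k + 1"]) auto
  then have "((\<lambda>k. ?f (k - 1)) has_sum s) UNIV"
    using s has_sum_reindex_bij_betw[of "\<lambda>k. k - 1" UNIV UNIV ?f] by simp
  then have "((\<lambda>k. ?f k + (- (x * q powi n)) * ?f (k - 1)) has_sum (s + (- (x * q powi n)) * s)) UNIV"
    by (intro has_sum_add has_sum_cmult_right s)
  moreover have "?f k + (- (x * q powi n)) * ?f (k - 1) = theta_coeff q k * x powi k" for k
  proof -
    have "q powi n = q powi (n - k) * q powi k" using assms(2) by (simp add: power_int_add [symmetric])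
    moreover have "x powi k = x * x powi (k - 1)" using assms(3) by (simp add: power_int_diff)
    ultimately have "(x * q powi n) * ?f (k - 1) = x powi k * q powi (n - k) * (q powi k * theta_coeff q (k - 1)) * kron_coeff q (n - k + 1)"
      by (simp add: algebra_simps)
    also have "\<dots> = - (theta_coeff q k * x powi k * (q powi (n - k) * kron_coeff q (n - k + 1)))"
      unfolding theta_coeff_pred[OF assms(2)] by (simp add: mult_ac)
    finally have "?f k + (- (x * q powi n)) * ?f (k - 1) = theta_coeff q k * x powi k * (kron_coeff q (n - k) + q powi (n - k) * kron_coeff q (n - k + 1))"
      by (simp add: algebra_simps)
    then show ?thesis unfolding kron_coeff_rec[OF assms(1,2)] by simp
  qed
  ultimately have "((\<lambda>k. theta_coeff q k * x powi k) has_sum (s + (- (x * q powi n)) * s)) UNIV" by simp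
  from has_sum_unique[OF this theta_series_has_sum[OF assms(1,3)]] show ?thesis by (simp add: algebra_simps)
qed

text \<open>Kronecker's identity with a factor still to be determined: multiply the series of
  \<open>theta_series q (x * y)\<close> and \<open>kron_series q y\<close> and collect powers of
  \<open>y\<close>. The coefficient of \<open>y^n\<close> is the expansion in
  \<open>theta_series_div_expansion\<close>, and the factor \<open>kron_series q y\<close> does not
  involve \<open>x\<close>.\<close>

lemma kronecker_has_sum:
  assumes "norm q < 1" "q \<noteq> 0" "x \<noteq> 0" "norm q < norm y" "norm y < 1" "\<And>n. x * q powi n \<noteq> 1"
  shows "((\<lambda>n. theta_series q x * (y powi n / (1 - x * q powi n))) has_sum (theta_series q (x * y) * kron_series q y)) UNIV"
proof -
  have y: "y \<noteq> 0" using assms by auto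
  let ?t = "\<lambda>k. theta_coeff q k * (x * y) powi k"
  let ?c = "\<lambda>j. kron_coeff q j * y powi j"
  note p = has_sum_product_abs[OF norm_theta_coeff_summable[of q "x * y", OF assms(1)] kron_series_abs_summable[OF assms(1,2,4,5)]]
  have "((\<lambda>(k,j). ?t k * ?c j) has_sum (theta_series q (x * y) * kron_series q y)) (UNIV \<times> UNIV)"
    using p(1) assms y by (simp add: theta_series_def kron_series_def)
  moreover have bij: "bij_betw (\<lambda>(n,k). (k, n - k)) (UNIV \<times> UNIV) (UNIV \<times> (UNIV :: int set))"
    by (rule bij_betwI[where g = "\<lambda>(k,j). (j + k, k)"]) auto
  ultimately have S: "((\<lambda>(n,k). ?t k * ?c (n - k)) has_sum (theta_series q (x * y) * kron_series q y)) (UNIV \<times> UNIV)"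
    using has_sum_reindex_bij_betw[OF bij, of "\<lambda>(k,j). ?t k * ?c j"] by (simp add: case_prod_unfold)
  have e: "?t k * ?c (n - k) = y powi n * (theta_coeff q k * kron_coeff q (n - k) * x powi k)" for n k
  proof -
    have "y powi n = y powi k * y powi (n - k)" using y by (simp add: power_int_add [symmetric])
    then show ?thesis by (simp add: power_int_mult_distrib mult_ac)
  qed
  show ?thesis
  proof (rule has_sum_SigmaD[OF S])
    fix n :: int
    have "(\<lambda>(n,k). ?t k * ?c (n - k)) summable_on (UNIV \<times> UNIV)" using S by (auto simp: summable_on_def)
    then have "(\<lambda>k. ?t k * ?c (n - k)) summable_on UNIV"
      by (rule summable_on_SigmaD1) simp
    then have "(\<lambda>k. y powi n * (theta_coeff q k * kron_coeff q (n - k) * x powi k)) summable_on UNIV" unfolding e .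
    then have "(\<lambda>k. (1 / y powi n) * (y powi n * (theta_coeff q k * kron_coeff q (n - k) * x powi k))) summable_on UNIV"
      by (rule summable_on_cmult_right)
    then have "(\<lambda>k. theta_coeff q k * kron_coeff q (n - k) * x powi k) summable_on UNIV"
      using y by simp
    then obtain s where s: "((\<lambda>k. theta_coeff q k * kron_coeff q (n - k) * x powi k) has_sum s) UNIV"
      by (auto simp: summable_on_def)
    have "(1 - x * q powi n) * s = theta_series q x" by (rule theta_series_div_expansion[OF assms(1-3) s])
    then have "s = theta_series q x / (1 - x * q powi n)" using assms(6)[of n] by (simp add: field_simps)
    then have "y powi n * s = theta_series q x * (y powi n / (1 - x * q powi n))"
      by simp
    moreover have "((\<lambda>k. y powi n * (theta_coeff q k * kron_coeff q (n - k) * x powi k)) has_sum (y powi n * s)) UNIV"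
      by (intro has_sum_cmult_right s)
    ultimately show "((\<lambda>k. case (n, k) of (n,k) \<Rightarrow> ?t k * ?c (n - k)) has_sum theta_series q x * (y powi n / (1 - x * q powi n))) UNIV"
      by (simp add: e)
  qed
qed

section \<open>Double Lambert series and the evaluation of the Kronecker sum\<close>

definition double_series :: "complex \<Rightarrow> complex \<Rightarrow> complex \<Rightarrow> complex" where
  "double_series q u v = (\<Sum>\<^sub>\<infinity>(m,n)\<in>{1..}\<times>{1..}. q ^ (m * n) * exp (of_nat m * u) * exp (of_nat n * v))"

definition half_series :: "complex \<Rightarrow> nat \<Rightarrow> complex \<Rightarrow> complex" where
  "half_series q l u = (\<Sum>\<^sub>\<infinity>m\<in>{1..}. polylog l (q ^ m) * exp (of_nat m * u))"

text \<open>For positive \<open>m\<close> and \<open>n\<close> one has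
  \<open>m + n <= 2 * m * n\<close>, so \<open>norm q ^ (m * n)\<close> is at most
  \<open>sqrt (norm q) ^ (m + n)\<close> and a product of two geometric series dominates. This is
  the origin of the square root in \<open>small_arg\<close>.\<close>

lemma double_series_dominated:
  fixes q :: complex
  assumes "norm q < 1" "exp a * sqrt (norm q) < 1" "exp b * sqrt (norm q) < 1"
  shows "(\<lambda>(m,n). norm q ^ (m * n) * exp (real m * a) * exp (real n * b)) summable_on {1..}\<times>{1..}"
proof -
  define s where "s = sqrt (norm q)"
  have s: "0 \<le> s" "s < 1" "s ^ 2 = norm q" using assms(1) by (auto simp: s_def)
  let ?A = "\<lambda>m::nat. (complex_of_real (exp a * s)) ^ m"
  let ?B = "\<lambda>m::nat. (complex_of_real (exp b * s)) ^ m"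
  have g: "(\<lambda>m. norm (complex_of_real c ^ m)) summable_on {1..}" if "0 \<le> c" "c < 1" for c
  proof -
    have "(\<lambda>m. norm (complex_of_real c ^ m)) summable_on UNIV"
      using that by (intro summable_nonneg_imp_summable_on) (auto simp: norm_power)
    then show ?thesis by (rule summable_on_subset_banach) simp
  qed
  have "(\<lambda>p. norm (?A (fst p) * ?B (snd p))) summable_on ({1..} \<times> {1..})"
    using has_sum_product_abs(2)[OF g[of "exp a * s"] g[of "exp b * s"]] assms s(1) by (simp add: s_def)
  then show ?thesis
  proof (rule summable_on_comparison_test)
    fix p :: "nat \<times> nat" assume p: "p \<in> {1..} \<times> {1..}"
    obtain m n where [simp]: "p = (m,n)" by force
    have mn: "1 \<le> m" "1 \<le> n" using p by auto
    have "m * 1 \<le> m * n" using mn by (intro mult_le_mono) auto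
    moreover have "1 * n \<le> m * n" using mn by (intro mult_le_mono) auto
    ultimately have "m + n \<le> 2 * (m * n)" unfolding mult_1 mult_1_right by linarith
    then have "s ^ (2 * (m * n)) \<le> s ^ (m + n)" using s by (intro power_decreasing) auto
    then have "norm q ^ (m * n) \<le> s ^ (m + n)" by (simp add: power_mult s(3))
    then have "norm q ^ (m * n) * exp (real m * a) * exp (real n * b) \<le> s ^ (m + n) * exp (real m * a) * exp (real n * b)"
      by (intro mult_right_mono) auto
    also have "\<dots> = norm (?A m * ?B n)"
      using s(1) by (simp add: norm_mult norm_power power_mult_distrib power_add exp_of_nat_mult)
    finally show "(case p of (m,n) \<Rightarrow> norm q ^ (m * n) * exp (real m * a) * exp (real n * b)) \<le> norm (?A (fst p) * ?B (snd p))"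
      by simp
  qed (auto simp: case_prod_unfold)
qed

lemma norm_exp_nat_le: "norm (exp (of_nat m * u)) \<le> exp (real m * norm (u::complex))"
  by (rule order_trans[OF norm_exp]) (simp add: norm_mult)

lemma double_series_abs_summable:
  fixes q u v :: complex
  assumes "norm q < 1" "exp (norm u) * sqrt (norm q) < 1" "exp (norm v) * sqrt (norm q) < 1"
  shows "(\<lambda>(m,n). norm (q ^ (m * n) * exp (of_nat m * u) * exp (of_nat n * v))) summable_on {1..}\<times>{1..}"
  by (rule summable_on_comparison_test[OF double_series_dominated[OF assms]])
     (auto simp: norm_mult norm_power simp del: norm_exp_eq_Re intro!: mult_mono norm_exp_nat_le)

lemma double_series_has_sum:
  assumes "norm q < 1" "exp (norm u) * sqrt (norm q) < 1" "exp (norm v) * sqrt (norm q) < 1"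
  shows "((\<lambda>(m,n). q ^ (m * n) * exp (of_nat m * u) * exp (of_nat n * v)) has_sum double_series q u v) ({1..}\<times>{1..})"
  unfolding double_series_def
  by (rule has_sum_infsum, rule abs_summable_summable)
     (use double_series_abs_summable[OF assms] in \<open>simp add: case_prod_unfold\<close>)

lemma double_series_commute:
  assumes "norm q < 1" "exp (norm u) * sqrt (norm q) < 1" "exp (norm v) * sqrt (norm q) < 1"
  shows "double_series q u v = double_series q v u"
proof -
  have "((\<lambda>(m,n). q ^ (m * n) * exp (of_nat m * v) * exp (of_nat n * u)) has_sum double_series q u v) ({1..}\<times>{1..})"
    using double_series_has_sum[OF assms] by (subst has_sum_swap) (simp add: case_prod_unfold mult_ac)
  from has_sum_unique[OF this double_series_has_sum[OF assms(1,3,2)]] show ?thesis .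
qed

text \<open>Expanding \<open>exp (n v)\<close> and summing over \<open>n\<close> first turns
  \<open>n^l q^(m n)\<close> into \<open>polylog l (q^m)\<close>.\<close>

lemma double_series_powser:
  assumes "norm q < 1" "exp (norm u) * sqrt (norm q) < 1" "exp (norm v) * sqrt (norm q) < 1"
  shows "(\<lambda>l. half_series q l u / fact l * v ^ l) sums double_series q u v"
proof -
  let ?I = "{1..}\<times>{1..} :: (nat \<times> nat) set"
  let ?g = "\<lambda>p l. q ^ (fst p * snd p) * exp (of_nat (fst p) * u) * ((of_nat (snd p) * v) ^ l /\<^sub>R fact l)"
  have ex: "((\<lambda>l. (of_nat n * v) ^ l /\<^sub>R fact l) has_sum exp (of_nat n * v)) UNIV"
    "((\<lambda>l. norm ((of_nat n * v) ^ l /\<^sub>R fact l)) has_sum exp (real n * norm v)) UNIV" for n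
  proof -
    have n: "(\<lambda>l. norm ((of_nat n * v) ^ l /\<^sub>R fact l)) sums exp (real n * norm v)"
      using exp_converges[of "real n * norm v"] by (simp add: norm_mult norm_power)
    show "((\<lambda>l. (of_nat n * v) ^ l /\<^sub>R fact l) has_sum exp (of_nat n * v)) UNIV"
      by (rule norm_summable_imp_has_sum[OF sums_summable[OF n] exp_converges])
    show "((\<lambda>l. norm ((of_nat n * v) ^ l /\<^sub>R fact l)) has_sum exp (real n * norm v)) UNIV"
      by (rule norm_summable_imp_has_sum[OF _ n]) (use sums_summable[OF n] in simp)
  qed
  have "(\<lambda>x. norm (case x of (p,l) \<Rightarrow> ?g p l)) summable_on (?I \<times> UNIV)"
  proof (subst Infinite_Sum.abs_summable_on_Sigma_iff, intro conjI ballI)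
    fix p
    show "(\<lambda>l. norm (case (p, l) of (p,l) \<Rightarrow> ?g p l)) summable_on UNIV"
      unfolding prod.case norm_mult[of _ "_ /\<^sub>R _"] using ex(2) by (intro summable_on_cmult_right) (auto simp: summable_on_def)
  next
    have "infsum (\<lambda>l. norm (?g p l)) UNIV = norm (q ^ (fst p * snd p) * exp (of_nat (fst p) * u)) * exp (real (snd p) * norm v)" for p
      unfolding norm_mult[of _ "_ /\<^sub>R _"] infsum_cmult_right' infsumI[OF ex(2)] ..
    moreover have "(\<lambda>p. norm (norm (q ^ (fst p * snd p) * exp (of_nat (fst p) * u)) * exp (real (snd p) * norm v))) summable_on ?I"
      by (rule summable_on_comparison_test[OF double_series_dominated[OF assms]])
         (auto simp: norm_mult norm_power abs_mult simp del: norm_exp_eq_Re intro!: mult_right_mono mult_left_mono norm_exp_nat_le)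
    ultimately show "(\<lambda>p. norm (\<Sum>\<^sub>\<infinity>l. norm (case (p, l) of (p,l) \<Rightarrow> ?g p l))) summable_on ?I"
      unfolding prod.case by simp
  qed
  then have s: "(\<lambda>(p,l). ?g p l) summable_on (?I \<times> UNIV)" by (rule abs_summable_summable)
  have "((\<lambda>(p,l). ?g p l) has_sum double_series q u v) (?I \<times> UNIV)"
  proof (rule has_sum_SigmaI[OF _ _ s])
    show "((\<lambda>y. case (p, y) of (p,l) \<Rightarrow> ?g p l) has_sum (q ^ (fst p * snd p) * exp (of_nat (fst p) * u) * exp (of_nat (snd p) * v))) UNIV" for p
      unfolding prod.case by (intro has_sum_cmult_right ex(1))
    show "((\<lambda>p. q ^ (fst p * snd p) * exp (of_nat (fst p) * u) * exp (of_nat (snd p) * v)) has_sum double_series q u v) ?I"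
      using double_series_has_sum[OF assms] by (simp add: case_prod_unfold)
  qed
  then have S: "((\<lambda>(l,p). ?g p l) has_sum double_series q u v) (UNIV \<times> ?I)"
    by (subst has_sum_swap) (simp add: case_prod_unfold)
  have "((\<lambda>l. half_series q l u / fact l * v ^ l) has_sum double_series q u v) UNIV"
  proof (rule has_sum_SigmaD[OF S])
    fix l :: nat
    have "(\<lambda>(l,p). ?g p l) summable_on (UNIV \<times> ?I)" using S by (auto simp: summable_on_def)
    then have sl: "(\<lambda>p. ?g p l) summable_on ?I" by (rule summable_on_SigmaD1) simp
    have Q: "norm (q ^ m) < 1" if "m \<in> {1..}" for m
      using assms(1) that by (simp add: norm_power power_less_one_iff)
    have inner: "((\<lambda>n. of_nat n ^ l * (q ^ m) ^ n) has_sum polylog l (q ^ m)) {1..}" if m: "m \<in> {1..}" for m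
    proof -
      have "bij_betw Suc UNIV {1..}" by (rule bij_betwI[where g = "\<lambda>n. n - 1"]) auto
      then have "((\<lambda>n. of_nat n ^ l * (q ^ m) ^ n) has_sum polylog l (q ^ m)) {1..} \<longleftrightarrow>
         ((\<lambda>n. of_nat (Suc n) ^ l * (q ^ m) ^ Suc n) has_sum polylog l (q ^ m)) UNIV"
        using has_sum_reindex_bij_betw[of Suc UNIV "{1..}" "\<lambda>n. of_nat n ^ l * (q ^ m) ^ n"] by simp
      also have "\<dots>"
        unfolding polylog_def
      proof (rule norm_summable_imp_has_sum)
        show "summable (\<lambda>n. norm (of_nat (Suc n) ^ l * (q ^ m) ^ Suc n))"
          using polylog_summable[of "norm (q ^ m)" l] Q[OF m]
          by (simp add: norm_mult norm_power del: of_nat_Suc power_Suc)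
        show "(\<lambda>n. of_nat (Suc n) ^ l * (q ^ m) ^ Suc n) sums (\<Sum>n. of_nat (Suc n) ^ l * (q ^ m) ^ Suc n)"
          by (rule summable_sums[OF polylog_summable[OF Q[OF m]]])
      qed
      finally show ?thesis .
    qed
    have i2: "((\<lambda>n. ?g (m,n) l) has_sum (polylog l (q ^ m) * exp (of_nat m * u) * (v ^ l / fact l))) {1..}" if m: "m \<in> {1..}" for m
      using has_sum_cmult_left[OF inner[OF m], of "exp (of_nat m * u) * (v ^ l / fact l)"]
      by (simp add: power_mult [symmetric] power_mult_distrib scaleR_conv_of_real divide_inverse mult_ac)
    have "((\<lambda>m. polylog l (q ^ m) * exp (of_nat m * u) * (v ^ l / fact l)) has_sum infsum (\<lambda>p. ?g p l) ?I) {1..}"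
      by (rule has_sum_SigmaD[OF has_sum_infsum[OF sl] i2])
    moreover have "((\<lambda>m. polylog l (q ^ m) * exp (of_nat m * u) * (v ^ l / fact l)) has_sum (half_series q l u * (v ^ l / fact l))) {1..}"
    proof (rule has_sum_cmult_left)
      have "norm q \<le> sqrt (norm q)"
      proof -
        have "norm q * norm q \<le> 1 * norm q" using assms(1) by (intro mult_right_mono) auto
        then show ?thesis by (intro real_le_rsqrt) (simp add: power2_eq_square)
      qed
      then have "exp (norm u) * norm q < 1" using assms(2) by (smt (verit) exp_gt_zero mult_left_mono)
      then have "(\<lambda>m. polylog l (q ^ m) * exp (of_nat m * u)) summable_on {1..}"
        by (rule abs_summable_summable[OF polylog_exp_abs_summable[OF assms(1)]])
      then show "((\<lambda>m. polylog l (q ^ m) * exp (of_nat m * u)) has_sum half_series q l u) {1..}"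
        unfolding half_series_def by (rule has_sum_infsum)
    qed
    ultimately have "infsum (\<lambda>p. ?g p l) ?I = half_series q l u * (v ^ l / fact l)" by (rule has_sum_unique)
    then show "((\<lambda>p. case (l, p) of (l,p) \<Rightarrow> ?g p l) has_sum (half_series q l u / fact l * v ^ l)) ?I"
      using has_sum_infsum[OF sl] by (simp add: mult_ac)
  qed
  then show ?thesis by (rule has_sum_imp_sums)
qed

lemma Z_series_eq_half_series:
  assumes "norm q < 1" "exp (norm u) * norm q < 1"
  shows "Z_series q l u = half_series q l u - (-1) ^ l * half_series q l (- u)"
proof -
  have h: "((\<lambda>m. polylog l (q ^ m) * exp (of_nat m * x)) has_sum half_series q l x) {1..}" if "x \<in> {u, -u}" for x
    unfolding half_series_def
    by (rule has_sum_infsum[OF abs_summable_summable[OF polylog_exp_abs_summable[OF assms(1)]]]) (use that assms(2) in auto)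
  have "((\<lambda>m. polylog l (q ^ m) * exp (of_nat m * u) + (- ((-1) ^ l)) * (polylog l (q ^ m) * exp (of_nat m * (- u)))) has_sum
      (half_series q l u + (- ((-1) ^ l)) * half_series q l (- u))) {1..}"
    by (intro has_sum_add has_sum_cmult_right h) auto
  then have "((\<lambda>m. polylog l (q ^ m) * (exp (of_nat m * u) - (-1) ^ l * exp (- of_nat m * u))) has_sum
      (half_series q l u + (- ((-1) ^ l)) * half_series q l (- u))) {1..}"
    by (simp add: algebra_simps)
  from infsumI[OF this] show ?thesis by (simp add: Z_series_def)
qed

definition odd_double_series :: "complex \<Rightarrow> complex \<Rightarrow> complex \<Rightarrow> complex" where
  "odd_double_series q u v = double_series q u v - double_series q (- u) (- v)"

lemma odd_double_series_powser:
  assumes "norm q < 1" "exp (norm u) * sqrt (norm q) < 1" "exp (norm u) * norm q < 1" "exp (norm v) * sqrt (norm q) < 1"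
  shows "(\<lambda>l. Z_series q l u / fact l * v ^ l) sums odd_double_series q u v"
proof -
  have "(\<lambda>l. half_series q l u / fact l * v ^ l - half_series q l (- u) / fact l * (- v) ^ l) sums odd_double_series q u v"
    unfolding odd_double_series_def by (intro sums_diff double_series_powser) (use assms in auto)
  moreover have "half_series q l u / fact l * v ^ l - half_series q l (- u) / fact l * (- v) ^ l = Z_series q l u / fact l * v ^ l" for l
    unfolding Z_series_eq_half_series[OF assms(1,3)] by (subst power_minus[of v]) (simp add: field_simps)
  ultimately show ?thesis by simp
qed

text \<open>This is the convergence condition of \<open>double_series\<close> in each argument. It
  also places \<open>exp u\<close> in the annulus between \<open>norm q\<close> and
  \<open>1 / norm q\<close>, which Kronecker's identity requires.\<close>

definition small_arg :: "complex \<Rightarrow> complex \<Rightarrow> bool" where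
  "small_arg q u \<longleftrightarrow> exp (norm u) * sqrt (norm q) < 1"

lemma small_arg_minus [simp]: "small_arg q (- u) = small_arg q u"
  by (simp add: small_arg_def)

lemma small_arg_norm:
  assumes "norm q < 1" "small_arg q u"
  shows "exp (norm u) * norm q < 1" "norm (exp u) * norm q < 1" "norm q < norm (exp u)"
proof -
  have "norm q * norm q \<le> 1 * norm q" using assms(1) by (intro mult_right_mono) auto
  then have "norm q \<le> sqrt (norm q)" by (intro real_le_rsqrt) (simp add: power2_eq_square)
  then have "exp (norm u) * norm q \<le> exp (norm u) * sqrt (norm q)" by (intro mult_left_mono) auto
  then show 1: "exp (norm u) * norm q < 1" using assms(2) unfolding small_arg_def by linarith
  have "norm (exp u) * norm q \<le> exp (norm u) * norm q" by (intro mult_right_mono norm_exp) auto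
  then show "norm (exp u) * norm q < 1" using 1 by simp
  have "norm (exp (- u)) * norm q \<le> exp (norm u) * norm q"
    using norm_exp[of "- u"] by (intro mult_right_mono) (simp_all del: norm_exp_eq_Re)
  then have "norm (exp (- u)) * norm q < 1" using 1 by simp
  then have "norm (exp u) * (norm (exp (- u)) * norm q) < norm (exp u) * 1" by (intro mult_strict_left_mono) auto
  moreover have "norm (exp u) * (norm (exp (- u)) * norm q) = norm q"
    unfolding mult.assoc [symmetric] norm_mult [symmetric] exp_add [symmetric] by simp
  ultimately show "norm q < norm (exp u)" unfolding mult_1_right by linarith
qed

lemma eventually_small_arg:
  assumes "norm q < 1" shows "eventually (small_arg q) (nhds 0)"
proof -
  have "isCont (\<lambda>u::complex. exp (norm u) * sqrt (norm q)) 0" by (intro continuous_intros)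
  then have "eventually (\<lambda>u::complex. exp (norm u) * sqrt (norm q) < 1) (at 0)"
    unfolding isCont_def by (rule order_tendstoD(2)) (use assms in simp)
  then show ?thesis unfolding small_arg_def using assms by (simp add: eventually_nhds_conv_at)
qed

lemma eventually_exp_neq_1: "eventually (\<lambda>u::complex. exp u \<noteq> 1) (at 0)"
proof -
  have "eventually (\<lambda>w. exp w - 1 \<noteq> 0 \<and> w \<in> UNIV) (at (0::complex))"
    by (rule non_zero_neighbour_alt[of _ _ _ "1"]) (auto intro!: holomorphic_intros simp: exp_eq_1)
  then show ?thesis by simp
qed

lemma kronecker_geometric:
  assumes "norm q < 1" "small_arg q u" "small_arg q v"
  shows "((\<lambda>n. exp v ^ n * (exp u * q ^ n / (1 - exp u * q ^ n))) has_sum double_series q u v) {1..}"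
proof -
  have "((\<lambda>n. exp v ^ n * (exp u * q ^ n / (1 - exp u * q ^ n))) has_sum double_series q v u) {1..}"
  proof (rule has_sum_SigmaD[OF double_series_has_sum[OF assms(1), of v u]])
    fix n :: nat assume n: "n \<in> {1..}"
    have "norm (exp u * q ^ n) \<le> norm (exp u) * norm q ^ 1"
      unfolding norm_mult norm_power using n assms(1) by (intro mult_left_mono power_decreasing) auto
    also have "\<dots> < 1" using small_arg_norm(2)[OF assms(1,2)] by simp
    finally have "((\<lambda>m. (exp u * q ^ n) ^ m) has_sum (exp u * q ^ n / (1 - exp u * q ^ n))) {1..}"
      by (rule has_sum_geometric_from_1)
    then have "((\<lambda>m. exp v ^ n * (exp u * q ^ n) ^ m) has_sum (exp v ^ n * (exp u * q ^ n / (1 - exp u * q ^ n)))) {1..}"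
      by (rule has_sum_cmult_right)
    moreover have "exp v ^ n * (exp u * q ^ n) ^ m = q ^ (n * m) * exp (of_nat n * v) * exp (of_nat m * u)" for m
      by (simp add: power_mult_distrib power_mult exp_of_nat_mult)
    ultimately show "((\<lambda>m. case (n, m) of (m,n) \<Rightarrow> q ^ (m * n) * exp (of_nat m * v) * exp (of_nat n * u)) has_sum
        (exp v ^ n * (exp u * q ^ n / (1 - exp u * q ^ n)))) {1..}" by simp
  qed (use assms in \<open>auto simp: small_arg_def\<close>)
  then show ?thesis using double_series_commute[OF assms(1), of u v] assms by (simp add: small_arg_def)
qed

text \<open>In the annulus \<open>|q| < |exp u| < 1/|q|\<close> a nonzero power of \<open>q\<close>
  cannot be the inverse of \<open>exp u\<close>, and power 0 is excluded by hypothesis.\<close>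

lemma exp_times_q_powi_neq_1:
  assumes "norm q < 1" "q \<noteq> 0" "small_arg q u" "exp u \<noteq> 1"
  shows "exp u * q powi n \<noteq> 1"
proof (cases n "0::int" rule: linorder_cases)
  case less
  define p where "p = nat (- n)"
  have n: "n = - int p" "p \<ge> 1" using less by (auto simp: p_def)
  have "norm q ^ p \<le> norm q ^ 1" using n assms(1) by (intro power_decreasing) auto
  then have "norm q ^ p < norm (exp u)" using small_arg_norm(3)[OF assms(1,3)] by simp
  then have "q ^ p \<noteq> exp u" by (metis norm_power less_irrefl)
  then show ?thesis unfolding n(1) using assms(2) by (simp add: power_int_minus field_simps)
next
  case greater
  define p where "p = nat n"
  have n: "n = int p" "p \<ge> 1" using greater by (auto simp: p_def)
  have "norm (exp u * q ^ p) \<le> norm (exp u) * norm q ^ 1"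
    unfolding norm_mult norm_power using n assms(1) by (intro mult_left_mono power_decreasing) auto
  also have "\<dots> < 1" using small_arg_norm(2)[OF assms(1,3)] by simp
  finally show ?thesis unfolding n(1) by auto
qed (use assms in simp)

text \<open>For small arguments this will be
  \<open>theta(u + v) theta'(0) / (theta(u) theta(v))\<close>, with its two poles split off.\<close>

definition kron :: "complex \<Rightarrow> complex \<Rightarrow> complex \<Rightarrow> complex" where
  "kron q u v = hcoth u + hcoth v - odd_double_series q u v"

text \<open>For \<open>n > 0\<close>, removing the geometric part \<open>y^n\<close> leaves
  \<open>double_series q u v\<close>; negative \<open>n\<close>, rewritten with inverse
  exponentials, give the series at \<open>(-u, -v)\<close>. The remaining \<open>1 / (1 - x)\<close>
  and \<open>y / (1 - y)\<close> add up to \<open>- (hcoth u + hcoth v)\<close>.\<close>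

lemma kronecker_eval:
  assumes "norm q < 1" "q \<noteq> 0" "small_arg q u" "small_arg q v" "exp u \<noteq> 1" "Re v < 0"
  shows "((\<lambda>n. exp v powi n / (1 - exp u * q powi n)) has_sum (- kron q u v)) UNIV"
proof -
  let ?x = "exp u" and ?y = "exp v"
  have y: "norm ?y < 1" using assms(6) by simp
  then have y1: "?y \<noteq> 1" by (metis norm_one less_irrefl)
  have "((\<lambda>n. ?y ^ n) has_sum (?y / (1 - ?y))) {1..}" by (rule has_sum_geometric_from_1[OF y])
  from has_sum_add[OF this kronecker_geometric[OF assms(1,3,4)]]
  have "((\<lambda>n. ?y ^ n / (1 - ?x * q ^ n)) has_sum (?y / (1 - ?y) + double_series q u v)) {1..}"
  proof (rule has_sum_cong[THEN iffD1, rotated])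
    fix n :: nat
    show "?y ^ n + ?y ^ n * (?x * q ^ n / (1 - ?x * q ^ n)) = ?y ^ n / (1 - ?x * q ^ n)"
      using exp_times_q_powi_neq_1[OF assms(1,2,3,5), of "int n"] by (simp add: field_simps)
  qed
  then have "((\<lambda>n. ?y ^ n / (1 - ?x * q ^ n)) has_sum (?y ^ 0 / (1 - ?x * q ^ 0) + (?y / (1 - ?y) + double_series q u v))) (insert 0 {1..})"
    by (rule has_sum_insert[rotated]) auto
  moreover have "insert 0 {1..} = (UNIV :: nat set)" by auto
  ultimately have pos: "((\<lambda>n. ?y powi (int n) / (1 - ?x * q powi (int n))) has_sum (1 / (1 - ?x) + (?y / (1 - ?y) + double_series q u v))) UNIV"
    by simp
  have "((\<lambda>n. exp (- v) ^ n * (exp (- u) * q ^ n / (1 - exp (- u) * q ^ n))) has_sum double_series q (- u) (- v)) {1..}"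
    using assms by (intro kronecker_geometric) auto
  moreover have "bij_betw Suc UNIV {1..}" by (rule bij_betwI[where g = "\<lambda>n. n - 1"]) auto
  ultimately have "((\<lambda>n. exp (- v) ^ Suc n * (exp (- u) * q ^ Suc n / (1 - exp (- u) * q ^ Suc n))) has_sum double_series q (- u) (- v)) UNIV"
    using has_sum_reindex_bij_betw[of Suc UNIV "{1..}" "\<lambda>n. exp (- v) ^ n * (exp (- u) * q ^ n / (1 - exp (- u) * q ^ n))" "double_series q (- u) (- v)"]
    by (simp only:)
  then have "((\<lambda>n. - (exp (- v) ^ Suc n * (exp (- u) * q ^ Suc n / (1 - exp (- u) * q ^ Suc n)))) has_sum - double_series q (- u) (- v)) UNIV"
    by (rule has_sum_uminusI)
  moreover have "- (exp (- v) ^ Suc n * (exp (- u) * q ^ Suc n / (1 - exp (- u) * q ^ Suc n)))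
      = ?y powi (- 1 - int n) / (1 - ?x * q powi (- 1 - int n))" for n
  proof -
    have e: "- 1 - int n = - int (Suc n)" by simp
    define Q where "Q = q ^ Suc n"
    have "?x * inverse Q \<noteq> 1"
      using exp_times_q_powi_neq_1[OF assms(1,2,3,5), of "- int (Suc n)"]
      unfolding power_int_minus power_int_of_nat Q_def .
    moreover have Q0: "Q \<noteq> 0" using assms(2) by (simp add: Q_def)
    ultimately have Q: "Q \<noteq> 0" "Q \<noteq> ?x" by auto
    show ?thesis
      unfolding e power_int_minus power_int_of_nat Q_def [symmetric] exp_minus power_inverse
      using Q by (simp add: field_simps)
  qed
  ultimately have neg: "((\<lambda>n. ?y powi (- 1 - int n) / (1 - ?x * q powi (- 1 - int n))) has_sum - double_series q (- u) (- v)) UNIV"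
    by simp
  have "1 / (1 - ?x) + (?y / (1 - ?y) + double_series q u v) + - double_series q (- u) (- v) = - kron q u v"
    using y1 assms(5) unfolding kron_def odd_double_series_def hcoth_def
    by (simp add: divide_simps) (simp add: algebra_simps)
  then show ?thesis using has_sum_int_split[OF pos neg] by simp
qed

text \<open>Comparing the two evaluations of one sum leaves only \<open>kron_series\<close>
  inexplicit. It depends on \<open>v\<close> alone, so a limit in \<open>u\<close> can determine
  it.\<close>

lemma theta_kron:
  assumes "norm q < 1" "q \<noteq> 0" "small_arg q u" "small_arg q v" "exp u \<noteq> 1" "Re v < 0"
  shows "bo_theta q u * kron q u v = - exp (- v / 2) * kron_series q (exp v) * bo_theta q (u + v)"
proof -
  have "((\<lambda>n. theta_series q (exp u) * (exp v powi n / (1 - exp u * q powi n))) has_sum (theta_series q (exp u * exp v) * kron_series q (exp v))) UNIV"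
    using assms small_arg_norm(3)[OF assms(1,4)] exp_times_q_powi_neq_1[OF assms(1,2,3,5)]
    by (intro kronecker_has_sum) auto
  moreover have "((\<lambda>n. theta_series q (exp u) * (exp v powi n / (1 - exp u * q powi n))) has_sum (theta_series q (exp u) * (- kron q u v))) UNIV"
    by (intro has_sum_cmult_right kronecker_eval assms)
  ultimately have "theta_series q (exp u) * (- kron q u v) = theta_series q (exp u * exp v) * kron_series q (exp v)"
    by (rule has_sum_unique[symmetric])
  then have e: "theta_series q (exp u) * kron q u v = - (theta_series q (exp u * exp v) * kron_series q (exp v))" by (metis mult_minus_right minus_minus)
  have "bo_theta q u * kron q u v = q powr (1/8) * exp (u / 2) * (theta_series q (exp u) * kron q u v)"
    by (simp add: bo_theta_eq[OF assms(2)])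
  also have "\<dots> = - exp (- v / 2) * kron_series q (exp v) * (q powr (1/8) * exp ((u + v) / 2) * theta_series q (exp (u + v)))"
  proof -
    have "exp (u / 2) = exp (- v / 2) * exp ((u + v) / 2)" by (simp add: exp_add [symmetric] add_divide_distrib)
    then show ?thesis unfolding e exp_add by (simp add: mult_ac)
  qed
  finally show ?thesis by (simp only: bo_theta_eq[OF assms(2)])
qed

section \<open>The Laurent expansion that defines the functions Z_l\<close>

definition hcoth_fps :: "complex fps" where
  "hcoth_fps = (fps_X * (fps_exp 1 + 1)) / (fps_const 2 * (fps_exp 1 - 1))"

text \<open>The vanishing coefficient says that \<open>hcoth\<close> has no constant term at 0. It
  is needed for \<open>Z_0\<close>, whose additive constant no alternating sum would remove.\<close>

lemma hcoth_fps_expansion: "(\<lambda>x. if x = 0 then 1 else x * hcoth x) has_fps_expansion hcoth_fps"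
  and hcoth_fps_1: "fps_nth hcoth_fps 1 = 0"
proof -
  define F :: "complex fps" where "F = fps_X * (fps_exp 1 + 1)"
  define G :: "complex fps" where "G = fps_const 2 * (fps_exp 1 - 1)"
  have G0: "fps_nth G 0 = 0" and G1: "fps_nth G 1 = 2" and G2: "fps_nth G 2 = 1"
    by (simp_all add: G_def)
  have F1: "fps_nth F 1 = 2" and F2: "fps_nth F 2 = 1" by (simp_all add: F_def)
  have Gn: "G \<noteq> 0" using G1 by (metis fps_zero_nth zero_neq_numeral)
  have sub: "subdegree G = 1" by (rule subdegreeI) (use G0 G1 in auto)
  have F0: "fps_nth F 0 = 0" by (simp add: F_def)
  have Fn: "F \<noteq> 0" using F1 by (metis fps_zero_nth zero_neq_numeral)
  have subF: "subdegree F = 1" by (rule subdegreeI) (use F0 F1 in auto)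
  have "(\<lambda>x. x * (exp (1 * x) + 1)) has_fps_expansion F" unfolding F_def by (intro fps_expansion_intros)
  moreover have "(\<lambda>x. 2 * (exp (1 * x) - 1)) has_fps_expansion G"
    unfolding G_def by (intro fps_expansion_intros)
  ultimately have "(\<lambda>x. if x = 0 then 1 else (x * (exp (1 * x) + 1)) / (2 * (exp (1 * x) - 1))) has_fps_expansion (F / G)"
    by (rule has_fps_expansion_divide) (use sub subF Gn G1 F1 in auto)
  then show "(\<lambda>x. if x = 0 then 1 else x * hcoth x) has_fps_expansion hcoth_fps"
  proof -
    assume "(\<lambda>x. if x = 0 then 1 else (x * (exp (1 * x) + 1)) / (2 * (exp (1 * x) - 1))) has_fps_expansion (F / G)"
    moreover have "(\<lambda>x. if x = 0 then 1 else (x * (exp (1 * x) + 1)) / (2 * (exp (1 * x) - 1)))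
       = (\<lambda>x. if x = 0 then 1 else x * hcoth x)"
      by (auto simp: hcoth_def fun_eq_iff)
    ultimately show ?thesis by (simp only: hcoth_fps_def F_def G_def)
  qed
  have "G dvd F" using sub subF Gn Fn by (simp add: fps_dvd_iff)
  then have FG: "hcoth_fps * G = F" unfolding hcoth_fps_def F_def [symmetric] G_def [symmetric] by simp
  have "fps_nth (hcoth_fps * G) 1 = fps_nth hcoth_fps 0 * 2"
    using G0 G1 by (simp add: fps_mult_nth)
  then have h0: "fps_nth hcoth_fps 0 = 1" using F1 FG by simp
  have "{0..2::nat} = {0,1,2}" by auto
  then have "fps_nth (hcoth_fps * G) 2 = fps_nth hcoth_fps 0 * 1 + fps_nth hcoth_fps 1 * 2"
    using G0 G1 G2 by (simp add: fps_mult_nth numeral_2_eq_2)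
  then show "fps_nth hcoth_fps 1 = 0" using F2 FG h0 by simp
qed

lemma hcoth_times_tendsto: "((\<lambda>u. u * hcoth u) \<longlongrightarrow> 1) (at 0)"
proof -
  have "((\<lambda>x. if x = 0 then 1 else x * hcoth x) \<longlongrightarrow> (if (0::complex) = 0 then 1 else 0 * hcoth 0)) (at 0)"
    using has_fps_expansion_imp_continuous[OF hcoth_fps_expansion, of UNIV] by (simp add: continuous_at)
  then have "((\<lambda>x. if x = 0 then 1 else x * hcoth x) \<longlongrightarrow> 1) (at 0)" by simp
  then show ?thesis
    by (rule Lim_transform_eventually) (auto simp: eventually_at_filter)
qed

lemma odd_double_series_expansion:
  assumes "norm q < 1" "small_arg q u"
  shows "(\<lambda>v. odd_double_series q u v) has_fps_expansion Abs_fps (\<lambda>l. Z_series q l u / fact l)"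
proof (rule has_fps_expansionI)
  show "eventually (\<lambda>v. (\<lambda>n. fps_nth (Abs_fps (\<lambda>l. Z_series q l u / fact l)) n * v ^ n) sums odd_double_series q u v) (nhds 0)"
    using eventually_small_arg[OF assms(1)]
  proof eventually_elim
    case (elim v)
    then show ?case using odd_double_series_powser[OF assms(1), of u v] small_arg_norm(1)[OF assms] assms(2) by (simp add: small_arg_def)
  qed
qed

lemma odd_double_series_commute:
  assumes "norm q < 1" "small_arg q u" "small_arg q v"
  shows "odd_double_series q u v = odd_double_series q v u"
  using assms double_series_commute[of q u v] double_series_commute[of q "- u" "- v"] by (simp add: odd_double_series_def small_arg_def)


text \<open>As \<open>u\<close> tends to 0 in \<open>theta_kron\<close>, the zero of theta cancels
  the pole of \<open>hcoth u\<close>, which has residue 1, and the other terms vanish. The limit is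
  the missing evaluation of \<open>kron_series\<close>.\<close>

lemma theta_kron_deriv:
  assumes "norm q < 1" "q \<noteq> 0" "small_arg q v" "Re v < 0"
  shows "deriv (bo_theta q) 0 = - exp (- v / 2) * kron_series q (exp v) * bo_theta q v"
proof -
  have hol: "bo_theta q holomorphic_on UNIV" by (rule bo_theta_holomorphic[OF assms(2,1)])
  have t0: "bo_theta q 0 = 0" by (rule bo_theta_0[OF assms(2,1)])
  have cont: "isCont (bo_theta q) z" for z
    using holomorphic_on_imp_continuous_on[OF hol] by (simp add: continuous_on_eq_continuous_at)
  have d: "((\<lambda>u. bo_theta q u / u) \<longlongrightarrow> deriv (bo_theta q) 0) (at 0)"
    using holomorphic_derivI[OF hol open_UNIV, of 0 UNIV] by (simp add: DERIV_def t0)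
  have ev: "eventually (\<lambda>u. small_arg q u \<and> exp u \<noteq> 1 \<and> u \<noteq> 0) (at 0)"
    using eventually_small_arg[OF assms(1)] eventually_exp_neq_1
    by (auto simp: eventually_at_filter elim: eventually_elim2)
  have "((\<lambda>u. odd_double_series q v u) \<longlongrightarrow> odd_double_series q v 0) (at 0)"
    using has_fps_expansion_imp_continuous[OF odd_double_series_expansion[OF assms(1,3)], of UNIV] by (simp add: continuous_at)
  then have D: "((\<lambda>u. odd_double_series q u v) \<longlongrightarrow> odd_double_series q v 0) (at 0)"
    by (rule Lim_transform_eventually) (use ev in eventually_elim, simp add: odd_double_series_commute[OF assms(1,3)])
  have "((\<lambda>u. (bo_theta q u / u) * (u * hcoth u) + bo_theta q u * (hcoth v - odd_double_series q u v)) \<longlongrightarrow>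
      deriv (bo_theta q) 0 * 1 + bo_theta q 0 * (hcoth v - odd_double_series q v 0)) (at 0)"
    using cont[of 0] by (intro tendsto_intros d hcoth_times_tendsto D) (simp add: isCont_def)
  then have "((\<lambda>u. bo_theta q u * kron q u v) \<longlongrightarrow> deriv (bo_theta q) 0) (at 0)"
    unfolding t0 mult_zero_left add_0_right mult_1_right
    by (rule Lim_transform_eventually)
       (use ev in eventually_elim, simp add: kron_def algebra_simps)
  then have "((\<lambda>u. - exp (- v / 2) * kron_series q (exp v) * bo_theta q (u + v)) \<longlongrightarrow> deriv (bo_theta q) 0) (at 0)"
    by (rule Lim_transform_eventually)
       (use ev in eventually_elim, use theta_kron[OF assms(1,2) _ assms(3) _ assms(4)] in auto)
  moreover have "((\<lambda>u. - exp (- v / 2) * kron_series q (exp v) * bo_theta q (u + v)) \<longlongrightarrow> - exp (- v / 2) * kron_series q (exp v) * bo_theta q (0 + v)) (at 0)"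
    by (intro tendsto_intros isCont_tendsto_compose[OF cont])
  ultimately show ?thesis using tendsto_unique[of "at (0::complex)"] by fastforce
qed

lemma theta_quotient_eq_kron:
  assumes "norm q < 1" "q \<noteq> 0" "small_arg q u" "small_arg q v" "exp u \<noteq> 1" "Re v < 0"
    "bo_theta q u \<noteq> 0" "bo_theta q v \<noteq> 0"
  shows "bo_theta q (u + v) * deriv (bo_theta q) 0 / (bo_theta q u * bo_theta q v) = kron q u v"
proof -
  have "bo_theta q u * kron q u v * bo_theta q v = deriv (bo_theta q) 0 * bo_theta q (u + v)"
    unfolding theta_kron[OF assms(1-6)] theta_kron_deriv[OF assms(1,2,4,6)] by (simp add: mult_ac)
  then show ?thesis using assms(7,8) by (simp add: field_simps)
qed

lemma bo_theta_eventually_nonzero: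
  assumes "norm q < 1" "q \<noteq> 0" "bo_theta q u \<noteq> 0"
  shows "eventually (\<lambda>w. bo_theta q w \<noteq> 0) (at z)"
  using non_zero_neighbour_alt[OF bo_theta_holomorphic[OF assms(2,1)] open_UNIV connected_UNIV _ _ assms(3)] by simp

lemma kron_laurent:
  assumes "norm q < 1" "small_arg q u"
  shows "kron q u has_laurent_expansion
    fls_shift 1 (fps_to_fls hcoth_fps) + fls_const (hcoth u) - fps_to_fls (Abs_fps (\<lambda>l. Z_series q l u / fact l))"
proof -
  have "(\<lambda>x. (if x = 0 then 1 else x * hcoth x) * inverse x) has_laurent_expansion (fps_to_fls hcoth_fps * fls_X_inv)"
    by (intro laurent_expansion_intros has_laurent_expansion_fps hcoth_fps_expansion)
  moreover have "eventually (\<lambda>x::complex. (if x = 0 then 1 else x * hcoth x) * inverse x = hcoth x) (at 0)"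
    by (auto simp: eventually_at_filter)
  ultimately have h: "hcoth has_laurent_expansion fls_shift 1 (fps_to_fls hcoth_fps)"
    by (subst has_laurent_expansion_cong[symmetric]) (auto simp: fls_X_inv_times_conv_shift)
  have "(\<lambda>v. hcoth v + hcoth u - odd_double_series q u v) has_laurent_expansion
    fls_shift 1 (fps_to_fls hcoth_fps) + fls_const (hcoth u) - fps_to_fls (Abs_fps (\<lambda>l. Z_series q l u / fact l))"
    by (intro laurent_expansion_intros has_laurent_expansion_fps h odd_double_series_expansion assms)
  moreover have "(\<lambda>v. hcoth v + hcoth u - odd_double_series q u v) = kron q u" by (simp add: kron_def fun_eq_iff)
  ultimately show ?thesis by simp
qed

text \<open>The theta quotient has been identified with \<open>kron\<close> only for
  \<open>Re v < 0\<close>, not in a punctured neighbourhood of 0. Both sides have Laurent expansions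
  there, so agreement at points accumulating at 0 is enough.\<close>

lemma bo_Z_small:
  assumes "norm q < 1" "q \<noteq> 0" "small_arg q u" "exp u \<noteq> 1" "bo_theta q u \<noteq> 0"
  shows "bo_Z q l u = fact l * fps_nth hcoth_fps (Suc l) + (if l = 0 then hcoth u else 0) - Z_series q l u"
proof -
  define f where "f = (\<lambda>v. bo_theta q (u + v) * deriv (bo_theta q) 0 / (bo_theta q u * bo_theta q v))"
  have hol: "bo_theta q holomorphic_on UNIV" by (rule bo_theta_holomorphic[OF assms(2,1)])
  have an: "bo_theta q analytic_on A" for A using hol analytic_on_holomorphic by blast
  have "(\<lambda>v. u + v) holomorphic_on UNIV" by (intro holomorphic_intros)
  from holomorphic_on_compose_gen[OF this hol] have "(\<lambda>v. bo_theta q (u + v)) holomorphic_on UNIV"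
    by (simp add: o_def)
  then have an2: "(\<lambda>v. bo_theta q (u + v)) analytic_on {0}"
    using analytic_on_holomorphic by blast
  have "f meromorphic_on {0}"
    unfolding f_def by (intro meromorphic_intros analytic_on_imp_meromorphic_on an an2)
  then have Lf: "f has_laurent_expansion laurent_expansion f 0"
    by (intro not_essential_has_laurent_expansion_0) (simp_all add: meromorphic_at_iff)
  let ?G = "fls_shift 1 (fps_to_fls hcoth_fps) + fls_const (hcoth u) - fps_to_fls (Abs_fps (\<lambda>l. Z_series q l u / fact l))"
  have L: "(\<lambda>v. f v - kron q u v) has_laurent_expansion (laurent_expansion f 0 - ?G)"
    by (intro laurent_expansion_intros Lf kron_laurent assms)
  have fr: "frequently (\<lambda>v. f v - kron q u v = 0) (at 0)"
    unfolding frequently_def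
  proof
    assume ne: "eventually (\<lambda>v. f v - kron q u v \<noteq> 0) (at 0)"
    \<comment> \<open>The approach is along the negative real axis, where \<open>Re v < 0\<close>
      holds.\<close>
    have lim: "filterlim (\<lambda>t. - complex_of_real t) (at 0) (at_right 0)"
      unfolding filterlim_at by (auto intro!: tendsto_eq_intros simp: eventually_at_filter)
    have "eventually (small_arg q) (at 0)"
      using eventually_small_arg[OF assms(1)] by (simp add: eventually_nhds_conv_at)
    then have ev: "eventually (\<lambda>v. small_arg q v \<and> bo_theta q v \<noteq> 0 \<and> f v - kron q u v \<noteq> 0) (at 0)"
      using bo_theta_eventually_nonzero[OF assms(1,2,5), of 0] ne by (intro eventually_conj)
    from eventually_compose_filterlim[OF ev lim]
    have "eventually (\<lambda>t. small_arg q (- complex_of_real t) \<and> bo_theta q (- complex_of_real t) \<noteq> 0 \<and>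
        f (- complex_of_real t) - kron q u (- complex_of_real t) \<noteq> 0) (at_right 0)"
      .
    then have "eventually (\<lambda>t::real. False) (at_right 0)"
      using eventually_at_right_less[of "0::real"]
    proof eventually_elim
      case (elim t)
      then show ?case
        using theta_quotient_eq_kron[OF assms(1-3) _ assms(4) _ assms(5), of "- complex_of_real t"] by (simp add: f_def)
    qed
    then show False by simp
  qed
  have "laurent_expansion f 0 - ?G = 0"
    using has_laurent_expansion_frequently_zero_iff[of "\<lambda>v. f v - kron q u v" 0 "laurent_expansion f 0 - ?G"] L fr
    by (simp only: add_0_left)
  then have LE: "laurent_expansion f 0 = ?G" by simp
  show ?thesis
    unfolding bo_Z_def f_def [symmetric] LE by (simp add: nat_add_distrib algebra_simps)
qed

section \<open>The functions \<open>Z\<^sub>l\<close> and the two-point identity near the origin\<close>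

text \<open>The Laurent expansion of \<open>\<theta>'(0) / \<theta>(v)\<close> at \<open>v = 0\<close> does not depend on \<open>u\<close>, so only Taylor
  coefficients of \<open>\<theta>\<close> at \<open>u\<close> enter. At the zeros of \<open>\<theta>\<close> both sides are \<open>0\<close> because \<open>x / 0 = 0\<close>.\<close>

lemma bo_Z_formula:
  assumes "norm q < 1" "q \<noteq> 0"
  shows "\<exists>m b. \<forall>u. bo_Z q l u = (\<Sum>i\<le>m. b i * (deriv ^^ i) (bo_theta q) u) / bo_theta q u"
proof -
  have hol: "bo_theta q holomorphic_on UNIV" by (rule bo_theta_holomorphic[OF assms(2,1)])
  have an: "bo_theta q analytic_on A" for A using hol analytic_on_holomorphic by blast
  have "(\<lambda>v. deriv (bo_theta q) 0 / bo_theta q v) meromorphic_on {0}"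
    by (intro meromorphic_intros analytic_on_imp_meromorphic_on an)
  then have "\<exists>C. (\<lambda>v. deriv (bo_theta q) 0 / bo_theta q v) has_laurent_expansion C"
    by (auto simp: meromorphic_on_def)
  then obtain C where C: "(\<lambda>v. deriv (bo_theta q) 0 / bo_theta q v) has_laurent_expansion C" by blast
  \<comment> \<open>\<open>N\<close> bounds the pole order of \<open>C\<close>, so \<open>C\<close>
    is a power series \<open>B\<close> divided by \<open>v^N\<close>, and the Laurent coefficient
    \<open>l\<close> becomes a Cauchy product of index \<open>l + N\<close>.\<close>
  define N where "N = nat (- fls_subdegree C)"
  define B where "B = fls_regpart (fls_shift (- int N) C)"
  have "fls_subdegree (fls_shift (- int N) C) \<ge> 0"
    by (cases "C = 0") (auto simp: N_def)
  then have "fps_to_fls B = fls_shift (- int N) C"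
    unfolding B_def by (rule fls_regpart_to_fls_trivial)
  then have CB: "C = fls_shift (int N) (fps_to_fls B)" by simp
  have "bo_Z q l u = (\<Sum>i\<le>l + N. (fact l * fps_nth B (l + N - i) / fact i) * (deriv ^^ i) (bo_theta q) u) / bo_theta q u" for u
  proof (cases "bo_theta q u = 0")
    case True
    have "laurent_expansion (\<lambda>v. 0) 0 = 0" by (rule laurent_expansion_0_eqI) simp
    then show ?thesis using True by (simp add: bo_Z_def)
  next
    case False
    let ?T = "fps_expansion (bo_theta q) u"
    have "(\<lambda>v. bo_theta q (u + v)) has_fps_expansion ?T"
      by (rule analytic_at_imp_has_fps_expansion[OF an])
    then have "(\<lambda>v. (1 / bo_theta q u) * (bo_theta q (u + v) * (deriv (bo_theta q) 0 / bo_theta q v))) has_laurent_expansion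
        fls_const (1 / bo_theta q u) * (fps_to_fls ?T * C)"
      by (intro laurent_expansion_intros has_laurent_expansion_fps C)
    then have "laurent_expansion (\<lambda>v. bo_theta q (u + v) * deriv (bo_theta q) 0 / (bo_theta q u * bo_theta q v)) 0
        = fls_const (1 / bo_theta q u) * (fps_to_fls ?T * C)"
      by (intro laurent_expansion_0_eqI) simp
    moreover have "fps_to_fls ?T * C = fls_shift (int N) (fps_to_fls (?T * B))"
      unfolding CB by (simp add: fls_times_fps_to_fls fls_shifted_times_simps)
    ultimately have "bo_Z q l u = fact l * ((1 / bo_theta q u) * fps_nth (?T * B) (l + N))"
      unfolding bo_Z_def by (simp add: nat_add_distrib fls_const_mult_const)
    then show ?thesis
      unfolding fps_mult_nth
      by (simp add: fps_expansion_def atMost_atLeast0 sum_distrib_left sum_divide_distrib mult_ac)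
  qed
  then show ?thesis
    by (intro exI[of _ "l + N"] exI[of _ "\<lambda>i. fact l * fps_nth B (l + N - i) / fact i"] allI)
qed

lemma bo_Z_meromorphic:
  assumes "norm q < 1" "q \<noteq> 0"
  shows "bo_Z q l meromorphic_on A"
proof -
  have hol: "bo_theta q holomorphic_on UNIV" by (rule bo_theta_holomorphic[OF assms(2,1)])
  have an: "(deriv ^^ i) (bo_theta q) analytic_on A" for i A
    using holomorphic_higher_deriv[OF hol open_UNIV] analytic_on_holomorphic by blast
  obtain m b where "\<forall>u. bo_Z q l u = (\<Sum>i\<le>m. b i * (deriv ^^ i) (bo_theta q) u) / bo_theta q u"
    using bo_Z_formula[OF assms] by blast
  then have eq: "bo_Z q l = (\<lambda>u. (\<Sum>i\<le>m. b i * (deriv ^^ i) (bo_theta q) u) / bo_theta q u)" by auto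
  show ?thesis
    unfolding eq using an[of 0] an by (intro meromorphic_intros analytic_on_imp_meromorphic_on) auto
qed

lemma bo_Z_holomorphic:
  assumes "norm q < 1" "q \<noteq> 0" "\<And>u. u \<in> A \<Longrightarrow> bo_theta q u \<noteq> 0"
  shows "bo_Z q l holomorphic_on A"
proof -
  have hol: "bo_theta q holomorphic_on B" for B by (rule bo_theta_holomorphic[OF assms(2,1)])
  have h: "(deriv ^^ i) (bo_theta q) holomorphic_on A" for i
    using holomorphic_higher_deriv[OF hol open_UNIV] holomorphic_on_subset by blast
  obtain m b where "\<forall>u. bo_Z q l u = (\<Sum>i\<le>m. b i * (deriv ^^ i) (bo_theta q) u) / bo_theta q u"
    using bo_Z_formula[OF assms(1,2)] by blast
  then have eq: "bo_Z q l = (\<lambda>u. (\<Sum>i\<le>m. b i * (deriv ^^ i) (bo_theta q) u) / bo_theta q u)" by auto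
  show ?thesis
    unfolding eq using assms(3) by (intro holomorphic_intros h hol) auto
qed

text \<open>The factor \<open>M\<close> before the specialisation \<open>v = -u\<close>.\<close>

definition bo_M2 :: "complex \<Rightarrow> complex \<Rightarrow> complex \<Rightarrow> (nat \<Rightarrow> complex) \<Rightarrow> nat set \<Rightarrow> complex" where
  "bo_M2 q u v z J = (\<Sum>I\<in>Pow J. (-1) ^ card (J - I) *
      (bo_Z q (card J) (sum z I + u) + bo_Z q (card J) (sum z I + v)))"

section \<open>The two-point identity near the origin\<close>

lemma prod_vars:
  fixes f :: "complex \<Rightarrow> complex"
  assumes "finite K"
  shows "(\<Prod>i<length (vars z K). f (vars z K ! i)) = (\<Prod>j\<in>K. f (z j))"
proof -
  have "(\<Prod>i<length (vars z K). f (vars z K ! i)) = prod_list (map f (vars z K))"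
    by (simp add: prod.list_conv_set_nth atLeast0LessThan)
  also have "\<dots> = prod_list (map (\<lambda>j. f (z j)) (sorted_list_of_set K))"
    by (simp add: vars_def o_def)
  also have "\<dots> = (\<Prod>j\<in>set (sorted_list_of_set K). f (z j))"
    by (rule prod.distinct_set_conv_list[symmetric]) simp
  finally show ?thesis using assms by simp
qed

lemma length_vars: "finite K \<Longrightarrow> length (vars z K) = card K"
  by (simp add: vars_def)

lemma set_vars: "finite K \<Longrightarrow> set (vars z K) = z ` K"
  by (simp add: vars_def)

lemma sum_minus_one_Pow:
  assumes "finite J" "J \<noteq> {}"
  shows "(\<Sum>I\<in>Pow J. (-1) ^ card (J - I)) = (0 :: complex)"
proof -
  have "card J > 0" using assms by (simp add: card_gt_0_iff)
  then show ?thesis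
    using prod_add[OF assms(1), of "\<lambda>_. 1" "\<lambda>_. -1 :: complex"] by (simp add: zero_power)
qed

text \<open>This is \<open>maya_sum_two_point_reduction\<close> divided by the partition function,
  with the Lambert series replaced by \<open>Z_l\<close>. The sums required to be nonzero are those
  at which weights or \<open>Z_l\<close> have poles.\<close>

lemma correlator_identity_near_0:
  assumes F: "is_bo_correlator q F" and q: "norm q < 1" "q \<noteq> 0" and N: "finite N"
    and th: "bo_theta q a \<noteq> 0"
  shows "\<exists>\<delta>>0. \<forall>u v z. norm u < \<delta> \<and> norm v < \<delta> \<and> (\<forall>j\<in>N. norm (z j) < \<delta> \<and> z j \<noteq> 0) \<and> u \<noteq> 0 \<and> v \<noteq> 0 \<and>
      (\<forall>I\<subseteq>N. u + v + sum z I \<noteq> 0 \<and> sum z I + u \<noteq> 0 \<and> sum z I + v \<noteq> 0) \<longrightarrow>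
      F (u # v # vars z N) = (\<Sum>J\<in>Pow N. F ((u + v + sum z J) # vars z (N - J)) * bo_M2 q u v z J)"
proof -
  define n where "n = card N"
  have "\<forall>m. \<exists>\<epsilon>>0. \<forall>x. length x = m \<and> (\<forall>i<m. 0 < norm (x ! i) \<and> norm (x ! i) < \<epsilon>) \<longrightarrow>
     F x = maya_sum q (\<lambda>S. \<Prod>i<m. weight S (x ! i)) * bo_norm q"
    using correlator_eq_maya_sum[OF F q(1)] by blast
  then obtain e where e: "\<And>m. e m > 0" "\<And>m x. length x = m \<and> (\<forall>i<m. 0 < norm (x ! i) \<and> norm (x ! i) < e m) \<Longrightarrow>
     F x = maya_sum q (\<lambda>S. \<Prod>i<m. weight S (x ! i)) * bo_norm q" by metis
  define e0 where "e0 = Min (e ` {..n + 2})"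
  have e0: "e0 > 0" "\<And>m. m \<le> n + 2 \<Longrightarrow> e0 \<le> e m" using e(1) by (auto simp: e0_def)
  have Fx: "F x = maya_sum q (\<lambda>S. \<Prod>i<length x. weight S (x ! i)) * bo_norm q"
    if "length x \<le> n + 2" "\<And>y. y \<in> set x \<Longrightarrow> y \<noteq> 0 \<and> norm y < e0" for x
  proof (rule e(2), intro conjI allI impI)
    fix i assume "i < length x"
    then have "x ! i \<noteq> 0 \<and> norm (x ! i) < e0" using that(2) by auto
    then show "0 < norm (x ! i)" "norm (x ! i) < e (length x)" using e0(2)[OF that(1)] by auto
  qed simp
  obtain r where r: "r > 0" "exp r * norm q < 1" using exists_exp_small[OF q(1)] .
  have "eventually (\<lambda>w. small_arg q w \<and> (w \<noteq> 0 \<longrightarrow> exp w \<noteq> 1 \<and> bo_theta q w \<noteq> 0)) (nhds 0)"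
    using eventually_small_arg[OF q(1)] eventually_exp_neq_1 bo_theta_eventually_nonzero[OF q th, of 0]
    unfolding eventually_at_filter by eventually_elim auto
  then obtain d0 where d0: "d0 > 0" "\<And>w. norm w < d0 \<Longrightarrow> small_arg q w \<and> (w \<noteq> 0 \<longrightarrow> exp w \<noteq> 1 \<and> bo_theta q w \<noteq> 0)"
    by (auto simp: eventually_nhds_metric dist_norm)
  \<comment> \<open>The factor \<open>n + 8\<close> leaves room for the rate
    \<open>3 * norm u + 3 * norm v\<close> plus the \<open>n\<close> norms and the slack
    \<open>\<delta>\<close>, and for every argument \<open>sum z I + x\<close> with
    \<open>norm x < 2 * \<delta>\<close>.\<close>
  define \<delta> where "\<delta> = Min {e0, r, d0} / (real n + 8)"
  have \<delta>: "\<delta> > 0" using e0 r d0 by (simp add: \<delta>_def)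
  have \<delta>': "(real n + 8) * \<delta> \<le> e0" "(real n + 8) * \<delta> \<le> r" "(real n + 8) * \<delta> \<le> d0" by (simp_all add: \<delta>_def)
  have "F (u # v # vars z N) = (\<Sum>J\<in>Pow N. F ((u + v + sum z J) # vars z (N - J)) * bo_M2 q u v z J)"
    if uv: "norm u < \<delta>" "norm v < \<delta>" "u \<noteq> 0" "v \<noteq> 0" and z: "\<forall>j\<in>N. norm (z j) < \<delta> \<and> z j \<noteq> 0"
      and ne: "\<forall>I\<subseteq>N. u + v + sum z I \<noteq> 0 \<and> sum z I + u \<noteq> 0 \<and> sum z I + v \<noteq> 0" for u v z
  proof -
    have zN: "(\<Sum>j\<in>N. norm (z j)) \<le> real n * \<delta>"
      using sum_bounded_above[of N "\<lambda>j. norm (z j)" \<delta>] z by (force simp: n_def)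
    have zI: "norm (sum z I) \<le> real n * \<delta>" if "I \<subseteq> N" for I
    proof -
      have "norm (sum z I) \<le> (\<Sum>j\<in>I. norm (z j))" by (rule norm_sum)
      also have "\<dots> \<le> (\<Sum>j\<in>N. norm (z j))" using that N by (intro sum_mono2) auto
      finally show ?thesis using zN by simp
    qed
    have e8: "(real n + 8) * \<delta> = real n * \<delta> + 8 * \<delta>" by (simp add: algebra_simps)
    have lt: "norm (sum z I + x) < (real n + 8) * \<delta>" if "I \<subseteq> N" "norm x < 2 * \<delta>" for I x
      using norm_triangle_ineq[of "sum z I" x] zI[OF that(1)] that(2) \<delta> unfolding e8 by linarith
    have uvl: "norm (u + v) < 2 * \<delta>" using norm_triangle_ineq[of u v] uv by linarith
    have sm: "small_arg q (sum z I + x) \<and> (sum z I + x \<noteq> 0 \<longrightarrow> exp (sum z I + x) \<noteq> 1 \<and> bo_theta q (sum z I + x) \<noteq> 0)"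
      if "I \<subseteq> N" "norm x < 2 * \<delta>" for I x
      using d0(2)[of "sum z I + x"] lt[OF that] \<delta>'(3) by linarith
    have zlt: "y \<noteq> 0 \<and> norm y < e0" if y: "y \<in> set (vars z K)" and K: "K \<subseteq> N" for y K
    proof -
      obtain j where j: "j \<in> N" "y = z j" using y K set_vars[OF finite_subset[OF K N], of z] by auto
      have "\<delta> \<le> (real n + 8) * \<delta>" using \<delta> by simp
      then show ?thesis using j z \<delta>'(1) by force
    qed
    have "F (u # v # vars z N) = maya_sum q (\<lambda>S. \<Prod>i<length (u # v # vars z N). weight S ((u # v # vars z N) ! i)) * bo_norm q"
    proof (rule Fx)
      have "\<delta> \<le> (real n + 8) * \<delta>" using \<delta> by simp
      then have "norm u < e0" "norm v < e0" using uv \<delta>'(1) by linarith+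
      then show "y \<noteq> 0 \<and> norm y < e0" if "y \<in> set (u # v # vars z N)" for y
        using that uv zlt[of y N] by auto
    qed (simp add: length_vars N n_def)
    also have "(\<lambda>S. \<Prod>i<length (u # v # vars z N). weight S ((u # v # vars z N) ! i)) = (\<lambda>S. weight S u * weight S v * (\<Prod>j\<in>N. weight S (z j)))"
    proof
      fix S show "(\<Prod>i<length (u # v # vars z N). weight S ((u # v # vars z N) ! i)) = weight S u * weight S v * (\<Prod>j\<in>N. weight S (z j))"
        using prod_vars[OF N, of "weight S" z] by (simp add: prod.lessThan_Suc_shift mult.assoc del: prod.lessThan_Suc)
    qed
    also have "maya_sum q \<dots> = (\<Sum>I\<in>Pow N. maya_sum_weight q z (u + v + sum z I) (N - I) *
       ((if I = {} then hcoth u + hcoth v else 0) -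
        (\<Sum>I'\<in>Pow I. (-1) ^ card (I - I') * (Z_series q (card I) (sum z I' + u) + Z_series q (card I) (sum z I' + v)))))"
    proof (rule maya_sum_two_point_reduction[OF N q(1) \<delta>])
      have "3 * norm u + 3 * norm v + (\<Sum>j\<in>N. norm (z j)) + \<delta> \<le> r"
        using zN uv \<delta>'(2) \<delta> unfolding e8 by linarith
      then have "exp (3 * norm u + 3 * norm v + (\<Sum>j\<in>N. norm (z j)) + \<delta>) * norm q \<le> exp r * norm q"
        by (intro mult_right_mono) auto
      then show "exp (3 * norm u + 3 * norm v + (\<Sum>j\<in>N. norm (z j)) + \<delta>) * norm q < 1" using r by linarith
      show "exp u \<noteq> 1" "exp v \<noteq> 1" using sm[of "{}" u] sm[of "{}" v] uv \<delta> by auto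
      show "exp (u + v + sum z I) \<noteq> 1" if "I \<subseteq> N" for I
        using sm[OF that uvl] ne that by (auto simp: add.commute)
    qed
    also have "\<dots> * bo_norm q = (\<Sum>J\<in>Pow N. F ((u + v + sum z J) # vars z (N - J)) * bo_M2 q u v z J)"
      unfolding sum_distrib_right
    proof (rule sum.cong[OF refl])
      fix J assume "J \<in> Pow N"
      then have J: "J \<subseteq> N" "finite J" "finite (N - J)" using N finite_subset by auto
      let ?w = "u + v + sum z J"
      have "F (?w # vars z (N - J)) = maya_sum q (\<lambda>S. \<Prod>i<length (?w # vars z (N - J)). weight S ((?w # vars z (N - J)) ! i)) * bo_norm q"
      proof (rule Fx)
        have "card (N - J) \<le> card N" using N by (intro card_mono) auto
        then show "length (?w # vars z (N - J)) \<le> n + 2" by (simp add: length_vars J n_def)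
        show "y \<noteq> 0 \<and> norm y < e0" if "y \<in> set (?w # vars z (N - J))" for y
          using that zlt[of y "N - J"] lt[OF J(1) uvl] ne J(1) \<delta>'(1) by (auto simp: add.commute)
      qed
      also have "(\<lambda>S. \<Prod>i<length (?w # vars z (N - J)). weight S ((?w # vars z (N - J)) ! i)) = (\<lambda>S. weight S ?w * (\<Prod>j\<in>N - J. weight S (z j)))"
      proof
        fix S show "(\<Prod>i<length (?w # vars z (N - J)). weight S ((?w # vars z (N - J)) ! i)) = weight S ?w * (\<Prod>j\<in>N - J. weight S (z j))"
          using prod_vars[OF J(3), of "weight S" z] by (simp add: prod.lessThan_Suc_shift del: prod.lessThan_Suc)
      qed
      finally have FJ: "F (?w # vars z (N - J)) = maya_sum_weight q z ?w (N - J) * bo_norm q" by (simp add: maya_sum_weight_def)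
      \<comment> \<open>For fixed \<open>J\<close> this constant is the same in all terms, so the
        alternating sum over \<open>I\<close> kills it if \<open>J\<close> is nonempty. For
        \<open>J = {}\<close> it is 0 by \<open>hcoth_fps_1\<close>.\<close>
      define c where "c = fact (card J) * fps_nth hcoth_fps (Suc (card J))"
      have Z: "bo_Z q (card J) (sum z I + x) = c + (if card J = 0 then hcoth (sum z I + x) else 0) - Z_series q (card J) (sum z I + x)"
        if "I \<subseteq> J" "x \<in> {u,v}" for I x
      proof -
        have I: "I \<subseteq> N" using that J by auto
        have "norm x < 2 * \<delta>" using that uv \<delta> by auto
        note s = sm[OF I this]
        have "sum z I + x \<noteq> 0" using that(2) ne I by auto
        then have "bo_Z q (card J) (sum z I + x) = fact (card J) * fps_nth hcoth_fps (Suc (card J)) +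
            (if card J = 0 then hcoth (sum z I + x) else 0) - Z_series q (card J) (sum z I + x)"
          using s by (intro bo_Z_small[OF q]) simp_all
        then show ?thesis by (simp only: c_def)
      qed
      have "bo_M2 q u v z J = (\<Sum>I\<in>Pow J. (-1) ^ card (J - I) * (2 * c + (if card J = 0 then hcoth (sum z I + u) + hcoth (sum z I + v) else 0)
          - (Z_series q (card J) (sum z I + u) + Z_series q (card J) (sum z I + v))))"
        unfolding bo_M2_def by (intro sum.cong refl) (simp add: Z)
      also have "\<dots> = (\<Sum>I\<in>Pow J. (-1) ^ card (J - I) * (2 * c)) +
          (\<Sum>I\<in>Pow J. (-1) ^ card (J - I) * (if card J = 0 then hcoth (sum z I + u) + hcoth (sum z I + v) else 0))
          - (\<Sum>I\<in>Pow J. (-1) ^ card (J - I) * (Z_series q (card J) (sum z I + u) + Z_series q (card J) (sum z I + v)))"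
        by (simp only: right_diff_distrib distrib_left sum_subtractf sum.distrib)
      also have "(\<Sum>I\<in>Pow J. (-1) ^ card (J - I) * (2 * c)) = 0"
      proof (cases "J = {}")
        case True
        then show ?thesis by (simp add: c_def hcoth_fps_1[simplified])
      next
        case False
        show ?thesis
          unfolding sum_distrib_right [symmetric] sum_minus_one_Pow[OF J(2) False] by simp
      qed
      also have "(\<Sum>I\<in>Pow J. (-1) ^ card (J - I) * (if card J = 0 then hcoth (sum z I + u) + hcoth (sum z I + v) else 0))
         = (if J = {} then hcoth u + hcoth v else 0)"
        using J by auto
      finally have "bo_M2 q u v z J = (if J = {} then hcoth u + hcoth v else 0) -
          (\<Sum>I\<in>Pow J. (-1) ^ card (J - I) * (Z_series q (card J) (sum z I + u) + Z_series q (card J) (sum z I + v)))" by simp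
      then show "maya_sum_weight q z ?w (N - J) * ((if J = {} then hcoth u + hcoth v else 0) -
          (\<Sum>I\<in>Pow J. (-1) ^ card (J - I) * (Z_series q (card J) (sum z I + u) + Z_series q (card J) (sum z I + v)))) * bo_norm q
        = F (?w # vars z (N - J)) * bo_M2 q u v z J" unfolding FJ by (simp only: mult_ac)
    qed
    finally show ?thesis .
  qed
  then show ?thesis using \<delta> by blast
qed

section \<open>Continuation along generic lines\<close>

text \<open>At the point whose coordinates are all displaced by half the radius, the terms are
  absolutely summable; there they majorise the terms on the whole smaller polydisc.\<close>

lemma holomorphic_at_uniform:
  assumes "holomorphic_at f p"
  shows "\<exists>\<rho>>0. \<exists>a. uniform_limit (polydisc p \<rho>)
     (\<lambda>X x. \<Sum>ks\<in>X. a ks * (\<Prod>i<length p. (x ! i - p ! i) ^ (ks ! i))) f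
     (finite_subsets_at_top {ks :: nat list. length ks = length p})"
proof -
  let ?L = "{ks :: nat list. length ks = length p}"
  obtain r a where r: "r > 0" and a: "\<And>x. x \<in> polydisc p r \<Longrightarrow>
      ((\<lambda>ks. a ks * (\<Prod>i<length p. (x ! i - p ! i) ^ (ks ! i))) has_sum f x) ?L"
    using assms unfolding holomorphic_at_def by blast
  define \<rho> where "\<rho> = r / 2"
  have \<rho>: "0 < \<rho>" "\<rho> < r" using r by (auto simp: \<rho>_def)
  define y where "y = map (\<lambda>w. w + complex_of_real \<rho>) p"
  have "y \<in> polydisc p r" using \<rho> by (auto simp: y_def polydisc_def)
  from a[OF this] have "(\<lambda>ks. a ks * (\<Prod>i<length p. (y ! i - p ! i) ^ (ks ! i))) summable_on ?L"
    by (auto simp: summable_on_def)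
  then have "(\<lambda>ks. norm (a ks * (\<Prod>i<length p. (y ! i - p ! i) ^ (ks ! i)))) summable_on ?L"
    by (simp only: summable_on_iff_abs_summable_on_complex)
  then have M: "(\<lambda>ks. norm (a ks) * (\<Prod>i<length p. \<rho> ^ (ks ! i))) summable_on ?L"
    using \<rho> by (simp add: y_def norm_mult prod_norm [symmetric] norm_power)
  have "uniform_limit (polydisc p \<rho>)
     (\<lambda>X x. \<Sum>ks\<in>X. a ks * (\<Prod>i<length p. (x ! i - p ! i) ^ (ks ! i))) f (finite_subsets_at_top ?L)"
  proof (rule Weierstrass_m_test_general'[OF _ _ M])
    fix ks x assume x: "x \<in> polydisc p \<rho>"
    then have "norm (x ! i - p ! i) ^ (ks ! i) \<le> \<rho> ^ (ks ! i)" if "i < length p" for i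
      using that by (intro power_mono) (auto simp: polydisc_def less_imp_le)
    then show "norm (a ks * (\<Prod>i<length p. (x ! i - p ! i) ^ (ks ! i))) \<le> norm (a ks) * (\<Prod>i<length p. \<rho> ^ (ks ! i))"
      unfolding norm_mult prod_norm [symmetric] norm_power
      by (intro mult_left_mono prod_mono) auto
  next
    fix x assume "x \<in> polydisc p \<rho>"
    then have "x \<in> polydisc p r" using \<rho> by (force simp: polydisc_def)
    then show "((\<lambda>ks. a ks * (\<Prod>i<length p. (x ! i - p ! i) ^ (ks ! i))) has_sum f x) ?L" by (rule a)
  qed
  then show ?thesis using \<rho>(1) by blast
qed

definition list_tendsto :: "(nat \<Rightarrow> complex list) \<Rightarrow> complex list \<Rightarrow> bool" where
  "list_tendsto X y \<longleftrightarrow> (\<forall>n. length (X n) = length y) \<and> (\<forall>i<length y. (\<lambda>n. X n ! i) \<longlonglongrightarrow> y ! i)"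

definition list_continuous :: "(complex list \<Rightarrow> complex) \<Rightarrow> complex list \<Rightarrow> bool" where
  "list_continuous F y \<longleftrightarrow> (\<forall>X. list_tendsto X y \<longrightarrow> (\<lambda>n. F (X n)) \<longlonglongrightarrow> F y)"

text \<open>Continuity is obtained on a polydisc and not only at its centre, because the points that
  approximate the centre in the final limit must be points of continuity themselves.\<close>

lemma holomorphic_at_list_continuous:
  assumes "holomorphic_at f p"
  shows "\<exists>\<rho>>0. \<forall>y\<in>polydisc p \<rho>. list_continuous f y"
proof -
  let ?L = "{ks :: nat list. length ks = length p}"
  obtain \<rho> a where \<rho>: "\<rho> > 0" and u: "uniform_limit (polydisc p \<rho>)
     (\<lambda>X x. \<Sum>ks\<in>X. a ks * (\<Prod>i<length p. (x ! i - p ! i) ^ (ks ! i))) f (finite_subsets_at_top ?L)"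
    using holomorphic_at_uniform[OF assms] by blast
  let ?s = "\<lambda>X x. \<Sum>ks\<in>X. a ks * (\<Prod>i<length p. (x ! i - p ! i) ^ (ks ! i))"
  have "(\<lambda>n. f (X n)) \<longlonglongrightarrow> f y"
    if y: "y \<in> polydisc p \<rho>" and len: "\<forall>n. length (X n) = length p" and lim: "\<forall>i<length p. (\<lambda>n. X n ! i) \<longlonglongrightarrow> y ! i"
    for y and X :: "nat \<Rightarrow> complex list"
  proof (rule tendstoI)
    fix e :: real assume e: "e > 0"
    then have "e / 3 > 0" by simp
    from uniform_limitD[OF u this] obtain A where A: "\<And>x. x \<in> polydisc p \<rho> \<Longrightarrow> dist (?s A x) (f x) < e / 3"
      using eventually_happens'[OF finite_subsets_at_top_neq_bot] by blast
    have "(\<lambda>n. ?s A (X n)) \<longlonglongrightarrow> ?s A y"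
      using lim by (intro tendsto_intros) auto
    then have 1: "eventually (\<lambda>n. dist (?s A (X n)) (?s A y) < e / 3) sequentially"
      using \<open>e / 3 > 0\<close> by (rule tendstoD)
    have "eventually (\<lambda>n. \<forall>i\<in>{..<length p}. norm (X n ! i - p ! i) < \<rho>) sequentially"
    proof (rule eventually_ball_finite)
      show "\<forall>i\<in>{..<length p}. eventually (\<lambda>n. norm (X n ! i - p ! i) < \<rho>) sequentially"
      proof
        fix i assume i: "i \<in> {..<length p}"
        have "(\<lambda>n. norm (X n ! i - p ! i)) \<longlonglongrightarrow> norm (y ! i - p ! i)"
          using lim i by (intro tendsto_intros) auto
        then show "eventually (\<lambda>n. norm (X n ! i - p ! i) < \<rho>) sequentially"
          by (rule order_tendstoD(2)) (use y i in \<open>auto simp: polydisc_def\<close>)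
      qed
    qed simp
    then have 2: "eventually (\<lambda>n. X n \<in> polydisc p \<rho>) sequentially"
      by eventually_elim (use len in \<open>auto simp: polydisc_def\<close>)
    show "eventually (\<lambda>n. dist (f (X n)) (f y) < e) sequentially"
      using 1 2
    proof eventually_elim
      case (elim n)
      have "dist (f (X n)) (f y) \<le> dist (?s A (X n)) (f (X n)) + dist (?s A (X n)) (?s A y) + dist (?s A y) (f y)"
        using dist_triangle[of "f (X n)" "f y" "?s A (X n)"] dist_triangle[of "?s A (X n)" "f y" "?s A y"]
        by (simp add: dist_commute)
      then show ?case using A[OF elim(2)] A[OF y] elim(1) by simp
    qed
  qed
  then have "list_continuous f y" if "y \<in> polydisc p \<rho>" for y
    using that by (simp add: list_continuous_def list_tendsto_def polydisc_def)
  then show ?thesis using \<rho> by blast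
qed

text \<open>Several variables enter the continuation only through holomorphic curves, to which
  one-variable identity theorems apply.\<close>

definition holomorphic_along_discs :: "(complex list \<Rightarrow> complex) \<Rightarrow> complex list \<Rightarrow> real \<Rightarrow> bool" where
  "holomorphic_along_discs f p \<rho> \<longleftrightarrow> (\<forall>L D. open D \<longrightarrow> (\<forall>t\<in>D. L t \<in> polydisc p \<rho>) \<longrightarrow>
     (\<forall>i<length p. (\<lambda>t. L t ! i) holomorphic_on D) \<longrightarrow> (\<lambda>t. f (L t)) holomorphic_on D)"

lemma polydisc_mono: "\<rho>' \<le> \<rho> \<Longrightarrow> polydisc p \<rho>' \<subseteq> polydisc p \<rho>"
  by (auto simp: polydisc_def intro: less_le_trans)

lemma holomorphic_along_discs_mono: "holomorphic_along_discs f p \<rho> \<Longrightarrow> \<rho>' \<le> \<rho> \<Longrightarrow> holomorphic_along_discs f p \<rho>'"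
  unfolding holomorphic_along_discs_def using polydisc_mono[of \<rho>' \<rho> p] by (meson subsetD)

lemma holomorphic_at_along_discs:
  assumes "holomorphic_at f p"
  shows "\<exists>\<rho>>0. holomorphic_along_discs f p \<rho>"
proof -
  let ?L = "{ks :: nat list. length ks = length p}"
  obtain \<rho> a where \<rho>: "\<rho> > 0" and u: "uniform_limit (polydisc p \<rho>)
     (\<lambda>X x. \<Sum>ks\<in>X. a ks * (\<Prod>i<length p. (x ! i - p ! i) ^ (ks ! i))) f (finite_subsets_at_top ?L)"
    using holomorphic_at_uniform[OF assms] by blast
  let ?s = "\<lambda>X x. \<Sum>ks\<in>X. a ks * (\<Prod>i<length p. (x ! i - p ! i) ^ (ks ! i))"
  have "(\<lambda>t. f (L t)) holomorphic_on D"
    if D: "open D" "\<forall>t\<in>D. L t \<in> polydisc p \<rho>" and hol: "\<forall>i<length p. (\<lambda>t. L t ! i) holomorphic_on D"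
    for L :: "complex \<Rightarrow> complex list" and D
  proof -
    have hs: "(\<lambda>t. ?s X (L t)) holomorphic_on D" for X
      using hol by (intro holomorphic_intros) auto
    have "\<exists>r>0. (\<lambda>t. f (L t)) holomorphic_on ball z r" if "z \<in> D" for z
    proof -
      obtain r where r: "r > 0" "cball z r \<subseteq> D" using D(1) \<open>z \<in> D\<close> by (meson open_contains_cball)
      have "uniform_limit (cball z r) (\<lambda>X t. ?s X (L t)) (\<lambda>t. f (L t)) (finite_subsets_at_top ?L)"
        by (rule uniform_limit_compose'[OF u]) (use r D in auto)
      moreover have "continuous_on (cball z r) (\<lambda>t. ?s X (L t)) \<and> (\<lambda>t. ?s X (L t)) holomorphic_on ball z r" for X
      proof
        show "continuous_on (cball z r) (\<lambda>t. ?s X (L t))"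
          by (rule continuous_on_subset[OF holomorphic_on_imp_continuous_on[OF hs] r(2)])
        show "(\<lambda>t. ?s X (L t)) holomorphic_on ball z r"
          by (rule holomorphic_on_subset[OF hs]) (use r(2) ball_subset_cball in blast)
      qed
      ultimately have "(\<lambda>t. f (L t)) holomorphic_on ball z r"
        by (rule_tac holomorphic_uniform_limit[OF always_eventually _ finite_subsets_at_top_neq_bot]) auto
      then show ?thesis using r(1) by blast
    qed
    then have "\<forall>z\<in>D. (\<lambda>t. f (L t)) field_differentiable at z"
      by (meson centre_in_ball holomorphic_on_imp_differentiable_at open_ball)
    then show ?thesis by (meson field_differentiable_at_within holomorphic_on_def)
  qed
  then show ?thesis using \<rho> by (auto simp: holomorphic_along_discs_def)
qed

section \<open>Generic points\<close>

definition point_box :: "nat set \<Rightarrow> real \<Rightarrow> (nat \<Rightarrow> complex) \<Rightarrow> (nat \<Rightarrow> complex) set" where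
  "point_box K \<eta> p = {P. \<forall>k\<in>K. norm (P k - p k) < \<eta>}"

definition point_segment :: "(nat \<Rightarrow> complex) \<Rightarrow> (nat \<Rightarrow> complex) \<Rightarrow> complex \<Rightarrow> nat \<Rightarrow> complex" where
  "point_segment P Q \<tau> = (\<lambda>k. P k + \<tau> * (Q k - P k))"

text \<open>Holomorphy is only required on complex lines, which suffices to avoid finitely many zero sets at once.\<close>

definition generic_fun :: "nat set \<Rightarrow> real \<Rightarrow> (nat \<Rightarrow> complex) \<Rightarrow> ((nat \<Rightarrow> complex) \<Rightarrow> complex) \<Rightarrow> bool" where
  "generic_fun K \<eta> p H \<longleftrightarrow>
     (\<forall>P\<in>point_box K \<eta> p. \<forall>Q\<in>point_box K \<eta> p. (\<lambda>\<tau>. H (point_segment P Q \<tau>)) holomorphic_on {\<tau>. point_segment P Q \<tau> \<in> point_box K \<eta> p}) \<and>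
     (\<forall>\<eta>'>0. \<exists>P\<in>point_box K \<eta>' p. H P \<noteq> 0)"

lemma point_box_mono: "\<eta>' \<le> \<eta> \<Longrightarrow> point_box K \<eta>' p \<subseteq> point_box K \<eta> p"
  by (auto simp: point_box_def intro: less_le_trans)

lemma generic_fun_mono:
  assumes "generic_fun K \<eta> p H" "\<eta>' \<le> \<eta>"
  shows "generic_fun K \<eta>' p H"
proof -
  have sub: "point_box K \<eta>' p \<subseteq> point_box K \<eta> p" by (rule point_box_mono[OF assms(2)])
  have "(\<lambda>\<tau>. H (point_segment P Q \<tau>)) holomorphic_on {\<tau>. point_segment P Q \<tau> \<in> point_box K \<eta>' p}"
    if "P \<in> point_box K \<eta>' p" "Q \<in> point_box K \<eta>' p" for P Q
  proof (rule holomorphic_on_subset)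
    show "(\<lambda>\<tau>. H (point_segment P Q \<tau>)) holomorphic_on {\<tau>. point_segment P Q \<tau> \<in> point_box K \<eta> p}"
      using assms(1) that sub by (auto simp: generic_fun_def)
  qed (use sub in auto)
  then show ?thesis using assms(1) by (simp add: generic_fun_def)
qed

lemma open_point_segment:
  assumes "finite K" shows "open {\<tau>. point_segment P Q \<tau> \<in> point_box K \<eta> p}"
proof -
  have "{\<tau>. point_segment P Q \<tau> \<in> point_box K \<eta> p} = (\<Inter>k\<in>K. {\<tau>. norm (P k + \<tau> * (Q k - P k) - p k) < \<eta>})"
    by (auto simp: point_box_def point_segment_def)
  also have "open \<dots>"
    using assms by (intro open_INT ballI open_Collect_less continuous_intros)
  finally show ?thesis .
qed

lemma convex_affine_preimage:
  fixes a b c :: complex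
  shows "convex {\<tau>. norm (a + \<tau> * b - c) < \<eta>}"
proof -
  have "{\<tau>. norm (a + \<tau> * b - c) < \<eta>} = (\<lambda>\<tau>. \<tau> * b) -` ball (c - a) \<eta>"
    by (auto simp: dist_norm norm_minus_commute algebra_simps)
  moreover have "linear (\<lambda>\<tau>::complex. \<tau> * b)"
    by (rule linearI) (simp_all add: algebra_simps)
  ultimately show ?thesis by (simp add: convex_linear_vimage)
qed

lemma connected_point_segment: "connected {\<tau>. point_segment P Q \<tau> \<in> point_box K \<eta> p}"
proof (rule convex_connected)
  have "{\<tau>. point_segment P Q \<tau> \<in> point_box K \<eta> p} = (\<Inter>k\<in>K. {\<tau>. norm (P k + \<tau> * (Q k - P k) - p k) < \<eta>})"
    by (auto simp: point_box_def point_segment_def)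
  then show "convex {\<tau>. point_segment P Q \<tau> \<in> point_box K \<eta> p}"
    by (auto intro!: convex_Inter convex_affine_preimage)
qed

text \<open>Join a point that is good for the earlier functions to one that is good for the new
  function. None of the functions vanishes identically on this complex line, so all are nonzero at
  small nonzero parameters.\<close>

lemma exists_generic_point:
  assumes "finite Hs" "finite K" "\<eta> > 0" "\<And>H. H \<in> Hs \<Longrightarrow> generic_fun K \<eta> p H"
  shows "\<exists>P\<in>point_box K \<eta> p. \<forall>H\<in>Hs. H P \<noteq> 0"
  using assms(1,4)
proof (induction Hs rule: finite_induct)
  case empty
  have "p \<in> point_box K \<eta> p" using assms(3) by (simp add: point_box_def)
  then show ?case by blast
next
  case (insert H Hs)
  obtain P where P: "P \<in> point_box K \<eta> p" "\<And>H. H \<in> Hs \<Longrightarrow> H P \<noteq> 0" using insert by auto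
  obtain Q where Q: "Q \<in> point_box K \<eta> p" "H Q \<noteq> 0"
    using insert.prems[of H] assms(3) by (auto simp: generic_fun_def)
  let ?D = "{\<tau>. point_segment P Q \<tau> \<in> point_box K \<eta> p}"
  have p01: "point_segment P Q 0 = P" "point_segment P Q 1 = Q" by (auto simp: point_segment_def)
  have ev: "eventually (\<lambda>\<tau>. G (point_segment P Q \<tau>) \<noteq> 0 \<and> \<tau> \<in> ?D) (at 0)" if G: "G \<in> insert H Hs" for G
  proof -
    obtain \<beta> where \<beta>: "\<beta> \<in> ?D" "G (point_segment P Q \<beta>) \<noteq> 0"
    proof (cases "G = H")
      case True
      then show ?thesis using that[of 1] p01 Q by simp
    next
      case False
      then show ?thesis using that[of 0] p01 P G by auto
    qed
    have "(\<lambda>\<tau>. G (point_segment P Q \<tau>)) holomorphic_on ?D"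
      using insert.prems[OF G] P(1) Q(1) by (auto simp: generic_fun_def)
    from non_zero_neighbour_alt[OF this open_point_segment[OF assms(2)] connected_point_segment _ \<beta>, of 0] P(1) p01
    show ?thesis by simp
  qed
  have "eventually (\<lambda>\<tau>. \<forall>G\<in>insert H Hs. G (point_segment P Q \<tau>) \<noteq> 0 \<and> \<tau> \<in> ?D) (at 0)"
    using insert.hyps ev by (intro eventually_ball_finite) auto
  then obtain \<tau> where "\<forall>G\<in>insert H Hs. G (point_segment P Q \<tau>) \<noteq> 0 \<and> \<tau> \<in> ?D"
    using eventually_happens'[OF at_neq_bot] by blast
  then show ?case by (intro bexI[of _ "point_segment P Q \<tau>"]) auto
qed

lemma generic_fun_sum:
  assumes "finite K" "A \<subseteq> K" "A \<noteq> {}"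
  shows "generic_fun K \<eta> p (\<lambda>P. sum P A)"
  unfolding generic_fun_def
proof (intro conjI ballI allI impI)
  fix P Q
  show "(\<lambda>\<tau>. sum (point_segment P Q \<tau>) A) holomorphic_on {\<tau>. point_segment P Q \<tau> \<in> point_box K \<eta> p}"
    unfolding point_segment_def by (intro holomorphic_intros)
next
  fix \<eta>' :: real assume \<eta>': "\<eta>' > 0"
  obtain a where a: "a \<in> A" using assms(3) by blast
  have fA: "finite A" using assms finite_subset by blast
  show "\<exists>P\<in>point_box K \<eta>' p. sum P A \<noteq> 0"
  proof (cases "sum p A = 0")
    case True
    have "sum (p(a := p a + of_real (\<eta>'/2))) A = sum p A + of_real (\<eta>'/2)"
      using sum.remove[OF fA a, of p] sum.remove[OF fA a, of "p(a := p a + of_real (\<eta>'/2))"] by simp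
    then show ?thesis using True \<eta>' by (intro bexI[of _ "p(a := p a + of_real (\<eta>'/2))"]) (auto simp: point_box_def)
  next
    case False
    then show ?thesis using \<eta>' by (intro bexI[of _ p]) (auto simp: point_box_def)
  qed
qed

text \<open>The arguments of all correlators in the identity are sums of the coordinates of \<open>P\<close> over disjoint sets.\<close>

definition pullback :: "nat set list \<Rightarrow> (nat \<Rightarrow> complex) \<Rightarrow> complex list" where
  "pullback As P = map (sum P) As"

definition disjoint_list :: "nat set list \<Rightarrow> bool" where
  "disjoint_list As \<longleftrightarrow> (\<forall>i<length As. finite (As ! i) \<and> As ! i \<noteq> {}) \<and>
     (\<forall>i<length As. \<forall>j<length As. i \<noteq> j \<longrightarrow> As ! i \<inter> As ! j = {})"

abbreviation scaled :: "(nat \<Rightarrow> complex) \<Rightarrow> complex \<Rightarrow> nat \<Rightarrow> complex" where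
  "scaled P t \<equiv> (\<lambda>k. t * P k)"

lemma pullback_line_nth: "i < length As \<Longrightarrow> pullback As (scaled P t) ! i = t * sum P (As ! i)"
  by (simp add: pullback_def sum_distrib_left)

lemma length_pullback [simp]: "length (pullback As P) = length As"
  by (simp add: pullback_def)

text \<open>One representative per block carries the prescribed value, and disjointness prevents
  interference. Every argument list is therefore attained, so a denominator that is not identically
  zero remains so as a function of \<open>P\<close>.\<close>

lemma pullback_solve:
  assumes "disjoint_list As"
  shows "\<exists>Q. \<forall>i<length As. sum Q (As ! i) = d i"
proof -
  define m where "m = length As"
  have "\<forall>i<m. \<exists>a. a \<in> As ! i" using assms by (auto simp: disjoint_list_def m_def)
  then obtain a where a: "\<And>i. i < m \<Longrightarrow> a i \<in> As ! i" by metis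
  define Q where "Q = (\<lambda>k. \<Sum>i<m. if k = a i then d i else 0)"
  have "sum Q (As ! j) = d j" if j: "j < m" for j
  proof -
    have fin: "finite (As ! j)" using assms j by (auto simp: disjoint_list_def m_def)
    have mem: "a i \<in> As ! j \<longleftrightarrow> i = j" if "i < m" for i
      using assms a[OF that] a[OF j] that j by (auto simp: disjoint_list_def m_def)
    have "sum Q (As ! j) = (\<Sum>i<m. \<Sum>k\<in>As ! j. if k = a i then d i else 0)"
      unfolding Q_def by (rule sum.swap)
    also have "\<dots> = (\<Sum>i<m. if i = j then d i else 0)"
      using fin mem by (intro sum.cong refl) simp
    also have "\<dots> = d j" using j by simp
    finally show ?thesis .
  qed
  then show ?thesis by (auto simp: m_def)
qed

section \<open>Restriction of the correlator to lines through the origin\<close>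

lemma pullback_line_near:
  assumes "finite K" "\<And>i. i < length As \<Longrightarrow> As ! i \<subseteq> K" "R > 0" "norm t0 \<le> 1"
  shows "\<exists>\<rho>>0. \<forall>P\<in>point_box K \<rho> p. \<forall>t. norm (t - t0) < \<rho> \<longrightarrow> pullback As (scaled P t) \<in> polydisc (pullback As (scaled p t0)) R"
proof -
  define S where "S = (\<Sum>k\<in>K. norm (p k))"
  define c where "c = real (card K)"
  have S: "S \<ge> 0" by (simp add: S_def sum_nonneg)
  have c: "c \<ge> 0" by (simp add: c_def)
  \<comment> \<open>\<open>S\<close> bounds the partial sums of \<open>p\<close> and
    \<open>c\<close> counts coordinates; moving \<open>P\<close> and \<open>t\<close> by
    \<open>\<rho> <= 1\<close> changes an entry by at most
    \<open>\<rho> * (S + 2 * c)\<close>.\<close>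
  define \<rho> where "\<rho> = min 1 (R / (S + 2 * c + 1))"
  have \<rho>: "\<rho> > 0" "\<rho> \<le> 1" using assms(3) S c by (auto simp: \<rho>_def)
  have "\<rho> * (S + 2 * c + 1) \<le> R / (S + 2 * c + 1) * (S + 2 * c + 1)"
    using S c by (intro mult_right_mono) (auto simp: \<rho>_def)
  moreover have "R / (S + 2 * c + 1) * (S + 2 * c + 1) = R" using S c by simp
  moreover have "\<rho> * (S + 2 * c + 1) = \<rho> * (S + 2 * c) + \<rho>" by (simp add: algebra_simps)
  ultimately have \<rho>R: "\<rho> * (S + 2 * c) < R"
    using \<rho>(1) by linarith
  have "pullback As (scaled P t) \<in> polydisc (pullback As (scaled p t0)) R"
    if P: "P \<in> point_box K \<rho> p" and t: "norm (t - t0) < \<rho>" for P t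
  proof -
    have "norm (t * sum P A - t0 * sum p A) < R" if A: "A \<subseteq> K" for A
    proof -
      have fA: "finite A" using A assms(1) finite_subset by blast
      have "norm (sum P A - sum p A) \<le> (\<Sum>k\<in>A. norm (P k - p k))"
        unfolding sum_subtractf [symmetric] by (rule norm_sum)
      also have "\<dots> \<le> (\<Sum>k\<in>K. norm (P k - p k))" using A assms(1) by (intro sum_mono2) auto
      also have "\<dots> \<le> c * \<rho>" unfolding c_def using P by (intro sum_bounded_above) (auto simp: point_box_def less_imp_le)
      finally have d: "norm (sum P A - sum p A) \<le> c * \<rho>" .
      have "norm (sum p A) \<le> (\<Sum>k\<in>A. norm (p k))" by (rule norm_sum)
      also have "\<dots> \<le> S" unfolding S_def using A assms(1) by (intro sum_mono2) auto
      finally have p: "norm (sum p A) \<le> S" .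
      have "norm (sum P A) \<le> norm (sum p A) + norm (sum P A - sum p A)" by norm
      also have "\<dots> \<le> S + c * 1" using p d \<rho>(2) c mult_left_mono[of \<rho> 1 c] by linarith
      finally have P': "norm (sum P A) \<le> S + c" by simp
      have "t * sum P A - t0 * sum p A = (t - t0) * sum P A + t0 * (sum P A - sum p A)" by (simp add: algebra_simps)
      then have "norm (t * sum P A - t0 * sum p A) \<le> norm (t - t0) * norm (sum P A) + norm t0 * norm (sum P A - sum p A)"
        by (metis norm_mult norm_triangle_ineq)
      also have "\<dots> \<le> \<rho> * (S + c) + 1 * (c * \<rho>)"
        using t P' d assms(4) \<rho> by (intro add_mono mult_mono) auto
      also have "\<dots> < R" using \<rho>R by (simp add: algebra_simps)
      finally show ?thesis .
    qed
    then show ?thesis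
      using assms(2) by (auto simp: polydisc_def pullback_line_nth)
  qed
  then show ?thesis using \<rho>(1) by blast
qed

text \<open>\<open>H\<close> is the denominator at a single parameter of the line. Where it is
  nonzero, the denominator has only isolated zeros along the line inside the disc, and the values of
  \<open>F\<close> there do not affect meromorphy.\<close>

lemma meromorphic_pullback_local:
  assumes F: "meromorphic_on_Cn (length As) F" and As: "disjoint_list As"
    and K: "finite K" "\<And>i. i < length As \<Longrightarrow> As ! i \<subseteq> K" and t0: "norm t0 \<le> 1"
  shows "\<exists>\<rho>>0. \<exists>H. generic_fun K \<rho> p H \<and>
     (\<forall>P\<in>point_box K \<rho> p. H P \<noteq> 0 \<longrightarrow> (\<lambda>t. F (pullback As (scaled P t))) meromorphic_on ball t0 \<rho>)"
proof -
  define x0 where "x0 = pullback As (scaled p t0)"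
  have len: "length x0 = length As" by (simp add: x0_def)
  obtain g h where gh: "holomorphic_at g x0" "holomorphic_at h x0" "\<And>s. s > 0 \<Longrightarrow> \<exists>x\<in>polydisc x0 s. h x \<noteq> 0"
    and ex: "\<exists>r>0. \<forall>x\<in>polydisc x0 r. h x \<noteq> 0 \<longrightarrow> F x = g x / h x"
    using F len unfolding meromorphic_on_Cn_def by blast
  from ex obtain r where r: "r > 0" "\<And>x. x \<in> polydisc x0 r \<Longrightarrow> h x \<noteq> 0 \<Longrightarrow> F x = g x / h x" by blast
  obtain rg where rg: "rg > 0" "holomorphic_along_discs g x0 rg" using holomorphic_at_along_discs[OF gh(1)] by blast
  obtain rh where rh: "rh > 0" "holomorphic_along_discs h x0 rh" using holomorphic_at_along_discs[OF gh(2)] by blast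
  define R where "R = min r (min rg rh)"
  have R: "R > 0" "R \<le> r" "R \<le> rg" "R \<le> rh" using r rg rh by (auto simp: R_def)
  have hd: "holomorphic_along_discs g x0 R" "holomorphic_along_discs h x0 R" using rg rh R holomorphic_along_discs_mono by blast+
  obtain \<rho> where \<rho>: "\<rho> > 0" and near: "\<And>P t. P \<in> point_box K \<rho> p \<Longrightarrow> norm (t - t0) < \<rho> \<Longrightarrow>
       pullback As (scaled P t) \<in> polydisc x0 R"
    using pullback_line_near[OF K R(1) t0, of p] unfolding x0_def by blast
  \<comment> \<open>At parameter 0 all lines meet in the origin and the denominator would not depend
    on \<open>P\<close>, so it is tested at a nonzero parameter.\<close>
  define t' where "t' = (if t0 = 0 then of_real (\<rho> / 2) else t0)"
  have t': "t' \<noteq> 0" "norm (t' - t0) < \<rho>" using \<rho> by (auto simp: t'_def)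
  define H where "H = (\<lambda>P. h (pullback As (scaled P t')))"
  have pself: "p \<in> point_box K \<rho>' p" if "\<rho>' > 0" for \<rho>' using that by (simp add: point_box_def)
  have entry: "pullback As (scaled (point_segment P Q \<tau>) t') ! i = t' * (sum P (As ! i) + \<tau> * (sum Q (As ! i) - sum P (As ! i)))"
    if "i < length As" for P Q \<tau> i
    unfolding pullback_line_nth[OF that] point_segment_def
    by (simp add: sum.distrib sum_distrib_left [symmetric] sum_subtractf)
  have hol: "(\<lambda>\<tau>. H (point_segment P Q \<tau>)) holomorphic_on D"
    if "open D" "\<And>\<tau>. \<tau> \<in> D \<Longrightarrow> pullback As (scaled (point_segment P Q \<tau>) t') \<in> polydisc x0 R" for P Q D
  proof -
    have "(\<lambda>\<tau>. pullback As (scaled (point_segment P Q \<tau>) t') ! i) holomorphic_on D" if "i < length As" for i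
      unfolding entry[OF that] by (intro holomorphic_intros)
    then show ?thesis using hd(2)[unfolded holomorphic_along_discs_def, rule_format, of D "\<lambda>\<tau>. pullback As (scaled (point_segment P Q \<tau>) t')"] that len
      by (simp add: H_def)
  qed
  have "generic_fun K \<rho> p H"
    unfolding generic_fun_def
  proof (intro conjI ballI allI impI)
    fix P Q assume "P \<in> point_box K \<rho> p" "Q \<in> point_box K \<rho> p"
    show "(\<lambda>\<tau>. H (point_segment P Q \<tau>)) holomorphic_on {\<tau>. point_segment P Q \<tau> \<in> point_box K \<rho> p}"
      by (rule hol[OF open_point_segment[OF K(1)]]) (use near t' in auto)
  next
    fix \<eta> :: real assume \<eta>: "\<eta> > 0"
    obtain x where x: "x \<in> polydisc x0 R" "h x \<noteq> 0" using gh(3)[OF R(1)] by blast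
    \<comment> \<open>\<open>Q\<close> may lie far outside the box. The parameters that keep the
      segment inside the polydisc form a convex set containing 0 and 1, and nonvanishing at 1
      propagates to parameters near 0, where the point is in the small box.\<close>
    obtain Q where Q: "\<And>i. i < length As \<Longrightarrow> sum Q (As ! i) = x ! i / t'"
      using pullback_solve[OF As, of "\<lambda>i. x ! i / t'"] by blast
    have xQ: "pullback As (scaled Q t') = x"
      using x(1) t' Q by (intro nth_equalityI) (auto simp: polydisc_def len pullback_line_nth)
    define D where "D = {\<tau>. pullback As (scaled (point_segment p Q \<tau>) t') \<in> polydisc x0 R}"
    have Dalt: "D = (\<Inter>i\<in>{..<length As}. {\<tau>. norm (t' * sum p (As ! i) + \<tau> * (t' * (sum Q (As ! i) - sum p (As ! i))) - x0 ! i) < R})"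
      unfolding D_def polydisc_def by (auto simp: len entry algebra_simps)
    have "open D" unfolding Dalt by (intro open_INT ballI open_Collect_less continuous_intros) simp
    moreover have "connected D" unfolding Dalt by (intro convex_connected convex_Inter) (auto intro: convex_affine_preimage)
    moreover have "0 \<in> D" using near[OF pself[OF \<rho>] t'(2)] by (simp add: D_def point_segment_def)
    moreover have 1: "1 \<in> D" using x xQ by (simp add: D_def point_segment_def)
    moreover have "(\<lambda>\<tau>. H (point_segment p Q \<tau>)) holomorphic_on D"
      by (rule hol[OF \<open>open D\<close>]) (simp add: D_def)
    moreover have "H (point_segment p Q 1) \<noteq> 0" using x(2) xQ by (simp add: H_def point_segment_def)
    ultimately have e1: "eventually (\<lambda>\<tau>. H (point_segment p Q \<tau>) \<noteq> 0 \<and> \<tau> \<in> D) (at 0)"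
      by (intro non_zero_neighbour_alt[of "\<lambda>\<tau>. H (point_segment p Q \<tau>)" D 0 1])
    have "eventually (\<lambda>\<tau>. \<tau> \<in> {\<tau>. point_segment p Q \<tau> \<in> point_box K \<eta> p}) (at 0)"
      by (rule eventually_at_in_open'[OF open_point_segment[OF K(1)]]) (use pself[OF \<eta>] in \<open>simp add: point_segment_def\<close>)
    from eventually_happens'[OF at_neq_bot eventually_conj[OF e1 this]]
    show "\<exists>P\<in>point_box K \<eta> p. H P \<noteq> 0" by blast
  qed
  moreover have "(\<lambda>t. F (pullback As (scaled P t))) meromorphic_on ball t0 \<rho>"
    if P: "P \<in> point_box K \<rho> p" "H P \<noteq> 0" for P
  proof -
    let ?B = "ball t0 \<rho>"
    have nearB: "pullback As (scaled P t) \<in> polydisc x0 R" if "t \<in> ?B" for t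
      using near[OF P(1)] that by (simp add: dist_norm norm_minus_commute)
    have ent: "\<forall>i<length x0. (\<lambda>t. pullback As (scaled P t) ! i) holomorphic_on ?B"
      using len by (auto simp: pullback_line_nth intro!: holomorphic_intros)
    have hg: "(\<lambda>t. g (pullback As (scaled P t))) holomorphic_on ?B" "(\<lambda>t. h (pullback As (scaled P t))) holomorphic_on ?B"
      using hd[unfolded holomorphic_along_discs_def, rule_format, of ?B "\<lambda>t. pullback As (scaled P t)"] ent nearB by auto
    have t'B: "t' \<in> ?B" using t'(2) by (simp add: dist_norm norm_minus_commute)
    have "(\<lambda>t. g (pullback As (scaled P t)) / h (pullback As (scaled P t))) meromorphic_on ?B"
      using hg by (intro meromorphic_intros analytic_on_imp_meromorphic_on) (auto simp: analytic_on_open)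
    moreover have "eventually (\<lambda>t. g (pullback As (scaled P t)) / h (pullback As (scaled P t)) = F (pullback As (scaled P t))) (at z)"
      if z: "z \<in> ?B" for z
    proof -
      have "eventually (\<lambda>t. h (pullback As (scaled P t)) \<noteq> 0 \<and> t \<in> ?B) (at z)"
        by (rule non_zero_neighbour_alt[OF hg(2) open_ball connected_ball z t'B]) (use P(2) in \<open>simp add: H_def\<close>)
      then show ?thesis
      proof eventually_elim
        case (elim t)
        then have "pullback As (scaled P t) \<in> polydisc x0 r" using nearB[of t] polydisc_mono[OF R(2)] by blast
        then show ?case using r(2) elim by simp
      qed
    qed
    ultimately show ?thesis by (subst meromorphic_on_cong[symmetric]) auto
  qed
  ultimately show ?thesis using \<rho> by blast
qed

text \<open>By compactness finitely many discs cover the segment, so finitely many conditions on the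
  smallest box suffice.\<close>

lemma meromorphic_pullback_line:
  assumes F: "meromorphic_on_Cn (length As) F" and As: "disjoint_list As"
    and K: "finite K" "\<And>i. i < length As \<Longrightarrow> As ! i \<subseteq> K"
  shows "\<exists>\<eta>>0. \<exists>Hs. finite Hs \<and> (\<forall>H\<in>Hs. generic_fun K \<eta> p H) \<and>
     (\<forall>P\<in>point_box K \<eta> p. (\<forall>H\<in>Hs. H P \<noteq> 0) \<longrightarrow> (\<lambda>t. F (pullback As (scaled P t))) meromorphic_on closed_segment 0 1)"
proof -
  let ?S = "closed_segment 0 1 :: complex set"
  have n1: "norm t \<le> 1" if "t \<in> ?S" for t
    using that by (auto simp: closed_segment_def norm_mult)
  have "\<forall>t0\<in>?S. \<exists>\<rho>>0. \<exists>H. generic_fun K \<rho> p H \<and>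
     (\<forall>P\<in>point_box K \<rho> p. H P \<noteq> 0 \<longrightarrow> (\<lambda>t. F (pullback As (scaled P t))) meromorphic_on ball t0 \<rho>)"
    using meromorphic_pullback_local[OF F As K n1] by blast
  then obtain \<rho> H where \<rho>: "\<And>t0. t0 \<in> ?S \<Longrightarrow> \<rho> t0 > 0" "\<And>t0. t0 \<in> ?S \<Longrightarrow> generic_fun K (\<rho> t0) p (H t0)"
    "\<And>t0 P. t0 \<in> ?S \<Longrightarrow> P \<in> point_box K (\<rho> t0) p \<Longrightarrow> H t0 P \<noteq> 0 \<Longrightarrow> (\<lambda>t. F (pullback As (scaled P t))) meromorphic_on ball t0 (\<rho> t0)"
    by metis
  have "?S \<subseteq> (\<Union>t0\<in>?S. ball t0 (\<rho> t0))" using \<rho>(1) by (auto intro!: bexI)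
  then obtain T where T: "T \<subseteq> ?S" "finite T" "?S \<subseteq> (\<Union>t0\<in>T. ball t0 (\<rho> t0))"
    using compactE_image[of ?S ?S "\<lambda>t0. ball t0 (\<rho> t0)"] compact_segment open_ball by metis
  have "0 \<in> ?S" by simp
  then have Tn: "T \<noteq> {}" using T(3) by auto
  define \<eta> where "\<eta> = Min (\<rho> ` T)"
  have \<eta>: "\<eta> > 0" "\<And>t. t \<in> T \<Longrightarrow> \<eta> \<le> \<rho> t" using T Tn \<rho>(1) by (auto simp: \<eta>_def)
  have "(\<lambda>t. F (pullback As (scaled P t))) meromorphic_on ?S" if P: "P \<in> point_box K \<eta> p" "\<forall>G\<in>H ` T. G P \<noteq> 0" for P
  proof -
    have "(\<lambda>t. F (pullback As (scaled P t))) meromorphic_on ball t0 (\<rho> t0)" if t0: "t0 \<in> T" for t0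
      using \<rho>(3)[of t0 P] point_box_mono[OF \<eta>(2)[OF t0], of K p] P t0 T(1) by blast
    then have "(\<lambda>t. F (pullback As (scaled P t))) meromorphic_on (\<Union>t0\<in>T. ball t0 (\<rho> t0))"
      by (subst meromorphic_on_UN) auto
    then show ?thesis using T(3) by (rule meromorphic_on_subset)
  qed
  moreover have "generic_fun K \<eta> p G" if "G \<in> H ` T" for G
    using that \<rho>(2) \<eta>(2) T(1) generic_fun_mono by blast
  ultimately show ?thesis using \<eta>(1) T(2) by (intro exI[of _ \<eta>] conjI exI[of _ "H ` T"]) auto
qed

lemma exists_generic_line:
  assumes "finite \<A>" and F: "\<And>As. As \<in> \<A> \<Longrightarrow> meromorphic_on_Cn (length As) F \<and> disjoint_list As \<and> (\<forall>i<length As. As ! i \<subseteq> K)"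
    and K: "finite K" and \<epsilon>: "\<epsilon> > 0"
  shows "\<exists>P\<in>point_box K \<epsilon> p. (\<forall>As\<in>\<A>. (\<lambda>t. F (pullback As (scaled P t))) meromorphic_on closed_segment 0 1) \<and>
     (\<forall>A. A \<subseteq> K \<and> A \<noteq> {} \<longrightarrow> sum P A \<noteq> 0)"
proof -
  define W where "W = (\<lambda>As \<eta> Hs. \<eta> > 0 \<and> finite Hs \<and> (\<forall>H\<in>Hs. generic_fun K \<eta> p H) \<and>
     (\<forall>P\<in>point_box K \<eta> p. (\<forall>H\<in>Hs. H P \<noteq> 0) \<longrightarrow> (\<lambda>t. F (pullback As (scaled P t))) meromorphic_on closed_segment 0 1))"
  have "\<forall>As\<in>\<A>. \<exists>\<eta> Hs. W As \<eta> Hs"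
    using meromorphic_pullback_line[OF _ _ K(1), of _ F p] F unfolding W_def by simp
  then obtain \<eta> Hs where "\<And>As. As \<in> \<A> \<Longrightarrow> W As (\<eta> As) (Hs As)"
    by metis
  then have h: "\<And>As. As \<in> \<A> \<Longrightarrow> \<eta> As > 0" "\<And>As. As \<in> \<A> \<Longrightarrow> finite (Hs As)"
    "\<And>As H. As \<in> \<A> \<Longrightarrow> H \<in> Hs As \<Longrightarrow> generic_fun K (\<eta> As) p H"
    "\<And>As P. As \<in> \<A> \<Longrightarrow> P \<in> point_box K (\<eta> As) p \<Longrightarrow> (\<forall>H\<in>Hs As. H P \<noteq> 0) \<Longrightarrow>
       (\<lambda>t. F (pullback As (scaled P t))) meromorphic_on closed_segment 0 1"
    by (simp_all add: W_def)
  define e where "e = Min (insert \<epsilon> (\<eta> ` \<A>))"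
  have e: "e > 0" "e \<le> \<epsilon>" "\<And>As. As \<in> \<A> \<Longrightarrow> e \<le> \<eta> As" using assms(1) \<epsilon> h(1) by (auto simp: e_def)
  define G where "G = (\<Union>As\<in>\<A>. Hs As) \<union> (\<lambda>A P. sum P A) ` (Pow K - {{}})"
  have "\<exists>P\<in>point_box K e p. \<forall>H\<in>G. H P \<noteq> 0"
  proof (rule exists_generic_point[OF _ K e(1)])
    show "finite G" using assms(1) h(2) K by (auto simp: G_def)
    show "generic_fun K e p H" if "H \<in> G" for H
    proof -
      from that consider As where "As \<in> \<A>" "H \<in> Hs As" | A where "A \<subseteq> K" "A \<noteq> {}" "H = (\<lambda>P. sum P A)"
        unfolding G_def by blast
      then show ?thesis
      proof cases
        case 1
        then show ?thesis using generic_fun_mono[OF h(3)[OF 1] e(3)[OF 1(1)]] by simp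
      next
        case 2
        then show ?thesis using generic_fun_sum[OF K 2(1,2)] by simp
      qed
    qed
  qed
  then obtain P where P: "P \<in> point_box K e p" "\<And>H. H \<in> G \<Longrightarrow> H P \<noteq> 0" by blast
  show ?thesis
  proof (intro bexI[of _ P] conjI ballI allI impI)
    fix As assume As: "As \<in> \<A>"
    show "(\<lambda>t. F (pullback As (scaled P t))) meromorphic_on closed_segment 0 1"
      by (rule h(4)[OF As]) (use P point_box_mono[OF e(3)[OF As], of K p] As in \<open>auto simp: G_def\<close>)
  next
    fix A assume "A \<subseteq> K \<and> A \<noteq> {}"
    then have "(\<lambda>P. sum P A) \<in> G" by (auto simp: G_def)
    then show "sum P A \<noteq> 0" using P(2) by blast
  next
    show "P \<in> point_box K \<epsilon> p" using P(1) point_box_mono[OF e(2)] by blast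
  qed
qed

text \<open>At each point the Laurent expansion is zero or not, so \<open>f\<close> is identically
  zero or nowhere zero in a punctured neighbourhood. Both alternatives are open, and the segment is
  connected.\<close>

lemma meromorphic_zero_continuation:
  assumes f: "f meromorphic_on closed_segment 0 1" and z: "eventually (\<lambda>t. f t = 0) (at 0)"
  shows "eventually (\<lambda>t. f t = 0) (at 1)"
proof -
  let ?S = "closed_segment 0 1 :: complex set"
  define A where "A = {t \<in> ?S. eventually (\<lambda>w. f w = 0) (at t)}"
  define B where "B = {t \<in> ?S. eventually (\<lambda>w. f w \<noteq> 0) (at t)}"
  have op: "\<exists>T. open T \<and> {t \<in> ?S. eventually Q (at t)} = T \<inter> ?S" for Q
  proof -
    have "open {t. eventually Q (at t)}"
    proof (subst open_subopen, intro ballI)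
      fix t assume "t \<in> {t. eventually Q (at t)}"
      then obtain U where U: "open U" "t \<in> U" "\<forall>w\<in>U. w \<noteq> t \<longrightarrow> Q w"
        by (auto simp: eventually_at_topological)
      have "eventually Q (at s)" if "s \<in> U" for s
      proof (cases "s = t")
        case True
        then show ?thesis using U by (auto simp: eventually_at_topological)
      next
        case False
        then have "open (U - {t})" "s \<in> U - {t}" "\<forall>w\<in>U - {t}. Q w" using U that by auto
        then show ?thesis unfolding eventually_at_topological by (intro exI[of _ "U - {t}"]) auto
      qed
      then show "\<exists>T. open T \<and> t \<in> T \<and> T \<subseteq> {t. eventually Q (at t)}"
        using U by (intro exI[of _ U]) auto
    qed
    then show ?thesis by (intro exI[of _ "{t. eventually Q (at t)}"]) auto
  qed
  have dich: "t \<in> A \<or> t \<in> B" if t: "t \<in> ?S" for t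
  proof -
    obtain L where L: "(\<lambda>w. f (t + w)) has_laurent_expansion L"
      using f t by (auto simp: meromorphic_on_def)
    show ?thesis
    proof (cases "L = 0")
      case True
      then show ?thesis using L t has_laurent_expansion_eventually_zero_iff[OF L] by (simp add: A_def)
    next
      case False
      then show ?thesis using L t has_laurent_expansion_eventually_nonzero_iff[OF L] by (simp add: B_def)
    qed
  qed
  have "A \<inter> B = {}"
  proof -
    have False if "eventually (\<lambda>w. f w = 0) (at t)" "eventually (\<lambda>w. f w \<noteq> 0) (at t)" for t
      using eventually_happens'[OF at_neq_bot eventually_conj[OF that]] by blast
    then show ?thesis by (auto simp: A_def B_def)
  qed
  moreover have "A \<union> B = ?S" using dich by (auto simp: A_def B_def)
  moreover obtain TA TB where T: "open TA" "A = TA \<inter> ?S" "open TB" "B = TB \<inter> ?S"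
    using op[of "\<lambda>w. f w = 0"] op[of "\<lambda>w. f w \<noteq> 0"] unfolding A_def B_def by blast
  moreover have "0 \<in> A" using z by (simp add: A_def)
  moreover have "connected ?S" by simp
  ultimately have "B = {}"
    using connectedD[of ?S TA TB] by auto
  then have "1 \<in> A" using dich[of 1] by simp
  then show ?thesis by (simp add: A_def)
qed

section \<open>The two-point identity at generic points\<close>

definition bo_identity :: "complex \<Rightarrow> (complex list \<Rightarrow> complex) \<Rightarrow> complex \<Rightarrow> complex \<Rightarrow> (nat \<Rightarrow> complex) \<Rightarrow> nat set \<Rightarrow> bool" where
  "bo_identity q F u v z N \<longleftrightarrow>
     F (u # v # vars z N) = (\<Sum>J\<in>Pow N. F ((u + v + sum z J) # vars z (N - J)) * bo_M2 q u v z J)"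

text \<open>\<open>B i\<close> collects the coordinates whose sum is variable \<open>i\<close>.
  Larger blocks allow \<open>u + v\<close> to be a single variable of one identity at a point where
  another identity has \<open>u\<close> and \<open>v\<close> as separate variables.\<close>

definition disjoint_blocks :: "nat set \<Rightarrow> (nat \<Rightarrow> nat set) \<Rightarrow> nat \<Rightarrow> nat \<Rightarrow> nat set \<Rightarrow> bool" where
  "disjoint_blocks K B a b N \<longleftrightarrow> finite N \<and> a \<notin> N \<and> b \<notin> N \<and> a \<noteq> b \<and>
     (\<forall>i\<in>insert a (insert b N). B i \<subseteq> K \<and> B i \<noteq> {}) \<and>
     disjoint_family_on B (insert a (insert b N))"

lemma sum_UN_blocks:
  assumes "finite K" "disjoint_blocks K B a b N" "J \<subseteq> insert a (insert b N)"
  shows "sum P (\<Union>(B ` J)) = (\<Sum>i\<in>J. sum P (B i))"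
proof (rule sum.UNION_disjoint)
  show "finite J" using assms by (meson disjoint_blocks_def finite.insertI finite_subset)
  show "\<forall>i\<in>J. finite (B i)" using assms unfolding disjoint_blocks_def by (meson finite_subset subsetD)
  show "\<forall>i\<in>J. \<forall>j\<in>J. i \<noteq> j \<longrightarrow> B i \<inter> B j = {}"
    using disjoint_family_onD[of B "insert a (insert b N)"] assms(2,3) by (simp add: disjoint_blocks_def subset_iff)
qed

lemma disjoint_list_blocks:
  assumes "distinct xs" "disjoint_family_on B (set xs)" "\<And>i. i \<in> set xs \<Longrightarrow> finite (B i) \<and> B i \<noteq> {}"
  shows "disjoint_list (map B xs)"
  unfolding disjoint_list_def length_map
proof (intro conjI allI impI)
  fix i assume i: "i < length xs"
  then show "finite (map B xs ! i)" "map B xs ! i \<noteq> {}" using assms(3)[of "xs ! i"] by auto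
  fix j assume j: "j < length xs" "i \<noteq> j"
  then have "xs ! i \<noteq> xs ! j" using i assms(1) by (simp add: nth_eq_iff_index_eq)
  then show "map B xs ! i \<inter> map B xs ! j = {}"
    using disjoint_family_onD[OF assms(2)] i j by simp
qed

lemma disjoint_list_Cons:
  assumes "disjoint_list As" "finite A" "A \<noteq> {}" "\<And>i. i < length As \<Longrightarrow> A \<inter> As ! i = {}"
  shows "disjoint_list (A # As)"
  unfolding disjoint_list_def
proof (intro conjI allI impI)
  fix i assume "i < length (A # As)"
  then show "finite ((A # As) ! i)" "(A # As) ! i \<noteq> {}" using assms by (cases i; auto simp: disjoint_list_def)+
next
  fix i j assume "i < length (A # As)" "j < length (A # As)" "i \<noteq> j"
  then show "(A # As) ! i \<inter> (A # As) ! j = {}"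
    using assms by (cases i; cases j) (auto simp: disjoint_list_def Int_commute)
qed

lemma bo_Z_scaled_meromorphic:
  assumes "norm q < 1" "q \<noteq> 0" "c \<noteq> 0"
  shows "(\<lambda>t. bo_Z q l (t * c)) meromorphic_on A"
proof (rule meromorphic_on_compose[OF bo_Z_meromorphic[OF assms(1,2), of _ UNIV]])
  show "(\<lambda>t. t * c) analytic_on A" by (intro analytic_intros)
qed simp

lemma open_bo_theta_nonzero:
  assumes "norm q < 1" "q \<noteq> 0"
  shows "open {x. bo_theta q x \<noteq> 0}"
proof (rule open_Collect_neq[OF _ continuous_on_const])
  show "continuous_on UNIV (bo_theta q)"
    by (intro holomorphic_on_imp_continuous_on bo_theta_holomorphic assms)
qed

lemma bo_Z_isCont:
  assumes "norm q < 1" "q \<noteq> 0" "bo_theta q x \<noteq> 0"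
  shows "isCont (bo_Z q l) x"
proof -
  show ?thesis
  using holomorphic_on_imp_continuous_on[OF bo_Z_holomorphic[OF assms(1,2), of "{x. bo_theta q x \<noteq> 0}"]]
    open_bo_theta_nonzero[OF assms(1,2)] assms(3)
  by (simp add: continuous_on_eq_continuous_at)
qed

lemma deriv_bo_Z_isCont:
  assumes "norm q < 1" "q \<noteq> 0" "bo_theta q x \<noteq> 0"
  shows "isCont (deriv (bo_Z q l)) x"
proof -
  show ?thesis
  using holomorphic_on_imp_continuous_on[OF holomorphic_deriv[OF bo_Z_holomorphic[OF assms(1,2), of "{x. bo_theta q x \<noteq> 0}"]]]
    open_bo_theta_nonzero[OF assms(1,2)] assms(3)
  by (simp add: continuous_on_eq_continuous_at)
qed

text \<open>Both points move, so the definition of the derivative is not enough. Continuity of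
  \<open>deriv f\<close> makes \<open>f x - deriv f u * x\<close> Lipschitz near \<open>u\<close>
  with an arbitrarily small constant.\<close>

lemma holomorphic_difference_quotient_tendsto:
  assumes f: "f holomorphic_on A" "open A" "u \<in> A"
    and lim: "X \<longlonglongrightarrow> u" "Y \<longlonglongrightarrow> u" and ne: "\<And>n. X n \<noteq> Y n"
  shows "(\<lambda>n. (f (X n) - f (Y n)) / (X n - Y n)) \<longlonglongrightarrow> deriv f u"
proof (rule tendstoI)
  fix e :: real assume e: "e > 0"
  have "isCont (deriv f) u"
    using holomorphic_on_imp_continuous_on[OF holomorphic_deriv[OF f(1,2)]] f by (simp add: continuous_on_eq_continuous_at)
  then obtain d where d: "d > 0" "\<And>x. dist x u < d \<Longrightarrow> dist (deriv f x) (deriv f u) < e / 2"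
    unfolding continuous_at_eps_delta using e by (meson half_gt_zero)
  obtain d' where d': "d' > 0" "ball u d' \<subseteq> A" using f by (meson openE)
  let ?B = "ball u (min d d')"
  have "norm ((f x - deriv f u * x) - (f y - deriv f u * y)) \<le> e / 2 * norm (x - y)" if "x \<in> ?B" "y \<in> ?B" for x y
  proof (rule field_differentiable_bound[where S = ?B and f' = "\<lambda>x. deriv f x - deriv f u"])
    fix z assume z: "z \<in> ?B"
    then have "(f has_field_derivative deriv f z) (at z)"
      using f d' by (intro holomorphic_derivI[OF f(1,2)]) auto
    then show "((\<lambda>x. f x - deriv f u * x) has_field_derivative deriv f z - deriv f u) (at z within ?B)"
      by (auto intro!: derivative_eq_intros intro: has_field_derivative_at_within)
    show "norm (deriv f z - deriv f u) \<le> e / 2"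
      using d(2)[of z] z by (simp add: dist_norm dist_commute norm_minus_commute less_imp_le)
  qed (use that in auto)
  then have b: "norm ((f x - f y) - deriv f u * (x - y)) \<le> e / 2 * norm (x - y)" if "x \<in> ?B" "y \<in> ?B" for x y
    using that by (simp add: algebra_simps)
  have "eventually (\<lambda>n. X n \<in> ?B) sequentially" "eventually (\<lambda>n. Y n \<in> ?B) sequentially"
    using lim d(1) d'(1) by (auto intro: topological_tendstoD simp del: mem_ball)
  then show "eventually (\<lambda>n. dist ((f (X n) - f (Y n)) / (X n - Y n)) (deriv f u) < e) sequentially"
  proof eventually_elim
    case (elim n)
    have "(f (X n) - f (Y n)) / (X n - Y n) - deriv f u = ((f (X n) - f (Y n)) - deriv f u * (X n - Y n)) / (X n - Y n)"
      using ne[of n] by (simp add: diff_divide_distrib)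
    then have "dist ((f (X n) - f (Y n)) / (X n - Y n)) (deriv f u) \<le> e / 2"
      using b[OF elim] ne[of n] by (simp add: dist_norm norm_divide divide_le_eq)
    then show ?case using e by simp
  qed
qed

text \<open>Oddness is visible in \<open>bo_Z_small\<close> near the origin and is continued along
  the multiples of \<open>u\<close>. At the endpoint continuity applies, as theta is nonzero at
  \<open>u\<close> and \<open>- u\<close>.\<close>

lemma bo_Z_0_odd:
  assumes q: "norm q < 1" "q \<noteq> 0" and u: "bo_theta q u \<noteq> 0" "bo_theta q (- u) \<noteq> 0"
  shows "bo_Z q 0 (- u) = - bo_Z q 0 u"
proof -
  have u0: "u \<noteq> 0" using u(1) bo_theta_0[OF q(2,1)] by auto
  define f where "f = (\<lambda>t. bo_Z q 0 (t * u) + bo_Z q 0 (t * (- u)))"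
  have "f meromorphic_on closed_segment 0 1"
    unfolding f_def by (intro meromorphic_intros bo_Z_scaled_meromorphic q) (use u0 in auto)
  moreover have "eventually (\<lambda>t. f t = 0) (at 0)"
  proof -
    have f1: "filterlim (\<lambda>t. t * u) (at 0) (at 0)"
      using u0 by (auto simp: filterlim_at eventually_at_filter intro!: tendsto_eq_intros)
    have f2: "filterlim (\<lambda>t. t * (- u)) (at 0) (at 0)"
      using u0 by (auto simp: filterlim_at eventually_at_filter intro!: tendsto_eq_intros)
    have "eventually (\<lambda>w. small_arg q w) (at 0)" using eventually_small_arg[OF q(1)] by (simp add: eventually_at_filter eventually_mono)
    then have e: "eventually (\<lambda>w. small_arg q w \<and> exp w \<noteq> 1 \<and> bo_theta q w \<noteq> 0) (at 0)"
      using eventually_exp_neq_1 bo_theta_eventually_nonzero[OF q u(1), of 0] by eventually_elim auto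
    show ?thesis
      using eventually_compose_filterlim[OF e f1] eventually_compose_filterlim[OF e f2]
    proof eventually_elim
      case (elim t)
      define x where "x = t * u"
      have x: "small_arg q x" "exp x \<noteq> 1" "bo_theta q x \<noteq> 0" "small_arg q (- x)" "exp (- x) \<noteq> 1" "bo_theta q (- x) \<noteq> 0"
        using elim by (simp_all add: x_def)
      have "Z_series q 0 (- x) = - Z_series q 0 x"
        unfolding Z_series_def infsum_uminus [symmetric] by (intro infsum_cong) (simp add: algebra_simps)
      moreover have "hcoth (- x) = - hcoth x"
        using x(2) by (simp add: hcoth_def exp_minus divide_simps) (simp add: algebra_simps)
      ultimately have "bo_Z q 0 (- x) = - bo_Z q 0 x"
        unfolding bo_Z_small[OF q x(1-3)] bo_Z_small[OF q x(4-6)] One_nat_def[symmetric] hcoth_fps_1 by simp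
      then show ?case by (simp add: f_def x_def)
    qed
  qed
  ultimately have "eventually (\<lambda>t. f t = 0) (at 1)" by (rule meromorphic_zero_continuation)
  moreover have "isCont f 1"
  proof -
    have "isCont (\<lambda>t. bo_Z q 0 (t * x)) 1" if "bo_theta q x \<noteq> 0" for x
      by (rule isCont_o2[where g = "bo_Z q 0"]) (use bo_Z_isCont[OF q] that in \<open>auto intro!: continuous_intros\<close>)
    from isCont_add[OF this[OF u(1)] this[OF u(2)]] show ?thesis by (simp only: f_def)
  qed
  ultimately have "f 1 = 0"
    using LIM_unique[of f "f 1" 1 0] tendsto_eventually[of f 0 "at 1"] by (simp add: isCont_def)
  then show ?thesis by (simp add: f_def add_eq_0_iff)
qed

definition merged_blocks :: "(nat \<Rightarrow> nat set) \<Rightarrow> nat \<Rightarrow> nat \<Rightarrow> nat set \<Rightarrow> nat set \<Rightarrow> nat set list" where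
  "merged_blocks B a b N J = (\<Union>(B ` insert a (insert b J))) # map B (sorted_list_of_set (N - J))"

definition argument_blocks :: "(nat \<Rightarrow> nat set) \<Rightarrow> nat \<Rightarrow> nat \<Rightarrow> nat set \<Rightarrow> nat set list set" where
  "argument_blocks B a b N = insert (B a # B b # map B (sorted_list_of_set N)) (merged_blocks B a b N ` Pow N)"

lemma argument_blocks_valid:
  assumes K: "finite K" and B: "disjoint_blocks K B a b N" and As: "As \<in> argument_blocks B a b N"
  shows "disjoint_list As \<and> (\<forall>i<length As. As ! i \<subseteq> K)"
proof -
  have b: "finite N" "a \<notin> N" "b \<notin> N" "a \<noteq> b" "\<And>i. i \<in> insert a (insert b N) \<Longrightarrow> B i \<subseteq> K \<and> B i \<noteq> {} \<and> finite (B i)"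
    using B K finite_subset[of _ K] by (auto simp: disjoint_blocks_def)
  have dis: "disjoint_family_on B (insert a (insert b N))" using B by (simp add: disjoint_blocks_def)
  from As consider "As = map B (a # b # sorted_list_of_set N)" | J where "J \<subseteq> N" "As = merged_blocks B a b N J"
    by (auto simp: argument_blocks_def)
  then show ?thesis
  proof cases
    case 1
    have "disjoint_list As"
      unfolding 1 using b dis by (intro disjoint_list_blocks) auto
    moreover have "\<forall>A\<in>set As. A \<subseteq> K" unfolding 1 using b by auto
    ultimately show ?thesis by simp
  next
    case 2
    have "disjoint_list As"
      unfolding 2(2) merged_blocks_def
    proof (rule disjoint_list_Cons)
      show "disjoint_list (map B (sorted_list_of_set (N - J)))"
        using b dis by (intro disjoint_list_blocks) (auto simp: disjoint_family_on_def)
      show "finite (\<Union> (B ` insert a (insert b J)))" using b 2(1) finite_subset[OF 2(1) b(1)] by (intro finite_UN_I) auto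
      show "\<Union> (B ` insert a (insert b J)) \<noteq> {}" using b(5)[of a] by auto
      fix i assume i: "i < length (map B (sorted_list_of_set (N - J)))"
      define k where "k = sorted_list_of_set (N - J) ! i"
      have k: "k \<in> N - J" using i b(1) nth_mem[of i "sorted_list_of_set (N - J)"] by (simp add: k_def)
      have "B l \<inter> B k = {}" if "l \<in> insert a (insert b J)" for l
        using disjoint_family_onD[OF dis, of l k] that k 2(1) b by blast
      then show "\<Union> (B ` insert a (insert b J)) \<inter> map B (sorted_list_of_set (N - J)) ! i = {}"
        using i by (auto simp: k_def)
    qed
    moreover have "\<forall>A\<in>set As. A \<subseteq> K" unfolding 2(2) merged_blocks_def using b 2(1) by auto
    ultimately show ?thesis by simp
  qed
qed

text \<open>The difference of the two sides is meromorphic along the line and vanishes near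
  parameter 0. The conclusion concerns parameters near 1 but different from it, since continuation
  says nothing about the value at an individual point.\<close>

lemma bo_identity_on_line:
  assumes F: "is_bo_correlator q F" and q: "norm q < 1" "q \<noteq> 0" and th: "bo_theta q c \<noteq> 0"
    and K: "finite K" and B: "disjoint_blocks K B a b N"
    and mer: "\<And>As. As \<in> argument_blocks B a b N \<Longrightarrow> (\<lambda>t. F (pullback As (scaled P t))) meromorphic_on closed_segment 0 1"
    and nz: "\<And>A. A \<subseteq> K \<Longrightarrow> A \<noteq> {} \<Longrightarrow> sum P A \<noteq> 0"
  shows "eventually (\<lambda>t. bo_identity q F (sum (scaled P t) (B a)) (sum (scaled P t) (B b)) (\<lambda>k. sum (scaled P t) (B k)) N) (at 1)"
proof -
  have b: "finite N" "a \<notin> N" "b \<notin> N" "a \<noteq> b" "\<And>i. i \<in> insert a (insert b N) \<Longrightarrow> B i \<subseteq> K \<and> B i \<noteq> {}"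
    using B unfolding disjoint_blocks_def by blast+
  define U V Z where "U = sum P (B a)" and "V = sum P (B b)" and "Z = (\<lambda>k. sum P (B k))"
  have sl: "sum (scaled P t) A = t * sum P A" for t A by (simp add: sum_distrib_left)
  have UN: "sum P (\<Union> (B ` J)) = sum Z J" if "J \<subseteq> insert a (insert b N)" for J
    unfolding Z_def by (rule sum_UN_blocks[OF K B that])
  have ne: "sum Z J \<noteq> 0" if J: "J \<subseteq> insert a (insert b N)" "J \<noteq> {}" for J
  proof -
    obtain x where x: "x \<in> J" using J(2) by blast
    then have "B x \<noteq> {}" using b(5) J(1) by blast
    then have "\<Union> (B ` J) \<noteq> {}" using x by blast
    moreover have "\<Union> (B ` J) \<subseteq> K" using b(5) J(1) by blast
    ultimately show ?thesis unfolding UN[OF J(1), symmetric] by (intro nz)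
  qed
  have fin: "finite J" if "J \<subseteq> N" for J using that b(1) finite_subset by blast
  have s2: "U + V + sum Z J = sum Z (insert a (insert b J))" "sum Z J + U = sum Z (insert a J)" "sum Z J + V = sum Z (insert b J)"
    if "J \<subseteq> N" for J
  proof -
    have J: "finite J" "a \<notin> J" "b \<notin> J" using fin[OF that] b that by auto
    show "U + V + sum Z J = sum Z (insert a (insert b J))" "sum Z J + U = sum Z (insert a J)" "sum Z J + V = sum Z (insert b J)"
      using J b(4) by (simp_all add: U_def V_def Z_def add.assoc add.commute)
  qed
  define f where "f = (\<lambda>t. F (t * U # t * V # vars (\<lambda>k. t * Z k) N) -
     (\<Sum>J\<in>Pow N. F ((t * U + t * V + (\<Sum>k\<in>J. t * Z k)) # vars (\<lambda>k. t * Z k) (N - J)) * bo_M2 q (t * U) (t * V) (\<lambda>k. t * Z k) J))"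
  have sZ: "(\<Sum>k\<in>J. t * Z k) = t * sum Z J" for t J by (simp add: sum_distrib_left)
  have f1: "F (t * U # t * V # vars (\<lambda>k. t * Z k) N) = F (pullback (B a # B b # map B (sorted_list_of_set N)) (scaled P t))" for t
    by (simp add: pullback_def vars_def sum_distrib_left U_def V_def Z_def o_def)
  have f2: "F ((t * U + t * V + (\<Sum>k\<in>J. t * Z k)) # vars (\<lambda>k. t * Z k) (N - J)) = F (pullback (merged_blocks B a b N J) (scaled P t))"
    if "J \<subseteq> N" for t J
  proof -
    have "t * U + t * V + (\<Sum>k\<in>J. t * Z k) = t * sum P (\<Union> (B ` insert a (insert b J)))"
    proof -
      have "sum P (\<Union> (B ` insert a (insert b J))) = U + V + sum Z J"
        unfolding s2(1)[OF that] by (rule UN) (use that in blast)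
      then show ?thesis by (simp only: sZ distrib_left)
    qed
    moreover have "vars (\<lambda>k. t * Z k) (N - J) = map (sum (scaled P t)) (map B (sorted_list_of_set (N - J)))"
      by (simp add: vars_def sum_distrib_left Z_def o_def)
    ultimately show ?thesis unfolding pullback_def merged_blocks_def list.map(2) sl by simp
  qed
  have "f meromorphic_on closed_segment 0 1"
    unfolding f_def
  proof (intro meromorphic_intros)
    show "(\<lambda>t. F (t * U # t * V # vars (\<lambda>k. t * Z k) N)) meromorphic_on closed_segment 0 1"
      unfolding f1 by (rule mer) (simp add: argument_blocks_def)
  next
    fix J assume "J \<in> Pow N"
    then have J: "J \<subseteq> N" by simp
    show "(\<lambda>t. F ((t * U + t * V + (\<Sum>k\<in>J. t * Z k)) # vars (\<lambda>k. t * Z k) (N - J))) meromorphic_on closed_segment 0 1"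
      unfolding f2[OF J] by (rule mer) (use J in \<open>auto simp: argument_blocks_def\<close>)
    show "(\<lambda>t. bo_M2 q (t * U) (t * V) (\<lambda>k. t * Z k) J) meromorphic_on closed_segment 0 1"
      unfolding bo_M2_def sZ distrib_left [symmetric]
    proof (intro meromorphic_intros bo_Z_scaled_meromorphic q)
      fix I assume "I \<in> Pow J"
      then have I: "I \<subseteq> N" using J by auto
      show "sum Z I + U \<noteq> 0" "sum Z I + V \<noteq> 0"
        unfolding s2[OF I] by (rule ne; use I in auto)+
    qed
  qed
  moreover have "eventually (\<lambda>t. f t = 0) (at 0)"
  proof -
    obtain \<delta> where \<delta>: "\<delta> > 0" and id: "\<And>u v z. norm u < \<delta> \<and> norm v < \<delta> \<and> (\<forall>j\<in>N. norm (z j) < \<delta> \<and> z j \<noteq> 0) \<and> u \<noteq> 0 \<and> v \<noteq> 0 \<and>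
      (\<forall>I\<subseteq>N. u + v + sum z I \<noteq> 0 \<and> sum z I + u \<noteq> 0 \<and> sum z I + v \<noteq> 0) \<Longrightarrow>
      F (u # v # vars z N) = (\<Sum>J\<in>Pow N. F ((u + v + sum z J) # vars z (N - J)) * bo_M2 q u v z J)"
      using correlator_identity_near_0[OF F q b(1) th] by blast
    have sm: "eventually (\<lambda>t. norm (t * x) < \<delta>) (at 0)" for x :: complex
    proof -
      have "((\<lambda>t. norm (t * x)) \<longlongrightarrow> norm (0 * x)) (at 0)" by (intro tendsto_intros)
      then show ?thesis by (rule order_tendstoD(2)) (use \<delta> in simp)
    qed
    have "eventually (\<lambda>t. \<forall>j\<in>N. norm (t * Z j) < \<delta>) (at 0)"
      using b(1) sm by (intro eventually_ball_finite) auto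
    moreover have "eventually (\<lambda>t::complex. t \<noteq> 0) (at 0)" by (simp add: eventually_at_filter)
    ultimately show ?thesis using sm[of U] sm[of V]
    proof eventually_elim
      case (elim t)
      have "Z j \<noteq> 0" if "j \<in> N" for j using ne[of "{j}"] that by simp
      moreover have "U \<noteq> 0" "V \<noteq> 0" using ne[of "{a}"] ne[of "{b}"] by (auto simp: U_def V_def Z_def)
      moreover have "t * U + t * V + (\<Sum>k\<in>I. t * Z k) \<noteq> 0 \<and> (\<Sum>k\<in>I. t * Z k) + t * U \<noteq> 0 \<and> (\<Sum>k\<in>I. t * Z k) + t * V \<noteq> 0"
        if I: "I \<subseteq> N" for I
      proof -
        have "U + V + sum Z I \<noteq> 0" "sum Z I + U \<noteq> 0" "sum Z I + V \<noteq> 0"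
          unfolding s2[OF I] by (rule ne; use I in auto)+
        then show ?thesis using elim(2) by (simp add: sZ distrib_left [symmetric])
      qed
      ultimately show ?case
        using id[of "t * U" "t * V" "\<lambda>k. t * Z k"] elim by (simp add: f_def)
    qed
  qed
  ultimately have "eventually (\<lambda>t. f t = 0) (at 1)" by (rule meromorphic_zero_continuation)
  then show ?thesis
    by eventually_elim (simp add: f_def bo_identity_def sl U_def V_def Z_def)
qed

text \<open>A family of block patterns is treated at once because the passage to the limit needs
  several identities at the same point.\<close>

lemma exists_generic_identity:
  assumes F: "is_bo_correlator q F" and q: "norm q < 1" "q \<noteq> 0" and th: "bo_theta q c \<noteq> 0"
    and K: "finite K" and C: "finite \<C>" "\<And>B a b N. (B, a, b, N) \<in> \<C> \<Longrightarrow> disjoint_blocks K B a b N"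
    and \<epsilon>: "\<epsilon> > 0"
  shows "\<exists>P\<in>point_box K \<epsilon> p. (\<forall>A. A \<subseteq> K \<and> A \<noteq> {} \<longrightarrow> sum P A \<noteq> 0 \<and> bo_theta q (sum P A) \<noteq> 0) \<and>
     (\<forall>(B, a, b, N)\<in>\<C>. bo_identity q F (sum P (B a)) (sum P (B b)) (\<lambda>k. sum P (B k)) N)"
proof -
  define \<A> where "\<A> = (\<Union>(B, a, b, N)\<in>\<C>. argument_blocks B a b N)"
  have "finite (argument_blocks B a b N)" if "(B, a, b, N) \<in> \<C>" for B a b N
    using C(2)[OF that] by (simp add: argument_blocks_def disjoint_blocks_def)
  then have fin: "finite \<A>" using C(1) by (auto simp: \<A>_def)
  have val: "disjoint_list As \<and> (\<forall>i<length As. As ! i \<subseteq> K)" if "As \<in> \<A>" for As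
  proof -
    obtain B a b N where c: "(B, a, b, N) \<in> \<C>" "As \<in> argument_blocks B a b N" using \<open>As \<in> \<A>\<close> by (auto simp: \<A>_def)
    show ?thesis by (rule argument_blocks_valid[OF K C(2)[OF c(1)] c(2)])
  qed
  have mer: "meromorphic_on_Cn m F" for m using F by (simp add: is_bo_correlator_def)
  \<comment> \<open>Half of \<open>\<epsilon>\<close> is spent on a generic direction
    \<open>P\<close>, the other half on replacing \<open>P\<close> by a multiple \<open>t P\<close>
    with \<open>t\<close> near 1.\<close>
  have e2: "\<epsilon> / 2 > 0" using \<epsilon> by simp
  have "\<exists>P\<in>point_box K (\<epsilon> / 2) p. (\<forall>As\<in>\<A>. (\<lambda>t. F (pullback As (scaled P t))) meromorphic_on closed_segment 0 1) \<and>
     (\<forall>A. A \<subseteq> K \<and> A \<noteq> {} \<longrightarrow> sum P A \<noteq> 0)"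
    by (rule exists_generic_line[OF fin _ K e2]) (use mer val in blast)
  then obtain P where P: "P \<in> point_box K (\<epsilon> / 2) p"
    "\<And>As. As \<in> \<A> \<Longrightarrow> (\<lambda>t. F (pullback As (scaled P t))) meromorphic_on closed_segment 0 1"
    "\<And>A. A \<subseteq> K \<Longrightarrow> A \<noteq> {} \<Longrightarrow> sum P A \<noteq> 0" by blast
  have "eventually (\<lambda>t. \<forall>c\<in>\<C>. case c of (B, a, b, N) \<Rightarrow>
      bo_identity q F (sum (scaled P t) (B a)) (sum (scaled P t) (B b)) (\<lambda>k. sum (scaled P t) (B k)) N) (at 1)"
  proof (rule eventually_ball_finite[OF C(1)], safe)
    fix B a b N assume c: "(B, a, b, N) \<in> \<C>"
    show "eventually (\<lambda>t. bo_identity q F (sum (scaled P t) (B a)) (sum (scaled P t) (B b)) (\<lambda>k. sum (scaled P t) (B k)) N) (at 1)"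
      by (rule bo_identity_on_line[OF F q th K C(2)[OF c] P(2) P(3)]) (use c in \<open>auto simp: \<A>_def\<close>)
  qed
  moreover have "eventually (\<lambda>t. \<forall>A\<in>Pow K - {{}}. bo_theta q (t * sum P A) \<noteq> 0) (at 1)"
  proof (rule eventually_ball_finite)
    show "\<forall>A\<in>Pow K - {{}}. eventually (\<lambda>t. bo_theta q (t * sum P A) \<noteq> 0) (at 1)"
    proof
      fix A assume "A \<in> Pow K - {{}}"
      then have A: "sum P A \<noteq> 0" using P(3) by blast
      have "filterlim (\<lambda>t. t * sum P A) (at (sum P A)) (at 1)"
        using A by (auto simp: filterlim_at eventually_at_filter intro!: tendsto_eq_intros)
      from eventually_compose_filterlim[OF bo_theta_eventually_nonzero[OF q th] this]
      show "eventually (\<lambda>t. bo_theta q (t * sum P A) \<noteq> 0) (at 1)" .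
    qed
  qed (use K in simp)
  moreover have "eventually (\<lambda>t. \<forall>k\<in>K. norm (t * P k - P k) < \<epsilon> / 2) (at 1)"
  proof (rule eventually_ball_finite[OF K], rule ballI)
    fix k assume "k \<in> K"
    have "((\<lambda>t. norm (t * P k - P k)) \<longlongrightarrow> norm (1 * P k - P k)) (at 1)" by (intro tendsto_intros)
    then show "eventually (\<lambda>t. norm (t * P k - P k) < \<epsilon> / 2) (at 1)" by (rule order_tendstoD(2)) (use \<epsilon> in simp)
  qed
  moreover have "eventually (\<lambda>t::complex. t \<noteq> 0) (at 1)"
    by (rule tendsto_imp_eventually_ne[OF tendsto_ident_at]) simp
  ultimately have "eventually (\<lambda>t. t \<noteq> 0 \<and> (\<forall>k\<in>K. norm (t * P k - P k) < \<epsilon> / 2) \<and> (\<forall>A\<in>Pow K - {{}}. bo_theta q (t * sum P A) \<noteq> 0) \<and>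
     (\<forall>c\<in>\<C>. case c of (B, a, b, N) \<Rightarrow>
      bo_identity q F (sum (scaled P t) (B a)) (sum (scaled P t) (B b)) (\<lambda>k. sum (scaled P t) (B k)) N)) (at 1)"
    by eventually_elim simp
  from eventually_happens'[OF at_neq_bot this] obtain t where t: "t \<noteq> 0" "\<And>k. k \<in> K \<Longrightarrow> norm (t * P k - P k) < \<epsilon> / 2"
    "\<And>A. A \<in> Pow K - {{}} \<Longrightarrow> bo_theta q (t * sum P A) \<noteq> 0"
    "\<forall>(B, a, b, N)\<in>\<C>. bo_identity q F (sum (scaled P t) (B a)) (sum (scaled P t) (B b)) (\<lambda>k. sum (scaled P t) (B k)) N"
    by blast
  have sl: "sum (scaled P t) A = t * sum P A" for A by (simp add: sum_distrib_left)
  show ?thesis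
  proof (intro bexI[of _ "scaled P t"] conjI t(4) allI impI)
    fix A assume "A \<subseteq> K \<and> A \<noteq> {}"
    then show "sum (scaled P t) A \<noteq> 0" "bo_theta q (sum (scaled P t) A) \<noteq> 0"
      unfolding sl using t(1,3) P(3) by auto
  next
    show "scaled P t \<in> point_box K \<epsilon> p"
      unfolding point_box_def
    proof (intro CollectI ballI)
      fix k assume k: "k \<in> K"
      have "norm (t * P k - p k) \<le> norm (t * P k - P k) + norm (P k - p k)" by norm
      then show "norm (t * P k - p k) < \<epsilon>" using t(2)[OF k] P(1) k by (auto simp: point_box_def)
    qed
  qed
qed

section \<open>The limit \<open>v \<rightarrow> -u\<close>\<close>

lemma list_tendsto_Cons: "(\<lambda>n. a n) \<longlonglongrightarrow> b \<Longrightarrow> list_tendsto X y \<Longrightarrow> list_tendsto (\<lambda>n. a n # X n) (b # y)"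
  unfolding list_tendsto_def by (auto simp: nth_Cons split: nat.split)

lemma list_tendsto_vars:
  assumes "finite M" "\<And>j. j \<in> M \<Longrightarrow> (\<lambda>n. Z n j) \<longlonglongrightarrow> z j"
  shows "list_tendsto (\<lambda>n. vars (Z n) M) (vars z M)"
  unfolding list_tendsto_def vars_def
proof (intro conjI allI impI)
  fix i assume i: "i < length (map z (sorted_list_of_set M))"
  then have "sorted_list_of_set M ! i \<in> M" using assms(1) nth_mem[of i "sorted_list_of_set M"] by simp
  then show "(\<lambda>n. map (Z n) (sorted_list_of_set M) ! i) \<longlonglongrightarrow> map z (sorted_list_of_set M) ! i"
    using i assms(2) by simp
qed simp

lemma list_continuousD: "list_continuous F y \<Longrightarrow> list_tendsto X y \<Longrightarrow> (\<lambda>n. F (X n)) \<longlonglongrightarrow> F y"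
  by (simp add: list_continuous_def)

text \<open>In \<open>bo_Z_small\<close> the only singular term is \<open>hcoth w\<close>, present
  for \<open>l = 0\<close> alone. The Lambert series stays bounded near 0 by comparison with
  exponentials at a fixed real point \<open>r\<close>.\<close>

lemma bo_Z_at_0:
  assumes q: "norm q < 1" "q \<noteq> 0" and th: "bo_theta q c \<noteq> 0"
  shows "((\<lambda>w. w * bo_Z q l w) \<longlongrightarrow> (if l = 0 then 1 else 0)) (at 0)"
proof -
  obtain d where d: "d > 0" "\<And>w. dist w 0 < d \<Longrightarrow> small_arg q w"
    using eventually_small_arg[OF q(1)] unfolding eventually_nhds_metric by blast
  define r where "r = d / 2"
  have r: "r > 0" using d by (simp add: r_def)
  have "small_arg q (of_real r)" using d by (simp add: r_def)
  then have sm: "exp (norm (of_real r :: complex)) * norm q < 1" by (rule small_arg_norm(1)[OF q(1)])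
  define g where "g = (\<lambda>m. norm (polylog l (q ^ m) * exp (of_nat m * (of_real r :: complex))))"
  have g: "g summable_on {1..}" unfolding g_def by (rule polylog_exp_abs_summable[OF q(1) sm])
  define S where "S = (\<Sum>\<^sub>\<infinity>m\<in>{1..}. 2 * g m)"
  have gS: "((\<lambda>m. 2 * g m) has_sum S) {1..}"
    unfolding S_def by (rule has_sum_infsum) (rule summable_on_cmult_right[OF g])
  have zb: "norm (Z_series q l w) \<le> S" if w: "norm w < r" for w
  proof -
    have sw: "exp (norm w) * norm q < 1"
      by (rule small_arg_norm(1)[OF q(1) d(2)]) (use w d(1) in \<open>simp add: r_def\<close>)
    have b: "norm (polylog l (q ^ m) * (exp (of_nat m * w) - (-1) ^ l * exp (- of_nat m * w))) \<le> 2 * g m" for m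
    proof -
      have e: "norm (exp (of_nat m * x)) \<le> exp (real m * r)" if "norm x < r" for x :: complex
      proof -
        have "Re x \<le> r" using complex_Re_le_cmod[of x] that by linarith
        then show ?thesis by (simp add: mult_left_mono)
      qed
      have "norm (exp (of_nat m * w) - (-1) ^ l * exp (- of_nat m * w)) \<le>
          norm (exp (of_nat m * w)) + norm ((-1) ^ l * exp (of_nat m * (- w)))"
        by (metis norm_triangle_ineq4 mult_minus_left mult_minus_right)
      also have "\<dots> \<le> exp (real m * r) + exp (real m * r)"
        using e[of w] e[of "- w"] w by (intro add_mono) (simp_all add: norm_mult norm_power del: norm_exp_eq_Re)
      finally have "norm (exp (of_nat m * w) - (-1) ^ l * exp (- of_nat m * w)) \<le> 2 * exp (real m * r)" by simp
      then have "norm (polylog l (q ^ m)) * norm (exp (of_nat m * w) - (-1) ^ l * exp (- of_nat m * w)) \<le>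
          norm (polylog l (q ^ m)) * (2 * exp (real m * r))" by (rule mult_left_mono) simp
      then show ?thesis by (simp add: g_def norm_mult mult_ac)
    qed
    have "(\<lambda>m. norm (polylog l (q ^ m) * (exp (of_nat m * w) - (-1) ^ l * exp (- of_nat m * w)))) summable_on {1..}"
      by (rule summable_on_comparison_test[OF has_sum_imp_summable[OF gS] b]) simp
    then obtain T where T: "((\<lambda>m. norm (polylog l (q ^ m) * (exp (of_nat m * w) - (-1) ^ l * exp (- of_nat m * w)))) has_sum T) {1..}"
      by (auto simp: summable_on_def)
    have "norm (Z_series q l w) \<le> T" by (rule norm_has_sum_bound[OF T Z_series_has_sum[OF q(1) sw]])
    also have "T \<le> S" by (rule has_sum_mono[OF T gS b])
    finally show ?thesis .
  qed
  have "((\<lambda>w. w * Z_series q l w) \<longlongrightarrow> 0) (at 0)"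
  proof (rule Lim_null_comparison)
    have "eventually (\<lambda>w::complex. norm w < r) (at 0)"
      unfolding eventually_at using r by (intro exI[of _ r]) auto
    then show "eventually (\<lambda>w. norm (w * Z_series q l w) \<le> norm w * S) (at 0)"
    proof eventually_elim
      case (elim w)
      show ?case unfolding norm_mult by (rule mult_left_mono[OF zb[OF elim]]) simp
    qed
    show "((\<lambda>w::complex. norm w * S) \<longlongrightarrow> 0) (at 0)"
      by (rule tendsto_eq_intros refl | simp)+
  qed
  moreover have "((\<lambda>w. if l = 0 then w * hcoth w else 0) \<longlongrightarrow> (if l = 0 then 1 else 0)) (at 0)"
    using hcoth_times_tendsto by simp
  ultimately have "((\<lambda>w. w * (fact l * fps_nth hcoth_fps (Suc l)) + (if l = 0 then w * hcoth w else 0) - w * Z_series q l w) \<longlongrightarrow>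
      0 * (fact l * fps_nth hcoth_fps (Suc l)) + (if l = 0 then 1 else 0) - 0) (at 0)"
    by (intro tendsto_intros)
  then have lim: "((\<lambda>w. w * (fact l * fps_nth hcoth_fps (Suc l)) + (if l = 0 then w * hcoth w else 0) - w * Z_series q l w) \<longlongrightarrow>
      (if l = 0 then 1 else 0)) (at 0)" by simp
  have "eventually (\<lambda>w. small_arg q w) (at 0)" using eventually_small_arg[OF q(1)] by (simp add: eventually_at_filter eventually_mono)
  then have "eventually (\<lambda>w. w * (fact l * fps_nth hcoth_fps (Suc l)) + (if l = 0 then w * hcoth w else 0) - w * Z_series q l w = w * bo_Z q l w) (at 0)"
    using eventually_exp_neq_1 bo_theta_eventually_nonzero[OF q th, of 0]
    by eventually_elim (simp add: bo_Z_small[OF q] ring_distribs)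
  from Lim_transform_eventually[OF lim this] show ?thesis .
qed

text \<open>With no further variable to pair with \<open>w\<close>, the residue comes directly from
  the definition: \<open>w F(w)\<close> is a power series near 0 whose constant term is the bracket
  of \<open>Q_0 = 1\<close>, which is \<open>F []\<close>.\<close>

lemma correlator_one_point_residue:
  assumes F: "is_bo_correlator q F" and W: "W \<longlonglongrightarrow> 0" "\<And>k. W k \<noteq> 0"
  shows "(\<lambda>k. W k * F [W k]) \<longlonglongrightarrow> F []"
proof -
  let ?L = "\<lambda>m. {ks :: nat list. length ks = m}"
  let ?c = "\<lambda>m ks. q_bracket q (\<lambda>\<mu>. \<Prod>i<m. bo_Q (ks ! i) \<mu>)"
  obtain e where "e > 0" and e: "\<forall>x. length x = 1 \<and> (\<forall>i<1. 0 < norm (x ! i) \<and> norm (x ! i) < e) \<longrightarrow>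
      ((\<lambda>ks. ?c 1 ks * (\<Prod>i<1. (x ! i) powi (int (ks ! i) - 1))) has_sum F x) (?L 1)"
    using F unfolding is_bo_correlator_def by blast
  have "((\<lambda>ks. ?c 0 ks * (\<Prod>i<0. ([] ! i) powi (int (ks ! i) - 1))) has_sum F []) (?L 0)"
    using F[unfolded is_bo_correlator_def, rule_format, of 0] by auto
  then have "F [] = q_bracket q (\<lambda>\<mu>. 1)"
    by (simp add: has_sum_finite_iff)
  then have F0: "F [] = ?c 1 [0]" by (simp add: bo_Q_def)
  define G where "G = (\<lambda>x. if x ! 0 = 0 then F [] else x ! 0 * F [x ! 0])"
  have "holomorphic_at G [0]"
    unfolding holomorphic_at_def
  proof (intro exI[of _ e] conjI \<open>e > 0\<close> exI[of _ "?c 1"] ballI)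
    fix x assume x: "x \<in> polydisc [0] e"
    then obtain w where w: "x = [w]" "norm w < e" by (auto simp: polydisc_def length_Suc_conv)
    have "((\<lambda>ks. ?c 1 ks * w ^ (ks ! 0)) has_sum G x) (?L 1)"
    proof (cases "w = 0")
      case True
      have "((\<lambda>ks. ?c 1 ks * w ^ (ks ! 0)) has_sum (\<Sum>ks\<in>{[0]}. ?c 1 ks * w ^ (ks ! 0))) (?L 1)"
        by (rule has_sum_finite_neutralI[of "{[0]}"]) (auto simp: True length_Suc_conv power_0_left)
      then show ?thesis using w True by (simp add: G_def F0)
    next
      case False
      have "((\<lambda>ks. ?c 1 ks * w powi (int (ks ! 0) - 1)) has_sum F [w]) (?L 1)"
        using e[rule_format, of "[w]"] w False by simp
      from has_sum_cmult_right[OF this, of w]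
      have "((\<lambda>ks. w * (?c 1 ks * w powi (int (ks ! 0) - 1))) has_sum G x) (?L 1)" using w False by (simp add: G_def)
      moreover have "w * (?c 1 ks * w powi (int (ks ! 0) - 1)) = ?c 1 ks * w ^ (ks ! 0)" for ks
        using False by (simp add: power_int_diff)
      ultimately show ?thesis by (simp only:)
    qed
    then show "((\<lambda>ks. ?c 1 ks * (\<Prod>i<length [0::complex]. (x ! i - [0] ! i) ^ (ks ! i))) has_sum G x) {ks. length ks = length [0::complex]}"
      using w by simp
  qed
  then obtain \<rho> where \<rho>: "\<rho> > 0" "\<forall>y\<in>polydisc [0] \<rho>. list_continuous G y"
    using holomorphic_at_list_continuous by blast
  then have "list_continuous G [0]" by (auto simp: polydisc_def)
  moreover have "list_tendsto (\<lambda>k. [W k]) [0]" using W(1) by (simp add: list_tendsto_def)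
  ultimately have "(\<lambda>k. G [W k]) \<longlonglongrightarrow> G [0]" by (rule list_continuousD)
  then show ?thesis using W(2) by (simp add: G_def)
qed

lemma vars_Cons:
  assumes "n \<ge> 1" shows "vars z {1..n} = z 1 # vars z {2..n}"
proof -
  have "sorted_list_of_set {1..n} = [1..<Suc n]" "sorted_list_of_set {2..n} = [2..<Suc n]"
    by (simp_all only: atLeastLessThanSuc_atLeastAtMost [symmetric] sorted_list_of_set_range)
  moreover have "[1..<Suc n] = 1 # [2..<Suc n]"
    using assms upt_conv_Cons[of 1 "Suc n"] by (simp del: upt_Suc add: numeral_2_eq_2)
  ultimately show ?thesis by (simp del: upt_Suc add: vars_def)
qed

lemma bo_Z_tendsto:
  assumes "norm q < 1" "q \<noteq> 0" "bo_theta q x \<noteq> 0" "X \<longlonglongrightarrow> x"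
  shows "(\<lambda>k. bo_Z q l (X k)) \<longlonglongrightarrow> bo_Z q l x"
  by (rule isCont_tendsto_compose[OF bo_Z_isCont[OF assms(1-3)] assms(4)])

text \<open>The identity for the two variables \<open>w\<close> and \<open>z\<^sub>1\<close> shows that the correlator has residue
  \<open>F(z\<^sub>1, \<dots>, z\<^sub>n)\<close> at \<open>w = 0\<close>, since only \<open>Z\<^sub>0\<close> has a pole at the origin.\<close>

lemma correlator_residue:
  assumes F: "is_bo_correlator q F" and q: "norm q < 1" "q \<noteq> 0"
    and N: "N = {1..n}"
    and cont: "\<And>J. J \<subseteq> N \<Longrightarrow> list_continuous F (merged_vars z N J)"
    and th: "bo_theta q c \<noteq> 0" "\<And>I. I \<subseteq> N \<Longrightarrow> I \<noteq> {} \<Longrightarrow> bo_theta q (sum z I) \<noteq> 0"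
    and W: "W \<longlonglongrightarrow> 0" "\<And>k. W k \<noteq> 0" and Z: "\<And>j. j \<in> N \<Longrightarrow> (\<lambda>k. Z k j) \<longlonglongrightarrow> z j"
    and id: "\<And>k. n \<ge> 1 \<Longrightarrow> bo_identity q F (W k) (Z k 1) (Z k) {2..n}"
  shows "(\<lambda>k. W k * F (W k # vars (Z k) N)) \<longlonglongrightarrow> F (vars z N)"
proof (cases "n \<ge> 1")
  case False
  then have "vars y N = []" for y by (simp add: N vars_def)
  then show ?thesis using correlator_one_point_residue[OF F W] by simp
next
  case True
  let ?M = "{2..n}"
  have sub: "J \<subseteq> N" "insert 1 J \<subseteq> N" "N - insert 1 J = ?M - J" "finite J" "1 \<notin> J" if "J \<subseteq> ?M" for J
    using that True finite_subset[OF that] by (auto simp: N)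
  have W0: "filterlim W (at 0) sequentially" using W by (auto simp: filterlim_at)
  have sZ: "(\<lambda>k. sum (Z k) I) \<longlonglongrightarrow> sum z I" if "I \<subseteq> N" for I
    using that Z by (intro tendsto_sum) auto
  have term_lim: "(\<lambda>k. F ((W k + Z k 1 + sum (Z k) J) # vars (Z k) (?M - J)) * (W k * bo_M2 q (W k) (Z k 1) (Z k) J)) \<longlonglongrightarrow>
      F (merged_vars z N (insert 1 J)) * (if J = {} then 1 else 0)" if J: "J \<subseteq> ?M" for J
  proof (rule tendsto_mult)
    have mv: "merged_vars z N (insert 1 J) = (0 + z 1 + sum z J) # vars z (?M - J)"
      using sub[OF J] by (simp add: merged_vars_def)
    have "list_tendsto (\<lambda>k. (W k + Z k 1 + sum (Z k) J) # vars (Z k) (?M - J)) (merged_vars z N (insert 1 J))"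
      unfolding mv
    proof (rule list_tendsto_Cons)
      show "(\<lambda>k. W k + Z k 1 + sum (Z k) J) \<longlonglongrightarrow> 0 + z 1 + sum z J"
        using True sub(1)[OF J] by (intro tendsto_add W Z sZ) (auto simp: N)
      show "list_tendsto (\<lambda>k. vars (Z k) (?M - J)) (vars z (?M - J))"
        by (rule list_tendsto_vars) (auto intro!: Z simp: N)
    qed
    then show "(\<lambda>k. F ((W k + Z k 1 + sum (Z k) J) # vars (Z k) (?M - J))) \<longlonglongrightarrow> F (merged_vars z N (insert 1 J))"
      by (rule list_continuousD[OF cont[OF sub(2)[OF J]]])
    let ?l = "card J"
    have "(\<lambda>k. \<Sum>I\<in>Pow J. (-1) ^ card (J - I) * (W k * bo_Z q ?l (sum (Z k) I + W k) + W k * bo_Z q ?l (sum (Z k) I + Z k 1))) \<longlonglongrightarrow>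
       (\<Sum>I\<in>Pow J. (-1) ^ card (J - I) * ((if I = {} then (if ?l = 0 then 1 else 0) else 0) + 0))"
    proof (intro tendsto_sum tendsto_mult tendsto_const tendsto_add)
      fix I assume "I \<in> Pow J"
      then have I: "I \<subseteq> ?M" using J by blast
      show "(\<lambda>k. W k * bo_Z q ?l (sum (Z k) I + W k)) \<longlonglongrightarrow> (if I = {} then (if ?l = 0 then 1 else 0) else 0)"
      proof (cases "I = {}")
        case True
        then show ?thesis using filterlim_compose[OF bo_Z_at_0[OF q th(1)] W0, of ?l] by simp
      next
        case False
        have "(\<lambda>k. W k * bo_Z q ?l (sum (Z k) I + W k)) \<longlonglongrightarrow> 0 * bo_Z q ?l (sum z I + 0)"
          using th(2)[OF sub(1)[OF I] False] by (intro tendsto_mult W bo_Z_tendsto q tendsto_add sZ sub(1)[OF I]) simp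
        then show ?thesis using False by simp
      qed
      have "sum z I + z 1 = sum z (insert 1 I)" using sub[OF I] by simp
      then have "(\<lambda>k. W k * bo_Z q ?l (sum (Z k) I + Z k 1)) \<longlonglongrightarrow> 0 * bo_Z q ?l (sum z I + z 1)"
        using th(2)[OF sub(2)[OF I]] True
        by (intro tendsto_mult W bo_Z_tendsto q tendsto_add sZ sub(1)[OF I] Z) (auto simp: N)
      then show "(\<lambda>k. W k * bo_Z q ?l (sum (Z k) I + Z k 1)) \<longlonglongrightarrow> 0" by simp
    qed
    moreover have "(\<Sum>I\<in>Pow J. (-1) ^ card (J - I) * ((if I = {} then (if ?l = 0 then 1 else 0) else 0) + 0)) = (if J = {} then 1 else 0 :: complex)"
      using sub(4)[OF J] by (auto intro!: sum.neutral)
    moreover have "(\<Sum>I\<in>Pow J. (-1) ^ card (J - I) * (W k * bo_Z q ?l (sum (Z k) I + W k) + W k * bo_Z q ?l (sum (Z k) I + Z k 1))) =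
        W k * bo_M2 q (W k) (Z k 1) (Z k) J" for k
      unfolding bo_M2_def sum_distrib_left by (intro sum.cong refl) (simp add: algebra_simps)
    ultimately show "(\<lambda>k. W k * bo_M2 q (W k) (Z k 1) (Z k) J) \<longlonglongrightarrow> (if J = {} then 1 else 0)" by simp
  qed
  have "(\<lambda>k. \<Sum>J\<in>Pow ?M. F ((W k + Z k 1 + sum (Z k) J) # vars (Z k) (?M - J)) * (W k * bo_M2 q (W k) (Z k 1) (Z k) J)) \<longlonglongrightarrow>
      (\<Sum>J\<in>Pow ?M. F (merged_vars z N (insert 1 J)) * (if J = {} then 1 else 0))"
    by (rule tendsto_sum) (use term_lim in blast)
  moreover have "(\<Sum>J\<in>Pow ?M. F (merged_vars z N (insert 1 J)) * (if J = {} then 1 else 0)) = F (vars z N)"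
  proof -
    have "(\<Sum>J\<in>Pow ?M. F (merged_vars z N (insert 1 J)) * (if J = {} then 1 else 0)) = F (merged_vars z N {1})"
      by (subst sum.remove[of _ "{}"]) (auto intro!: sum.neutral)
    moreover have "merged_vars z N {1} = vars z N"
      using sub(3)[of "{}"] vars_Cons[OF True] by (simp add: merged_vars_def N)
    ultimately show ?thesis by simp
  qed
  moreover have "(\<Sum>J\<in>Pow ?M. F ((W k + Z k 1 + sum (Z k) J) # vars (Z k) (?M - J)) * (W k * bo_M2 q (W k) (Z k 1) (Z k) J)) =
      W k * F (W k # vars (Z k) N)" for k
    using id[OF True, of k] unfolding bo_identity_def N vars_Cons[OF True]
    by (simp add: sum_distrib_left mult_ac)
  ultimately show ?thesis by simp
qed

text \<open>For \<open>J = {}\<close>, oddness turns \<open>Z_0(U) + Z_0(V)\<close> into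
  \<open>Z_0(U) - Z_0(- V)\<close>. Dividing by \<open>U + V\<close> makes this a difference
  quotient, while multiplying the correlator by \<open>U + V\<close> produces its residue. All other
  terms converge by continuity.\<close>

lemma bo_identity_limit:
  assumes F: "is_bo_correlator q F" and q: "norm q < 1" "q \<noteq> 0"
    and N: "N = {1..n}"
    and cont: "list_continuous F (u # - u # vars z N)" "\<And>J. J \<subseteq> N \<Longrightarrow> list_continuous F (merged_vars z N J)"
    and th: "\<And>I. I \<subseteq> N \<Longrightarrow> bo_theta q (sum z I + u) \<noteq> 0 \<and> bo_theta q (sum z I - u) \<noteq> 0"
      "\<And>I. I \<subseteq> N \<Longrightarrow> I \<noteq> {} \<Longrightarrow> bo_theta q (sum z I) \<noteq> 0"
    and lim: "U \<longlonglongrightarrow> u" "V \<longlonglongrightarrow> - u" "\<And>j. j \<in> N \<Longrightarrow> (\<lambda>k. Z k j) \<longlonglongrightarrow> z j" and ne: "\<And>k. U k + V k \<noteq> 0"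
    and id: "\<And>k. bo_identity q F (U k) (V k) (Z k) N"
      "\<And>k. n \<ge> 1 \<Longrightarrow> bo_identity q F (U k + V k) (Z k 1) (Z k) {2..n}"
  shows "F (u # - u # vars z N) = (\<Sum>J\<in>Pow N. F (merged_vars z N J) * bo_M q u z J)"
proof -
  have finN: "finite N" by (simp add: N)
  have thu: "bo_theta q u \<noteq> 0" "bo_theta q (- u) \<noteq> 0" using th(1)[of "{}"] by auto
  have W: "(\<lambda>k. U k + V k) \<longlonglongrightarrow> 0" using tendsto_add[OF lim(1,2)] by simp
  have sZ: "(\<lambda>k. sum (Z k) I) \<longlonglongrightarrow> sum z I" if "I \<subseteq> N" for I
    using that lim(3) by (intro tendsto_sum) auto
  have lhs: "(\<lambda>k. F (U k # V k # vars (Z k) N)) \<longlonglongrightarrow> F (u # - u # vars z N)"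
    by (intro list_continuousD[OF cont(1)] list_tendsto_Cons list_tendsto_vars lim finN)
  have empty: "(\<lambda>k. F ((U k + V k + sum (Z k) {}) # vars (Z k) (N - {})) * bo_M2 q (U k) (V k) (Z k) {}) \<longlonglongrightarrow>
      F (merged_vars z N {}) * bo_M q u z {}"
  proof -
    have res: "(\<lambda>k. (U k + V k) * F ((U k + V k) # vars (Z k) N)) \<longlonglongrightarrow> F (vars z N)"
      by (rule correlator_residue[OF F q N cont(2) thu(1) th(2) W ne lim(3) id(2)])
    let ?A = "{x. bo_theta q x \<noteq> 0}"
    have "(\<lambda>k. (bo_Z q 0 (U k) - bo_Z q 0 (- V k)) / (U k - (- V k))) \<longlonglongrightarrow> deriv (bo_Z q 0) u"
    proof (rule holomorphic_difference_quotient_tendsto[where A = ?A])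
      show "bo_Z q 0 holomorphic_on ?A" by (rule bo_Z_holomorphic[OF q]) simp
      show "open ?A" by (rule open_bo_theta_nonzero[OF q])
      show "(\<lambda>k. - V k) \<longlonglongrightarrow> u" using tendsto_minus[OF lim(2)] by simp
      show "U k \<noteq> - V k" for k using ne[of k] by (simp add: eq_neg_iff_add_eq_0)
    qed (use thu lim in auto)
    then have "(\<lambda>k. ((U k + V k) * F ((U k + V k) # vars (Z k) N)) * ((bo_Z q 0 (U k) - bo_Z q 0 (- V k)) / (U k - (- V k)))) \<longlonglongrightarrow>
       F (vars z N) * deriv (bo_Z q 0) u"
      by (intro tendsto_mult res)
    moreover have "eventually (\<lambda>k. bo_theta q (V k) \<noteq> 0) sequentially" "eventually (\<lambda>k. bo_theta q (- V k) \<noteq> 0) sequentially"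
    proof -
      have "(\<lambda>k. - V k) \<longlonglongrightarrow> u" using tendsto_minus[OF lim(2)] by simp
      from topological_tendstoD[OF this open_bo_theta_nonzero[OF q]] topological_tendstoD[OF lim(2) open_bo_theta_nonzero[OF q]]
      show "eventually (\<lambda>k. bo_theta q (V k) \<noteq> 0) sequentially" "eventually (\<lambda>k. bo_theta q (- V k) \<noteq> 0) sequentially"
        using thu by auto
    qed
    then have "eventually (\<lambda>k. ((U k + V k) * F ((U k + V k) # vars (Z k) N)) * ((bo_Z q 0 (U k) - bo_Z q 0 (- V k)) / (U k - (- V k))) =
        F ((U k + V k + sum (Z k) {}) # vars (Z k) (N - {})) * bo_M2 q (U k) (V k) (Z k) {}) sequentially"
    proof eventually_elim
      case (elim k)
      show ?case using ne[of k] bo_Z_0_odd[OF q elim] by (simp add: bo_M2_def)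
    qed
    ultimately show ?thesis
      using Lim_transform_eventually by (fastforce simp: bo_M_def merged_vars_def)
  qed
  have nonempty: "(\<lambda>k. F ((U k + V k + sum (Z k) J) # vars (Z k) (N - J)) * bo_M2 q (U k) (V k) (Z k) J) \<longlonglongrightarrow>
      F (merged_vars z N J) * bo_M q u z J" if J: "J \<subseteq> N" "J \<noteq> {}" for J
  proof (rule tendsto_mult)
    have mv: "merged_vars z N J = (0 + sum z J) # vars z (N - J)" using J by (simp add: merged_vars_def)
    have "list_tendsto (\<lambda>k. (U k + V k + sum (Z k) J) # vars (Z k) (N - J)) (merged_vars z N J)"
      unfolding mv
      by (intro list_tendsto_Cons list_tendsto_vars tendsto_add[OF W] sZ J(1) lim(3)) (use finN in auto)
    then show "(\<lambda>k. F ((U k + V k + sum (Z k) J) # vars (Z k) (N - J))) \<longlonglongrightarrow> F (merged_vars z N J)"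
      by (rule list_continuousD[OF cont(2)[OF J(1)]])
    have M: "bo_M q u z J = (\<Sum>I\<in>Pow J. (-1) ^ card (J - I) * (bo_Z q (card J) (sum z I + u) + bo_Z q (card J) (sum z I + - u)))"
      using J by (simp add: bo_M_def)
    show "(\<lambda>k. bo_M2 q (U k) (V k) (Z k) J) \<longlonglongrightarrow> bo_M q u z J"
      unfolding M bo_M2_def
    proof (rule tendsto_sum)
      fix I assume "I \<in> Pow J"
      then have I: "I \<subseteq> N" using J by blast
      show "(\<lambda>k. (-1) ^ card (J - I) * (bo_Z q (card J) (sum (Z k) I + U k) + bo_Z q (card J) (sum (Z k) I + V k))) \<longlonglongrightarrow>
          (-1) ^ card (J - I) * (bo_Z q (card J) (sum z I + u) + bo_Z q (card J) (sum z I + - u))"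
        using th(1)[OF I] by (intro tendsto_mult tendsto_const tendsto_add bo_Z_tendsto q lim(1,2) sZ[OF I]) simp_all
    qed
  qed
  have "(\<lambda>k. \<Sum>J\<in>Pow N. F ((U k + V k + sum (Z k) J) # vars (Z k) (N - J)) * bo_M2 q (U k) (V k) (Z k) J) \<longlonglongrightarrow>
      (\<Sum>J\<in>Pow N. F (merged_vars z N J) * bo_M q u z J)"
  proof (rule tendsto_sum)
    fix J assume "J \<in> Pow N"
    then show "(\<lambda>k. F ((U k + V k + sum (Z k) J) # vars (Z k) (N - J)) * bo_M2 q (U k) (V k) (Z k) J) \<longlonglongrightarrow>
      F (merged_vars z N J) * bo_M q u z J"
      using empty nonempty[of J] by (cases "J = {}") simp_all
  qed
  then have "(\<lambda>k. F (U k # V k # vars (Z k) N)) \<longlonglongrightarrow> (\<Sum>J\<in>Pow N. F (merged_vars z N J) * bo_M q u z J)"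
    using id(1) by (simp add: bo_identity_def)
  from LIMSEQ_unique[OF lhs this] show ?thesis .
qed

lemma eventually_list_continuous:
  assumes "holomorphic_at F p" "list_tendsto X p"
  shows "eventually (\<lambda>k. list_continuous F (X k)) sequentially" "(\<lambda>k. F (X k)) \<longlonglongrightarrow> F p"
proof -
  obtain \<rho> where \<rho>: "\<rho> > 0" "\<forall>y\<in>polydisc p \<rho>. list_continuous F y"
    using holomorphic_at_list_continuous[OF assms(1)] by blast
  have "eventually (\<lambda>k. \<forall>i\<in>{..<length p}. norm (X k ! i - p ! i) < \<rho>) sequentially"
  proof (rule eventually_ball_finite)
    show "\<forall>i\<in>{..<length p}. eventually (\<lambda>k. norm (X k ! i - p ! i) < \<rho>) sequentially"
      using assms(2) \<rho>(1) by (auto simp: list_tendsto_def dist_norm [symmetric] intro: tendstoD)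
  qed simp
  then show "eventually (\<lambda>k. list_continuous F (X k)) sequentially"
    by eventually_elim (use \<rho>(2) assms(2) in \<open>auto simp: polydisc_def list_tendsto_def\<close>)
  have "p \<in> polydisc p \<rho>" using \<rho>(1) by (simp add: polydisc_def)
  then show "(\<lambda>k. F (X k)) \<longlonglongrightarrow> F p"
    using list_continuousD[OF _ assms(2)] \<rho>(2) by blast
qed

lemma point_box_sequence:
  assumes "\<And>k. P k \<in> point_box K (1 / real (Suc k)) p" "j \<in> K"
  shows "(\<lambda>k. P k j) \<longlonglongrightarrow> p j"
proof (rule LIM_zero_cancel, rule Lim_null_comparison)
  show "eventually (\<lambda>k. norm (P k j - p j) \<le> inverse (real (Suc k))) sequentially"
    using assms by (intro always_eventually allI) (auto simp: point_box_def field_simps less_imp_le)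
qed (rule LIMSEQ_inverse_real_of_nat)

text \<open>The target is approached by points with independent coordinates for \<open>u\<close> and
  \<open>v\<close>. They satisfy the identity for the pair \<open>u, v\<close> and, if
  \<open>n >= 1\<close>, the one for the pair \<open>u + v, z_1\<close> behind the residue. The
  latter evaluates \<open>Z_l\<close> at sums of the \<open>z_j\<close>, whence the second condition
  on theta.\<close>

lemma correlator_identity_generic:
  assumes F: "is_bo_correlator q F" and q: "norm q < 1" "q \<noteq> 0"
    and N: "N = {1..n}"
    and cont: "list_continuous F (u # - u # vars z N)" "\<And>J. J \<subseteq> N \<Longrightarrow> list_continuous F (merged_vars z N J)"
    and th: "\<And>I. I \<subseteq> N \<Longrightarrow> bo_theta q (sum z I + u) \<noteq> 0 \<and> bo_theta q (sum z I - u) \<noteq> 0"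
      "\<And>I. I \<subseteq> N \<Longrightarrow> I \<noteq> {} \<Longrightarrow> bo_theta q (sum z I) \<noteq> 0"
  shows "F (u # - u # vars z N) = (\<Sum>J\<in>Pow N. F (merged_vars z N J) * bo_M q u z J)"
proof -
  define K where "K = {0..Suc n}"
  define p where "p = z(0 := u, Suc n := - u)"
  \<comment> \<open>Coordinate 0 carries \<open>u\<close> and coordinate \<open>Suc n\<close>
    carries \<open>v\<close>; their common block is the single variable
    \<open>u + v\<close>.\<close>
  define B where "B = (\<lambda>k. if k = 0 then {0, Suc n} else {k})"
  define \<C> where "\<C> = insert ((\<lambda>k. {k}), 0 :: nat, Suc n, N) (if n \<ge> 1 then {(B, 0, 1, {2..n})} else {})"
  have thu: "bo_theta q u \<noteq> 0" using th(1)[of "{}"] by simp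
  have "disjoint_blocks K (\<lambda>k. {k}) 0 (Suc n) N"
    by (auto simp: disjoint_blocks_def K_def N disjoint_family_on_def)
  moreover have "disjoint_blocks K B 0 1 {2..n}" if "n \<ge> 1"
    using that by (auto simp: disjoint_blocks_def K_def B_def disjoint_family_on_def)
  ultimately have C: "finite \<C>" "\<And>B a b N. (B, a, b, N) \<in> \<C> \<Longrightarrow> disjoint_blocks K B a b N"
    by (auto simp: \<C>_def split: if_splits)
  define Q where "Q = (\<lambda>k P. P \<in> point_box K (1 / real (Suc k)) p \<and> (\<forall>A. A \<subseteq> K \<and> A \<noteq> {} \<longrightarrow> sum P A \<noteq> 0 \<and> bo_theta q (sum P A) \<noteq> 0) \<and>
     (\<forall>(B, a, b, N)\<in>\<C>. bo_identity q F (sum P (B a)) (sum P (B b)) (\<lambda>i. sum P (B i)) N))"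
  have "\<exists>P. Q k P" for k
    unfolding Q_def Bex_def [symmetric] by (rule exists_generic_identity[OF F q thu _ C]) (auto simp: K_def)
  then have "\<forall>k. \<exists>P. Q k P" ..
  from choice[OF this] obtain P where "\<forall>k. Q k (P k)" ..
  then have P: "\<And>k. P k \<in> point_box K (1 / real (Suc k)) p" "\<And>k A. A \<subseteq> K \<Longrightarrow> A \<noteq> {} \<Longrightarrow> sum (P k) A \<noteq> 0"
    "\<And>k. \<forall>(B, a, b, N)\<in>\<C>. bo_identity q F (sum (P k) (B a)) (sum (P k) (B b)) (\<lambda>i. sum (P k) (B i)) N"
    by (simp_all add: Q_def)
  have lim: "(\<lambda>k. P k j) \<longlonglongrightarrow> p j" if "j \<in> K" for j by (rule point_box_sequence[OF P(1) that])
  have B_eq: "bo_identity q F a b (\<lambda>i. sum (P k) (B i)) {2..n} = bo_identity q F a b (P k) {2..n}" for a b k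
  proof -
    have s: "sum (\<lambda>i. sum (P k) (B i)) J = sum (P k) J" if "J \<subseteq> {2..n}" for J
      using that by (intro sum.cong refl) (auto simp: B_def)
    have v: "vars (\<lambda>i. sum (P k) (B i)) M = vars (P k) M" if "M \<subseteq> {2..n}" for M
      using that finite_subset[OF that] by (auto simp: vars_def B_def)
    have m: "bo_M2 q a b (\<lambda>i. sum (P k) (B i)) J = bo_M2 q a b (P k) J" if "J \<subseteq> {2..n}" for J
      unfolding bo_M2_def using that by (intro sum.cong refl) (subst s, auto)+
    show ?thesis
      unfolding bo_identity_def v[OF subset_refl]
      by (intro arg_cong2[of _ _ _ _ "(=)"] refl sum.cong arg_cong2[of _ _ _ _ "(*)"] m) (auto simp: s v)
  qed
  show ?thesis
  proof (rule bo_identity_limit[OF F q N cont th])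
    show "(\<lambda>k. P k 0) \<longlonglongrightarrow> u" using lim[of 0] by (simp add: K_def p_def)
    show "(\<lambda>k. P k (Suc n)) \<longlonglongrightarrow> - u" using lim[of "Suc n"] by (simp add: K_def p_def)
    show "(\<lambda>k. P k j) \<longlonglongrightarrow> z j" if "j \<in> N" for j using lim[of j] that by (simp add: K_def p_def N)
    show "P k 0 + P k (Suc n) \<noteq> 0" for k using P(2)[of "{0, Suc n}" k] by (simp add: K_def)
    show "bo_identity q F (P k 0) (P k (Suc n)) (P k) N" for k
      using P(3)[of k] by (simp add: \<C>_def)
    show "bo_identity q F (P k 0 + P k (Suc n)) (P k 1) (P k) {2..n}" if "n \<ge> 1" for k
    proof -
      have "bo_identity q F (sum (P k) (B 0)) (sum (P k) (B 1)) (\<lambda>i. sum (P k) (B i)) {2..n}"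
        using P(3)[of k] that by (simp add: \<C>_def)
      then show ?thesis unfolding B_eq by (simp add: B_def)
    qed
  qed assumption
qed

text \<open>The hypotheses survive small perturbations of \<open>u\<close> and \<open>z\<close>, in
  the form of continuity and nonvanishing of theta. At suitable perturbed points theta is also
  nonzero at all sums of the \<open>z_j\<close>, so \<open>correlator_identity_generic\<close>
  applies there, and both sides converge to their values at the given point.\<close>

theorem corollary15p2:
  fixes q u :: complex and n :: nat and z :: "nat \<Rightarrow> complex"
    and N :: "nat set" and F :: "complex list \<Rightarrow> complex"
  assumes "0 < norm q" and "norm q < 1"
    and "is_bo_correlator q F"
    and "N = {1..n}"
    and "holomorphic_at F (u # -u # vars z N)"
    and "\<And>J. J \<subseteq> N \<Longrightarrow> holomorphic_at F (merged_vars z N J)"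
    and "\<And>I. I \<subseteq> N \<Longrightarrow> bo_theta q (sum z I + u) \<noteq> 0 \<and> bo_theta q (sum z I - u) \<noteq> 0"
  shows "F (u # -u # vars z N) = (\<Sum>J\<in>Pow N. F (merged_vars z N J) * bo_M q u z J)"
proof -
  have q: "norm q < 1" "q \<noteq> 0" using assms(1,2) by auto
  note F = assms(3) and N = assms(4) and th = assms(7)
  have finN: "finite N" by (simp add: N)
  have thu: "bo_theta q u \<noteq> 0" using th[of "{}"] by simp
  define K where "K = {0..n}"
  define p where "p = z(0 := u)"
  \<comment> \<open>Only nonvanishing of theta at partial sums is wanted here, hence the empty
    family of identities and no coordinate for \<open>v\<close>.\<close>
  define Q where "Q = (\<lambda>k P. P \<in> point_box K (1 / real (Suc k)) p \<and> (\<forall>A. A \<subseteq> K \<and> A \<noteq> {} \<longrightarrow> sum P A \<noteq> 0 \<and> bo_theta q (sum P A) \<noteq> 0) \<and>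
     (\<forall>(B, a, b, N)\<in>{}. bo_identity q F (sum P (B a)) (sum P (B b)) (\<lambda>i. sum P (B i)) N))"
  have "\<exists>P. Q k P" for k
    unfolding Q_def Bex_def [symmetric] by (rule exists_generic_identity[OF F q thu]) (auto simp: K_def)
  then have "\<forall>k. \<exists>P. Q k P" ..
  from choice[OF this] obtain P where "\<forall>k. Q k (P k)" ..
  then have P: "\<And>k. P k \<in> point_box K (1 / real (Suc k)) p" "\<And>k A. A \<subseteq> K \<Longrightarrow> A \<noteq> {} \<Longrightarrow> bo_theta q (sum (P k) A) \<noteq> 0"
    by (simp_all add: Q_def)
  have lim: "(\<lambda>k. P k j) \<longlonglongrightarrow> p j" if "j \<in> K" for j by (rule point_box_sequence[OF P(1) that])
  have limu: "(\<lambda>k. P k 0) \<longlonglongrightarrow> u" using lim[of 0] by (simp add: K_def p_def)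
  have limz: "(\<lambda>k. P k j) \<longlonglongrightarrow> z j" if "j \<in> N" for j using lim[of j] that by (simp add: K_def p_def N)
  have sZ: "(\<lambda>k. sum (P k) I) \<longlonglongrightarrow> sum z I" if "I \<subseteq> N" for I
    using that limz by (intro tendsto_sum) auto
  \<comment> \<open>Here the second entry is the exact negative of the first, so the approximating
    points stay on the locus of the theorem.\<close>
  have "list_tendsto (\<lambda>k. P k 0 # - P k 0 # vars (P k) N) (u # - u # vars z N)"
    by (intro list_tendsto_Cons list_tendsto_vars limu limz tendsto_minus finN)
  note lhs = eventually_list_continuous[OF assms(5) this]
  have "list_tendsto (\<lambda>k. merged_vars (P k) N J) (merged_vars z N J)" if J: "J \<subseteq> N" for J
  proof (cases "J = {}")
    case True
    then show ?thesis unfolding merged_vars_def using finN limz by (simp add: list_tendsto_vars)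
  next
    case False
    then show ?thesis
      unfolding merged_vars_def using finN by (auto intro!: list_tendsto_Cons list_tendsto_vars sZ J limz)
  qed
  note rhs = eventually_list_continuous[OF assms(6) this]
  have M: "(\<lambda>k. bo_M q (P k 0) (P k) J) \<longlonglongrightarrow> bo_M q u z J" if J: "J \<subseteq> N" for J
  proof (cases "J = {}")
    case True
    then show ?thesis
      using isCont_tendsto_compose[OF deriv_bo_Z_isCont[OF q thu] limu] by (simp add: bo_M_def)
  next
    case False
    have "(\<lambda>k. \<Sum>I\<in>Pow J. (-1) ^ card (J - I) * (bo_Z q (card J) (sum (P k) I + P k 0) + bo_Z q (card J) (sum (P k) I - P k 0))) \<longlonglongrightarrow>
       (\<Sum>I\<in>Pow J. (-1) ^ card (J - I) * (bo_Z q (card J) (sum z I + u) + bo_Z q (card J) (sum z I - u)))"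
    proof (rule tendsto_sum)
      fix I assume "I \<in> Pow J"
      then have I: "I \<subseteq> N" using J by blast
      show "(\<lambda>k. (-1) ^ card (J - I) * (bo_Z q (card J) (sum (P k) I + P k 0) + bo_Z q (card J) (sum (P k) I - P k 0))) \<longlonglongrightarrow>
          (-1) ^ card (J - I) * (bo_Z q (card J) (sum z I + u) + bo_Z q (card J) (sum z I - u))"
        using th[OF I] by (intro tendsto_mult tendsto_const tendsto_add tendsto_diff bo_Z_tendsto q limu sZ[OF I]) simp_all
    qed
    then show ?thesis using False by (simp add: bo_M_def)
  qed
  have "eventually (\<lambda>k. \<forall>I\<in>Pow N. bo_theta q (sum (P k) I + P k 0) \<noteq> 0 \<and> bo_theta q (sum (P k) I - P k 0) \<noteq> 0) sequentially"
  proof (rule eventually_ball_finite)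
    show "\<forall>I\<in>Pow N. eventually (\<lambda>k. bo_theta q (sum (P k) I + P k 0) \<noteq> 0 \<and> bo_theta q (sum (P k) I - P k 0) \<noteq> 0) sequentially"
    proof
      fix I assume "I \<in> Pow N"
      then have I: "I \<subseteq> N" by simp
      have "(\<lambda>k. sum (P k) I + P k 0) \<longlonglongrightarrow> sum z I + u" "(\<lambda>k. sum (P k) I - P k 0) \<longlonglongrightarrow> sum z I - u"
        by (intro tendsto_add tendsto_diff sZ[OF I] limu)+
      from this[THEN topological_tendstoD[OF _ open_bo_theta_nonzero[OF q]]]
      show "eventually (\<lambda>k. bo_theta q (sum (P k) I + P k 0) \<noteq> 0 \<and> bo_theta q (sum (P k) I - P k 0) \<noteq> 0) sequentially"
        using th[OF I] by (intro eventually_conj) simp_all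
    qed
  qed (simp add: finN)
  moreover have "eventually (\<lambda>k. \<forall>J\<in>Pow N. list_continuous F (merged_vars (P k) N J)) sequentially"
    using rhs(1) finN by (intro eventually_ball_finite) auto
  ultimately have "eventually (\<lambda>k. F (P k 0 # - P k 0 # vars (P k) N) =
      (\<Sum>J\<in>Pow N. F (merged_vars (P k) N J) * bo_M q (P k 0) (P k) J)) sequentially"
    using lhs(1)
  proof eventually_elim
    case (elim k)
    show ?case
    proof (rule correlator_identity_generic[OF F q N])
      show "bo_theta q (sum (P k) I) \<noteq> 0" if "I \<subseteq> N" "I \<noteq> {}" for I
      proof (rule P(2)[OF _ that(2)])
        have "N \<subseteq> K" by (auto simp: K_def N)
        then show "I \<subseteq> K" using that(1) by blast
      qed
    qed (use elim in auto)
  qed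
  from Lim_transform_eventually[OF lhs(2) this]
  have "(\<lambda>k. \<Sum>J\<in>Pow N. F (merged_vars (P k) N J) * bo_M q (P k 0) (P k) J) \<longlonglongrightarrow> F (u # - u # vars z N)" .
  moreover have "(\<lambda>k. \<Sum>J\<in>Pow N. F (merged_vars (P k) N J) * bo_M q (P k 0) (P k) J) \<longlonglongrightarrow>
      (\<Sum>J\<in>Pow N. F (merged_vars z N J) * bo_M q u z J)"
  proof (rule tendsto_sum)
    fix J assume "J \<in> Pow N"
    then have J: "J \<subseteq> N" by simp
    show "(\<lambda>k. F (merged_vars (P k) N J) * bo_M q (P k 0) (P k) J) \<longlonglongrightarrow> F (merged_vars z N J) * bo_M q u z J"
      by (rule tendsto_mult[OF rhs(2)[OF J J] M[OF J]])
  qed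
  ultimately show ?thesis by (rule LIMSEQ_unique)
qed

end
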